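(* Let $\Gamma$ be a Schottky group of rank $g\ge2$ with limit set $\Lambda_\Gamma$. The Cuntz--Krieger algebra ${\mathcal O}_A$ satisfies the following properties. 1. There is an injection $C(\Lambda_\Gamma)\to{\mathcal O}_A$ which identifies $C(\Lambda_\Gamma)$ with the maximal commutative subalgebra of ${\mathcal O}_A$ generated by the projections $P_\gamma$, $\gamma\in\Gamma$. 2. The generators $S_i=\sum_jA_{ij}T_iP_j$ of ${\mathcal O}_A$ realize ${\mathcal O}_A$ as a subalgebra of $C(\Lambda_\Gamma)\rtimes\Gamma$. 3. The operators $T_\gamma$, $\gamma\in\Gamma$, are elements of ${\mathcal O}_A$, hence the injection of ${\mathcal O}_A$ inside $C(\Lambda_\Gamma)\rtimes\Gamma$ is an isomorphism, $${\mathcal O}_A\cong C(\Lambda_\Gamma)\rtimes\Gamma.$$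
   Context: A Schottky group of rank $g$ is a discrete, purely loxodromic subgroup of $\mathrm{PSL}(2,\mathbb{C})$ free of rank $g$; $g_1,\dots,g_g$ are generators and $g_{i+g}=g_i^{-1}$. $\Lambda_\Gamma$ is identified with the space of right-infinite reduced sequences $a_0a_1\ldots$ in the $g_i$, $i=1,\dots,2g$ ($a_{k+1}\ne a_k^{-1}$), via $a_0a_1\ldots\mapsto\lim_\ell(a_0\cdots a_\ell)x_0$; for $\gamma\in\Gamma$ written as a reduced word, $\Lambda_\Gamma(\gamma)$ is the set of sequences beginning with that word and $\chi_\gamma$ its characteristic function. $\delta_H=\dim_H\Lambda_\Gamma$, and $\mu$ is the Patterson--Sullivan measure, $\gamma^*d\mu=|\gamma'|^{\delta_H}d\mu$. On $L^2(\Lambda_\Gamma,\mu)$: $(T_{\gamma^{-1}}f)(x)=|\gamma'(x)|^{\delta_H/2}f(\gamma x)$ (unitary, $T_\gamma^*=T_{\gamma^{-1}}$), $(P_\gamma f)(x)=\chi_\gamma(x)f(x)$, $T_i=T_{g_i}$, $P_i=P_{g_i}$. ${\mathcal O}_A$ is the universal $C^*$-algebra generated by partial isometries $S_1,\dots,S_{2g}$ with $\sum_jS_jS_j^*=I$ and $S_i^*S_i=\sum_jA_{ij}S_jS_j^*$, where $A_{ij}=0$ if $|i-j|=g$ and $A_{ij}=1$ otherwise; it is identified with the algebra of operators on $L^2(\Lambda_\Gamma,\mu)$ generated by the operators $S_i=\sum_jA_{ij}T_iP_j$. $C(\Lambda_\Gamma)\rtimes\Gamma$ is the (reduced) crossed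 product $C^*$-algebra for the action of $\Gamma$ on $\Lambda_\Gamma$, implemented by multiplication operators and the unitaries $T_\gamma$. *)

theory Defs
  imports "HOL-Probability.Probability" "HOL-Algebra.Subrings" "HOL-Algebra.Generated_Groups"
    "HOL-Algebra.Module"
begin

section \<open>C*-algebras\<close>

definition complex_ring :: "complex ring" where
  "complex_ring = \<lparr>carrier = UNIV, monoid.mult = (*), one = 1, ring.zero = 0, add = (+)\<rparr>"

record 'a cstar = "(complex, 'a) module" +
  cstar_adj :: "'a \<Rightarrow> 'a"
  cstar_norm :: "'a \<Rightarrow> real"

text \<open>All C*-algebras below are unital. The zero algebra is not excluded.\<close>

locale cstar_algebra = Module.module complex_ring A + Ring.ring A
  for A :: "('a, 'm) cstar_scheme" (structure) +
  assumes smult_mult_left: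
      "x \<in> carrier A \<Longrightarrow> y \<in> carrier A \<Longrightarrow> (c \<odot>\<^bsub>A\<^esub> x) \<otimes>\<^bsub>A\<^esub> y = c \<odot>\<^bsub>A\<^esub> (x \<otimes>\<^bsub>A\<^esub> y)"
    and smult_mult_right:
      "x \<in> carrier A \<Longrightarrow> y \<in> carrier A \<Longrightarrow> x \<otimes>\<^bsub>A\<^esub> (c \<odot>\<^bsub>A\<^esub> y) = c \<odot>\<^bsub>A\<^esub> (x \<otimes>\<^bsub>A\<^esub> y)"
    and adj_closed: "x \<in> carrier A \<Longrightarrow> cstar_adj A x \<in> carrier A"
    and adj_adj: "x \<in> carrier A \<Longrightarrow> cstar_adj A (cstar_adj A x) = x"
    and adj_add: "x \<in> carrier A \<Longrightarrow> y \<in> carrier A \<Longrightarrow>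
      cstar_adj A (x \<oplus>\<^bsub>A\<^esub> y) = cstar_adj A x \<oplus>\<^bsub>A\<^esub> cstar_adj A y"
    and adj_smult: "x \<in> carrier A \<Longrightarrow> cstar_adj A (c \<odot>\<^bsub>A\<^esub> x) = cnj c \<odot>\<^bsub>A\<^esub> cstar_adj A x"
    and adj_mult: "x \<in> carrier A \<Longrightarrow> y \<in> carrier A \<Longrightarrow>
      cstar_adj A (x \<otimes>\<^bsub>A\<^esub> y) = cstar_adj A y \<otimes>\<^bsub>A\<^esub> cstar_adj A x"
    and norm_nonneg: "x \<in> carrier A \<Longrightarrow> 0 \<le> cstar_norm A x"
    and norm_eq_zero: "x \<in> carrier A \<Longrightarrow> cstar_norm A x = 0 \<longleftrightarrow> x = \<zero>\<^bsub>A\<^esub>"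
    and norm_triangle: "x \<in> carrier A \<Longrightarrow> y \<in> carrier A \<Longrightarrow>
      cstar_norm A (x \<oplus>\<^bsub>A\<^esub> y) \<le> cstar_norm A x + cstar_norm A y"
    and norm_smult: "x \<in> carrier A \<Longrightarrow> cstar_norm A (c \<odot>\<^bsub>A\<^esub> x) = cmod c * cstar_norm A x"
    and norm_mult: "x \<in> carrier A \<Longrightarrow> y \<in> carrier A \<Longrightarrow>
      cstar_norm A (x \<otimes>\<^bsub>A\<^esub> y) \<le> cstar_norm A x * cstar_norm A y"
    and norm_cstar: "x \<in> carrier A \<Longrightarrow> cstar_norm A (cstar_adj A x \<otimes>\<^bsub>A\<^esub> x) = (cstar_norm A x)\<^sup>2"
    and complete: "range X \<subseteq> carrier A \<Longrightarrow>
      (\<And>e::real. 0 < e \<Longrightarrow> \<exists>N::nat. \<forall>m\<ge>N. \<forall>n\<ge>N. cstar_norm A (X m \<ominus>\<^bsub>A\<^esub> X n) < e) \<Longrightarrow>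
      \<exists>x\<in>carrier A. (\<lambda>n. cstar_norm A (X n \<ominus>\<^bsub>A\<^esub> x)) \<longlonglongrightarrow> 0"

text \<open>Unital *-homomorphisms; note that \<open>ring_hom\<close> preserves the unit.\<close>

definition star_hom :: "('a, 'm) cstar_scheme \<Rightarrow> ('b, 'n) cstar_scheme \<Rightarrow> ('a \<Rightarrow> 'b) set" where
  "star_hom A B = {\<phi> \<in> ring_hom A B.
     (\<forall>c. \<forall>x\<in>carrier A. \<phi> (c \<odot>\<^bsub>A\<^esub> x) = c \<odot>\<^bsub>B\<^esub> \<phi> x) \<and>
     (\<forall>x\<in>carrier A. \<phi> (cstar_adj A x) = cstar_adj B (\<phi> x))}"

definition cstar_subalgebra :: "'a set \<Rightarrow> ('a, 'm) cstar_scheme \<Rightarrow> bool" where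
  "cstar_subalgebra B A \<longleftrightarrow> subring B A \<and>
     (\<forall>c. \<forall>x\<in>B. c \<odot>\<^bsub>A\<^esub> x \<in> B) \<and> (\<forall>x\<in>B. cstar_adj A x \<in> B) \<and>
     (\<forall>X x. range X \<subseteq> B \<longrightarrow> x \<in> carrier A \<longrightarrow>
        (\<lambda>n::nat. cstar_norm A (X n \<ominus>\<^bsub>A\<^esub> x)) \<longlonglongrightarrow> 0 \<longrightarrow> x \<in> B)"

definition cstar_span :: "('a, 'm) cstar_scheme \<Rightarrow> 'a set \<Rightarrow> 'a set" where
  "cstar_span A X = \<Inter> {B. cstar_subalgebra B A \<and> X \<subseteq> B}"

definition cstar_generated :: "('a, 'm) cstar_scheme \<Rightarrow> 'a set \<Rightarrow> ('a, 'm) cstar_scheme" where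
  "cstar_generated A X = A\<lparr>carrier := cstar_span A X\<rparr>"

definition commutative_in :: "'a set \<Rightarrow> ('a, 'm) cstar_scheme \<Rightarrow> bool" where
  "commutative_in D A \<longleftrightarrow> (\<forall>x\<in>D. \<forall>y\<in>D. x \<otimes>\<^bsub>A\<^esub> y = y \<otimes>\<^bsub>A\<^esub> x)"

definition maximal_commutative_subalgebra :: "'a set \<Rightarrow> ('a, 'm) cstar_scheme \<Rightarrow> bool" where
  "maximal_commutative_subalgebra D A \<longleftrightarrow> cstar_subalgebra D A \<and> commutative_in D A \<and>
     (\<forall>D'. cstar_subalgebra D' A \<longrightarrow> commutative_in D' A \<longrightarrow> D \<subseteq> D' \<longrightarrow> D' = D)"

definition continuous_functions ::
    "'x::topological_space set \<Rightarrow> ('x \<Rightarrow> complex) cstar" where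
  "continuous_functions X = \<lparr>
     carrier = {f \<in> extensional X. continuous_on X f},
     monoid.mult = (\<lambda>f h. \<lambda>x\<in>X. f x * h x),
     one = (\<lambda>x\<in>X. 1),
     ring.zero = (\<lambda>x\<in>X. 0),
     add = (\<lambda>f h. \<lambda>x\<in>X. f x + h x),
     smult = (\<lambda>c f. \<lambda>x\<in>X. c * f x),
     cstar_adj = (\<lambda>f. \<lambda>x\<in>X. cnj (f x)),
     cstar_norm = (\<lambda>f. SUP x\<in>X. cmod (f x))\<rparr>"

subsection \<open>Cuntz--Krieger algebras\<close>

definition cuntz_krieger_family ::
    "nat \<Rightarrow> (nat \<Rightarrow> nat \<Rightarrow> nat) \<Rightarrow> ('a, 'm) cstar_scheme \<Rightarrow> (nat \<Rightarrow> 'a) \<Rightarrow> bool" where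
  "cuntz_krieger_family n a A s \<longleftrightarrow>
     (\<forall>i\<in>{1..n}. s i \<in> carrier A \<and> s i \<otimes>\<^bsub>A\<^esub> cstar_adj A (s i) \<otimes>\<^bsub>A\<^esub> s i = s i) \<and>
     (\<Oplus>\<^bsub>A\<^esub>j\<in>{1..n}. s j \<otimes>\<^bsub>A\<^esub> cstar_adj A (s j)) = \<one>\<^bsub>A\<^esub> \<and>
     (\<forall>i\<in>{1..n}. cstar_adj A (s i) \<otimes>\<^bsub>A\<^esub> s i =
        (\<Oplus>\<^bsub>A\<^esub>j\<in>{1..n}. of_nat (a i j) \<odot>\<^bsub>A\<^esub> (s j \<otimes>\<^bsub>A\<^esub> cstar_adj A (s j))))"

text \<open>The pair \<open>(A, s)\<close> is the universal C*-algebra generated by a Cuntz--Krieger family for the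
  matrix \<open>a\<close>. HOL cannot quantify over types inside a formula, so the type of the competing
  algebras is a parameter; a theorem with this predicate as its conclusion, for a type variable
  \<open>'b\<close>, covers all of them.\<close>

definition cuntz_krieger_algebra ::
    "'b itself \<Rightarrow> nat \<Rightarrow> (nat \<Rightarrow> nat \<Rightarrow> nat) \<Rightarrow> ('a, 'm) cstar_scheme \<Rightarrow> (nat \<Rightarrow> 'a) \<Rightarrow> bool" where
  "cuntz_krieger_algebra T n a A s \<longleftrightarrow>
     cstar_algebra A \<and> cuntz_krieger_family n a A s \<and> carrier A = cstar_span A (s ` {1..n}) \<and>
     (\<forall>(B :: 'b cstar) t. cstar_algebra B \<longrightarrow> cuntz_krieger_family n a B t \<longrightarrow>
        (\<exists>\<phi>\<in>star_hom A B. \<forall>i\<in>{1..n}. \<phi> (s i) = t i))"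

section \<open>Bounded operators on \<open>L\<^sup>2\<close>\<close>

definition L2_class :: "'x measure \<Rightarrow> ('x \<Rightarrow> complex) \<Rightarrow> ('x \<Rightarrow> complex) set" where
  "L2_class M f = {h \<in> borel_measurable M. AE x in M. h x = f x}"

definition L2 :: "'x measure \<Rightarrow> ('x \<Rightarrow> complex) set set" where
  "L2 M = L2_class M ` {f \<in> borel_measurable M. integrable M (\<lambda>x. (cmod (f x))\<^sup>2)}"

definition L2_rep :: "('x \<Rightarrow> complex) set \<Rightarrow> 'x \<Rightarrow> complex" where
  "L2_rep u = (SOME f. f \<in> u)"

definition L2_add ::
    "'x measure \<Rightarrow> ('x \<Rightarrow> complex) set \<Rightarrow> ('x \<Rightarrow> complex) set \<Rightarrow> ('x \<Rightarrow> complex) set" where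
  "L2_add M u v = L2_class M (\<lambda>x. L2_rep u x + L2_rep v x)"

definition L2_scale :: "'x measure \<Rightarrow> complex \<Rightarrow> ('x \<Rightarrow> complex) set \<Rightarrow> ('x \<Rightarrow> complex) set" where
  "L2_scale M c u = L2_class M (\<lambda>x. c * L2_rep u x)"

definition L2_inner :: "'x measure \<Rightarrow> ('x \<Rightarrow> complex) set \<Rightarrow> ('x \<Rightarrow> complex) set \<Rightarrow> complex" where
  "L2_inner M u v = (LINT x|M. L2_rep u x * cnj (L2_rep v x))"

definition L2_norm :: "'x measure \<Rightarrow> ('x \<Rightarrow> complex) set \<Rightarrow> real" where
  "L2_norm M u = sqrt (LINT x|M. (cmod (L2_rep u x))\<^sup>2)"

type_synonym 'x L2_op = "('x \<Rightarrow> complex) set \<Rightarrow> ('x \<Rightarrow> complex) set"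

definition bounded_op :: "'x measure \<Rightarrow> 'x L2_op \<Rightarrow> bool" where
  "bounded_op M T \<longleftrightarrow> T \<in> L2 M \<rightarrow>\<^sub>E L2 M \<and>
     (\<forall>u\<in>L2 M. \<forall>v\<in>L2 M. T (L2_add M u v) = L2_add M (T u) (T v)) \<and>
     (\<forall>c. \<forall>u\<in>L2 M. T (L2_scale M c u) = L2_scale M c (T u)) \<and>
     (\<exists>K. \<forall>u\<in>L2 M. L2_norm M (T u) \<le> K * L2_norm M u)"

definition L2_operators :: "'x measure \<Rightarrow> 'x L2_op cstar" where
  "L2_operators M = \<lparr>
     carrier = {T. bounded_op M T},
     monoid.mult = (\<lambda>S T. compose (L2 M) S T),
     one = (\<lambda>u\<in>L2 M. u),
     ring.zero = (\<lambda>u\<in>L2 M. L2_class M (\<lambda>_. 0)),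
     add = (\<lambda>S T. \<lambda>u\<in>L2 M. L2_add M (S u) (T u)),
     smult = (\<lambda>c T. \<lambda>u\<in>L2 M. L2_scale M c (T u)),
     cstar_adj = (\<lambda>T. THE T'. bounded_op M T' \<and>
        (\<forall>u\<in>L2 M. \<forall>v\<in>L2 M. L2_inner M (T u) v = L2_inner M u (T' v))),
     cstar_norm = (\<lambda>T. SUP u\<in>{u \<in> L2 M. L2_norm M u \<le> 1}. L2_norm M (T u))\<rparr>"

text \<open>The operator induced by a map on functions that respects equality almost everywhere.\<close>

definition L2_lift :: "'x measure \<Rightarrow> (('x \<Rightarrow> complex) \<Rightarrow> ('x \<Rightarrow> complex)) \<Rightarrow> 'x L2_op" where
  "L2_lift M F = (\<lambda>u\<in>L2 M. L2_class M (F (L2_rep u)))"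

definition mult_op :: "'x measure \<Rightarrow> ('x \<Rightarrow> complex) \<Rightarrow> 'x L2_op" where
  "mult_op M f = L2_lift M (\<lambda>h x. f x * h x)"

subsection \<open>Reduced crossed products\<close>

text \<open>The reduced crossed product of \<open>C(X)\<close> by a discrete group acting on a compact space \<open>X\<close>,
  through the regular representation on \<open>\<ell>\<^sup>2(G, H)\<close>, where \<open>C(X)\<close> is represented
  faithfully by multiplication on \<open>H = \<ell>\<^sup>2(X)\<close>, and \<open>\<ell>\<^sup>2(G, H)\<close> is identified with
  \<open>\<ell>\<^sup>2(G \<times> X)\<close>. A function \<open>f\<close> acts on \<open>\<delta>\<^sub>s \<otimes> H\<close> as its translate \<open>x \<mapsto> f (s x)\<close>.\<close>

definition crossed_fun ::
    "('g, 'm) monoid_scheme \<Rightarrow> ('g \<Rightarrow> 'x \<Rightarrow> 'x) \<Rightarrow> 'x set \<Rightarrow> ('x \<Rightarrow> complex) \<Rightarrow> ('g \<times> 'x) L2_op" where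
  "crossed_fun G act X f =
     L2_lift (count_space (carrier G \<times> X)) (\<lambda>\<xi> (s, x). f (act s x) * \<xi> (s, x))"

definition crossed_unitary ::
    "('g, 'm) monoid_scheme \<Rightarrow> 'x set \<Rightarrow> 'g \<Rightarrow> ('g \<times> 'x) L2_op" where
  "crossed_unitary G X t =
     L2_lift (count_space (carrier G \<times> X)) (\<lambda>\<xi> (s, x). \<xi> (inv\<^bsub>G\<^esub> t \<otimes>\<^bsub>G\<^esub> s, x))"

definition reduced_crossed_product ::
    "('g, 'm) monoid_scheme \<Rightarrow> ('g \<Rightarrow> 'x::topological_space \<Rightarrow> 'x) \<Rightarrow> 'x set \<Rightarrow>
      ('g \<times> 'x) L2_op cstar" where
  "reduced_crossed_product G act X =
     cstar_generated (L2_operators (count_space (carrier G \<times> X)))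
       (crossed_fun G act X ` carrier (continuous_functions X) \<union>
        crossed_unitary G X ` carrier G)"

section \<open>Hausdorff dimension\<close>

definition hausdorff_premeasure :: "real \<Rightarrow> real \<Rightarrow> 'a::euclidean_space set \<Rightarrow> ennreal" where
  "hausdorff_premeasure s e S =
     (INF U\<in>{U :: nat \<Rightarrow> 'a set. (\<forall>i. bounded (U i) \<and> diameter (U i) \<le> e) \<and> S \<subseteq> (\<Union>i. U i)}.
        \<Sum>i. ennreal (diameter (U i) powr s))"

definition hausdorff_measure :: "real \<Rightarrow> 'a::euclidean_space set \<Rightarrow> ennreal" where
  "hausdorff_measure s S = (SUP e\<in>{0<..}. hausdorff_premeasure s e S)"

definition hausdorff_dim :: "'a::euclidean_space set \<Rightarrow> real" where
  "hausdorff_dim S = Inf {s. 0 < s \<and> hausdorff_measure s S = 0}"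

section \<open>\<open>PSL(2,\<complex>)\<close> acting on hyperbolic space and its boundary sphere\<close>

type_synonym psl2 = "(complex^2^2) set"
type_synonym pt = "complex \<times> real"

definition SL2C :: "(complex^2^2) monoid" where
  "SL2C = \<lparr>carrier = {A. det A = 1}, monoid.mult = (**), one = mat 1\<rparr>"

definition PSL2C :: "psl2 monoid" where
  "PSL2C = SL2C Mod {mat 1, - mat 1}"

definition PSL2C_topology :: "psl2 topology" where
  "PSL2C_topology =
     topology (\<lambda>U. U \<subseteq> carrier PSL2C \<and> openin (top_of_set (carrier SL2C)) (\<Union>U))"

definition discrete_in_PSL2C :: "psl2 set \<Rightarrow> bool" where
  "discrete_in_PSL2C \<Gamma> \<longleftrightarrow> subtopology PSL2C_topology \<Gamma> = discrete_topology \<Gamma>"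

text \<open>Conjugate to \<open>z \<mapsto> \<lambda>\<^sup>2 z\<close> with \<open>\<bar>\<lambda>\<bar> \<noteq> 1\<close>; hyperbolic elements are included.\<close>

definition loxodromic :: "psl2 \<Rightarrow> bool" where
  "loxodromic \<gamma> \<longleftrightarrow> (\<exists>A\<in>\<gamma>. \<exists>B l. B \<in> carrier SL2C \<and> l \<noteq> 0 \<and> cmod l \<noteq> 1 \<and>
     A ** B = B ** vector [vector [l, 0], vector [0, inverse l]])"

text \<open>Hyperbolic 3-space together with its boundary \<open>P\<^sup>1(\<complex>)\<close> is modelled by the closed unit
  ball of \<open>\<complex> \<times> \<real>\<close>: the nonzero positive semidefinite Hermitian matrices up to positive
  scalars, on which \<open>A\<close> acts by \<open>N \<mapsto> A N A\<^sup>*\<close>, are parametrised as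
  \<open>N = (1 + t, z; cnj z, 1 - t)\<close> with \<open>\<bar>z\<bar>\<^sup>2 + t\<^sup>2 \<le> 1\<close>. Writing \<open>N = M M\<^sup>*\<close>, the action is
  \<open>M \<mapsto> A M\<close>. Rank one matrices \<open>M = (v, 0)\<close> give the unit sphere, and the point of \<open>P\<^sup>1(\<complex>)\<close>
  spanned by \<open>v = (z, 1)\<close> is the inverse stereographic projection of \<open>z\<close>, moved by \<open>A\<close>
  through the fractional linear transformation. Positive definite matrices give the interior
  (the Klein model).\<close>

definition ball_point :: "complex^2^2 \<Rightarrow> pt" where
  "ball_point M = (let N = M ** (\<chi> i j. cnj (M $ j $ i)) in
     (2 * N $ 1 $ 2 / trace N, Re ((N $ 1 $ 1 - N $ 2 $ 2) / trace N)))"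

definition psl_act :: "psl2 \<Rightarrow> pt \<Rightarrow> pt" where
  "psl_act \<gamma> p = ball_point ((SOME A. A \<in> \<gamma>) ** (SOME M. M \<noteq> 0 \<and> ball_point M = p))"

text \<open>\<open>\<bar>\<gamma>'(x)\<bar>\<close> for the spherical (chordal) metric, which is defined at every point of
  \<open>P\<^sup>1(\<complex>)\<close>.\<close>

definition conformal_deriv :: "psl2 \<Rightarrow> pt \<Rightarrow> real" where
  "conformal_deriv \<gamma> x =
     Lim (at x within sphere 0 1) (\<lambda>y. dist (psl_act \<gamma> y) (psl_act \<gamma> x) / dist y x)"

text \<open>Accumulation points on the sphere of the orbit of the centre of the ball.\<close>

definition limit_set :: "psl2 set \<Rightarrow> pt set" where
  "limit_set \<Gamma> = {p \<in> sphere 0 1. p islimpt ((\<lambda>\<gamma>. psl_act \<gamma> 0) ` \<Gamma>)}"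

section \<open>Schottky groups and the coding of the limit set\<close>

text \<open>Letters are \<open>1, \<dots>, 2g\<close>, and the letters \<open>i\<close>, \<open>j\<close> are mutually inverse iff \<open>\<bar>i - j\<bar> = g\<close>.\<close>

definition schottky_matrix :: "nat \<Rightarrow> nat \<Rightarrow> nat \<Rightarrow> nat" where
  "schottky_matrix g i j = (if \<bar>int i - int j\<bar> = int g then 0 else 1)"

definition letter :: "nat \<Rightarrow> (nat \<Rightarrow> psl2) \<Rightarrow> nat \<Rightarrow> psl2" where
  "letter g gen i = (if i \<le> g then gen i else inv\<^bsub>PSL2C\<^esub> (gen (i - g)))"

definition word_val :: "nat \<Rightarrow> (nat \<Rightarrow> psl2) \<Rightarrow> nat list \<Rightarrow> psl2" where
  "word_val g gen w = foldr (\<lambda>i h. letter g gen i \<otimes>\<^bsub>PSL2C\<^esub> h) w \<one>\<^bsub>PSL2C\<^esub>"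

definition reduced_word :: "nat \<Rightarrow> nat list \<Rightarrow> bool" where
  "reduced_word g w \<longleftrightarrow> set w \<subseteq> {1..2*g} \<and>
     (\<forall>k. Suc k < length w \<longrightarrow> schottky_matrix g (w ! k) (w ! Suc k) = 1)"

definition reduced_sequences :: "nat \<Rightarrow> (nat \<Rightarrow> nat) set" where
  "reduced_sequences g =
     {a. range a \<subseteq> {1..2*g} \<and> (\<forall>k. schottky_matrix g (a k) (a (Suc k)) = 1)}"

definition free_basis :: "nat \<Rightarrow> psl2 set \<Rightarrow> (nat \<Rightarrow> psl2) \<Rightarrow> bool" where
  "free_basis g \<Gamma> gen \<longleftrightarrow> gen ` {1..g} \<subseteq> carrier PSL2C \<and>
     generate PSL2C (gen ` {1..g}) = \<Gamma> \<and>
     (\<forall>w. reduced_word g w \<longrightarrow> w \<noteq> [] \<longrightarrow> word_val g gen w \<noteq> \<one>\<^bsub>PSL2C\<^esub>)"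

definition schottky_group :: "nat \<Rightarrow> psl2 set \<Rightarrow> (nat \<Rightarrow> psl2) \<Rightarrow> bool" where
  "schottky_group g \<Gamma> gen \<longleftrightarrow> subgroup \<Gamma> PSL2C \<and> discrete_in_PSL2C \<Gamma> \<and>
     (\<forall>\<gamma>\<in>\<Gamma>. \<gamma> \<noteq> \<one>\<^bsub>PSL2C\<^esub> \<longrightarrow> loxodromic \<gamma>) \<and> free_basis g \<Gamma> gen"

definition orbit_seq :: "nat \<Rightarrow> (nat \<Rightarrow> psl2) \<Rightarrow> pt \<Rightarrow> (nat \<Rightarrow> nat) \<Rightarrow> nat \<Rightarrow> pt" where
  "orbit_seq g gen x\<^sub>0 a l = psl_act (word_val g gen (map a [0..<Suc l])) x\<^sub>0"

definition coding :: "nat \<Rightarrow> (nat \<Rightarrow> psl2) \<Rightarrow> pt \<Rightarrow> (nat \<Rightarrow> nat) \<Rightarrow> pt" where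
  "coding g gen x\<^sub>0 a = lim (orbit_seq g gen x\<^sub>0 a)"

text \<open>The identification of the limit set with the space of reduced sequences, which carries the
  product topology. For groups satisfying \<open>schottky_group\<close> it is a genuine restriction: it
  excludes the geometrically infinite ones, whose limit set is the whole sphere.\<close>

definition coded_limit_set :: "nat \<Rightarrow> psl2 set \<Rightarrow> (nat \<Rightarrow> psl2) \<Rightarrow> pt \<Rightarrow> bool" where
  "coded_limit_set g \<Gamma> gen x\<^sub>0 \<longleftrightarrow>
     (\<forall>a\<in>reduced_sequences g. convergent (orbit_seq g gen x\<^sub>0 a)) \<and>
     (\<exists>d. homeomorphism (reduced_sequences g) (limit_set \<Gamma>) (coding g gen x\<^sub>0) d)"

definition cylinder :: "nat \<Rightarrow> (nat \<Rightarrow> psl2) \<Rightarrow> pt \<Rightarrow> psl2 \<Rightarrow> pt set" where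
  "cylinder g gen x\<^sub>0 \<gamma> =
     {coding g gen x\<^sub>0 a | a w. a \<in> reduced_sequences g \<and> reduced_word g w \<and>
        word_val g gen w = \<gamma> \<and> (\<forall>k<length w. a k = w ! k)}"

definition patterson_sullivan_measure :: "psl2 set \<Rightarrow> pt measure \<Rightarrow> bool" where
  "patterson_sullivan_measure \<Gamma> \<mu> \<longleftrightarrow> prob_space \<mu> \<and>
     sets \<mu> = sets (restrict_space borel (limit_set \<Gamma>)) \<and>
     (\<forall>\<gamma>\<in>\<Gamma>. \<forall>E\<in>sets \<mu>. emeasure \<mu> (psl_act \<gamma> ` E) =
        (\<integral>\<^sup>+x\<in>E. ennreal (conformal_deriv \<gamma> x powr hausdorff_dim (limit_set \<Gamma>)) \<partial>\<mu>))"

section \<open>The operators on \<open>L\<^sup>2(\<Lambda>, \<mu>)\<close>\<close>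

definition T_op :: "psl2 set \<Rightarrow> pt measure \<Rightarrow> psl2 \<Rightarrow> pt L2_op" where
  "T_op \<Gamma> \<mu> \<gamma> = L2_lift \<mu> (\<lambda>f x.
     of_real (conformal_deriv (inv\<^bsub>PSL2C\<^esub> \<gamma>) x powr (hausdorff_dim (limit_set \<Gamma>) / 2)) *
     f (psl_act (inv\<^bsub>PSL2C\<^esub> \<gamma>) x))"

definition P_op :: "nat \<Rightarrow> (nat \<Rightarrow> psl2) \<Rightarrow> pt \<Rightarrow> pt measure \<Rightarrow> psl2 \<Rightarrow> pt L2_op" where
  "P_op g gen x\<^sub>0 \<mu> \<gamma> = mult_op \<mu> (indicator (cylinder g gen x\<^sub>0 \<gamma>))"

definition S_op ::
    "nat \<Rightarrow> psl2 set \<Rightarrow> (nat \<Rightarrow> psl2) \<Rightarrow> pt \<Rightarrow> pt measure \<Rightarrow> nat \<Rightarrow> pt L2_op" where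
  "S_op g \<Gamma> gen x\<^sub>0 \<mu> i = (\<Oplus>\<^bsub>L2_operators \<mu>\<^esub>j\<in>{1..2*g}. of_nat (schottky_matrix g i j)
     \<odot>\<^bsub>L2_operators \<mu>\<^esub> (T_op \<Gamma> \<mu> (letter g gen i) \<otimes>\<^bsub>L2_operators \<mu>\<^esub>
        P_op g gen x\<^sub>0 \<mu> (letter g gen j)))"

definition OA :: "nat \<Rightarrow> psl2 set \<Rightarrow> (nat \<Rightarrow> psl2) \<Rightarrow> pt \<Rightarrow> pt measure \<Rightarrow> pt L2_op cstar" where
  "OA g \<Gamma> gen x\<^sub>0 \<mu> = cstar_generated (L2_operators \<mu>) (S_op g \<Gamma> gen x\<^sub>0 \<mu> ` {1..2*g})"

definition schottky_crossed_product :: "psl2 set \<Rightarrow> (psl2 \<times> pt) L2_op cstar" where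
  "schottky_crossed_product \<Gamma> =
     reduced_crossed_product (PSL2C\<lparr>carrier := \<Gamma>\<rparr>) psl_act (limit_set \<Gamma>)"

end

theory Submission
  imports Defs
begin

text \<open>Let \<open>\<pi>\<close>, \<open>U\<close> be a covariant representation of \<open>C(\<Lambda>)\<close> and \<open>\<Gamma>\<close>. As \<open>g\<^sub>i\<close> maps the complement of the
  cylinder of \<open>g\<^sub>i\<^sup>-\<^sup>1\<close> onto the cylinder of \<open>g\<^sub>i\<close>, the \<open>S\<^sub>i = \<pi> \<chi>\<^sub>i U\<^sub>i\<close> form a Cuntz--Krieger family;
  conversely \<open>U\<^sub>i = S\<^sub>i + S\<^sub>i\<^sub>+\<^sub>g\<^sup>*\<close> and \<open>\<pi> \<chi>\<^sub>w = S\<^sub>w S\<^sub>w\<^sup>*\<close>, so the \<open>S\<^sub>i\<close> generate the same algebra as \<open>\<pi>\<close> and \<open>U\<close>.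
  This applies to \<open>L\<^sup>2(\<mu>)\<close> and to the crossed product. The isomorphism and universality come from the
  uniqueness of Cuntz--Krieger families for \<open>g \<ge> 2\<close>: the norm of a star-polynomial in the \<open>S\<^sub>i\<close> equals,
  up to a factor linear in the degree, the norm of its action on reduced words, and passing to powers
  removes the factor. An element of the crossed product has continuous Fourier coefficients; if it
  commutes with \<open>C(\<Lambda>)\<close>, then it lies in \<open>C(\<Lambda>)\<close> because loxodromic elements have at most two fixed
  points and \<open>\<Lambda>\<close> is perfect.\<close>

text \<open>The comparison of norms does without spectral theory and without the gauge action:
  everything rests on norms and the C*-identity. Two obstacles shape it. Removing the last letter of
  a word leaves a source projection instead of a scalar, so \<open>act\<close> agrees with
  multiplication only on words longer than the degree. And distinct words need orthogonal ranges
  even when one is a prefix of the other; an appended tail \<open>a ... a b\<close> achieves this,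
  and finding one that may follow a given last letter uses the room provided by rank at least 2. The
  relations only ask that the range projections sum to 1. Their orthogonality has to be derived,
  from a notion of positivity expressed through norms. Operators are restricted to those with an
  explicit adjoint, instead of proving that every bounded operator has one. In
  \<open>L^2(mu)\<close> no Fourier expansion is at hand, so injectivity on C(\<Lambda>) and
  maximality are established in the crossed product and carried back along the isomorphism.\<close>

context cstar_algebra
begin

abbreviation star :: "'a \<Rightarrow> 'a" where "star x \<equiv> cstar_adj A x"
abbreviation nrm :: "'a \<Rightarrow> real" where "nrm x \<equiv> cstar_norm A x"

lemma carrier_complex_ring: "c \<in> carrier complex_ring"
  by (simp add: complex_ring_def)

lemma sm_closed [simp, intro]: "x \<in> carrier A \<Longrightarrow> c \<odot> x \<in> carrier A"
  using smult_closed carrier_complex_ring by blast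

lemma sm_l_distr: "x \<in> carrier A \<Longrightarrow> (a + b) \<odot> x = a \<odot> x \<oplus> b \<odot> x"
  using smult_l_distr[of a b x] by (simp add: complex_ring_def)

lemma sm_r_distr: "x \<in> carrier A \<Longrightarrow> y \<in> carrier A \<Longrightarrow> a \<odot> (x \<oplus> y) = a \<odot> x \<oplus> a \<odot> y"
  using smult_r_distr[of a x y] by (simp add: complex_ring_def)

lemma sm_assoc: "x \<in> carrier A \<Longrightarrow> a \<odot> (b \<odot> x) = (a * b) \<odot> x"
  using smult_assoc1[of a b x] by (simp add: complex_ring_def)

lemma sm_one [simp]: "x \<in> carrier A \<Longrightarrow> 1 \<odot> x = x"
  using smult_one[of x] by (simp add: complex_ring_def)

lemma sm_0_left [simp]: "x \<in> carrier A \<Longrightarrow> 0 \<odot> x = \<zero>"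
  using smult_l_null[of x] by (simp add: complex_ring_def)

lemma sm_0_right [simp]: "c \<odot> \<zero> = \<zero>"
  using smult_r_null[of c] by (simp add: complex_ring_def)

lemma sm_minus_one: assumes "x \<in> carrier A" shows "(-1) \<odot> x = \<ominus> x"
proof -
  have "x \<oplus> (-1) \<odot> x = \<zero>"
    using sm_l_distr[OF assms, of 1 "-1"] assms by simp
  then show ?thesis using assms by (metis local.minus_equality a_comm sm_closed)
qed

lemma sm_minus: "x \<in> carrier A \<Longrightarrow> c \<odot> (\<ominus> x) = \<ominus> (c \<odot> x)"
  by (simp add: sm_minus_one[symmetric] sm_assoc)

lemma star_closed [simp, intro]: "x \<in> carrier A \<Longrightarrow> star x \<in> carrier A"
  by (rule adj_closed)

lemma star_zero [simp]: "star \<zero> = \<zero>"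
  using adj_smult[of \<zero> 0] by simp

lemma star_one [simp]: "star \<one> = \<one>"
proof -
  have "star \<one> = star \<one> \<otimes> \<one>" by simp
  also have "\<dots> = star (star \<one> \<otimes> \<one>)" by (subst adj_mult) (auto simp: adj_adj)
  finally show ?thesis by (simp add: adj_adj)
qed

lemma star_minus: "x \<in> carrier A \<Longrightarrow> star (\<ominus> x) = \<ominus> star x"
  using adj_smult[of x "-1"] by (simp add: sm_minus_one)

lemma star_diff: "x \<in> carrier A \<Longrightarrow> y \<in> carrier A \<Longrightarrow> star (x \<ominus> y) = star x \<ominus> star y"
  by (simp add: a_minus_def adj_add star_minus)

lemma nrm_zero [simp]: "nrm \<zero> = 0"
  using norm_eq_zero by simp

lemma nrm_minus: "x \<in> carrier A \<Longrightarrow> nrm (\<ominus> x) = nrm x"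
  using norm_smult[of x "-1"] by (simp add: sm_minus_one)

lemma nrm_diff_commute: assumes "x \<in> carrier A" "y \<in> carrier A" shows "nrm (x \<ominus> y) = nrm (y \<ominus> x)"
proof -
  have "\<ominus> (x \<ominus> y) = y \<ominus> x" using assms by algebra
  then show ?thesis using nrm_minus[of "x \<ominus> y"] assms by simp
qed

lemma nrm_diff_trans:
  assumes "x \<in> carrier A" "y \<in> carrier A" "z \<in> carrier A"
  shows "nrm (x \<ominus> z) \<le> nrm (x \<ominus> y) + nrm (y \<ominus> z)"
proof -
  have "x \<ominus> z = (x \<ominus> y) \<oplus> (y \<ominus> z)" using assms by algebra
  then show ?thesis using norm_triangle[of "x \<ominus> y" "y \<ominus> z"] assms by simp
qed

lemma diff_eq_zero: "x \<in> carrier A \<Longrightarrow> y \<in> carrier A \<Longrightarrow> x \<ominus> y = \<zero> \<longleftrightarrow> x = y"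
  by (metis minus_equality minus_minus a_minus_def r_neg a_inv_closed)

lemma nrm_diff_zero: "x \<in> carrier A \<Longrightarrow> y \<in> carrier A \<Longrightarrow> nrm (x \<ominus> y) = 0 \<longleftrightarrow> x = y"
  by (simp add: norm_eq_zero diff_eq_zero)

text \<open>The C*-identity bounds \<open>(nrm y)^2\<close> by \<open>nrm (star y) * nrm y\<close>;
  cancel, then exchange \<open>y\<close> and \<open>star y\<close>.\<close>

lemma nrm_star [simp]: assumes "x \<in> carrier A" shows "nrm (star x) = nrm x"
proof -
  have *: "nrm y \<le> nrm (star y)" if y: "y \<in> carrier A" for y
  proof -
    have "nrm y * nrm y \<le> nrm (star y) * nrm y"
      using norm_mult[of "star y" y] norm_cstar[OF y] y by (simp add: power2_eq_square)
    then show ?thesis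
      using norm_nonneg[OF y] norm_nonneg[of "star y"] y
      by (cases "nrm y = 0") (auto simp: mult_le_cancel_right)
  qed
  from *[OF assms] *[of "star x"] assms show ?thesis by (simp add: adj_adj)
qed

lemma nrm_finsum: "finite I \<Longrightarrow> f \<in> I \<rightarrow> carrier A \<Longrightarrow> nrm (\<Oplus>i\<in>I. f i) \<le> (\<Sum>i\<in>I. nrm (f i))"
proof (induction I rule: finite_induct)
  case (insert x F)
  then have "nrm (f x \<oplus> (\<Oplus>i\<in>F. f i)) \<le> nrm (f x) + nrm (\<Oplus>i\<in>F. f i)"
    by (intro norm_triangle) auto
  with insert show ?case by (simp add: Pi_def)
qed simp

lemma star_finsum: "finite I \<Longrightarrow> f \<in> I \<rightarrow> carrier A \<Longrightarrow> star (\<Oplus>i\<in>I. f i) = (\<Oplus>i\<in>I. star (f i))"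
  by (induction I rule: finite_induct) (simp_all add: adj_add Pi_def)

lemma sm_finsum: "finite I \<Longrightarrow> f \<in> I \<rightarrow> carrier A \<Longrightarrow> c \<odot> (\<Oplus>i\<in>I. f i) = (\<Oplus>i\<in>I. c \<odot> f i)"
  by (induction I rule: finite_induct) (simp_all add: sm_r_distr Pi_def)

lemma mult_sm: "x \<in> carrier A \<Longrightarrow> y \<in> carrier A \<Longrightarrow> (a \<odot> x) \<otimes> (b \<odot> y) = (a * b) \<odot> (x \<otimes> y)"
  by (simp add: smult_mult_left smult_mult_right sm_assoc mult.commute)

subsection \<open>Convergence\<close>

definition conv :: "(nat \<Rightarrow> 'a) \<Rightarrow> 'a \<Rightarrow> bool" where
  "conv X x \<longleftrightarrow> (\<lambda>n. nrm (X n \<ominus> x)) \<longlonglongrightarrow> 0"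

lemma conv_bound:
  assumes "\<And>n. nrm (X n \<ominus> x) \<le> B n" "B \<longlonglongrightarrow> 0" "\<And>n. X n \<in> carrier A" "x \<in> carrier A"
  shows "conv X x"
  unfolding conv_def
  by (rule tendsto_sandwich[OF _ _ tendsto_const assms(2)])
     (use assms in \<open>auto intro!: always_eventually norm_nonneg\<close>)

lemma conv_const: "x \<in> carrier A \<Longrightarrow> conv (\<lambda>_. x) x"
  by (simp add: conv_def r_neg a_minus_def)

lemma conv_add:
  assumes "conv X x" "conv Y y" and c: "\<And>n. X n \<in> carrier A" "\<And>n. Y n \<in> carrier A" "x \<in> carrier A" "y \<in> carrier A"
  shows "conv (\<lambda>n. X n \<oplus> Y n) (x \<oplus> y)"
proof (rule conv_bound)
  fix n
  have cn: "X n \<in> carrier A" "Y n \<in> carrier A" using c by auto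
  have "(X n \<oplus> Y n) \<ominus> (x \<oplus> y) = (X n \<ominus> x) \<oplus> (Y n \<ominus> y)" using c(3,4) cn by algebra
  then show "nrm ((X n \<oplus> Y n) \<ominus> (x \<oplus> y)) \<le> nrm (X n \<ominus> x) + nrm (Y n \<ominus> y)"
    using norm_triangle c(3,4) cn by simp
qed (use assms tendsto_add[of _ 0 _ _ 0] in \<open>auto simp: conv_def\<close>)

lemma conv_sm:
  assumes "conv X x" and c: "\<And>n. X n \<in> carrier A" "x \<in> carrier A"
  shows "conv (\<lambda>n. c \<odot> X n) (c \<odot> x)"
proof (rule conv_bound)
  fix n
  have cn: "X n \<in> carrier A" using c by auto
  have "c \<odot> X n \<ominus> c \<odot> x = c \<odot> (X n \<ominus> x)" using c(2) cn by (simp add: a_minus_def sm_r_distr sm_minus)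
  then show "nrm (c \<odot> X n \<ominus> c \<odot> x) \<le> cmod c * nrm (X n \<ominus> x)"
    using norm_smult c(2) cn by simp
next
  show "(\<lambda>n. cmod c * nrm (X n \<ominus> x)) \<longlonglongrightarrow> 0"
    using assms(1) tendsto_mult_right_zero unfolding conv_def by blast
qed (use assms in auto)

lemma conv_star:
  assumes "conv X x" and c: "\<And>n. X n \<in> carrier A" "x \<in> carrier A"
  shows "conv (\<lambda>n. star (X n)) (star x)"
proof -
  have "nrm (star (X n) \<ominus> star x) = nrm (X n \<ominus> x)" for n
    using c star_diff[of "X n" x] nrm_star[of "X n \<ominus> x"] by auto
  then show ?thesis using assms(1) by (simp add: conv_def)
qed

lemma nrm_rev_triangle:
  assumes "x \<in> carrier A" "y \<in> carrier A"
  shows "\<bar>nrm x - nrm y\<bar> \<le> nrm (x \<ominus> y)"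
proof -
  have "x = (x \<ominus> y) \<oplus> y" "y = (y \<ominus> x) \<oplus> x" using assms by algebra+
  then have "nrm x \<le> nrm (x \<ominus> y) + nrm y" "nrm y \<le> nrm (y \<ominus> x) + nrm x"
    using norm_triangle assms by (metis minus_closed)+
  then show ?thesis using nrm_diff_commute[OF assms] by linarith
qed

lemma conv_nrm:
  assumes "conv X x" and c: "\<And>n. X n \<in> carrier A" "x \<in> carrier A"
  shows "(\<lambda>n. nrm (X n)) \<longlonglongrightarrow> nrm x"
proof (rule LIM_zero_cancel, rule Lim_null_comparison)
  show "\<forall>\<^sub>F n in sequentially. norm (nrm (X n) - nrm x) \<le> nrm (X n \<ominus> x)"
    using nrm_rev_triangle c by (auto intro!: always_eventually)
qed (use assms in \<open>simp add: conv_def\<close>)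

lemma conv_mult:
  assumes "conv X x" "conv Y y" and c: "\<And>n. X n \<in> carrier A" "\<And>n. Y n \<in> carrier A" "x \<in> carrier A" "y \<in> carrier A"
  shows "conv (\<lambda>n. X n \<otimes> Y n) (x \<otimes> y)"
proof (rule conv_bound)
  fix n
  have cn: "X n \<in> carrier A" "Y n \<in> carrier A" using c by auto
  have "(X n \<otimes> Y n) \<ominus> (x \<otimes> y) = ((X n \<ominus> x) \<otimes> Y n) \<oplus> (x \<otimes> (Y n \<ominus> y))" using c(3,4) cn by algebra
  then have "nrm ((X n \<otimes> Y n) \<ominus> (x \<otimes> y)) \<le> nrm ((X n \<ominus> x) \<otimes> Y n) + nrm (x \<otimes> (Y n \<ominus> y))"
    using norm_triangle c(3,4) cn by simp
  also have "\<dots> \<le> nrm (X n \<ominus> x) * nrm (Y n) + nrm x * nrm (Y n \<ominus> y)"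
    using norm_mult c(3,4) cn by (intro add_mono) auto
  finally show "nrm ((X n \<otimes> Y n) \<ominus> (x \<otimes> y)) \<le> nrm (X n \<ominus> x) * nrm (Y n) + nrm x * nrm (Y n \<ominus> y)" .
next
  have "(\<lambda>n. nrm (X n \<ominus> x) * nrm (Y n) + nrm x * nrm (Y n \<ominus> y)) \<longlonglongrightarrow> 0 * nrm y + nrm x * 0"
    using assms conv_nrm[of Y y] by (intro tendsto_intros) (auto simp: conv_def)
  then show "(\<lambda>n. nrm (X n \<ominus> x) * nrm (Y n) + nrm x * nrm (Y n \<ominus> y)) \<longlonglongrightarrow> 0" by simp
qed (use assms in auto)

lemma conv_unique:
  assumes "conv X x" "conv X y" and c: "\<And>n. X n \<in> carrier A" "x \<in> carrier A" "y \<in> carrier A"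
  shows "x = y"
proof -
  have "(\<lambda>n. nrm (X n \<ominus> x) + nrm (X n \<ominus> y)) \<longlonglongrightarrow> 0"
    using tendsto_add[of _ 0 _ _ 0] assms(1,2) by (fastforce simp: conv_def)
  moreover have "nrm (x \<ominus> y) \<le> nrm (X n \<ominus> x) + nrm (X n \<ominus> y)" for n
    using nrm_diff_trans[of x "X n" y] nrm_diff_commute[of x "X n"] c by auto
  ultimately have "nrm (x \<ominus> y) \<le> 0" by (intro LIMSEQ_le_const) auto
  then have "nrm (x \<ominus> y) = 0" using norm_nonneg[of "x \<ominus> y"] c by simp
  then show ?thesis using nrm_diff_zero c by simp
qed

lemma conv_Suc: "conv X x \<Longrightarrow> conv (\<lambda>n. X (Suc n)) x"
  unfolding conv_def by (rule LIMSEQ_Suc)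

text \<open>The increments of \<open>X\<close> are dominated by those of a convergent real sequence,
  so \<open>X\<close> is Cauchy. Meant for \<open>sqrt_iter\<close> with the majorant
  \<open>sqrt_bd\<close>.\<close>

lemma conv_exists:
  assumes c: "\<And>n. X n \<in> carrier A" and b: "\<And>m n. m \<le> n \<Longrightarrow> nrm (X n \<ominus> X m) \<le> B n - B m" and "convergent B"
  shows "\<exists>x\<in>carrier A. conv X x"
  unfolding conv_def
proof (rule complete)
  show "range X \<subseteq> carrier A" using c by auto
next
  fix e :: real assume "0 < e"
  obtain N where N: "\<And>m n. m \<ge> N \<Longrightarrow> n \<ge> N \<Longrightarrow> norm (B m - B n) < e"
    using \<open>convergent B\<close> \<open>0 < e\<close> by (meson Cauchy_iff convergent_eq_Cauchy Cauchy_convergent_iff)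
  have "nrm (X m \<ominus> X n) < e" if "m \<ge> N" "n \<ge> N" for m n
  proof (cases "n \<le> m")
    case True then show ?thesis using b[of n m] N[OF that] by auto
  next
    case False then show ?thesis using b[of m n] N[OF that] nrm_diff_commute[of "X m" "X n"] c by auto
  qed
  then show "\<exists>N. \<forall>m\<ge>N. \<forall>n\<ge>N. nrm (X m \<ominus> X n) < e" by blast
qed

end

text \<open>Otherwise the ratio \<open>q = y / z > 1\<close> would satisfy
  \<open>q ^ (2^k) \<le> c * 2^k + 1\<close>, exponential against linear growth in
  \<open>2^k\<close>. Only exponents that are powers of two occur, since for these the C*-identity
  gives the norm of a power of a self-adjoint element.\<close>

lemma power_trick:
  fixes y z c :: real
  assumes "0 \<le> z" and "0 \<le> c" and le: "\<And>k. y ^ (2^k) \<le> (c * 2^k + 1) * z ^ (2^k)"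
  shows "y \<le> z"
proof (rule ccontr)
  assume "\<not> y \<le> z"
  then have yz: "z < y" by simp
  show False
  proof (cases "z = 0")
    case True
    with le[of 0] yz show False by simp
  next
    case False
    with assms yz have z: "0 < z" "0 < y" by auto
    define q where "q = y / z"
    have q: "1 < q" using z yz by (simp add: q_def)
    have "(q ^ (2^k)) \<le> c * 2^k + 1" for k
      using le[of k] z by (simp add: q_def power_divide field_simps)
    moreover have "exp (ln q * 2^k) = q ^ (2^k)" for k
      using exp_of_nat_mult[of "2^k" "ln q"] q by (simp add: mult.commute)
    ultimately have *: "exp (ln q * 2^k) \<le> c * 2^k + 1" for k by simp
    have "filterlim (\<lambda>k. (2::real)^k) at_top sequentially"
      by real_asymp
    moreover have "eventually (\<lambda>t. exp (ln q * t) > c * t + 1) at_top"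
      using q ln_gt_zero[OF q] by real_asymp
    ultimately have "eventually (\<lambda>k. exp (ln q * 2^k) > c * 2^k + 1) sequentially"
      by (rule eventually_compose_filterlim[rotated])
    then obtain k where "exp (ln q * 2^k) > c * 2^k + 1"
      by (auto simp: eventually_sequentially)
    with *[of k] show False by simp
  qed
qed

section \<open>Positivity through norms: square roots, projections and their orthogonality\<close>

context cstar_algebra
begin

text \<open>Each squaring is an instance of the C*-identity, because powers of a self-adjoint
  element are self-adjoint.\<close>

lemma nrm_selfadj_power:
  assumes "x \<in> carrier A" "star x = x"
  shows "nrm (x [^] (2^k::nat)) = nrm x ^ (2^k)"
proof -
  have "star (x [^] (n::nat)) = x [^] n" for n
    using assms by (induction n) (simp_all add: adj_mult nat_pow_Suc2[symmetric])
  then have "nrm (x [^] (n::nat) \<otimes> x [^] n) = (nrm (x [^] n))\<^sup>2" for n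
    using norm_cstar[of "x [^] n"] assms by simp
  then show ?thesis
    using assms by (induction k) (simp_all add: mult_2 nat_pow_mult[symmetric] power_add power2_eq_square)
qed

text \<open>A limit \<open>y\<close> solves \<open>y = (k + y^2) / 2\<close>, that is
  \<open>(1 - y)^2 = 1 - k\<close>. So this is the fixed-point iteration for 1 minus the square root
  of \<open>1 - k\<close>.\<close>

primrec sqrt_iter :: "'a \<Rightarrow> nat \<Rightarrow> 'a" where
  "sqrt_iter k 0 = \<zero>"
| "sqrt_iter k (Suc n) = (1/2) \<odot> (k \<oplus> sqrt_iter k n \<otimes> sqrt_iter k n)"

text \<open>The same iteration for the scalar \<open>k = 1\<close>. It increases within the unit
  interval and majorises norms and increments of \<open>sqrt_iter k\<close> when
  \<open>nrm k \<le> 1\<close>.\<close>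

primrec sqrt_bd :: "nat \<Rightarrow> real" where
  "sqrt_bd 0 = 0"
| "sqrt_bd (Suc n) = (1 + sqrt_bd n * sqrt_bd n) / 2"

declare sqrt_iter.simps(2) [simp del] sqrt_bd.simps(2) [simp del]

lemma sqrt_bd: "0 \<le> sqrt_bd n" "sqrt_bd n \<le> sqrt_bd (Suc n)" "sqrt_bd n \<le> 1"
proof -
  have *: "0 \<le> sqrt_bd n \<and> sqrt_bd n \<le> 1" for n
  proof (induction n)
    case (Suc n)
    then have "sqrt_bd n * sqrt_bd n \<le> 1" by (simp add: mult_le_one)
    then show ?case using Suc by (simp add: sqrt_bd.simps(2))
  qed simp
  then show "0 \<le> sqrt_bd n" "sqrt_bd n \<le> 1" by auto
  have "0 \<le> (1 - sqrt_bd n)\<^sup>2" by simp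
  then show "sqrt_bd n \<le> sqrt_bd (Suc n)" by (simp add: sqrt_bd.simps(2) power2_eq_square algebra_simps)
qed

lemma sqrt_bd_convergent: "convergent sqrt_bd"
proof (rule Bseq_monoseq_convergent)
  show "Bseq sqrt_bd" by (rule BseqI'[of _ 1]) (simp add: sqrt_bd)
  show "monoseq sqrt_bd" by (intro incseq_imp_monoseq incseq_SucI sqrt_bd)
qed

lemma sqrt_iter_closed [simp]: "k \<in> carrier A \<Longrightarrow> sqrt_iter k n \<in> carrier A"
  by (induction n) (auto simp: sqrt_iter.simps(2))

lemma sqrt_iter_commute:
  assumes "k \<in> carrier A" "z \<in> carrier A" "z \<otimes> k = k \<otimes> z"
  shows "z \<otimes> sqrt_iter k n = sqrt_iter k n \<otimes> z"
proof (induction n)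
  case (Suc n)
  let ?y = "sqrt_iter k n"
  have "z \<otimes> (?y \<otimes> ?y) = (z \<otimes> ?y) \<otimes> ?y" using assms by (simp add: m_assoc)
  also have "\<dots> = (?y \<otimes> z) \<otimes> ?y" unfolding Suc ..
  also have "\<dots> = ?y \<otimes> (z \<otimes> ?y)" using assms by (simp add: m_assoc)
  also have "\<dots> = ?y \<otimes> (?y \<otimes> z)" unfolding Suc ..
  also have "\<dots> = ?y \<otimes> ?y \<otimes> z" using assms by (simp add: m_assoc)
  finally show ?case using assms by (simp add: sqrt_iter.simps(2) smult_mult_left smult_mult_right l_distr r_distr)
qed (use assms in simp)

lemma sqrt_iter_star: "k \<in> carrier A \<Longrightarrow> star k = k \<Longrightarrow> star (sqrt_iter k n) = sqrt_iter k n"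
  by (induction n) (simp_all add: sqrt_iter.simps(2) adj_smult adj_add adj_mult)

lemma half_sm: assumes "x \<in> carrier A" shows "(1/2) \<odot> (x \<oplus> x) = x"
  using sm_l_distr[OF assms, of "1/2" "1/2"] assms by (simp add: sm_r_distr)

text \<open>Successive iterates commute, so \<open>u^2 - v^2\<close> factors as
  \<open>(u - v)(u + v)\<close>. The scalar iteration obeys the same factorisation, hence both
  estimates propagate by induction.\<close>

lemma sqrt_iter_nrm:
  assumes k: "k \<in> carrier A" "nrm k \<le> 1"
  shows "nrm (sqrt_iter k n) \<le> sqrt_bd n"
    "nrm (sqrt_iter k (Suc n) \<ominus> sqrt_iter k n) \<le> sqrt_bd (Suc n) - sqrt_bd n"
proof -
  let ?y = "sqrt_iter k"
  show 1: "nrm (?y n) \<le> sqrt_bd n" for n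
  proof (induction n)
    case (Suc n)
    have "nrm (?y (Suc n)) = nrm (k \<oplus> ?y n \<otimes> ?y n) / 2" using k norm_smult[of _ "1/2"] by (simp add: sqrt_iter.simps(2))
    also have "nrm (k \<oplus> ?y n \<otimes> ?y n) \<le> nrm k + nrm (?y n) * nrm (?y n)"
      using norm_triangle[of k "?y n \<otimes> ?y n"] norm_mult[of "?y n" "?y n"] k by simp
    also have "\<dots> \<le> 1 + sqrt_bd n * sqrt_bd n"
      using k Suc norm_nonneg[of "?y n"] by (intro add_mono mult_mono) (auto intro: sqrt_bd)
    finally show ?case by (simp add: sqrt_bd.simps(2))
  qed simp
  show "nrm (?y (Suc n) \<ominus> ?y n) \<le> sqrt_bd (Suc n) - sqrt_bd n"
  proof (induction n)
    case 0
    then show ?case using k norm_smult[of k "1/2"] by (simp add: a_minus_def sqrt_iter.simps(2) sqrt_bd.simps(2))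
  next
    case (Suc n)
    let ?u = "?y (Suc n)" and ?v = "?y n"
    have cl: "?u \<in> carrier A" "?v \<in> carrier A" using k sqrt_iter_closed by blast+
    \<comment> \<open>The iterate \<open>?u\<close> commutes with \<open>k\<close>, hence with every
      iterate.\<close>
    have cm: "?u \<otimes> ?v = ?v \<otimes> ?u"
      using sqrt_iter_commute[OF k(1) cl(1)] sqrt_iter_commute[OF k(1) k(1) refl, of "Suc n"]
      by simp
    have "(k \<oplus> ?u \<otimes> ?u) \<ominus> (k \<oplus> ?v \<otimes> ?v) = ?u \<otimes> ?u \<ominus> ?v \<otimes> ?v" using k cl by algebra
    also have "\<dots> = (?u \<ominus> ?v) \<otimes> (?u \<oplus> ?v)"
    proof -
      have "(?u \<ominus> ?v) \<otimes> (?u \<oplus> ?v) = ?u \<otimes> ?u \<ominus> ?v \<otimes> ?v \<oplus> (?u \<otimes> ?v \<ominus> ?v \<otimes> ?u)"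
        using cl by algebra
      then show ?thesis using cm cl diff_eq_zero[of "?v \<otimes> ?u" "?v \<otimes> ?u"] by simp
    qed
    finally have e: "(k \<oplus> ?u \<otimes> ?u) \<ominus> (k \<oplus> ?v \<otimes> ?v) = (?u \<ominus> ?v) \<otimes> (?u \<oplus> ?v)" .
    have "?y (Suc (Suc n)) \<ominus> ?u = (1/2) \<odot> ((k \<oplus> ?u \<otimes> ?u) \<ominus> (k \<oplus> ?v \<otimes> ?v))"
      using k(1) by (subst (1 2) sqrt_iter.simps(2)) (simp add: a_minus_def sm_r_distr sm_minus minus_add)
    then have "nrm (?y (Suc (Suc n)) \<ominus> ?u) = nrm ((?u \<ominus> ?v) \<otimes> (?u \<oplus> ?v)) / 2"
      unfolding e using norm_smult[of "(?u \<ominus> ?v) \<otimes> (?u \<oplus> ?v)" "1/2"] cl by simp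
    also have "nrm ((?u \<ominus> ?v) \<otimes> (?u \<oplus> ?v)) \<le> nrm (?u \<ominus> ?v) * (nrm ?u + nrm ?v)"
      using norm_mult[of "?u \<ominus> ?v" "?u \<oplus> ?v"] norm_triangle[OF cl] cl norm_nonneg[of "?u \<ominus> ?v"]
      by (meson mult_left_mono order_trans minus_closed add.m_closed)
    also have "\<dots> \<le> (sqrt_bd (Suc n) - sqrt_bd n) * (sqrt_bd (Suc n) + sqrt_bd n)"
      using Suc 1[of "Suc n"] 1[of n] cl norm_nonneg sqrt_bd(2)[of n]
      by (intro mult_mono add_mono) (auto)
    finally have "2 * nrm (?y (Suc (Suc n)) \<ominus> ?u) \<le> (sqrt_bd (Suc n) - sqrt_bd n) * (sqrt_bd (Suc n) + sqrt_bd n)"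
      by simp
    moreover have "(sqrt_bd (Suc n) - sqrt_bd n) * (sqrt_bd (Suc n) + sqrt_bd n) = 2 * (sqrt_bd (Suc (Suc n)) - sqrt_bd (Suc n))"
      by (simp add: sqrt_bd.simps(2)[of "Suc n"] sqrt_bd.simps(2)[of n] algebra_simps)
    moreover have "a \<le> b" if "2 * a \<le> c" "c = 2 * b" for a b c :: real using that by linarith
    ultimately show ?case by blast
  qed
qed

text \<open>The root is \<open>1 - y\<close> for the limit \<open>y\<close> of
  \<open>sqrt_iter k\<close>. Every iterate is a polynomial in \<open>k\<close>, so commutation with
  \<open>k\<close> passes to the limit; this clause is what makes the two roots in
  \<open>selfadj_squeeze\<close> commute.\<close>

lemma sqrt_exists:
  assumes k: "k \<in> carrier A" "star k = k" "nrm k \<le> 1"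
  obtains r where "r \<in> carrier A" "star r = r" "r \<otimes> r = \<one> \<ominus> k"
    "\<And>z. z \<in> carrier A \<Longrightarrow> z \<otimes> k = k \<otimes> z \<Longrightarrow> z \<otimes> r = r \<otimes> z"
proof -
  let ?y = "sqrt_iter k"
  have "nrm (?y n \<ominus> ?y m) \<le> sqrt_bd n - sqrt_bd m" if "m \<le> n" for m n
    using that
  proof (induction n rule: dec_induct)
    case base then show ?case using k by (simp add: a_minus_def r_neg)
  next
    case (step n)
    then show ?case
      using nrm_diff_trans[of "?y (Suc n)" "?y n" "?y m"] sqrt_iter_nrm(2)[OF k(1,3), of n] k
      by simp
  qed
  then obtain y where y: "y \<in> carrier A" "conv ?y y"
    using conv_exists[of ?y sqrt_bd] sqrt_bd_convergent k by auto
  have "conv (\<lambda>n. star (?y n)) (star y)" using y k by (intro conv_star) auto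
  then have sy: "star y = y" using conv_unique[of ?y "star y" y] y k by (simp add: sqrt_iter_star)
  have "conv (\<lambda>n. (1/2) \<odot> (k \<oplus> ?y n \<otimes> ?y n)) ((1/2) \<odot> (k \<oplus> y \<otimes> y))"
    using y k by (intro conv_sm conv_add conv_mult conv_const) auto
  moreover have "conv (\<lambda>n. (1/2) \<odot> (k \<oplus> ?y n \<otimes> ?y n)) y" using conv_Suc[OF y(2)] by (simp add: sqrt_iter.simps(2))
  ultimately have "y = (1/2) \<odot> (k \<oplus> y \<otimes> y)"
    using y k by (intro conv_unique[of "\<lambda>n. (1/2) \<odot> (k \<oplus> ?y n \<otimes> ?y n)"]) auto
  then have "y \<oplus> y = (1/2) \<odot> (k \<oplus> y \<otimes> y) \<oplus> (1/2) \<odot> (k \<oplus> y \<otimes> y)" by simp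
  also have "\<dots> = k \<oplus> y \<otimes> y" using y k half_sm by (subst sm_r_distr[symmetric]) auto
  finally have yy: "y \<oplus> y = k \<oplus> y \<otimes> y" .
  have "(\<one> \<ominus> y) \<otimes> (\<one> \<ominus> y) = \<one> \<ominus> (y \<oplus> y) \<oplus> y \<otimes> y"
    using y(1) by (simp add: a_minus_def l_distr r_distr l_minus r_minus minus_add a_ac)
  also have "\<dots> = \<one> \<ominus> (k \<oplus> y \<otimes> y) \<oplus> y \<otimes> y" by (simp only: yy)
  also have "\<dots> = \<one> \<ominus> k" using y(1) k(1) by (simp add: a_minus_def minus_add a_assoc l_neg)
  finally have fin: "(\<one> \<ominus> y) \<otimes> (\<one> \<ominus> y) = \<one> \<ominus> k" .
  have com: "z \<otimes> (\<one> \<ominus> y) = (\<one> \<ominus> y) \<otimes> z" if z: "z \<in> carrier A" "z \<otimes> k = k \<otimes> z" for z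
  proof -
    have "conv (\<lambda>n. z \<otimes> ?y n) (z \<otimes> y)" "conv (\<lambda>n. ?y n \<otimes> z) (y \<otimes> z)"
      using y k z by (auto intro!: conv_mult conv_const)
    then have "z \<otimes> y = y \<otimes> z"
      using y k z by (intro conv_unique[of "\<lambda>n. z \<otimes> ?y n"]) (auto simp: sqrt_iter_commute)
    then show ?thesis using y z by (simp add: a_minus_def r_distr l_distr r_minus l_minus)
  qed
  have "\<one> \<ominus> y \<in> carrier A" "star (\<one> \<ominus> y) = \<one> \<ominus> y" using y(1) sy by (simp_all add: star_diff)
  then show ?thesis by (rule that[OF _ _ fin com])
qed

lemma star_mult_zero: "x \<in> carrier A \<Longrightarrow> star x \<otimes> x = \<zero> \<Longrightarrow> x = \<zero>"
  using norm_cstar[of x] norm_eq_zero[of x] by simp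

text \<open>Both \<open>x = r\<^sup>2\<close> and \<open>- x = q\<^sup>2\<close> are squares of commuting self-adjoint elements, and
  \<open>(r - \<i> q) (r + \<i> q) = 0\<close>.\<close>

lemma selfadj_squeeze:
  assumes x: "x \<in> carrier A" "star x = x" and n: "nrm (\<one> \<ominus> x) \<le> 1" "nrm (\<one> \<oplus> x) \<le> 1"
  shows "x = \<zero>"
proof -
  have hyp: "\<one> \<ominus> x \<in> carrier A" "star (\<one> \<ominus> x) = \<one> \<ominus> x" "\<one> \<oplus> x \<in> carrier A" "star (\<one> \<oplus> x) = \<one> \<oplus> x"
    using x by (simp_all add: star_diff adj_add)
  obtain r where r: "r \<in> carrier A" "star r = r" "r \<otimes> r = \<one> \<ominus> (\<one> \<ominus> x)"
    and rc: "\<And>z. z \<in> carrier A \<Longrightarrow> z \<otimes> (\<one> \<ominus> x) = (\<one> \<ominus> x) \<otimes> z \<Longrightarrow> z \<otimes> r = r \<otimes> z"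
    using sqrt_exists[OF hyp(1,2) n(1)] by blast
  obtain q where q: "q \<in> carrier A" "star q = q" "q \<otimes> q = \<one> \<ominus> (\<one> \<oplus> x)"
    and qc: "\<And>z. z \<in> carrier A \<Longrightarrow> z \<otimes> (\<one> \<oplus> x) = (\<one> \<oplus> x) \<otimes> z \<Longrightarrow> z \<otimes> q = q \<otimes> z"
    using sqrt_exists[OF hyp(3,4) n(2)] by blast
  have rr: "r \<otimes> r = x" unfolding r(3) using x(1) by algebra
  have qq: "q \<otimes> q = \<ominus> x" unfolding q(3) using x(1) by algebra
  have "x \<otimes> r = r \<otimes> x"
    by (rule rc) (use x in \<open>simp_all add: a_minus_def r_distr l_distr r_minus l_minus\<close>)
  then have comm: "r \<otimes> q = q \<otimes> r" by (intro qc) (use x r in \<open>simp_all add: r_distr l_distr\<close>)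
  \<comment> \<open>This \<open>p\<close> is skew-adjoint with square \<open>x\<close>, so
    \<open>r \<ominus> p\<close> is \<open>star (r \<oplus> p)\<close> and the vanishing product
    below has the form \<open>star w \<otimes> w\<close>.\<close>
  define p where "p = \<i> \<odot> q"
  have p: "p \<in> carrier A" "star p = \<ominus> p" "r \<otimes> p = p \<otimes> r" "p \<otimes> p = x"
    using q(1,2) r(1) x(1) comm qq sm_minus_one[of p] sm_minus_one[of "\<ominus> x"]
    by (simp_all add: p_def adj_smult sm_assoc mult_sm smult_mult_left smult_mult_right)
  have "(r \<ominus> p) \<otimes> (r \<oplus> p) = (r \<otimes> r \<ominus> p \<otimes> p) \<oplus> (r \<otimes> p \<ominus> p \<otimes> r)" using r(1) p(1) by algebra
  then have "star (r \<oplus> p) \<otimes> (r \<oplus> p) = \<zero>" using r p x rr by (simp add: adj_add a_minus_def r_neg)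
  then have w: "r \<oplus> p = \<zero>" using star_mult_zero[of "r \<oplus> p"] r p by simp
  have "r \<ominus> p = star (r \<oplus> p)" using r p by (simp add: adj_add a_minus_def)
  then have "r \<oplus> p \<oplus> (r \<ominus> p) = \<zero>" unfolding w by simp
  moreover have "r \<oplus> p \<oplus> (r \<ominus> p) = r \<oplus> r" using r(1) p(1) by algebra
  ultimately have "r \<oplus> r = \<zero>" by (rule trans[OF sym, rotated])
  from half_sm[OF r(1), unfolded this] have "r = \<zero>" by simp
  then show ?thesis using rr by simp
qed

lemma add_eq_self_zero: "x \<in> carrier A \<Longrightarrow> y \<in> carrier A \<Longrightarrow> x \<oplus> y = x \<Longrightarrow> y = \<zero>"
  using r_neg1[of x y] l_neg[of x] by simp

definition projection :: "'a \<Rightarrow> bool" where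
  "projection p \<longleftrightarrow> p \<in> carrier A \<and> star p = p \<and> p \<otimes> p = p"

lemma projection_nrm: assumes "projection p" shows "nrm p \<le> 1"
proof -
  have "(nrm p)\<^sup>2 = nrm p" using norm_cstar[of p] assms by (simp add: projection_def)
  then show ?thesis by (auto simp add: power2_eq_square)
qed

text \<open>The condition \<open>nrm (\<one> \<ominus> x) \<le> 1\<close> stands for positivity of a
  self-adjoint \<open>x\<close>. With \<open>m\<close> the number of the other summands,
  \<open>m + x i\<close> is the sum of the \<open>1 - x j\<close> over these and
  \<open>m - x i\<close> is \<open>(m - 1) + (1 - x i)\<close>. Both have norm at most
  \<open>m\<close>, and \<open>selfadj_squeeze\<close> applies to \<open>x i / m\<close>.\<close>

lemma positive_sum_zero:
  assumes J: "finite J" and x: "\<And>j. j \<in> J \<Longrightarrow> x j \<in> carrier A \<and> star (x j) = x j \<and> nrm (\<one> \<ominus> x j) \<le> 1"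
    and s: "(\<Oplus>j\<in>J. x j) = \<zero>" and i: "i \<in> J"
  shows "x i = \<zero>"
proof (cases "J - {i} = {}")
  case True
  then have "J = {i}" using i by auto
  then show ?thesis using s x[OF i] by simp
next
  case False
  define K where "K = J - {i}"
  have K: "finite K" "i \<notin> K" "J = insert i K" "K \<noteq> {}" using J i False by (auto simp: K_def)
  define m where "m = card K"
  have m: "0 < m" using K by (simp add: m_def card_gt_0_iff)
  have xK: "x \<in> K \<rightarrow> carrier A" using x K by auto
  have "x i \<oplus> (\<Oplus>j\<in>K. x j) = \<zero>" using s K x xK by (simp add: finsum_insert)
  then have xi: "x i = \<ominus> (\<Oplus>j\<in>K. x j)" using x[OF i] xK
    by (metis finsum_closed minus_equality)
  have "(\<Oplus>j\<in>F. \<one> \<ominus> x j) = of_nat (card F) \<odot> \<one> \<ominus> (\<Oplus>j\<in>F. x j)" if "finite F" "F \<subseteq> K" for F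
    using that
  proof (induction F rule: finite_induct)
    case (insert j F)
    have "x \<in> F \<rightarrow> carrier A" "x j \<in> carrier A" using insert xK by auto
    moreover have "(\<Oplus>j\<in>insert j F. \<one> \<ominus> x j) = (\<one> \<ominus> x j) \<oplus> (\<Oplus>j\<in>F. \<one> \<ominus> x j)"
      using insert xK by (intro finsum_insert) auto
    ultimately show ?case using insert
      by (simp add: sm_l_distr a_minus_def minus_add a_ac)
  qed (simp add: a_minus_def)
  then have "(\<Oplus>j\<in>K. \<one> \<ominus> x j) = of_nat m \<odot> \<one> \<oplus> x i"
    using K xi xK by (simp add: m_def a_minus_def)
  moreover have "nrm (\<Oplus>j\<in>K. \<one> \<ominus> x j) \<le> (\<Sum>j\<in>K. nrm (\<one> \<ominus> x j))"
    using xK K by (intro nrm_finsum) auto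
  moreover have "(\<Sum>j\<in>K. nrm (\<one> \<ominus> x j)) \<le> m"
    using sum_bounded_above[of K "\<lambda>j. nrm (\<one> \<ominus> x j)" 1] x K by (simp add: m_def)
  ultimately have "nrm (of_nat m \<odot> \<one> \<oplus> x i) \<le> m" by simp
  moreover have "nrm (of_nat m \<odot> \<one> \<ominus> x i) \<le> m"
  proof -
    have "of_nat m \<odot> \<one> \<ominus> x i = of_nat (m - 1) \<odot> \<one> \<oplus> (\<one> \<ominus> x i)"
      using sm_l_distr[of \<one> "of_nat (m - 1)" 1] m x[OF i] by (simp add: a_minus_def a_assoc of_nat_diff)
    also have "nrm \<dots> \<le> nrm (of_nat (m - 1) \<odot> \<one>) + nrm (\<one> \<ominus> x i)" using x[OF i] by (intro norm_triangle) auto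
    also have "\<dots> \<le> real (m - 1) * 1 + 1"
      using x[OF i] projection_nrm[of \<one>] norm_smult[of \<one> "of_nat (m - 1)"]
      by (intro add_mono) (simp_all add: projection_def mult_left_le)
    finally show ?thesis using m by (simp add: of_nat_diff)
  qed
  moreover have "nrm ((1 / of_nat m) \<odot> z) \<le> 1" if "nrm z \<le> m" "z \<in> carrier A" for z
    using norm_smult[OF that(2), of "1 / of_nat m"] that m by (simp add: norm_divide)
  moreover have "(1 / of_nat m) \<odot> (of_nat m \<odot> \<one> \<oplus> x i) = \<one> \<oplus> (1 / of_nat m) \<odot> x i"
    "(1 / of_nat m) \<odot> (of_nat m \<odot> \<one> \<ominus> x i) = \<one> \<ominus> (1 / of_nat m) \<odot> x i"
    using x[OF i] m by (simp_all add: a_minus_def sm_r_distr sm_assoc sm_minus)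
  ultimately have "(1 / of_nat m) \<odot> x i = \<zero>"
    using x[OF i] by (intro selfadj_squeeze) (simp_all add: adj_smult, metis minus_closed sm_closed one_closed, metis a_closed sm_closed one_closed)
  then have "of_nat m \<odot> ((1 / of_nat m) \<odot> x i) = \<zero>" by simp
  then show ?thesis using x[OF i] m by (simp add: sm_assoc)
qed

lemma projection_nrm_eq: assumes "projection p" "p \<noteq> \<zero>" shows "nrm p = 1"
proof -
  have "(nrm p)\<^sup>2 = nrm p" using norm_cstar[of p] assms by (simp add: projection_def)
  then show ?thesis using assms norm_eq_zero[of p] by (auto simp add: power2_eq_square projection_def)
qed

lemma projection_compl: "projection p \<Longrightarrow> projection (\<one> \<ominus> p)"
  by (auto simp: projection_def adj_add star_minus a_minus_def l_distr r_distr l_minus r_minus minus_add r_neg)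

text \<open>Write \<open>1 - p q p = e + y\<close> with \<open>e = 1 - p\<close> and
  \<open>y = p (1 - q) p\<close>. These are self-adjoint contractions with
  \<open>e y = y e = 0\<close>, so \<open>(e + y)^n = e + y^n\<close> has norm at most 2, and
  passing to powers lowers the bound to 1.\<close>

lemma projection_corner:
  assumes p: "projection p" and q: "projection q"
  shows "nrm (\<one> \<ominus> p \<otimes> q \<otimes> p) \<le> 1"
proof -
  have pc: "p \<in> carrier A" "star p = p" "p \<otimes> p = p" and qc: "q \<in> carrier A" "star q = q" "q \<otimes> q = q"
    using p q by (auto simp: projection_def)
  define e where "e = \<one> \<ominus> p"
  define y where "y = p \<otimes> (\<one> \<ominus> q) \<otimes> p"
  have ec: "e \<in> carrier A" "star e = e" "e \<otimes> e = e" "nrm e \<le> 1"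
    using projection_compl[OF p] projection_nrm by (auto simp: e_def projection_def)
  have yc: "y \<in> carrier A" "star y = y" using pc qc by (auto simp: y_def adj_mult star_diff m_assoc)
  have "p \<otimes> e = \<zero>" "e \<otimes> p = \<zero>"
    using pc by (auto simp: e_def a_minus_def l_distr r_distr l_minus r_minus r_neg)
  then have ey: "e \<otimes> y = \<zero>" "y \<otimes> e = \<zero>" using pc qc ec by (auto simp: y_def m_assoc) (simp flip: m_assoc)
  have "nrm y \<le> nrm (p \<otimes> (\<one> \<ominus> q)) * nrm p" using pc qc unfolding y_def by (intro norm_mult) auto
  also have "\<dots> \<le> (nrm p * nrm (\<one> \<ominus> q)) * nrm p"
    using pc qc by (intro mult_right_mono norm_mult norm_nonneg) auto
  also have "\<dots> \<le> (1 * 1) * 1"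
    using projection_nrm p q projection_compl pc qc by (intro mult_mono norm_nonneg) (auto simp: norm_nonneg)
  finally have ny: "nrm y \<le> 1" by simp
  have e: "\<one> \<ominus> p \<otimes> q \<otimes> p = e \<oplus> y"
  proof -
    have "p \<otimes> (\<one> \<ominus> q) \<otimes> p = p \<ominus> p \<otimes> q \<otimes> p"
      using pc qc by (simp add: a_minus_def l_distr r_distr l_minus r_minus m_assoc)
    then show ?thesis unfolding e_def y_def using pc qc by algebra
  qed
  have pw: "(e \<oplus> y) [^] Suc n = e \<oplus> y [^] Suc n" for n
  proof (induction n)
    case (Suc n)
    have "(e \<oplus> y [^] Suc n) \<otimes> (e \<oplus> y) = e \<oplus> y [^] Suc (Suc n)"
      using ec yc ey by (simp add: l_distr r_distr m_assoc)
    with Suc show ?case by simp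
  qed (use ec yc in simp)
  have "nrm (e \<oplus> y) ^ 2^k \<le> (1 * 2^k + 1) * 1 ^ 2^k" for k
  proof -
    have "nrm (e \<oplus> y) ^ 2^k = nrm (e \<oplus> y [^] (2^k::nat))"
      using nrm_selfadj_power[of "e \<oplus> y" k] ec yc pw[of "2^k - 1"] by (simp add: adj_add)
    also have "\<dots> \<le> nrm e + nrm (y [^] (2^k::nat))" using ec yc by (intro norm_triangle) auto
    also have "\<dots> \<le> 1 + 1" using ec ny nrm_selfadj_power[OF yc, of k] norm_nonneg[of y] yc
      by (intro add_mono) (auto intro: power_le_one)
    finally have "nrm (e \<oplus> y) ^ 2^k \<le> 1 + 1" .
    \<comment> \<open>The constant 2 is weakened to the form \<open>c * 2^k + 1\<close> of
      \<open>power_trick\<close>, with \<open>c = 1\<close>.\<close>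
    also have "1 + 1 \<le> 2 ^ k + (1::real)" by (intro add_mono one_le_power) auto
    finally show ?thesis by simp
  qed
  then have "nrm (e \<oplus> y) \<le> 1" by (rule power_trick[rotated 2]) simp_all
  then show ?thesis unfolding e .
qed

text \<open>Compressing the sum by \<open>p i\<close> and cancelling \<open>p i\<close> leaves a
  vanishing sum of the positive elements \<open>p i p k p i\<close>, so each of them is zero. Now
  \<open>p i p j p i\<close> is \<open>star w \<otimes> w\<close> for
  \<open>w = p j p i\<close>.\<close>

lemma projections_sum_one_orthogonal:
  assumes J: "finite J" and p: "\<And>j. j \<in> J \<Longrightarrow> projection (p j)" and s: "(\<Oplus>j\<in>J. p j) = \<one>"
    and ij: "i \<in> J" "j \<in> J" "i \<noteq> j"
  shows "p i \<otimes> p j = \<zero>"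
proof -
  have pc: "\<And>j. j \<in> J \<Longrightarrow> p j \<in> carrier A \<and> star (p j) = p j \<and> p j \<otimes> p j = p j"
    using p by (auto simp: projection_def)
  define K where "K = J - {i}"
  have K: "finite K" "i \<notin> K" "J = insert i K" "j \<in> K" using J ij by (auto simp: K_def)
  have pK: "p \<in> K \<rightarrow> carrier A" using pc K by auto
  have "p i \<oplus> (\<Oplus>k\<in>K. p k) = \<one>" using s K pK pc by (simp add: finsum_insert)
  then have "p i \<otimes> (p i \<oplus> (\<Oplus>k\<in>K. p k)) \<otimes> p i = p i" using pc ij by simp
  moreover have "p i \<otimes> (p i \<oplus> (\<Oplus>k\<in>K. p k)) \<otimes> p i = p i \<oplus> (\<Oplus>k\<in>K. p i \<otimes> p k \<otimes> p i)"
    using pK pc ij K by (simp add: l_distr r_distr finsum_ldistr finsum_rdistr m_assoc Pi_def)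
  ultimately have "p i \<oplus> (\<Oplus>k\<in>K. p i \<otimes> p k \<otimes> p i) = p i" by simp
  then have "(\<Oplus>k\<in>K. p i \<otimes> p k \<otimes> p i) = \<zero>"
    using pc ij pK by (intro add_eq_self_zero[of "p i"] finsum_closed) auto
  then have z: "p i \<otimes> p j \<otimes> p i = \<zero>"
  proof (rule positive_sum_zero[OF K(1), rotated])
    show "j \<in> K" by fact
    fix k assume "k \<in> K"
    then have "p k \<in> carrier A" "star (p k) = p k" "projection (p k)" "p i \<in> carrier A" "star (p i) = p i" "projection (p i)"
      using pc p ij K by auto
    then show "p i \<otimes> p k \<otimes> p i \<in> carrier A \<and> star (p i \<otimes> p k \<otimes> p i) = p i \<otimes> p k \<otimes> p i \<and>
      nrm (\<one> \<ominus> p i \<otimes> p k \<otimes> p i) \<le> 1"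
      using projection_corner[of "p i" "p k"] by (simp add: adj_mult m_assoc)
  qed
  have "star (p j \<otimes> p i) \<otimes> (p j \<otimes> p i) = p i \<otimes> (p j \<otimes> p j) \<otimes> p i"
    using pc[OF ij(1)] pc[OF ij(2), THEN conjunct1] pc[OF ij(2), THEN conjunct2, THEN conjunct1]
    by (simp add: adj_mult m_assoc)
  also have "\<dots> = \<zero>" using z pc[OF ij(2)] by simp
  finally have "star (p j \<otimes> p i) \<otimes> (p j \<otimes> p i) = \<zero>" .
  then have "star (p j \<otimes> p i) = \<zero>" using star_mult_zero[of "p j \<otimes> p i"] pc ij by simp
  then show ?thesis using pc ij by (simp add: adj_mult)
qed

end

section \<open>Combinatorial side: scalar matrices, reduced words, star-polynomials\<close>

abbreviation "l2sq E \<eta> \<equiv> \<Sum>u\<in>E. (cmod (\<eta> u))\<^sup>2"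

subsection \<open>Scalar matrices\<close>

text \<open>An upper bound \<open>C\<close> for the operator norm of the matrix \<open>m\<close>
  from \<ell>2 of \<open>E\<close> to \<ell>2 of \<open>F\<close>.\<close>

definition l2_bounded :: "'v set \<Rightarrow> 'u set \<Rightarrow> ('v \<Rightarrow> 'u \<Rightarrow> complex) \<Rightarrow> real \<Rightarrow> bool" where
  "l2_bounded F E m C \<longleftrightarrow> 0 \<le> C \<and>
     (\<forall>\<eta>. (\<Sum>v\<in>F. (cmod (\<Sum>u\<in>E. m v u * \<eta> u))\<^sup>2) \<le> C\<^sup>2 * l2sq E \<eta>)"

lemma l2_boundedD: "l2_bounded F E m C \<Longrightarrow>
    (\<Sum>v\<in>F. (cmod (\<Sum>u\<in>E. m v u * \<eta> u))\<^sup>2) \<le> C\<^sup>2 * l2sq E \<eta>"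
  by (simp add: l2_bounded_def)

lemma cmod_sum_mult_le:
  "(cmod (\<Sum>v\<in>F. f v * h v))\<^sup>2 \<le> l2sq F f * l2sq F h"
proof -
  have "cmod (\<Sum>v\<in>F. f v * h v) \<le> (\<Sum>v\<in>F. cmod (f v) * cmod (h v))"
    by (rule order_trans[OF norm_sum]) (simp add: norm_mult)
  then have "(cmod (\<Sum>v\<in>F. f v * h v))\<^sup>2 \<le> (\<Sum>v\<in>F. cmod (f v) * cmod (h v))\<^sup>2"
    by (intro power_mono) auto
  also have "\<dots> \<le> l2sq F f * l2sq F h"
    by (rule Cauchy_Schwarz_ineq_sum)
  finally show ?thesis .
qed

text \<open>Let \<eta> be the adjoint matrix applied to \<zeta>. Its squared norm \<open>S\<close>
  is the inner product of the image of \<eta> with \<zeta>, so Cauchy-Schwarz gives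
  \<open>S^2 \<le> C^2 * S * Z\<close>; cancel \<open>S\<close>.\<close>

lemma l2_bounded_adjoint:
  assumes "l2_bounded F E m C"
  shows "l2_bounded E F (\<lambda>u v. cnj (m v u)) C"
  unfolding l2_bounded_def
proof (intro conjI allI)
  show C: "0 \<le> C" using assms by (simp add: l2_bounded_def)
  fix \<zeta>
  define \<eta> where "\<eta> u = (\<Sum>v\<in>F. cnj (m v u) * \<zeta> v)" for u
  define S where "S = l2sq E \<eta>"
  define Z where "Z = l2sq F \<zeta>"
  have S0: "0 \<le> S" and Z0: "0 \<le> Z" by (auto simp: S_def Z_def sum_nonneg)
  have "complex_of_real S = (\<Sum>u\<in>E. \<eta> u * cnj (\<eta> u))"
    by (simp only: S_def of_real_sum complex_norm_square)
  also have "\<dots> = (\<Sum>u\<in>E. \<Sum>v\<in>F. (m v u * \<eta> u) * cnj (\<zeta> v))"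
    by (simp add: \<eta>_def[of u for u, THEN arg_cong[where f = cnj]] sum_distrib_left mult_ac)
  also have "\<dots> = (\<Sum>v\<in>F. (\<Sum>u\<in>E. m v u * \<eta> u) * cnj (\<zeta> v))"
    by (subst sum.swap) (simp add: sum_distrib_right)
  finally have "S = cmod (\<Sum>v\<in>F. (\<Sum>u\<in>E. m v u * \<eta> u) * cnj (\<zeta> v))"
    using S0 by (metis norm_of_real abs_of_nonneg)
  then have "S\<^sup>2 \<le> (\<Sum>v\<in>F. (cmod (\<Sum>u\<in>E. m v u * \<eta> u))\<^sup>2) * Z"
    using cmod_sum_mult_le[of "\<lambda>v. \<Sum>u\<in>E. m v u * \<eta> u" "\<lambda>v. cnj (\<zeta> v)" F] by (simp add: Z_def)
  also have "\<dots> \<le> (C\<^sup>2 * S) * Z"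
    using assms Z0 by (intro mult_right_mono) (auto simp: l2_bounded_def S_def)
  finally have "S * S \<le> (C\<^sup>2 * Z) * S" by (simp add: power2_eq_square mult_ac)
  then have "S \<le> C\<^sup>2 * Z"
    using S0 Z0 by (cases "S = 0") (auto simp: mult_le_cancel_right)
  then show "(\<Sum>u\<in>E. (cmod (\<Sum>v\<in>F. cnj (m v u) * \<zeta> v))\<^sup>2) \<le> C\<^sup>2 * l2sq F \<zeta>"
    by (simp add: S_def Z_def \<eta>_def)
qed

lemma l2_bounded_mult:
  assumes "l2_bounded F E m C" "l2_bounded E H n D"
  shows "l2_bounded F H (\<lambda>v h. \<Sum>u\<in>E. m v u * n u h) (C * D)"
  unfolding l2_bounded_def
proof (intro conjI allI)
  show "0 \<le> C * D" using assms by (simp add: l2_bounded_def)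
  fix \<eta> :: "_ \<Rightarrow> complex"
  have "(\<Sum>h\<in>H. (\<Sum>u\<in>E. m v u * n u h) * \<eta> h) = (\<Sum>u\<in>E. m v u * (\<Sum>h\<in>H. n u h * \<eta> h))" for v
    by (simp add: sum_distrib_left sum_distrib_right mult.assoc) (rule sum.swap)
  then have "(\<Sum>v\<in>F. (cmod (\<Sum>h\<in>H. (\<Sum>u\<in>E. m v u * n u h) * \<eta> h))\<^sup>2)
      = (\<Sum>v\<in>F. (cmod (\<Sum>u\<in>E. m v u * (\<Sum>h\<in>H. n u h * \<eta> h)))\<^sup>2)" by simp
  also have "\<dots> \<le> C\<^sup>2 * (\<Sum>u\<in>E. (cmod (\<Sum>h\<in>H. n u h * \<eta> h))\<^sup>2)"
    by (rule l2_boundedD[OF assms(1)])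
  also have "\<dots> \<le> C\<^sup>2 * (D\<^sup>2 * l2sq H \<eta>)"
    by (intro mult_left_mono l2_boundedD[OF assms(2)]) simp
  finally show "(\<Sum>v\<in>F. (cmod (\<Sum>h\<in>H. (\<Sum>u\<in>E. m v u * n u h) * \<eta> h))\<^sup>2)
      \<le> (C * D)\<^sup>2 * l2sq H \<eta>" by (simp add: power_mult_distrib mult.assoc)
qed

text \<open>The entry is a coordinate of the image of the unit vector at \<open>u\<close>.\<close>

lemma l2_bounded_entry:
  assumes "l2_bounded F E m C" "finite F" "finite E" "v \<in> F" "u \<in> E"
  shows "cmod (m v u) \<le> C"
proof -
  let ?\<eta> = "\<lambda>w. if w = u then 1 else (0::complex)"
  have e: "(\<Sum>w\<in>E. m v' w * ?\<eta> w) = m v' u" for v'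
    using assms by (simp add: if_distrib[of "\<lambda>t. _ * t"] cong: if_cong)
  have "(cmod (m v u))\<^sup>2 \<le> (\<Sum>v'\<in>F. (cmod (m v' u))\<^sup>2)"
    using assms by (intro member_le_sum) auto
  also have "\<dots> = (\<Sum>v'\<in>F. (cmod (\<Sum>w\<in>E. m v' w * ?\<eta> w))\<^sup>2)" by (simp only: e)
  also have "\<dots> \<le> C\<^sup>2 * l2sq E ?\<eta>"
    by (rule l2_boundedD[OF assms(1)])
  also have "l2sq E ?\<eta> = (\<Sum>w\<in>E. if w = u then 1 else 0)" by (intro sum.cong) auto
  also have "\<dots> = 1" using assms by simp
  finally show ?thesis using assms(1) by (auto simp: l2_bounded_def intro: power2_le_imp_le)
qed

text \<open>Off by one: index \<open>n\<close> gives the power \<open>n + 1\<close>. This leaves out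
  the unit matrix, which for a set \<open>E\<close> of words need not represent the unit of the
  algebra.\<close>

primrec mat_power :: "'u set \<Rightarrow> ('u \<Rightarrow> 'u \<Rightarrow> complex) \<Rightarrow> nat \<Rightarrow> 'u \<Rightarrow> 'u \<Rightarrow> complex" where
  "mat_power E G 0 = G"
| "mat_power E G (Suc n) = (\<lambda>u w. \<Sum>v\<in>E. mat_power E G n u v * G v w)"

lemma l2_bounded_mat_power:
  "l2_bounded E E G C \<Longrightarrow> l2_bounded E E (mat_power E G n) (C ^ Suc n)"
proof (induction n)
  case (Suc n)
  from l2_bounded_mult[OF Suc.IH[OF Suc.prems] Suc.prems] show ?case by (simp add: mult_ac)
qed simp

subsection \<open>Reduced words\<close>

lemma schottky_matrix_cases: "schottky_matrix g i j = 0 \<or> schottky_matrix g i j = 1"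
  by (simp add: schottky_matrix_def)

lemma reduced_word_Nil [simp]: "reduced_word g []"
  by (simp add: reduced_word_def)

lemma reduced_word_Cons:
  "reduced_word g (i # w) \<longleftrightarrow> i \<in> {1..2*g} \<and> reduced_word g w \<and> (w \<noteq> [] \<longrightarrow> schottky_matrix g i (hd w) = 1)"
  (is "?L = ?R")
proof
  assume L: ?L
  then have "schottky_matrix g ((i # w) ! Suc k) ((i # w) ! Suc (Suc k)) = 1" if "Suc k < length w" for k
    using that unfolding reduced_word_def by (metis length_Cons Suc_less_eq)
  moreover have "w \<noteq> [] \<longrightarrow> schottky_matrix g ((i # w) ! 0) ((i # w) ! Suc 0) = 1"
    using L unfolding reduced_word_def by (metis length_Cons Suc_less_eq length_greater_0_conv)
  ultimately show ?R using L by (auto simp: reduced_word_def hd_conv_nth)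
next
  assume R: ?R
  then have "schottky_matrix g ((i # w) ! k) ((i # w) ! Suc k) = 1" if "k < length w" for k
    using that by (cases k) (auto simp: reduced_word_def hd_conv_nth)
  then show ?L using R by (auto simp: reduced_word_def)
qed

lemma reduced_word_append:
  "reduced_word g (u @ v) \<longleftrightarrow> reduced_word g u \<and> reduced_word g v \<and>
    (u \<noteq> [] \<longrightarrow> v \<noteq> [] \<longrightarrow> schottky_matrix g (last u) (hd v) = 1)"
  by (induction u) (auto simp: reduced_word_Cons)

lemma reduced_word_letters: "reduced_word g w \<Longrightarrow> set w \<subseteq> {1..2*g}"
  by (simp add: reduced_word_def)

definition inv_letter :: "nat \<Rightarrow> nat \<Rightarrow> nat" where
  "inv_letter g i = (if i \<le> g then i + g else i - g)"

lemma inv_letter_in [simp]: "i \<in> {1..2*g} \<Longrightarrow> inv_letter g i \<in> {1..2*g}"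
  by (auto simp: inv_letter_def)

lemma inv_letter_inv [simp]: "i \<in> {1..2*g} \<Longrightarrow> inv_letter g (inv_letter g i) = i"
  by (auto simp: inv_letter_def)

lemma schottky_matrix_iff:
  "i \<in> {1..2*g} \<Longrightarrow> j \<in> {1..2*g} \<Longrightarrow> schottky_matrix g i j = 1 \<longleftrightarrow> j \<noteq> inv_letter g i"
  by (auto simp: schottky_matrix_def inv_letter_def)

lemma inv_letter_neq: "1 \<le> g \<Longrightarrow> inv_letter g i \<noteq> i"
  by (auto simp: inv_letter_def)

text \<open>Rank at least 2 gives at least four letters, so three can be forbidden. This is the room
  for choosing tails that avoid both cancellation and periodicity.\<close>

lemma exists_letter_avoiding:
  fixes g :: nat
  assumes "2 \<le> g"
  shows "\<exists>a\<in>{1..2*g}. a \<noteq> i \<and> a \<noteq> j \<and> a \<noteq> k"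
proof -
  have "card ({1..2*g} - {i,j,k}) \<ge> card {1..2*g} - card {i,j,k}" by (intro diff_card_le_card_Diff) auto
  moreover have "card {i,j,k} \<le> 3" by (simp add: card_insert_if)
  ultimately have "card ({1..2*g} - {i,j,k}) > 0" using assms by simp
  then obtain a where "a \<in> {1..2*g} - {i,j,k}" by (metis card_gt_0_iff ex_in_conv)
  then show ?thesis by blast
qed

subsection \<open>Star-polynomials in the generators and their action on words\<close>

text \<open>Star-polynomials are kept as syntax so that one polynomial can be evaluated in two
  algebras of different types, and so that its degree is available.\<close>

datatype ck_term = TOne | TGen nat | TAdj nat | TAdd ck_term ck_term | TMul ck_term ck_term
  | TScl complex ck_term

text \<open>Bounds the change in word length, up or down, caused by \<open>act\<close>.\<close>

primrec tdeg :: "ck_term \<Rightarrow> nat" where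
  "tdeg TOne = 0"
| "tdeg (TGen i) = 1"
| "tdeg (TAdj i) = 1"
| "tdeg (TAdd a b) = max (tdeg a) (tdeg b)"
| "tdeg (TMul a b) = tdeg a + tdeg b"
| "tdeg (TScl c a) = tdeg a"

primrec letters :: "ck_term \<Rightarrow> nat set" where
  "letters TOne = {}"
| "letters (TGen i) = {i}"
| "letters (TAdj i) = {i}"
| "letters (TAdd a b) = letters a \<union> letters b"
| "letters (TMul a b) = letters a \<union> letters b"
| "letters (TScl c a) = letters a"

primrec tstar :: "ck_term \<Rightarrow> ck_term" where
  "tstar TOne = TOne"
| "tstar (TGen i) = TAdj i"
| "tstar (TAdj i) = TGen i"
| "tstar (TAdd a b) = TAdd (tstar a) (tstar b)"
| "tstar (TMul a b) = TMul (tstar b) (tstar a)"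
| "tstar (TScl c a) = TScl (cnj c) (tstar a)"

primrec tpow :: "ck_term \<Rightarrow> nat \<Rightarrow> ck_term" where
  "tpow a 0 = TOne"
| "tpow a (Suc n) = TMul (tpow a n) a"

lemma tdeg_tstar [simp]: "tdeg (tstar a) = tdeg a" by (induction a) auto
lemma letters_tstar [simp]: "letters (tstar a) = letters a" by (induction a) auto
lemma tdeg_tpow [simp]: "tdeg (tpow a n) = n * tdeg a" by (induction n) auto
lemma letters_tpow: "letters (tpow a n) \<subseteq> letters a" by (induction n) auto

text \<open>The generator \<open>i\<close> prepends the letter \<open>i\<close> and its adjoint removes it. This describes left
  multiplication on the span of the products \<open>s\<^sub>w\<close> as long as no word becomes empty.\<close>

primrec act :: "nat \<Rightarrow> ck_term \<Rightarrow> (nat list \<Rightarrow> complex) \<Rightarrow> nat list \<Rightarrow> complex" where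
  "act g TOne \<xi> = \<xi>"
| "act g (TGen i) \<xi> = (\<lambda>v. if v \<noteq> [] \<and> hd v = i \<and> tl v \<noteq> [] \<and> reduced_word g v then \<xi> (tl v) else 0)"
| "act g (TAdj i) \<xi> = (\<lambda>v. if v \<noteq> [] then \<xi> (i # v) else 0)"
| "act g (TAdd a b) \<xi> = (\<lambda>v. act g a \<xi> v + act g b \<xi> v)"
| "act g (TMul a b) \<xi> = act g a (act g b \<xi>)"
| "act g (TScl c a) \<xi> = (\<lambda>v. c * act g a \<xi> v)"

text \<open>The lower length \<open>a\<close> measures how many letters may still be removed before
  a word becomes empty; the upper length \<open>b\<close> tells which finite set of words
  suffices.\<close>

definition supported :: "nat \<Rightarrow> nat \<Rightarrow> nat \<Rightarrow> (nat list \<Rightarrow> complex) \<Rightarrow> bool" where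
  "supported g a b \<xi> \<longleftrightarrow> (\<forall>w. \<xi> w \<noteq> 0 \<longrightarrow> reduced_word g w \<and> w \<noteq> [] \<and> a \<le> length w \<and> length w \<le> b)"

lemma supported_mono: "supported g a b \<xi> \<Longrightarrow> a' \<le> a \<Longrightarrow> b \<le> b' \<Longrightarrow> supported g a' b' \<xi>"
  by (fastforce simp: supported_def)

text \<open>A generator or its adjoint changes the length by one; \<open>tdeg \<tau> < a\<close>
  keeps the truncated difference \<open>a - tdeg \<tau>\<close> positive.\<close>

lemma act_supported:
  "supported g a b \<xi> \<Longrightarrow> tdeg \<tau> < a \<Longrightarrow> supported g (a - tdeg \<tau>) (b + tdeg \<tau>) (act g \<tau> \<xi>)"
proof (induction \<tau> arbitrary: a b \<xi>)
  case (TGen i)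
  show ?case unfolding supported_def
  proof (intro allI impI)
    fix w assume "act g (TGen i) \<xi> w \<noteq> 0"
    then have "w \<noteq> []" "reduced_word g w" "\<xi> (tl w) \<noteq> 0" by (auto split: if_splits)
    with TGen show "reduced_word g w \<and> w \<noteq> [] \<and> a - tdeg (TGen i) \<le> length w \<and> length w \<le> b + tdeg (TGen i)"
      by (cases w) (auto simp: supported_def)
  qed
next
  case (TAdj i)
  show ?case unfolding supported_def
  proof (intro allI impI)
    fix w assume "act g (TAdj i) \<xi> w \<noteq> 0"
    then have "w \<noteq> []" "\<xi> (i # w) \<noteq> 0" by (auto split: if_splits)
    with TAdj show "reduced_word g w \<and> w \<noteq> [] \<and> a - tdeg (TAdj i) \<le> length w \<and> length w \<le> b + tdeg (TAdj i)"
      by (fastforce simp: supported_def reduced_word_Cons)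
  qed
next
  case (TAdd \<tau> \<sigma>)
  have "supported g (a - tdeg (TAdd \<tau> \<sigma>)) (b + tdeg (TAdd \<tau> \<sigma>)) (act g \<tau> \<xi>)"
    "supported g (a - tdeg (TAdd \<tau> \<sigma>)) (b + tdeg (TAdd \<tau> \<sigma>)) (act g \<sigma> \<xi>)"
    using TAdd.IH(1)[OF TAdd.prems(1)] TAdd.IH(2)[OF TAdd.prems(1)] TAdd.prems(2) by (auto elim!: supported_mono)
  moreover have "act g \<tau> \<xi> w \<noteq> 0 \<or> act g \<sigma> \<xi> w \<noteq> 0" if "act g (TAdd \<tau> \<sigma>) \<xi> w \<noteq> 0" for w
    using that by auto
  ultimately show ?case unfolding supported_def by blast
next
  case (TMul \<tau> \<sigma>)
  have "supported g (a - tdeg \<sigma>) (b + tdeg \<sigma>) (act g \<sigma> \<xi>)" using TMul by simp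
  moreover have "tdeg \<tau> < a - tdeg \<sigma>" using TMul.prems(2) by simp
  ultimately have "supported g (a - tdeg \<sigma> - tdeg \<tau>) (b + tdeg \<sigma> + tdeg \<tau>) (act g \<tau> (act g \<sigma> \<xi>))"
    by (rule TMul.IH(1))
  moreover have "a - tdeg \<sigma> - tdeg \<tau> = a - tdeg (TMul \<tau> \<sigma>)" "b + tdeg \<sigma> + tdeg \<tau> = b + tdeg (TMul \<tau> \<sigma>)"
    by simp_all
  ultimately show ?case by (simp only: act.simps)
next
  case (TScl c \<tau>)
  have "supported g (a - tdeg (TScl c \<tau>)) (b + tdeg (TScl c \<tau>)) (act g \<tau> \<xi>)"
    using TScl.IH[OF TScl.prems(1)] TScl.prems(2) by simp
  moreover have "act g \<tau> \<xi> w \<noteq> 0" if "act g (TScl c \<tau>) \<xi> w \<noteq> 0" for w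
    using that by auto
  ultimately show ?case unfolding supported_def by blast
qed simp

text \<open>Letters are added and removed only at the front, so the last letter never changes and
  the action splits into one block for each last letter.\<close>

lemma act_local:
  assumes "\<And>w. w \<noteq> [] \<Longrightarrow> last w = l \<Longrightarrow> \<xi> w = \<eta> w" "v \<noteq> []" "last v = l"
  shows "act g \<tau> \<xi> v = act g \<tau> \<eta> v"
  using assms
proof (induction \<tau> arbitrary: \<xi> \<eta> v)
  case (TGen i) then show ?case by (cases v) auto
next
  case (TAdd \<tau> \<sigma>)
  have "act g \<tau> \<xi> v = act g \<tau> \<eta> v" by (rule TAdd.IH(1)) (use TAdd.prems in simp_all)
  moreover have "act g \<sigma> \<xi> v = act g \<sigma> \<eta> v" by (rule TAdd.IH(2)) (use TAdd.prems in simp_all)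
  ultimately show ?case by simp
next
  case (TMul \<tau> \<sigma>)
  show ?case unfolding act.simps
    by (rule TMul.IH(1)) (rule TMul.IH(2), use TMul.prems in simp_all)
next
  case (TScl c \<tau>)
  have "act g \<tau> \<xi> v = act g \<tau> \<eta> v" by (rule TScl.IH) (use TScl.prems in simp_all)
  then show ?case by simp
qed simp_all

lemma act_sum: "act g \<tau> (\<lambda>w. \<Sum>u\<in>S. c u * f u w) = (\<lambda>v. \<Sum>u\<in>S. c u * act g \<tau> (f u) v)"
proof (induction \<tau> arbitrary: f)
  case (TAdd \<tau> \<sigma>)
  show ?case by (simp only: act.simps TAdd.IH distrib_left sum.distrib)
next
  case (TMul \<tau> \<sigma>)
  show ?case by (simp only: act.simps TMul.IH)
next
  case (TScl a \<tau>)
  show ?case by (simp only: act.simps TScl.IH sum_distrib_left mult.left_commute)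
qed (auto intro!: ext)

definition words :: "nat \<Rightarrow> nat \<Rightarrow> nat list set" where
  "words g U = {w. reduced_word g w \<and> w \<noteq> [] \<and> length w \<le> U}"

definition words_eq :: "nat \<Rightarrow> nat \<Rightarrow> nat list set" where
  "words_eq g n = {w. reduced_word g w \<and> length w = n}"

lemma finite_words [simp]: "finite (words g U)"
  by (rule finite_subset[OF _ finite_lists_length_le[of "{1..2*g}" U]])
     (use reduced_word_letters in \<open>auto simp: words_def\<close>)

lemma finite_words_eq [simp]: "finite (words_eq g U)"
  by (rule finite_subset[OF _ finite_lists_length_le[of "{1..2*g}" U]])
     (use reduced_word_letters in \<open>auto simp: words_eq_def\<close>)

text \<open>Letters shifted against each other never agree: \<open>l a a \<dots> a b\<close> has no short period.\<close>

lemma aperiodic_tail: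
  assumes "w \<noteq> w'" "length w \<le> K" "length w' \<le> K" "a \<noteq> b"
  defines "x \<equiv> replicate K a @ [b]"
  shows "\<exists>k<min (length (w @ x)) (length (w' @ x)). (w @ x) ! k \<noteq> (w' @ x) ! k"
proof -
  have *: "\<exists>k<min (length (u @ x)) (length (u' @ x)). (u @ x) ! k \<noteq> (u' @ x) ! k"
    if "length u < length u'" "length u' \<le> K" for u u'
  proof (intro exI conjI)
    \<comment> \<open>The position of the final \<open>b\<close> behind the shorter word. Behind the
      longer one it still lies within the run of \<open>a\<close>.\<close>
    let ?k = "length u + K"
    show "?k < min (length (u @ x)) (length (u' @ x))" using that by (simp add: x_def)
    have "(u' @ x) ! ?k = x ! (?k - length u')" using that by (simp add: nth_append)
    also have "\<dots> = a"
    proof -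
      have "?k - length u' < K" using that by linarith
      then show ?thesis by (simp add: x_def nth_append)
    qed
    finally show "(u @ x) ! ?k \<noteq> (u' @ x) ! ?k" using assms by (simp add: x_def nth_append)
  qed
  consider "length w < length w'" | "length w' < length w" | "length w = length w'" by linarith
  then show ?thesis
  proof cases
    case 1 then show ?thesis using * assms by blast
  next
    case 2 then show ?thesis using *[of w' w] assms by (metis min.commute)
  next
    case 3
    then obtain k where "k < length w" "w ! k \<noteq> w' ! k" using assms by (auto simp: list_eq_iff_nth_eq)
    then show ?thesis using 3 by (intro exI[of _ k]) (auto simp: nth_append)
  qed
qed

context cstar_algebra
begin

primrec ev :: "(nat \<Rightarrow> 'a) \<Rightarrow> ck_term \<Rightarrow> 'a" where
  "ev s TOne = \<one>"
| "ev s (TGen i) = s i"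
| "ev s (TAdj i) = star (s i)"
| "ev s (TAdd a b) = ev s a \<oplus> ev s b"
| "ev s (TMul a b) = ev s a \<otimes> ev s b"
| "ev s (TScl c a) = c \<odot> ev s a"

lemma ev_closed: "(\<And>i. i \<in> letters \<tau> \<Longrightarrow> s i \<in> carrier A) \<Longrightarrow> ev s \<tau> \<in> carrier A"
  by (induction \<tau>) auto

lemma ev_tstar: "(\<And>i. i \<in> letters \<tau> \<Longrightarrow> s i \<in> carrier A) \<Longrightarrow> ev s (tstar \<tau>) = star (ev s \<tau>)"
  by (induction \<tau>) (auto simp: adj_adj adj_add adj_mult adj_smult ev_closed)

lemma ev_tpow: "(\<And>i. i \<in> letters \<tau> \<Longrightarrow> s i \<in> carrier A) \<Longrightarrow> ev s (tpow \<tau> n) = ev s \<tau> [^] n"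
  by (induction n) auto

lemma finsum_swap:
  assumes "finite I" "finite J" "\<And>i j. i \<in> I \<Longrightarrow> j \<in> J \<Longrightarrow> f i j \<in> carrier A"
  shows "(\<Oplus>i\<in>I. \<Oplus>j\<in>J. f i j) = (\<Oplus>j\<in>J. \<Oplus>i\<in>I. f i j)"
  using assms(1,3)
proof (induction I rule: finite_induct)
  case (insert x F)
  have c: "(\<lambda>i. \<Oplus>j\<in>J. f i j) \<in> F \<rightarrow> carrier A" "f x \<in> J \<rightarrow> carrier A"
    "(\<lambda>j. \<Oplus>i\<in>F. f i j) \<in> J \<rightarrow> carrier A" using insert by auto
  have "(\<Oplus>j\<in>J. \<Oplus>i\<in>insert x F. f i j) = (\<Oplus>j\<in>J. f x j \<oplus> (\<Oplus>i\<in>F. f i j))"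
    using insert by (intro finsum_cong') auto
  also have "\<dots> = (\<Oplus>j\<in>J. f x j) \<oplus> (\<Oplus>j\<in>J. \<Oplus>i\<in>F. f i j)" using c by (simp add: finsum_addf)
  finally show ?case using insert c by simp
qed simp

lemma finsum_single:
  assumes "finite I" "i \<in> I" "f i \<in> carrier A" "\<And>j. j \<in> I \<Longrightarrow> j \<noteq> i \<Longrightarrow> f j = \<zero>"
  shows "(\<Oplus>j\<in>I. f j) = f i"
proof -
  have c: "f j \<in> carrier A" if "j \<in> I" for j using assms that by (cases "j = i") auto
  have "(\<Oplus>j\<in>I. f j) = (\<Oplus>j\<in>I. if i = j then f j else \<zero>)"
    using assms c by (intro finsum_cong') auto
  also have "\<dots> = f i" using assms c by (intro add.finprod_singleton) auto
  finally show ?thesis .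
qed

lemma sum_sm:
  "finite S \<Longrightarrow> x \<in> carrier A \<Longrightarrow> (\<Sum>i\<in>S. c i) \<odot> x = (\<Oplus>i\<in>S. c i \<odot> x)"
  by (induction S rule: finite_induct) (auto simp: sm_l_distr)

end

section \<open>Cuntz-Krieger families and two-sided norm estimates for star-polynomials\<close>

locale ck_family = cstar_algebra A for A :: "('a, 'm) cstar_scheme" (structure) +
  fixes g :: nat and s :: "nat \<Rightarrow> 'a"
  assumes g1: "1 \<le> g" and ck: "cuntz_krieger_family (2*g) (schottky_matrix g) A s"
begin

abbreviation "I \<equiv> {1..2*g}"

definition "p i = s i \<otimes> star (s i)"
definition "q i = star (s i) \<otimes> s i"

lemma s_closed [simp]: "i \<in> I \<Longrightarrow> s i \<in> carrier A"
  using ck by (simp add: cuntz_krieger_family_def)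

lemma p_closed [simp]: "i \<in> I \<Longrightarrow> p i \<in> carrier A" by (simp add: p_def)
lemma q_closed [simp]: "i \<in> I \<Longrightarrow> q i \<in> carrier A" by (simp add: q_def)

lemma sss: "i \<in> I \<Longrightarrow> s i \<otimes> star (s i) \<otimes> s i = s i"
  using ck by (simp add: cuntz_krieger_family_def)

lemma p_s [simp]: "i \<in> I \<Longrightarrow> p i \<otimes> s i = s i" by (simp add: p_def sss)
lemma s_q [simp]: "i \<in> I \<Longrightarrow> s i \<otimes> q i = s i" using sss[of i] by (simp add: q_def m_assoc)

lemma star_s_p: "i \<in> I \<Longrightarrow> star (s i) \<otimes> p i = star (s i)"
  using arg_cong[OF sss[of i], of star] by (simp add: p_def adj_mult adj_adj m_assoc)

lemma p_projection: "i \<in> I \<Longrightarrow> projection (p i)"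
  using m_assoc[of "p i" "s i" "star (s i)"] p_s[of i] unfolding projection_def
  by (simp add: p_def adj_mult adj_adj)

lemma q_projection: "i \<in> I \<Longrightarrow> projection (q i)"
  using m_assoc[of "star (s i)" "s i" "q i"] s_q[of i] unfolding projection_def
  by (simp add: q_def adj_mult adj_adj)

lemma p_sum: "(\<Oplus>j\<in>I. p j) = \<one>"
  using ck by (simp add: cuntz_krieger_family_def p_def)

lemma p_orth: "i \<in> I \<Longrightarrow> j \<in> I \<Longrightarrow> i \<noteq> j \<Longrightarrow> p i \<otimes> p j = \<zero>"
  by (rule projections_sum_one_orthogonal[of I]) (use p_projection p_sum in auto)

lemma p_s_orth: assumes "i \<in> I" "j \<in> I" "i \<noteq> j" shows "p i \<otimes> s j = \<zero>"
proof -
  have "p i \<otimes> s j = p i \<otimes> (p j \<otimes> s j)" using assms by simp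
  also have "\<dots> = (p i \<otimes> p j) \<otimes> s j" by (rule m_assoc[symmetric]) (use assms in auto)
  finally show ?thesis using assms p_orth by simp
qed

lemma star_s_s_orth: assumes "i \<in> I" "j \<in> I" "i \<noteq> j" shows "star (s i) \<otimes> s j = \<zero>"
proof -
  have "star (s i) \<otimes> s j = (star (s i) \<otimes> p i) \<otimes> s j" using assms star_s_p by simp
  also have "\<dots> = star (s i) \<otimes> (p i \<otimes> s j)" using assms by (intro m_assoc) auto
  finally show ?thesis using assms p_s_orth by simp
qed

lemma q_expand: "i \<in> I \<Longrightarrow> q i = (\<Oplus>j\<in>I. of_nat (schottky_matrix g i j) \<odot> p j)"
  using ck by (simp add: cuntz_krieger_family_def p_def q_def)

lemma q_s: assumes "i \<in> I" "j \<in> I" shows "q i \<otimes> s j = (if schottky_matrix g i j = 1 then s j else \<zero>)"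
proof -
  have "q i \<otimes> s j = (\<Oplus>k\<in>I. (of_nat (schottky_matrix g i k) \<odot> p k) \<otimes> s j)"
    unfolding q_expand[OF assms(1)] by (rule finsum_ldistr) (use assms in auto)
  also have "\<dots> = (of_nat (schottky_matrix g i j) \<odot> p j) \<otimes> s j"
    by (rule finsum_single) (use assms in \<open>auto simp: smult_mult_left p_s_orth\<close>)
  also have "\<dots> = (if schottky_matrix g i j = 1 then s j else \<zero>)"
    using assms schottky_matrix_cases[of g i j] by (auto simp: smult_mult_left)
  finally show ?thesis .
qed

primrec sw :: "nat list \<Rightarrow> 'a" where
  "sw [] = \<one>"
| "sw (i # w) = s i \<otimes> sw w"

lemma sw_closed_I: "set w \<subseteq> I \<Longrightarrow> sw w \<in> carrier A" by (induction w) auto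

lemma sw_closed [simp]: "reduced_word g w \<Longrightarrow> sw w \<in> carrier A"
  using sw_closed_I reduced_word_letters by blast

lemma sw_append: "set u \<subseteq> I \<Longrightarrow> set v \<subseteq> I \<Longrightarrow> sw (u @ v) = sw u \<otimes> sw v"
  by (induction u) (auto simp: sw_closed_I m_assoc)

lemma nrm_s: "i \<in> I \<Longrightarrow> nrm (s i) \<le> 1"
  using norm_cstar[of "s i"] projection_nrm[OF q_projection[of i]] power2_le_imp_le[of "nrm (s i)" 1]
  by (simp add: q_def)

lemma nrm_sw: "reduced_word g w \<Longrightarrow> nrm (sw w) \<le> 1"
proof (induction w)
  case Nil
  have "projection \<one>" by (simp add: projection_def)
  then show ?case using projection_nrm by simp
next
  case (Cons i w)
  then have "nrm (s i \<otimes> sw w) \<le> nrm (s i) * nrm (sw w)"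
    by (intro norm_mult) (auto simp: reduced_word_Cons)
  also have "\<dots> \<le> 1 * 1"
    using Cons nrm_s by (intro mult_mono norm_nonneg) (auto simp: reduced_word_Cons norm_nonneg)
  finally show ?case by simp
qed

lemma q_sw: "i \<in> I \<Longrightarrow> reduced_word g w \<Longrightarrow> w \<noteq> [] \<Longrightarrow>
    q i \<otimes> sw w = (if schottky_matrix g i (hd w) = 1 then sw w else \<zero>)"
proof (cases w)
  case (Cons j v)
  assume a: "i \<in> I" "reduced_word g w"
  then have j: "j \<in> I" "reduced_word g v" using Cons by (auto simp: reduced_word_Cons)
  have "q i \<otimes> sw w = (q i \<otimes> s j) \<otimes> sw v" using a j Cons by (simp add: m_assoc)
  then show ?thesis using q_s[OF a(1) j(1)] j Cons by simp
qed simp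

text \<open>\<open>s i\<close> factors through its source projection \<open>q i\<close>, which
  annihilates \<open>s j\<close> for a forbidden transition.\<close>

lemma s_sw_not_reduced:
  assumes "i \<in> I" "reduced_word g w" "w \<noteq> []" "\<not> reduced_word g (i # w)"
  shows "s i \<otimes> sw w = \<zero>"
proof -
  have "s i \<otimes> sw w = (s i \<otimes> q i) \<otimes> sw w" using assms by simp
  also have "\<dots> = s i \<otimes> (q i \<otimes> sw w)" using assms(1,2) by (intro m_assoc) auto
  finally show ?thesis using assms q_sw[of i w] by (auto simp: reduced_word_Cons)
qed

lemma star_s_sw:
  assumes "i \<in> I" "reduced_word g (j # w)" "w \<noteq> []"
  shows "star (s i) \<otimes> sw (j # w) = (if i = j then sw w else \<zero>)"
proof -
  have j: "j \<in> I" "reduced_word g w" "schottky_matrix g j (hd w) = 1" using assms by (auto simp: reduced_word_Cons)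
  have e: "star (s i) \<otimes> sw (j # w) = (star (s i) \<otimes> s j) \<otimes> sw w" using assms(1) j by (simp add: m_assoc)
  show ?thesis
  proof (cases "i = j")
    case True then show ?thesis using e j q_sw[OF j(1,2) assms(3)] by (simp add: q_def)
  next
    case False then show ?thesis using e star_s_s_orth[OF assms(1) j(1)] j by simp
  qed
qed

lemma star_sw_self: "reduced_word g w \<Longrightarrow> w \<noteq> [] \<Longrightarrow> star (sw w) \<otimes> sw w = q (last w)"
proof (induction w)
  case (Cons i w)
  show ?case
  proof (cases "w = []")
    case True then show ?thesis using Cons by (simp add: q_def reduced_word_Cons)
  next
    case False
    have c: "i \<in> I" "reduced_word g w" using Cons by (auto simp: reduced_word_Cons)
    have "star (sw (i # w)) \<otimes> sw (i # w) = star (sw w) \<otimes> (star (s i) \<otimes> sw (i # w))"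
      using c by (simp add: adj_mult m_assoc)
    also have "\<dots> = star (sw w) \<otimes> sw w" using star_s_sw[OF c(1) Cons.prems(1) False] by simp
    finally show ?thesis using Cons False c by simp
  qed
qed simp

text \<open>Neither word is a prefix of the other: common letters cancel from the left until two
  different letters meet, whose ranges are orthogonal.\<close>

lemma star_sw_orth:
  "reduced_word g u \<Longrightarrow> reduced_word g v \<Longrightarrow> k < min (length u) (length v) \<Longrightarrow> u ! k \<noteq> v ! k \<Longrightarrow>
    star (sw u) \<otimes> sw v = \<zero>"
proof (induction u arbitrary: v k)
  case (Cons i u)
  then obtain j w where v: "v = j # w" by (cases v) auto
  have c: "i \<in> I" "reduced_word g u" "j \<in> I" "reduced_word g w" using Cons v by (auto simp: reduced_word_Cons)
  have e: "star (sw (i # u)) \<otimes> sw v = star (sw u) \<otimes> (star (s i) \<otimes> sw v)"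
    using c v by (simp add: adj_mult m_assoc)
  show ?case
  proof (cases "i = j")
    case False
    have "star (s i) \<otimes> sw v = (star (s i) \<otimes> s j) \<otimes> sw w" using c v by (simp add: m_assoc)
    then show ?thesis using e c False star_s_s_orth by simp
  next
    case True
    then obtain k' where k: "k = Suc k'" using Cons.prems(4) v by (cases k) auto
    then have w: "w \<noteq> []" using Cons.prems v by auto
    have "star (s i) \<otimes> sw v = sw w" using star_s_sw[OF c(1) _ w, of j] Cons.prems(2) v True by simp
    moreover have "star (sw u) \<otimes> sw w = \<zero>" by (rule Cons.IH[OF c(2,4), of k']) (use Cons.prems k v in auto)
    ultimately show ?thesis using e by simp
  qed
qed simp

lemma star_sw_same_length:
  assumes "reduced_word g u" "reduced_word g v" "length u = length v" "u \<noteq> v"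
  shows "star (sw u) \<otimes> sw v = \<zero>"
proof -
  obtain k where "k < length u" "u ! k \<noteq> v ! k" using assms by (auto simp: list_eq_iff_nth_eq)
  then show ?thesis using star_sw_orth[of u v k] assms by simp
qed

lemma last_in_I: "reduced_word g w \<Longrightarrow> w \<noteq> [] \<Longrightarrow> last w \<in> I"
  using reduced_word_letters last_in_set by blast

lemma sw_q_last: "reduced_word g w \<Longrightarrow> w \<noteq> [] \<Longrightarrow> sw w \<otimes> q (last w) = sw w"
proof (induction w)
  case (Cons i w)
  then have "last w \<in> I" if "w \<noteq> []" using that last_in_I by (auto simp: reduced_word_Cons)
  with Cons show ?case by (cases "w = []") (auto simp: reduced_word_Cons m_assoc)
qed simp

text \<open>Grouping the words by their first letter, the inner sum over \<open>w\<close> is 1 by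
  induction, and what remains is the sum of the \<open>p i\<close>.\<close>

lemma sw_sum: "(\<Oplus>w\<in>words_eq g n. sw w \<otimes> star (sw w)) = \<one>"
proof (induction n)
  case 0
  have "words_eq g 0 = {[]}" by (auto simp: words_eq_def)
  then show ?case by simp
next
  case (Suc n)
  define T where "T i = {w \<in> words_eq g n. reduced_word g (i # w)}" for i
  have c: "sw w \<in> carrier A" "reduced_word g w" if "w \<in> words_eq g m" for w m
    using that by (auto simp: words_eq_def)
  have un: "words_eq g (Suc n) = (\<Union>i\<in>I. (#) i ` T i)"
  proof
    show "words_eq g (Suc n) \<subseteq> (\<Union>i\<in>I. (#) i ` T i)"
    proof
      fix w assume "w \<in> words_eq g (Suc n)"
      then show "w \<in> (\<Union>i\<in>I. (#) i ` T i)"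
        by (cases w) (auto simp: words_eq_def T_def reduced_word_Cons)
    qed
  qed (auto simp: words_eq_def T_def)
  have fT: "finite (T i)" for i by (simp add: T_def)
  have "(\<Oplus>w\<in>words_eq g (Suc n). sw w \<otimes> star (sw w)) = (\<Oplus>i\<in>I. \<Oplus>w\<in>(#) i ` T i. sw w \<otimes> star (sw w))"
    unfolding un using fT by (intro add.finprod_UN_disjoint) (auto simp: T_def reduced_word_Cons pairwise_def disjnt_def intro!: m_closed s_closed)
  also have "\<dots> = (\<Oplus>i\<in>I. p i)"
  proof (rule finsum_cong')
    fix i assume i: "i \<in> I"
    have "(\<Oplus>w\<in>(#) i ` T i. sw w \<otimes> star (sw w)) = (\<Oplus>w\<in>T i. sw (i # w) \<otimes> star (sw (i # w)))"
      by (rule finsum_reindex) (use i c in \<open>auto simp: T_def\<close>)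
    \<comment> \<open>The words that may not follow \<open>i\<close> can be included, because
      \<open>s i \<otimes> sw w\<close> vanishes for them; only then does the induction hypothesis
      apply.\<close>
    also have "\<dots> = (\<Oplus>w\<in>words_eq g n. s i \<otimes> (sw w \<otimes> star (sw w)) \<otimes> star (s i))"
    proof (rule add.finprod_mono_neutral_cong_left)
      fix w assume w: "w \<in> words_eq g n - T i"
      have "s i \<otimes> (sw w \<otimes> star (sw w)) \<otimes> star (s i) = (s i \<otimes> sw w) \<otimes> star (sw w) \<otimes> star (s i)"
        using i w c[of w n] by (simp add: m_assoc)
      moreover have "s i \<otimes> sw w = \<zero>"
        using w i c[of w n] by (intro s_sw_not_reduced) (auto simp: T_def reduced_word_Cons)
      ultimately show "s i \<otimes> (sw w \<otimes> star (sw w)) \<otimes> star (s i) = \<zero>" using c[of w n] w i by simp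
    qed (use i c in \<open>auto simp: T_def adj_mult m_assoc\<close>)
    also have "\<dots> = s i \<otimes> (\<Oplus>w\<in>words_eq g n. sw w \<otimes> star (sw w)) \<otimes> star (s i)"
      using i c by (simp add: finsum_ldistr finsum_rdistr)
    finally show "(\<Oplus>w\<in>(#) i ` T i. sw w \<otimes> star (sw w)) = p i" using i Suc by (simp add: p_def)
  qed simp_all
  finally show ?case using p_sum by simp
qed

subsection \<open>The action of star-polynomials on words\<close>

text \<open>A coefficient function on words becomes a vector in the algebra once a tail
  \<open>x\<close> is appended to every word. The empty tail serves the upper bound, an aperiodic
  one the lower bound.\<close>

definition wvec :: "nat list \<Rightarrow> nat \<Rightarrow> (nat list \<Rightarrow> complex) \<Rightarrow> 'a" where
  "wvec x U \<xi> = (\<Oplus>w\<in>words g U. \<xi> w \<odot> sw (w @ x))"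

lemma words_letters: "w \<in> words g U \<Longrightarrow> set w \<subseteq> I"
  using reduced_word_letters by (auto simp: words_def)

lemma sw_tail_closed: "set x \<subseteq> I \<Longrightarrow> w \<in> words g U \<Longrightarrow> sw (w @ x) \<in> carrier A"
  using words_letters by (intro sw_closed_I) auto

lemma wvec_closed [simp]: "set x \<subseteq> I \<Longrightarrow> wvec x U \<xi> \<in> carrier A"
  unfolding wvec_def by (intro finsum_closed) (auto simp: sw_tail_closed)

text \<open>On nonempty remainders the generators act on the \<open>sw w\<close> exactly as they do
  on words. For a word of one letter \<open>star (s i) \<otimes> s i\<close> would be the projection
  \<open>q i\<close>, which \<open>tdeg \<tau> < a\<close> excludes; \<open>U\<close> is large
  enough to hold the image.\<close>

lemma wvec_act:
  assumes x: "set x \<subseteq> I"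
  shows "letters \<tau> \<subseteq> I \<Longrightarrow> supported g a b \<xi> \<Longrightarrow> tdeg \<tau> < a \<Longrightarrow> b + tdeg \<tau> \<le> U \<Longrightarrow>
    ev s \<tau> \<otimes> wvec x U \<xi> = wvec x U (act g \<tau> \<xi>)"
proof (induction \<tau> arbitrary: a b \<xi>)
  case (TGen i)
  then have i: "i \<in> I" by simp
  define T where "T = {w \<in> words g U. \<xi> w \<noteq> 0 \<and> reduced_word g (i # w)}"
  have T: "finite T" "T \<subseteq> words g U" by (auto simp: T_def)
  have cl: "\<And>w. w \<in> words g U \<Longrightarrow> sw (w @ x) \<in> carrier A" using sw_tail_closed x by blast
  have "s i \<otimes> wvec x U \<xi> = (\<Oplus>w\<in>words g U. s i \<otimes> (\<xi> w \<odot> sw (w @ x)))"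
    unfolding wvec_def by (rule finsum_rdistr) (use i cl in auto)
  also have "\<dots> = (\<Oplus>w\<in>T. \<xi> w \<odot> sw (i # w @ x))"
  proof (rule add.finprod_mono_neutral_cong_right)
    fix w assume w: "w \<in> words g U - T"
    show "s i \<otimes> (\<xi> w \<odot> sw (w @ x)) = \<zero>"
    proof (cases "\<xi> w = 0")
      case False
      have wr: "reduced_word g w" "w \<noteq> []" using w by (auto simp: words_def)
      have "s i \<otimes> sw w = \<zero>" by (rule s_sw_not_reduced) (use wr w i False in \<open>auto simp: T_def\<close>)
      then have "s i \<otimes> sw (w @ x) = \<zero>"
        using i wr x sw_closed_I[OF x] reduced_word_letters[OF wr(1)] by (simp add: sw_append m_assoc[symmetric])
      then show ?thesis using i w cl by (simp add: smult_mult_right)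
    qed (use i w cl in simp)
  qed (use i cl T in \<open>auto simp: smult_mult_right\<close>)
  also have "\<dots> = (\<Oplus>v\<in>(#) i ` T. act g (TGen i) \<xi> v \<odot> sw (v @ x))"
  proof -
    have "(\<Oplus>v\<in>(#) i ` T. act g (TGen i) \<xi> v \<odot> sw (v @ x)) = (\<Oplus>w\<in>T. act g (TGen i) \<xi> (i # w) \<odot> sw ((i # w) @ x))"
      by (rule finsum_reindex) (use i cl T in auto)
    also have "\<dots> = (\<Oplus>w\<in>T. \<xi> w \<odot> sw (i # w @ x))"
      by (rule finsum_cong') (use i cl T in \<open>auto simp: T_def words_def\<close>)
    finally show ?thesis by simp
  qed
  also have "\<dots> = wvec x U (act g (TGen i) \<xi>)"
    unfolding wvec_def
  proof (rule add.finprod_mono_neutral_cong_left)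
    show "(#) i ` T \<subseteq> words g U"
      using TGen.prems(2,4) by (fastforce simp: T_def words_def supported_def)
    fix v assume v: "v \<in> words g U - (#) i ` T"
    have "act g (TGen i) \<xi> v = 0"
    proof (rule ccontr)
      assume "act g (TGen i) \<xi> v \<noteq> 0"
      then have "v = i # tl v" "\<xi> (tl v) \<noteq> 0" "reduced_word g v" "tl v \<noteq> []" by (auto split: if_splits)
      moreover from this have "tl v \<in> T"
        using v by (cases v) (auto simp: T_def words_def reduced_word_Cons)
      ultimately show False using v by (metis DiffD2 imageI)
    qed
    then show "act g (TGen i) \<xi> v \<odot> sw (v @ x) = \<zero>" using v cl by simp
  qed (use cl in auto)
  finally show ?case by simp
next
  case (TAdj i)
  then have i: "i \<in> I" by simp
  define T where "T = {v \<in> words g U. \<xi> (i # v) \<noteq> 0}"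
  have T: "finite T" "T \<subseteq> words g U" by (auto simp: T_def)
  have cl: "\<And>w. w \<in> words g U \<Longrightarrow> sw (w @ x) \<in> carrier A" using sw_tail_closed x by blast
  \<comment> \<open>Length above 1 is the content of \<open>tdeg \<tau> < a\<close> here: removing a
    letter leaves a nonempty word.\<close>
  have sup: "reduced_word g w" "1 < length w" "length w \<le> U" if "\<xi> w \<noteq> 0" for w
    using TAdj.prems(2-4) that by (auto simp: supported_def)
  have TU: "(#) i ` T \<subseteq> words g U" using sup by (auto simp: T_def words_def)
  have cl2: "s i \<otimes> sw (v @ x) \<in> carrier A" if "v \<in> T" for v
    using cl[of "i # v"] TU that by auto
  have sx: "star (s i) \<otimes> sw ((j # v) @ x) = (if i = j then sw (v @ x) else \<zero>)"
    if "reduced_word g (j # v)" "v \<noteq> []" for j v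
  proof -
    have "sw ((j # v) @ x) = sw (j # v) \<otimes> sw x"
      using x reduced_word_letters[OF that(1)] by (intro sw_append) auto
    then have "star (s i) \<otimes> sw ((j # v) @ x) = (star (s i) \<otimes> sw (j # v)) \<otimes> sw x"
      using i x that(1) sw_closed_I[OF x] m_assoc[of "star (s i)" "sw (j # v)" "sw x"] sw_closed[OF that(1)] by simp
    moreover have "sw (v @ x) = sw v \<otimes> sw x"
      using x reduced_word_letters[OF that(1)] by (intro sw_append) auto
    ultimately show ?thesis using star_s_sw[OF i that] sw_closed_I[OF x] by simp
  qed
  have "star (s i) \<otimes> wvec x U \<xi> = (\<Oplus>w\<in>words g U. star (s i) \<otimes> (\<xi> w \<odot> sw (w @ x)))"
    unfolding wvec_def by (rule finsum_rdistr) (use i cl in auto)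
  also have "\<dots> = (\<Oplus>w\<in>(#) i ` T. star (s i) \<otimes> (\<xi> w \<odot> sw (w @ x)))"
  proof (rule add.finprod_mono_neutral_cong_right)
    fix w assume w: "w \<in> words g U - (#) i ` T"
    show "star (s i) \<otimes> (\<xi> w \<odot> sw (w @ x)) = \<zero>"
    proof (cases "\<xi> w = 0")
      case False
      then obtain j v where jv: "w = j # v" "v \<noteq> []" using sup(2)[OF False] by (cases w) auto
      have "i \<noteq> j"
      proof
        assume "i = j"
        then have "v \<in> T" using w jv False by (auto simp: T_def words_def reduced_word_Cons)
        then show False using w jv \<open>i = j\<close> by auto
      qed
      then show ?thesis using sx[of j v] jv sup(1)[OF False] i w cl[of w] by (simp add: smult_mult_right)
    qed (use i w cl in simp)
  qed (use i cl TU in auto)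
  also have "\<dots> = (\<Oplus>v\<in>T. star (s i) \<otimes> (\<xi> (i # v) \<odot> sw ((i # v) @ x)))"
    by (rule finsum_reindex) (use i cl2 in auto)
  also have "\<dots> = (\<Oplus>v\<in>T. act g (TAdj i) \<xi> v \<odot> sw (v @ x))"
  proof (rule finsum_cong')
    fix v assume v: "v \<in> T"
    then have "v \<noteq> []" "i # v \<in> words g U" using TU by (auto simp: T_def words_def)
    then show "star (s i) \<otimes> (\<xi> (i # v) \<odot> sw ((i # v) @ x)) = act g (TAdj i) \<xi> v \<odot> sw (v @ x)"
      using sx[of i v] i cl[of "i # v"] v by (simp add: smult_mult_right words_def)
  qed (use T cl in auto)
  also have "\<dots> = wvec x U (act g (TAdj i) \<xi>)"
    unfolding wvec_def
  proof (rule add.finprod_mono_neutral_cong_left)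
    fix v assume v: "v \<in> words g U - T"
    then have "act g (TAdj i) \<xi> v = 0" by (auto simp: T_def)
    then show "act g (TAdj i) \<xi> v \<odot> sw (v @ x) = \<zero>" using cl[of v] v by simp
  qed (use T cl in auto)
  finally show ?case by simp
next
  case TOne
  then show ?case using x by simp
next
  case (TAdd \<tau> \<sigma>)
  have c: "ev s \<tau> \<in> carrier A" "ev s \<sigma> \<in> carrier A" using TAdd.prems(1) by (auto intro!: ev_closed)
  have cl: "\<And>w. w \<in> words g U \<Longrightarrow> sw (w @ x) \<in> carrier A" using sw_tail_closed x by blast
  have "ev s \<tau> \<otimes> wvec x U \<xi> = wvec x U (act g \<tau> \<xi>)" "ev s \<sigma> \<otimes> wvec x U \<xi> = wvec x U (act g \<sigma> \<xi>)"
    using TAdd.IH(1)[of a b \<xi>] TAdd.IH(2)[of a b \<xi>] TAdd.prems(1-4) by simp_all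
  moreover have "wvec x U (act g (TAdd \<tau> \<sigma>) \<xi>) = wvec x U (act g \<tau> \<xi>) \<oplus> wvec x U (act g \<sigma> \<xi>)"
  proof -
    have "wvec x U (act g (TAdd \<tau> \<sigma>) \<xi>) = (\<Oplus>w\<in>words g U. act g \<tau> \<xi> w \<odot> sw (w @ x) \<oplus> act g \<sigma> \<xi> w \<odot> sw (w @ x))"
      unfolding wvec_def using cl by (intro finsum_cong') (auto simp: sm_l_distr)
    then show ?thesis unfolding wvec_def using cl by (simp add: finsum_addf Pi_def)
  qed
  ultimately show ?case using c x by (simp add: l_distr)
next
  case (TMul \<tau> \<sigma>)
  have c: "ev s \<tau> \<in> carrier A" "ev s \<sigma> \<in> carrier A" using TMul.prems(1) by (auto intro!: ev_closed)
  have "ev s \<sigma> \<otimes> wvec x U \<xi> = wvec x U (act g \<sigma> \<xi>)"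
    using TMul.IH(2)[of a b \<xi>] TMul.prems(1-4) by simp
  moreover have "supported g (a - tdeg \<sigma>) (b + tdeg \<sigma>) (act g \<sigma> \<xi>)"
    using TMul.prems(2,3) by (intro act_supported) auto
  then have "ev s \<tau> \<otimes> wvec x U (act g \<sigma> \<xi>) = wvec x U (act g \<tau> (act g \<sigma> \<xi>))"
    by (intro TMul.IH(1)) (use TMul.prems(1-4) in auto)
  ultimately show ?case using c x by (simp add: m_assoc)
next
  case (TScl c \<tau>)
  have cl: "\<And>w. w \<in> words g U \<Longrightarrow> sw (w @ x) \<in> carrier A" using sw_tail_closed x by blast
  have e: "ev s \<tau> \<in> carrier A" using TScl.prems(1) by (auto intro!: ev_closed)
  have "ev s \<tau> \<otimes> wvec x U \<xi> = wvec x U (act g \<tau> \<xi>)"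
    using TScl.IH[of a b \<xi>] TScl.prems(1-4) by simp
  moreover have "wvec x U (act g (TScl c \<tau>) \<xi>) = c \<odot> wvec x U (act g \<tau> \<xi>)"
    unfolding wvec_def using cl by (subst sm_finsum) (auto intro!: finsum_cong' simp: sm_assoc)
  ultimately show ?case using e x by (simp add: smult_mult_left)
qed

subsection \<open>The lower bound\<close>

text \<open>If \<open>s i\<close> vanishes, so does \<open>q i\<close>, and with it every
  \<open>s j\<close> that may follow. All letters are reached from \<open>i\<close> within two
  transitions, so the \<open>p j\<close> would sum to zero instead of 1.\<close>

lemma s_nonzero:
  assumes one: "\<one> \<noteq> \<zero>" and g2: "2 \<le> g" and i: "i \<in> I"
  shows "s i \<noteq> \<zero>"
proof
  assume z: "s i = \<zero>"
  have step: "s j = \<zero>" if "k \<in> I" "s k = \<zero>" "j \<in> I" "schottky_matrix g k j = 1" for k j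
  proof -
    have "q k = \<zero>" using that by (simp add: q_def)
    then show ?thesis using q_s[OF that(1,3)] that by simp
  qed
  have "s j = \<zero>" if j: "j \<in> I" for j
  proof (cases "j = inv_letter g i")
    case False
    then show ?thesis using step[OF i z j] schottky_matrix_iff[OF i j] by simp
  next
    case True
    \<comment> \<open>The inverse of \<open>i\<close> is the only letter that may not follow
      \<open>i\<close>; it is reached through an intermediate \<open>k\<close>.\<close>
    obtain k where k: "k \<in> I" "k \<noteq> i" "k \<noteq> inv_letter g i" using exists_letter_avoiding[OF g2, of i "inv_letter g i" i] by blast
    have "s k = \<zero>" using step[OF i z k(1)] schottky_matrix_iff[OF i k(1)] k by simp
    moreover have "inv_letter g i \<noteq> inv_letter g k" using k i by (metis inv_letter_inv)
    ultimately show ?thesis using step[OF k(1) _ j] schottky_matrix_iff[OF k(1) j] True by simp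
  qed
  then have "(\<Oplus>j\<in>I. p j) = (\<Oplus>j\<in>I. \<zero>)" by (intro finsum_cong') (auto simp: p_def)
  also have "\<dots> = \<zero>" by (rule finsum_zero)
  finally show False using p_sum one by simp
qed

lemma nrm_q:
  assumes "\<one> \<noteq> \<zero>" "2 \<le> g" "i \<in> I"
  shows "nrm (q i) = 1"
  using projection_nrm_eq[OF q_projection[OF assms(3)]] star_mult_zero[of "s i"] s_nonzero[OF assms] assms(3)
  by (auto simp: q_def)

text \<open>Since \<open>x = a \<dots> a b\<close> is aperiodic, the \<open>s\<^sub>w\<^sub>x\<close> have orthogonal ranges, so they carry the
  \<open>\<ell>\<^sup>2\<close> norm of the coefficients.\<close>

lemma nrm_wvec:
  fixes U :: nat
  assumes one: "\<one> \<noteq> \<zero>" and g2: "2 \<le> g" and ab: "a \<in> I" "b \<in> I" "a \<noteq> b" "b \<noteq> inv_letter g a"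
    and \<xi>: "\<And>w. \<xi> w \<noteq> 0 \<Longrightarrow> w \<noteq> [] \<Longrightarrow> last w \<noteq> inv_letter g a"
  defines "x \<equiv> replicate U a @ [b]"
  shows "(nrm (wvec x U \<xi>))\<^sup>2 = l2sq (words g U) \<xi>"
proof -
  have aa: "a \<noteq> inv_letter g a" using inv_letter_neq[OF g1] by metis
  have "reduced_word g (replicate n a @ [b])" for n
    using ab aa by (induction n) (auto simp: reduced_word_Cons schottky_matrix_iff hd_append simp del: One_nat_def)
  then have xr: "reduced_word g x" by (simp add: x_def)
  then have xI: "set x \<subseteq> I" by (rule reduced_word_letters)
  have cl: "\<And>w. w \<in> words g U \<Longrightarrow> sw (w @ x) \<in> carrier A" using sw_tail_closed xI by blast
  have hx: "x \<noteq> []" "hd x = a \<or> U = 0" by (auto simp: x_def hd_append)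
  \<comment> \<open>A nonzero coefficient means that the last letter of \<open>w\<close> may be
    followed by \<open>a\<close>. The remaining words enter with coefficient 0, whatever the product
    with the tail is.\<close>
  have red: "reduced_word g (w @ x)" if "w \<in> words g U" "\<xi> w \<noteq> 0" for w
  proof -
    have w: "reduced_word g w" "w \<noteq> []" "last w \<in> I" using that last_in_I by (auto simp: words_def)
    have "U \<noteq> 0" using that(1) w(2) by (cases w) (auto simp: words_def)
    then have "hd x = a" using hx by simp
    moreover have "schottky_matrix g (last w) a = 1"
    proof -
      have "a \<noteq> inv_letter g (last w)" using \<xi>[OF that(2) w(2)] inv_letter_inv[OF w(3)] by metis
      then show ?thesis using schottky_matrix_iff[OF w(3) ab(1)] by blast
    qed
    ultimately show ?thesis using w xr by (simp add: reduced_word_append)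
  qed
  have e: "star (\<xi> w \<odot> sw (w @ x)) \<otimes> (\<xi> w' \<odot> sw (w' @ x)) = (if w = w' then of_real ((cmod (\<xi> w))\<^sup>2) \<odot> q b else \<zero>)"
    if ww: "w \<in> words g U" "w' \<in> words g U" for w w'
  proof (cases "\<xi> w = 0 \<or> \<xi> w' = 0")
    case True
    then show ?thesis using that cl ab by (auto simp: adj_smult)
  next
    case False
    have "star (\<xi> w \<odot> sw (w @ x)) \<otimes> (\<xi> w' \<odot> sw (w' @ x)) = (cnj (\<xi> w) * \<xi> w') \<odot> (star (sw (w @ x)) \<otimes> sw (w' @ x))"
      using that cl by (simp add: adj_smult mult_sm)
    moreover have "star (sw (w @ x)) \<otimes> sw (w' @ x) = (if w = w' then q b else \<zero>)"
    proof (cases "w = w'")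
      case True
      then show ?thesis using star_sw_self[OF red[of w]] that False by (simp add: x_def)
    next
      case ne: False
      then obtain k where "k < min (length (w @ x)) (length (w' @ x))" "(w @ x) ! k \<noteq> (w' @ x) ! k"
        using aperiodic_tail[of w w' U a b] ww ab(3) unfolding x_def words_def by blast
      then show ?thesis using star_sw_orth[OF red[of w] red[of w']] ww False ne by simp
    qed
    moreover have "complex_of_real ((cmod (\<xi> w))\<^sup>2) = cnj (\<xi> w) * \<xi> w"
      by (simp only: complex_norm_square mult.commute)
    ultimately show ?thesis by (cases "w = w'") (simp_all del: of_real_power)
  qed
  let ?V = "\<lambda>w. \<xi> w \<odot> sw (w @ x)"
  have c: "?V \<in> words g U \<rightarrow> carrier A" using cl by auto
  have "star (wvec x U \<xi>) \<otimes> wvec x U \<xi> = (\<Oplus>w\<in>words g U. star (?V w)) \<otimes> wvec x U \<xi>"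
    unfolding wvec_def using c by (simp add: star_finsum)
  also have "\<dots> = (\<Oplus>w\<in>words g U. star (?V w) \<otimes> wvec x U \<xi>)"
    using c xI by (intro finsum_ldistr) auto
  also have "\<dots> = (\<Oplus>w\<in>words g U. of_real ((cmod (\<xi> w))\<^sup>2) \<odot> q b)"
  proof (rule finsum_cong')
    fix w assume w: "w \<in> words g U"
    have "star (?V w) \<otimes> wvec x U \<xi> = (\<Oplus>w'\<in>words g U. star (?V w) \<otimes> ?V w')"
      unfolding wvec_def using c w by (intro finsum_rdistr) auto
    also have "\<dots> = star (?V w) \<otimes> ?V w"
      by (rule finsum_single) (use c w e cl ab in \<open>auto\<close>)
    finally show "star (?V w) \<otimes> wvec x U \<xi> = of_real ((cmod (\<xi> w))\<^sup>2) \<odot> q b" using e[OF w w] by simp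
  qed (use ab in auto)
  also have "\<dots> = (\<Sum>w\<in>words g U. of_real ((cmod (\<xi> w))\<^sup>2)) \<odot> q b"
    using ab by (intro sum_sm[symmetric]) auto
  also have "\<dots> = of_real (l2sq (words g U) \<xi>) \<odot> q b" by simp
  finally have "nrm (star (wvec x U \<xi>) \<otimes> wvec x U \<xi>) = cmod (of_real (l2sq (words g U) \<xi>)) * nrm (q b)"
    using norm_smult ab by simp
  moreover have "cmod (of_real (l2sq (words g U) \<xi>)) = l2sq (words g U) \<xi>"
    by (subst norm_of_real) (simp add: sum_nonneg)
  ultimately show ?thesis
    using norm_cstar[OF wvec_closed[OF xI], of U \<xi>] nrm_q[OF one g2 ab(2)] by (simp only: mult_1_right)
qed

text \<open>Fixing the last letter \<open>l\<close> allows a tail \<open>c ... c d\<close> that may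
  follow every word in the support, before and after the action. With this tail both sides become
  norms in the algebra, where the action is left multiplication by
  \<open>ev s \<tau>\<close>.\<close>

lemma act_lower_bound_last:
  assumes one: "\<one> \<noteq> \<zero>" and g2: "2 \<le> g" and l: "l \<in> I"
    and \<tau>: "letters \<tau> \<subseteq> I" and sup: "supported g a b \<xi>" and ab: "tdeg \<tau> < a" "b + tdeg \<tau> \<le> U"
    and last: "\<And>w. \<xi> w \<noteq> 0 \<Longrightarrow> w \<noteq> [] \<Longrightarrow> last w = l"
  shows "l2sq (words g U) (act g \<tau> \<xi>) \<le> (nrm (ev s \<tau>))\<^sup>2 * l2sq (words g U) \<xi>"
proof -
  obtain c where c: "c \<in> I" "c \<noteq> inv_letter g l" using exists_letter_avoiding[OF g2, of "inv_letter g l"] by blast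
  obtain d where d: "d \<in> I" "d \<noteq> c" "d \<noteq> inv_letter g c" using exists_letter_avoiding[OF g2, of c "inv_letter g c"] by blast
  have lc: "l \<noteq> inv_letter g c" using c inv_letter_inv[OF c(1)] by metis
  define x where "x = replicate U c @ [d]"
  have xI: "set x \<subseteq> I" using c d by (auto simp: x_def)
  have last': "last w = l" if "act g \<tau> \<xi> w \<noteq> 0" "w \<noteq> []" for w
  proof (rule ccontr)
    assume "last w \<noteq> l"
    then have "act g \<tau> \<xi> w = act g \<tau> (\<lambda>_. 0) w"
      using that by (intro act_local[of "last w"]) (use last \<open>last w \<noteq> l\<close> in fastforce)+
    also have "\<dots> = 0" using act_sum[of g \<tau> "\<lambda>_::nat. 0" "\<lambda>_ _. 0" "{}"] by simp
    finally show False using that by simp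
  qed
  have ec: "ev s \<tau> \<in> carrier A" using \<tau> by (intro ev_closed s_closed) auto
  have "l2sq (words g U) (act g \<tau> \<xi>) = (nrm (wvec x U (act g \<tau> \<xi>)))\<^sup>2"
    unfolding x_def by (rule nrm_wvec[OF one g2 c(1) d(1) d(2)[symmetric] d(3), symmetric]) (use last' lc in auto)
  also have "wvec x U (act g \<tau> \<xi>) = ev s \<tau> \<otimes> wvec x U \<xi>" using wvec_act[OF xI \<tau> sup ab] by simp
  also have "(nrm (ev s \<tau> \<otimes> wvec x U \<xi>))\<^sup>2 \<le> (nrm (ev s \<tau>) * nrm (wvec x U \<xi>))\<^sup>2"
    using ec xI by (intro power_mono norm_mult norm_nonneg) auto
  also have "\<dots> = (nrm (ev s \<tau>))\<^sup>2 * (nrm (wvec x U \<xi>))\<^sup>2" by (simp add: power_mult_distrib)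
  also have "(nrm (wvec x U \<xi>))\<^sup>2 = l2sq (words g U) \<xi>"
    unfolding x_def by (rule nrm_wvec[OF one g2 c(1) d(1) d(2)[symmetric] d(3)]) (use last lc in auto)
  finally show ?thesis .
qed

text \<open>No single tail may follow every last letter, so \<xi> is cut into pieces by last letter.
  By \<open>act_local\<close> the pieces stay apart under the action and their squared norms add
  up.\<close>

lemma act_lower_bound:
  assumes one: "\<one> \<noteq> \<zero>" and g2: "2 \<le> g"
    and \<tau>: "letters \<tau> \<subseteq> I" and sup: "supported g a b \<xi>" and ab: "tdeg \<tau> < a" "b + tdeg \<tau> \<le> U"
  shows "l2sq (words g U) (act g \<tau> \<xi>) \<le> (nrm (ev s \<tau>))\<^sup>2 * l2sq (words g U) \<xi>"
proof -
  let ?W = "words g U"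
  define f where "f l = (\<lambda>w. if w \<noteq> [] \<and> last w = l then \<xi> w else 0)" for l
  have split: "(\<Sum>w\<in>?W. h w) = (\<Sum>l\<in>I. \<Sum>w\<in>?W. if last w = l then h w else 0)" for h :: "nat list \<Rightarrow> real"
  proof -
    have "(\<Sum>l\<in>I. \<Sum>w\<in>?W. if last w = l then h w else 0) = (\<Sum>w\<in>?W. \<Sum>l\<in>I. if last w = l then h w else 0)"
      by (rule sum.swap)
    also have "\<dots> = (\<Sum>w\<in>?W. h w)"
      using last_in_I by (intro sum.cong) (auto simp: words_def sum.delta')
    finally show ?thesis by simp
  qed
  have "l2sq ?W (act g \<tau> \<xi>) = (\<Sum>l\<in>I. \<Sum>w\<in>?W. if last w = l then (cmod (act g \<tau> \<xi> w))\<^sup>2 else 0)"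
    by (rule split)
  also have "\<dots> \<le> (\<Sum>l\<in>I. \<Sum>w\<in>?W. (cmod (act g \<tau> (f l) w))\<^sup>2)"
  proof (intro sum_mono)
    fix l w assume w: "w \<in> ?W"
    show "(if last w = l then (cmod (act g \<tau> \<xi> w))\<^sup>2 else 0) \<le> (cmod (act g \<tau> (f l) w))\<^sup>2"
    proof (cases "last w = l")
      case True
      have "act g \<tau> \<xi> w = act g \<tau> (f l) w" using w True by (intro act_local[of l]) (auto simp: f_def words_def)
      then show ?thesis by simp
    qed simp
  qed
  also have "\<dots> \<le> (\<Sum>l\<in>I. (nrm (ev s \<tau>))\<^sup>2 * l2sq ?W (f l))"
  proof (rule sum_mono)
    fix l assume l: "l \<in> I"
    have "supported g a b (f l)" using sup by (auto simp: supported_def f_def split: if_splits)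
    then show "l2sq ?W (act g \<tau> (f l)) \<le> (nrm (ev s \<tau>))\<^sup>2 * l2sq ?W (f l)"
      by (rule act_lower_bound_last[OF one g2 l \<tau> _ ab]) (auto simp: f_def split: if_splits)
  qed
  also have "\<dots> = (nrm (ev s \<tau>))\<^sup>2 * (\<Sum>l\<in>I. \<Sum>w\<in>?W. if last w = l then (cmod (\<xi> w))\<^sup>2 else 0)"
    by (simp only: sum_distrib_left[symmetric]) (auto intro!: arg_cong[of _ _ "\<lambda>t. _ * t"] sum.cong simp: f_def words_def)
  also have "\<dots> = (nrm (ev s \<tau>))\<^sup>2 * l2sq ?W \<xi>" by (simp only: split[symmetric])
  finally show ?thesis .
qed

subsection \<open>The upper bound\<close>

text \<open>The matrix \<open>m\<close> written in the elements
  \<open>sw v \<otimes> star (sw u)\<close>. These are almost matrix units: a product produces the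
  source projection of the last letter in the middle.\<close>

definition mat_elt :: "nat list set \<Rightarrow> nat list set \<Rightarrow> (nat list \<Rightarrow> nat list \<Rightarrow> complex) \<Rightarrow> 'a" where
  "mat_elt F E m = (\<Oplus>v\<in>F. sw v \<otimes> (\<Oplus>u\<in>E. m v u \<odot> star (sw u)))"

lemma mat_elt_closed [simp]:
  "F \<subseteq> Collect (reduced_word g) \<Longrightarrow> E \<subseteq> Collect (reduced_word g) \<Longrightarrow> mat_elt F E m \<in> carrier A"
  unfolding mat_elt_def by (intro finsum_closed Pi_I m_closed) (auto intro!: star_closed)

lemma mat_elt_double:
  assumes "F \<subseteq> Collect (reduced_word g)" "E \<subseteq> Collect (reduced_word g)" "finite E"
  shows "mat_elt F E m = (\<Oplus>v\<in>F. \<Oplus>u\<in>E. m v u \<odot> (sw v \<otimes> star (sw u)))"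
  unfolding mat_elt_def
proof (rule finsum_cong')
  fix v assume v: "v \<in> F"
  have "sw v \<otimes> (\<Oplus>u\<in>E. m v u \<odot> star (sw u)) = (\<Oplus>u\<in>E. sw v \<otimes> (m v u \<odot> star (sw u)))"
    using assms v by (intro finsum_rdistr) auto
  also have "\<dots> = (\<Oplus>u\<in>E. m v u \<odot> (sw v \<otimes> star (sw u)))"
    using assms v by (intro finsum_cong') (auto simp: smult_mult_right subset_iff)
  finally show "sw v \<otimes> (\<Oplus>u\<in>E. m v u \<odot> star (sw u)) = (\<Oplus>u\<in>E. m v u \<odot> (sw v \<otimes> star (sw u)))" .
qed (use assms in \<open>auto intro!: finsum_closed sm_closed m_closed\<close>)

lemma star_mat_elt:
  assumes "F \<subseteq> Collect (reduced_word g)" "E \<subseteq> Collect (reduced_word g)" "finite E" "finite F"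
  shows "star (mat_elt F E m) = mat_elt E F (\<lambda>u v. cnj (m v u))"
proof -
  have c: "sw v \<in> carrier A" if "v \<in> F \<union> E" for v using assms that by auto
  have "star (mat_elt F E m) = (\<Oplus>v\<in>F. \<Oplus>u\<in>E. star (m v u \<odot> (sw v \<otimes> star (sw u))))"
    unfolding mat_elt_double[OF assms(1-3)] using assms c
    by (subst star_finsum) (auto intro!: finsum_cong' finsum_closed star_finsum)
  also have "\<dots> = (\<Oplus>v\<in>F. \<Oplus>u\<in>E. cnj (m v u) \<odot> (sw u \<otimes> star (sw v)))"
    using c by (intro finsum_cong') (auto simp: adj_smult adj_mult adj_adj)
  also have "\<dots> = (\<Oplus>u\<in>E. \<Oplus>v\<in>F. cnj (m v u) \<odot> (sw u \<otimes> star (sw v)))"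
    using assms c by (intro finsum_swap) auto
  also have "\<dots> = mat_elt E F (\<lambda>u v. cnj (m v u))"
    by (rule mat_elt_double[symmetric]) (use assms in auto)
  finally show ?thesis .
qed

text \<open>For words of one length \<open>star (sw u) \<otimes> sw w\<close> is zero unless
  \<open>u = w\<close>, and then it is \<open>q (last u)\<close>. Where \<open>M v u\<close> is
  nonzero the last letters agree, so \<open>sw v\<close> absorbs that projection and plain matrix
  multiplication remains.\<close>

lemma mat_elt_mult:
  assumes F: "F \<subseteq> words_eq g j" and E: "E \<subseteq> words_eq g k" "0 < k" "0 < j" and H: "H \<subseteq> words_eq g i"
    and M: "\<And>v u. v \<in> F \<Longrightarrow> u \<in> E \<Longrightarrow> M v u \<noteq> 0 \<Longrightarrow> last v = last u"
  shows "mat_elt F E M \<otimes> mat_elt E H N = mat_elt F H (\<lambda>v h. \<Sum>u\<in>E. M v u * N u h)"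
proof -
  have fin: "finite F" "finite E" "finite H" using assms finite_words_eq by (meson finite_subset)+
  have r: "reduced_word g v" if "v \<in> F \<union> E \<union> H" for v using assms that by (auto simp: words_eq_def)
  have c: "sw v \<in> carrier A" if "v \<in> F \<union> E \<union> H" for v using r[OF that] by simp
  have ne: "v \<noteq> []" if "v \<in> F \<union> E" for v using assms that by (auto simp: words_eq_def)
  define b where "b u = (\<Oplus>h\<in>H. N u h \<odot> star (sw h))" for u
  have bc: "b u \<in> carrier A" for u unfolding b_def using c by (intro finsum_closed) auto
  have lastI: "last u \<in> I" if "u \<in> F \<union> E" for u using r ne that last_in_I by blast
  have qc: "q (last u) \<in> carrier A" if "u \<in> F \<union> E" for u using lastI[OF that] by (rule q_closed)
  have inner: "star (sw u) \<otimes> mat_elt E H N = q (last u) \<otimes> b u" if u: "u \<in> E" for u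
  proof -
    have "star (sw u) \<otimes> mat_elt E H N = (\<Oplus>w\<in>E. star (sw u) \<otimes> (sw w \<otimes> b w))"
      unfolding mat_elt_def b_def[symmetric] using u c bc fin by (intro finsum_rdistr) auto
    also have "\<dots> = star (sw u) \<otimes> (sw u \<otimes> b u)"
    proof (rule finsum_single)
      fix w assume w: "w \<in> E" "w \<noteq> u"
      have "star (sw u) \<otimes> sw w = \<zero>"
        by (rule star_sw_same_length) (use w u r E in \<open>auto simp: words_eq_def\<close>)
      then show "star (sw u) \<otimes> (sw w \<otimes> b w) = \<zero>" using c[of u] c[of w] bc u w by (simp add: m_assoc[symmetric])
    qed (use fin u c bc in auto)
    also have "\<dots> = q (last u) \<otimes> b u"
      using star_sw_self[of u] r[of u] ne[of u] u c[of u] bc[of u] by (simp add: m_assoc[symmetric])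
    finally show ?thesis .
  qed
  have mc: "mat_elt E H N \<in> carrier A" using r by (intro mat_elt_closed) auto
  have "mat_elt F E M \<otimes> mat_elt E H N = (\<Oplus>v\<in>F. sw v \<otimes> (\<Oplus>u\<in>E. M v u \<odot> star (sw u)) \<otimes> mat_elt E H N)"
    unfolding mat_elt_def[of F] using fin c mc by (intro finsum_ldistr) (auto intro!: m_closed finsum_closed)
  also have "\<dots> = (\<Oplus>v\<in>F. sw v \<otimes> (\<Oplus>h\<in>H. (\<Sum>u\<in>E. M v u * N u h) \<odot> star (sw h)))"
  proof (rule finsum_cong')
    fix v assume v: "v \<in> F"
    have "sw v \<otimes> (\<Oplus>u\<in>E. M v u \<odot> star (sw u)) \<otimes> mat_elt E H N
        = sw v \<otimes> ((\<Oplus>u\<in>E. M v u \<odot> star (sw u)) \<otimes> mat_elt E H N)"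
      using c v mc by (intro m_assoc finsum_closed) auto
    also have "(\<Oplus>u\<in>E. M v u \<odot> star (sw u)) \<otimes> mat_elt E H N = (\<Oplus>u\<in>E. (M v u \<odot> star (sw u)) \<otimes> mat_elt E H N)"
      using c mc fin by (intro finsum_ldistr) auto
    also have "\<dots> = (\<Oplus>u\<in>E. M v u \<odot> (q (last u) \<otimes> b u))"
      using c mc qc bc inner by (intro finsum_cong') (auto simp: smult_mult_left)
    also have "sw v \<otimes> (\<Oplus>u\<in>E. M v u \<odot> (q (last u) \<otimes> b u)) = (\<Oplus>u\<in>E. sw v \<otimes> (M v u \<odot> (q (last u) \<otimes> b u)))"
      using c v fin qc bc by (intro finsum_rdistr) auto
    also have "\<dots> = (\<Oplus>u\<in>E. sw v \<otimes> (M v u \<odot> b u))"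
    proof (rule finsum_cong')
      fix u assume u: "u \<in> E"
      show "sw v \<otimes> (M v u \<odot> (q (last u) \<otimes> b u)) = sw v \<otimes> (M v u \<odot> b u)"
      proof (cases "M v u = 0")
        case False
        then have l: "last u = last v" using M v u by metis
        have "sw v \<otimes> (q (last v) \<otimes> b u) = sw v \<otimes> b u"
          using sw_q_last[of v] r[of v] ne[of v] v c[of v] bc qc[of v] m_assoc[of "sw v" "q (last v)" "b u"] by simp
        then show ?thesis using l c[of v] v bc qc[of v] by (simp add: smult_mult_right)
      qed (use u v c bc qc in simp)
    qed (use v c bc in auto)
    also have "\<dots> = sw v \<otimes> (\<Oplus>u\<in>E. M v u \<odot> b u)"
      using c v fin bc by (intro finsum_rdistr[symmetric]) auto
    also have "(\<Oplus>u\<in>E. M v u \<odot> b u) = (\<Oplus>u\<in>E. \<Oplus>h\<in>H. (M v u * N u h) \<odot> star (sw h))"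
      using c fin by (intro finsum_cong') (auto simp: b_def sm_finsum sm_assoc intro!: finsum_cong' finsum_closed)
    also have "\<dots> = (\<Oplus>h\<in>H. \<Oplus>u\<in>E. (M v u * N u h) \<odot> star (sw h))"
      using c fin by (intro finsum_swap) auto
    also have "\<dots> = (\<Oplus>h\<in>H. (\<Sum>u\<in>E. M v u * N u h) \<odot> star (sw h))"
      using c fin by (intro finsum_cong') (auto simp: sum_sm)
    finally show "sw v \<otimes> (\<Oplus>u\<in>E. M v u \<odot> star (sw u)) \<otimes> mat_elt E H N
        = sw v \<otimes> (\<Oplus>h\<in>H. (\<Sum>u\<in>E. M v u * N u h) \<odot> star (sw h))" .
  qed (use c in \<open>auto intro!: m_closed finsum_closed\<close>)
  finally show ?thesis unfolding mat_elt_def[of F] .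
qed

text \<open>A crude triangle inequality. Its factor depends only on the size of \<open>E\<close>, so
  it disappears once the lemma is applied to high powers.\<close>

lemma nrm_mat_elt_le:
  fixes C :: real
  assumes E: "E \<subseteq> words_eq g k" and m: "\<And>v u. v \<in> E \<Longrightarrow> u \<in> E \<Longrightarrow> cmod (m v u) \<le> C"
  shows "nrm (mat_elt E E m) \<le> (real (card E))\<^sup>2 * C"
proof -
  have fin: "finite E" using E finite_words_eq by (meson finite_subset)
  have r: "reduced_word g v" if "v \<in> E" for v using E that by (auto simp: words_eq_def)
  have c: "sw v \<in> carrier A" if "v \<in> E" for v using r[OF that] by simp
  have "mat_elt E E m = (\<Oplus>v\<in>E. \<Oplus>u\<in>E. m v u \<odot> (sw v \<otimes> star (sw u)))"
    using r fin by (intro mat_elt_double) auto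
  also have "nrm \<dots> \<le> (\<Sum>v\<in>E. nrm (\<Oplus>u\<in>E. m v u \<odot> (sw v \<otimes> star (sw u))))"
    using fin c by (intro nrm_finsum) (auto intro!: finsum_closed)
  also have "\<dots> \<le> (\<Sum>v\<in>E. \<Sum>u\<in>E. nrm (m v u \<odot> (sw v \<otimes> star (sw u))))"
    using fin c by (intro sum_mono nrm_finsum) auto
  also have "\<dots> \<le> (\<Sum>v\<in>E. \<Sum>u\<in>E. C)"
  proof (intro sum_mono)
    fix v u assume vu: "v \<in> E" "u \<in> E"
    have "nrm (m v u \<odot> (sw v \<otimes> star (sw u))) = cmod (m v u) * nrm (sw v \<otimes> star (sw u))"
      using vu c by (intro norm_smult) auto
    also have "\<dots> \<le> C * 1"
    proof (rule mult_mono)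
      have "nrm (sw v \<otimes> star (sw u)) \<le> nrm (sw v) * nrm (star (sw u))" using vu c by (intro norm_mult) auto
      also have "\<dots> \<le> 1 * 1" using vu c r nrm_sw by (intro mult_mono) (auto simp: norm_nonneg)
      finally show "nrm (sw v \<otimes> star (sw u)) \<le> 1" by simp
      show "0 \<le> C" using m[OF vu] by (rule order_trans[OF norm_ge_zero])
    qed (use m vu c in \<open>auto intro!: norm_nonneg\<close>)
    finally show "nrm (m v u \<odot> (sw v \<otimes> star (sw u))) \<le> C" by simp
  qed
  also have "\<dots> = (real (card E))\<^sup>2 * C" by (simp add: power2_eq_square)
  finally show ?thesis .
qed

text \<open>\<open>star X \<otimes> X\<close> is represented by the Gram matrix \<open>G\<close>,
  and its powers by the powers of \<open>G\<close>. The entries of these grow at most like powers of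
  \<open>C^2\<close>, so the crude bound together with \<open>power_trick\<close> gives the sharp
  one.\<close>

lemma nrm_mat_elt:
  assumes F: "F \<subseteq> words_eq g j" "0 < j" and E: "E \<subseteq> words_eq g k" "0 < k"
    and m: "\<And>v u. v \<in> F \<Longrightarrow> u \<in> E \<Longrightarrow> m v u \<noteq> 0 \<Longrightarrow> last v = last u" and C: "l2_bounded F E m C"
  shows "nrm (mat_elt F E m) \<le> C"
proof -
  have fin: "finite F" "finite E" using assms finite_words_eq by (meson finite_subset)+
  have r: "F \<subseteq> Collect (reduced_word g)" "E \<subseteq> Collect (reduced_word g)" using assms by (auto simp: words_eq_def)
  have C0: "0 \<le> C" using C by (simp add: l2_bounded_def)
  define X where "X = mat_elt F E m"
  define G where "G = (\<lambda>u u'. \<Sum>v\<in>F. cnj (m v u) * m v u')"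
  have Xc: "X \<in> carrier A" using r by (simp add: X_def)
  have G: "last u = last u'" if uu: "u \<in> E" "u' \<in> E" "G u u' \<noteq> 0" for u u'
  proof -
    obtain v where "v \<in> F" "cnj (m v u) * m v u' \<noteq> 0"
      using uu(3) unfolding G_def by (metis (no_types, lifting) sum.neutral)
    then show ?thesis using m[of v u] m[of v u'] uu by auto
  qed
  have XX: "star X \<otimes> X = mat_elt E E G"
    unfolding X_def G_def star_mat_elt[OF r fin(2,1)]
    by (rule mat_elt_mult[OF E(1) F(1) F(2) E(2) E(1)]) (use m in force)
  have GP: "last u = last u'" if "u \<in> E" "u' \<in> E" "mat_power E G n u u' \<noteq> 0" for u u' n
    using that
  proof (induction n arbitrary: u')
    case (Suc n)
    then obtain v where "v \<in> E" "mat_power E G n u v * G v u' \<noteq> 0"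
      using Suc.prems(3) by (metis (no_types, lifting) sum.neutral mat_power.simps(2))
    then show ?case using Suc.IH[of v] G[of v u'] Suc.prems by auto
  qed (use G in simp)
  have pow: "(star X \<otimes> X) [^] Suc n = mat_elt E E (mat_power E G n)" for n
  proof (induction n)
    case (Suc n)
    have "(star X \<otimes> X) [^] Suc (Suc n) = mat_elt E E (mat_power E G n) \<otimes> mat_elt E E G"
      using Suc XX by simp
    also have "\<dots> = mat_elt E E (mat_power E G (Suc n))"
      unfolding mat_power.simps by (rule mat_elt_mult) (use E GP in auto)
    finally show ?case .
  qed (use XX r in simp)
  have Gb: "l2_bounded E E G (C * C)" unfolding G_def by (rule l2_bounded_mult[OF l2_bounded_adjoint[OF C] C])
  \<comment> \<open>The bound has the constant factor \<open>(card E)^2\<close>; the extra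
    \<open>2^n\<close> and \<open>+ 1\<close> only bring it into the shape of
    \<open>power_trick\<close>.\<close>
  have "((nrm X)\<^sup>2) ^ (2^n) \<le> ((real (card E))\<^sup>2 * 2^n + 1) * (C * C) ^ (2^n)" for n
  proof -
    have "((nrm X)\<^sup>2) ^ (2^n) = nrm (star X \<otimes> X) ^ (2^n)" using norm_cstar[OF Xc] by simp
    also have "\<dots> = nrm ((star X \<otimes> X) [^] (2^n::nat))"
      using Xc by (intro nrm_selfadj_power[symmetric]) (auto simp: adj_mult adj_adj)
    also have "\<dots> = nrm (mat_elt E E (mat_power E G (2^n - 1)))" using pow[of "2^n - 1"] by simp
    also have "\<dots> \<le> (real (card E))\<^sup>2 * (C * C) ^ Suc (2^n - 1)"
      by (rule nrm_mat_elt_le[OF E(1)]) (rule l2_bounded_entry[OF l2_bounded_mat_power[OF Gb] fin(2,2)])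
    also have "\<dots> = (real (card E))\<^sup>2 * (C * C) ^ (2^n)" by simp
    also have "\<dots> \<le> ((real (card E))\<^sup>2 * 2^n + 1) * (C * C) ^ (2^n)"
    proof (rule mult_right_mono)
      have "(real (card E))\<^sup>2 * 1 \<le> (real (card E))\<^sup>2 * 2^n" by (intro mult_left_mono) auto
      then show "(real (card E))\<^sup>2 \<le> (real (card E))\<^sup>2 * 2^n + 1" by simp
    qed (use C0 in simp)
    finally show ?thesis .
  qed
  then have "(nrm X)\<^sup>2 \<le> C * C" by (rule power_trick[rotated 2]) (use C0 in simp_all)
  then show ?thesis using C0 unfolding X_def by (auto simp: power2_eq_square intro: power2_le_imp_le)
qed

text \<open>Writing \<open>\<tau> = \<Sum> \<tau> s\<^sub>u s\<^sub>u\<^sup>*\<close> over the words \<open>u\<close> of length \<open>deg \<tau> + 1\<close> makes it a matrix in the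
  \<open>s\<^sub>v s\<^sub>u\<^sup>*\<close>. Its \<open>2 deg \<tau> + 1\<close> blocks with \<open>v\<close> of constant length are bounded by scalar matrices.\<close>

lemma ev_upper_bound:
  assumes \<tau>: "letters \<tau> \<subseteq> I" and C0: "0 \<le> C"
    and C: "\<And>\<xi> a b U. supported g a b \<xi> \<Longrightarrow> tdeg \<tau> < a \<Longrightarrow> b + tdeg \<tau> \<le> U \<Longrightarrow>
      l2sq (words g U) (act g \<tau> \<xi>) \<le> C\<^sup>2 * l2sq (words g U) \<xi>"
  shows "nrm (ev s \<tau>) \<le> real (2 * tdeg \<tau> + 1) * C"
proof -
  \<comment> \<open>Words of length \<open>tdeg \<tau> + 1\<close> cannot be used up by \<tau>, and
    \<open>U\<close> is the greatest length they can reach.\<close>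
  define D where "D = tdeg \<tau> + 1"
  define U where "U = 2 * tdeg \<tau> + 1"
  define E where "E = words_eq g D"
  define \<delta> where "\<delta> u = (\<lambda>w. if w = u then 1 else 0 :: complex)" for u :: "nat list"
  define m where "m v u = act g \<tau> (\<delta> u) v" for v u
  have ec: "ev s \<tau> \<in> carrier A" using \<tau> by (intro ev_closed s_closed) auto
  have E: "reduced_word g u" "length u = D" "u \<noteq> []" "u \<in> words g U" "sw u \<in> carrier A" if "u \<in> E" for u
    using that by (auto simp: E_def words_eq_def words_def D_def U_def)
  have fE: "finite E" by (simp add: E_def)
  have wc: "sw v \<in> carrier A" if "v \<in> words g U" for v using that by (auto simp: words_def)
  have col: "ev s \<tau> \<otimes> sw u = (\<Oplus>v\<in>words g U. m v u \<odot> sw v)" if u: "u \<in> E" for u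
  proof -
    have "wvec [] U (\<delta> u) = \<delta> u u \<odot> sw (u @ [])"
      unfolding wvec_def by (rule finsum_single) (use E[OF u] wc in \<open>auto simp: \<delta>_def\<close>)
    then have "wvec [] U (\<delta> u) = sw u" using E[OF u] by (simp add: \<delta>_def)
    moreover have "supported g D D (\<delta> u)" using E[OF u] by (auto simp: supported_def \<delta>_def)
    then have "ev s \<tau> \<otimes> wvec [] U (\<delta> u) = wvec [] U (act g \<tau> (\<delta> u))"
      using \<tau> by (intro wvec_act) (auto simp: D_def U_def)
    ultimately show ?thesis by (simp add: wvec_def m_def)
  qed
  have sub: "words_eq g n \<subseteq> Collect (reduced_word g)" "E \<subseteq> Collect (reduced_word g)" for n
    using E by (auto simp: words_eq_def)
  have UN: "words g U = (\<Union>n\<in>{1..U}. words_eq g n)"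
    by (auto simp: words_def words_eq_def Suc_le_eq)
  have "ev s \<tau> = ev s \<tau> \<otimes> (\<Oplus>u\<in>E. sw u \<otimes> star (sw u))"
    unfolding E_def sw_sum using ec by simp
  also have "\<dots> = (\<Oplus>u\<in>E. ev s \<tau> \<otimes> (sw u \<otimes> star (sw u)))"
    using ec fE E by (intro finsum_rdistr) auto
  also have "\<dots> = (\<Oplus>u\<in>E. \<Oplus>v\<in>words g U. m v u \<odot> (sw v \<otimes> star (sw u)))"
  proof (rule finsum_cong')
    fix u assume u: "u \<in> E"
    have "ev s \<tau> \<otimes> (sw u \<otimes> star (sw u)) = (ev s \<tau> \<otimes> sw u) \<otimes> star (sw u)"
      using ec E[OF u] by (simp add: m_assoc)
    also have "\<dots> = (\<Oplus>v\<in>words g U. (m v u \<odot> sw v) \<otimes> star (sw u))"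
      unfolding col[OF u] using E[OF u] wc by (intro finsum_ldistr) auto
    also have "\<dots> = (\<Oplus>v\<in>words g U. m v u \<odot> (sw v \<otimes> star (sw u)))"
      using E[OF u] wc by (intro finsum_cong') (auto simp: smult_mult_left)
    finally show "ev s \<tau> \<otimes> (sw u \<otimes> star (sw u)) = (\<Oplus>v\<in>words g U. m v u \<odot> (sw v \<otimes> star (sw u)))" .
  qed (use E wc in \<open>auto intro!: finsum_closed\<close>)
  also have "\<dots> = (\<Oplus>v\<in>words g U. \<Oplus>u\<in>E. m v u \<odot> (sw v \<otimes> star (sw u)))"
    using fE E wc by (intro finsum_swap) auto
  \<comment> \<open>Only words of equal length have orthogonal ranges, as \<open>nrm_mat_elt\<close>
    needs. The number \<open>U\<close> of lengths becomes the linear factor.\<close>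
  also have "\<dots> = (\<Oplus>n\<in>{1..U}. \<Oplus>v\<in>words_eq g n. \<Oplus>u\<in>E. m v u \<odot> (sw v \<otimes> star (sw u)))"
    unfolding UN
  proof (rule add.finprod_UN_disjoint)
    show "pairwise (\<lambda>n n'. disjnt (words_eq g n) (words_eq g n')) {1..U}"
      by (auto simp: pairwise_def disjnt_def words_eq_def)
  qed (use E in \<open>auto intro!: finsum_closed simp: words_eq_def[THEN eqset_imp_iff]\<close>)
  also have "\<dots> = (\<Oplus>n\<in>{1..U}. mat_elt (words_eq g n) E m)"
  proof (rule finsum_cong')
    fix n
    show "(\<Oplus>v\<in>words_eq g n. \<Oplus>u\<in>E. m v u \<odot> (sw v \<otimes> star (sw u))) = mat_elt (words_eq g n) E m"
      by (rule mat_elt_double[symmetric]) (use fE sub in auto)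
  qed (use sub in auto)
  finally have "nrm (ev s \<tau>) = nrm (\<Oplus>n\<in>{1..U}. mat_elt (words_eq g n) E m)" by simp
  also have "\<dots> \<le> (\<Sum>n\<in>{1..U}. nrm (mat_elt (words_eq g n) E m))"
    using sub by (intro nrm_finsum) auto
  also have "\<dots> \<le> (\<Sum>n\<in>{1..U}. C)"
  proof (rule sum_mono)
    fix n assume n: "n \<in> {1..U}"
    show "nrm (mat_elt (words_eq g n) E m) \<le> C"
    proof (rule nrm_mat_elt[of _ n _ D])
      show "words_eq g n \<subseteq> words_eq g n" "E \<subseteq> words_eq g D" "0 < n" "0 < D" using n by (auto simp: E_def D_def)
      fix v u assume v: "v \<in> words_eq g n" and u: "u \<in> E" and nz: "m v u \<noteq> 0"
      show "last v = last u"
      proof (rule ccontr)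
        assume ne: "last v \<noteq> last u"
        have "v \<noteq> []" using v n by (auto simp: words_eq_def)
        then have "act g \<tau> (\<delta> u) v = act g \<tau> (\<lambda>_. 0) v"
          by (intro act_local[of "last v"]) (use ne in \<open>auto simp: \<delta>_def\<close>)
        also have "\<dots> = 0" using act_sum[of g \<tau> "\<lambda>_::nat. 0" "\<lambda>_ _. 0" "{}"] by simp
        finally show False using nz by (simp add: m_def)
      qed
    next
      show "l2_bounded (words_eq g n) E m C"
        unfolding l2_bounded_def
      proof (intro conjI allI C0)
        fix \<eta> :: "nat list \<Rightarrow> complex"
        \<comment> \<open>The vector \<eta> extended by zero from \<open>E\<close>, so that the
          hypothesis on \<open>act\<close> applies to it.\<close>
        define \<zeta> where "\<zeta> = (\<lambda>w. \<Sum>u\<in>E. \<eta> u * \<delta> u w)"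
        have \<zeta>: "\<zeta> w = (if w \<in> E then \<eta> w else 0)" for w
        proof -
          have "\<zeta> w = (\<Sum>u\<in>E. if w = u then \<eta> u else 0)" unfolding \<zeta>_def \<delta>_def by (intro sum.cong) auto
          then show ?thesis using fE by simp
        qed
        have "act g \<tau> \<zeta> v = (\<Sum>u\<in>E. m v u * \<eta> u)" for v
          unfolding \<zeta>_def act_sum m_def by (simp add: mult.commute)
        then have "(\<Sum>v\<in>words_eq g n. (cmod (\<Sum>u\<in>E. m v u * \<eta> u))\<^sup>2) = (\<Sum>v\<in>words_eq g n. (cmod (act g \<tau> \<zeta> v))\<^sup>2)"
          by simp
        also have "\<dots> \<le> l2sq (words g U) (act g \<tau> \<zeta>)"
          using n by (intro sum_mono2) (auto simp: UN)
        also have "\<dots> \<le> C\<^sup>2 * l2sq (words g U) \<zeta>"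
        proof (rule C)
          show "supported g D D \<zeta>" using E by (auto simp: supported_def \<zeta> split: if_splits)
        qed (auto simp: D_def U_def)
        also have "l2sq (words g U) \<zeta> = l2sq E \<eta>"
          using E(4) by (intro sum.mono_neutral_cong_right) (auto simp: \<zeta>)
        finally show "(\<Sum>v\<in>words_eq g n. (cmod (\<Sum>u\<in>E. m v u * \<eta> u))\<^sup>2) \<le> C\<^sup>2 * l2sq E \<eta>" .
      qed
    qed
  qed
  also have "\<dots> = real (2 * tdeg \<tau> + 1) * C" by (simp add: U_def)
  finally show ?thesis .
qed

end

text \<open>The action on words belongs to no algebra: it is bounded by the norm in \<open>A\<close>
  and bounds the norm in \<open>B\<close> up to a factor linear in the degree. Applied to powers of
  \<open>star \<tau>\<close> times \<tau>, whose norms are powers by the C*-identity, the factor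
  vanishes.\<close>

theorem ck_family_nrm_le:
  fixes A :: "('a, 'm) cstar_scheme" and B :: "('b, 'n) cstar_scheme"
  assumes "ck_family A g s" "ck_family B g t" and g2: "2 \<le> g" and one: "\<one>\<^bsub>A\<^esub> \<noteq> \<zero>\<^bsub>A\<^esub>"
    and \<tau>: "letters \<tau> \<subseteq> {1..2*g}"
  shows "cstar_norm B (cstar_algebra.ev B t \<tau>) \<le> cstar_norm A (cstar_algebra.ev A s \<tau>)"
proof -
  interpret A: ck_family A g s by fact
  interpret B: ck_family B g t by fact
  have crude: "B.nrm (B.ev t \<sigma>) \<le> real (2 * tdeg \<sigma> + 1) * A.nrm (A.ev s \<sigma>)" if \<sigma>: "letters \<sigma> \<subseteq> {1..2*g}" for \<sigma>
  proof (rule B.ev_upper_bound[OF \<sigma>])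
    show "0 \<le> A.nrm (A.ev s \<sigma>)" using \<sigma> by (intro A.norm_nonneg A.ev_closed A.s_closed) auto
  qed (rule A.act_lower_bound[OF one g2 \<sigma>])
  let ?\<rho> = "TMul (tstar \<tau>) \<tau>"
  have ca: "\<And>i. i \<in> letters ?\<rho> \<Longrightarrow> s i \<in> carrier A" and cb: "\<And>i. i \<in> letters ?\<rho> \<Longrightarrow> t i \<in> carrier B"
    using \<tau> A.s_closed B.s_closed by auto
  have ea: "A.ev s \<tau> \<in> carrier A" and eb: "B.ev t \<tau> \<in> carrier B"
    by (rule A.ev_closed, use ca in simp) (rule B.ev_closed, use cb in simp)
  have na: "A.nrm (A.ev s (tpow ?\<rho> (2^k))) = ((A.nrm (A.ev s \<tau>))\<^sup>2) ^ (2^k)" for k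
  proof -
    have "A.ev s (tpow ?\<rho> (2^k)) = (A.star (A.ev s \<tau>) \<otimes>\<^bsub>A\<^esub> A.ev s \<tau>) [^]\<^bsub>A\<^esub> ((2::nat)^k)"
      using A.ev_tpow[of ?\<rho> s "2^k"] A.ev_tstar[of \<tau> s] ca by simp
    then show ?thesis using A.nrm_selfadj_power[of "A.star (A.ev s \<tau>) \<otimes>\<^bsub>A\<^esub> A.ev s \<tau>" k] ea
      by (simp add: A.adj_mult A.adj_adj A.norm_cstar)
  qed
  have nb: "B.nrm (B.ev t (tpow ?\<rho> (2^k))) = ((B.nrm (B.ev t \<tau>))\<^sup>2) ^ (2^k)" for k
  proof -
    have "B.ev t (tpow ?\<rho> (2^k)) = (B.star (B.ev t \<tau>) \<otimes>\<^bsub>B\<^esub> B.ev t \<tau>) [^]\<^bsub>B\<^esub> ((2::nat)^k)"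
      using B.ev_tpow[of ?\<rho> t "2^k"] B.ev_tstar[of \<tau> t] cb by simp
    then show ?thesis using B.nrm_selfadj_power[of "B.star (B.ev t \<tau>) \<otimes>\<^bsub>B\<^esub> B.ev t \<tau>" k] eb
      by (simp add: B.adj_mult B.adj_adj B.norm_cstar)
  qed
  \<comment> \<open>The power has degree \<open>2^k * 2 * tdeg \<tau>\<close>, so the factor
    \<open>2 * degree + 1\<close> is linear in \<open>2^k\<close> with slope
    \<open>4 * tdeg \<tau>\<close>.\<close>
  have "((B.nrm (B.ev t \<tau>))\<^sup>2) ^ (2^k) \<le> (real (4 * tdeg \<tau>) * 2^k + 1) * ((A.nrm (A.ev s \<tau>))\<^sup>2) ^ (2^k)" for k
  proof -
    have "letters (tpow ?\<rho> (2^k)) \<subseteq> {1..2*g}" using letters_tpow[of ?\<rho>] \<tau> by auto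
    from crude[OF this] show ?thesis unfolding na nb by (simp add: algebra_simps)
  qed
  then have "(B.nrm (B.ev t \<tau>))\<^sup>2 \<le> (A.nrm (A.ev s \<tau>))\<^sup>2"
    by (rule power_trick[rotated 2]) simp_all
  then show ?thesis using A.norm_nonneg[OF ea] by (rule power2_le_imp_le)
qed

subsection \<open>Extension to the generated algebra\<close>

text \<open>The graph of the homomorphism to be constructed: both entries are limits of the same
  polynomials. With \<open>A = B\<close> and \<open>s = t\<close> its diagonal is the closure of the
  polynomials, so density and extension share the closure properties below.\<close>

definition joint_limit ::
    "('a, 'm) cstar_scheme \<Rightarrow> ('b, 'n) cstar_scheme \<Rightarrow> (nat \<Rightarrow> 'a) \<Rightarrow> (nat \<Rightarrow> 'b) \<Rightarrow> nat set \<Rightarrow> 'a \<Rightarrow> 'b \<Rightarrow> bool" where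
  "joint_limit A B s t J x y \<longleftrightarrow> x \<in> carrier A \<and> y \<in> carrier B \<and> (\<exists>\<tau>. (\<forall>n. letters (\<tau> n) \<subseteq> J) \<and>
     cstar_algebra.conv A (\<lambda>n. cstar_algebra.ev A s (\<tau> n)) x \<and> cstar_algebra.conv B (\<lambda>n. cstar_algebra.ev B t (\<tau> n)) y)"

lemma joint_limit_closed:
  fixes A :: "('a, 'm) cstar_scheme" and B :: "('b, 'n) cstar_scheme"
    and s :: "nat \<Rightarrow> 'a" and t :: "nat \<Rightarrow> 'b" and J :: "nat set"
  defines "R \<equiv> joint_limit A B s t J"
  assumes "cstar_algebra A" "cstar_algebra B" and s: "s ` J \<subseteq> carrier A" and t: "t ` J \<subseteq> carrier B"
  shows "letters \<sigma> \<subseteq> J \<Longrightarrow> R (cstar_algebra.ev A s \<sigma>) (cstar_algebra.ev B t \<sigma>)"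
    and "R x y \<Longrightarrow> R (c \<odot>\<^bsub>A\<^esub> x) (c \<odot>\<^bsub>B\<^esub> y)"
    and "R x y \<Longrightarrow> R (cstar_adj A x) (cstar_adj B y)"
    and "R x y \<Longrightarrow> R x' y' \<Longrightarrow> R (x \<otimes>\<^bsub>A\<^esub> x') (y \<otimes>\<^bsub>B\<^esub> y')"
    and "R x y \<Longrightarrow> R x' y' \<Longrightarrow> R (x \<oplus>\<^bsub>A\<^esub> x') (y \<oplus>\<^bsub>B\<^esub> y')"
proof -
  interpret A: cstar_algebra A by fact
  interpret B: cstar_algebra B by fact
  have e: "A.ev s \<tau> \<in> carrier A" "B.ev t \<tau> \<in> carrier B" if "letters \<tau> \<subseteq> J" for \<tau>
    using that s t by (auto intro!: A.ev_closed B.ev_closed)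
  have I: "R x y" if "x \<in> carrier A" "y \<in> carrier B" "\<And>n. letters (\<tau> n) \<subseteq> J"
    "A.conv (\<lambda>n. A.ev s (\<tau> n)) x" "B.conv (\<lambda>n. B.ev t (\<tau> n)) y" for x y \<tau>
    unfolding R_def joint_limit_def using that by blast
  show "R (A.ev s \<sigma>) (B.ev t \<sigma>)" if "letters \<sigma> \<subseteq> J"
    using e[OF that] that by (intro I[of _ _ "\<lambda>_. \<sigma>"] A.conv_const B.conv_const)
  assume "R x y"
  then obtain \<tau> where c: "x \<in> carrier A" "y \<in> carrier B" and \<tau>: "\<And>n. letters (\<tau> n) \<subseteq> J"
    "A.conv (\<lambda>n. A.ev s (\<tau> n)) x" "B.conv (\<lambda>n. B.ev t (\<tau> n)) y" unfolding R_def joint_limit_def by blast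
  show "R (c \<odot>\<^bsub>A\<^esub> x) (c \<odot>\<^bsub>B\<^esub> y)"
    using A.conv_sm[OF \<tau>(2), of c] B.conv_sm[OF \<tau>(3), of c] e c \<tau>(1) by (intro I[of _ _ "\<lambda>n. TScl c (\<tau> n)"]) auto
  have st: "A.ev s (tstar (\<tau> n)) = A.star (A.ev s (\<tau> n))" "B.ev t (tstar (\<tau> n)) = B.star (B.ev t (\<tau> n))" for n
    using \<tau>(1)[of n] s t by (intro A.ev_tstar B.ev_tstar; blast)+
  show "R (A.star x) (B.star y)"
    using A.conv_star[OF \<tau>(2)] B.conv_star[OF \<tau>(3)] e c \<tau>(1) by (intro I[of _ _ "\<lambda>n. tstar (\<tau> n)"]) (auto simp: st)
  assume "R x' y'"
  then obtain \<sigma> where d: "x' \<in> carrier A" "y' \<in> carrier B" and \<sigma>: "\<And>n. letters (\<sigma> n) \<subseteq> J"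
    "A.conv (\<lambda>n. A.ev s (\<sigma> n)) x'" "B.conv (\<lambda>n. B.ev t (\<sigma> n)) y'" unfolding R_def joint_limit_def by blast
  show "R (x \<otimes>\<^bsub>A\<^esub> x') (y \<otimes>\<^bsub>B\<^esub> y')"
    using A.conv_mult[OF \<tau>(2) \<sigma>(2)] B.conv_mult[OF \<tau>(3) \<sigma>(3)] e c d \<tau>(1) \<sigma>(1)
    by (intro I[of _ _ "\<lambda>n. TMul (\<tau> n) (\<sigma> n)"]) auto
  show "R (x \<oplus>\<^bsub>A\<^esub> x') (y \<oplus>\<^bsub>B\<^esub> y')"
    using A.conv_add[OF \<tau>(2) \<sigma>(2)] B.conv_add[OF \<tau>(3) \<sigma>(3)] e c d \<tau>(1) \<sigma>(1)
    by (intro I[of _ _ "\<lambda>n. TAdd (\<tau> n) (\<sigma> n)"]) auto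
qed

text \<open>The limits of polynomials form a C*-subalgebra containing the generators, hence contain
  the span, which is the least such.\<close>

lemma (in cstar_algebra) ev_dense:
  assumes s: "\<And>i. i \<in> J \<Longrightarrow> s i \<in> carrier A" and x: "x \<in> cstar_span A (s ` J)"
  shows "x \<in> carrier A \<and> (\<exists>\<tau>. (\<forall>n. letters (\<tau> n) \<subseteq> J) \<and> conv (\<lambda>n. ev s (\<tau> n)) x)"
proof -
  define K where "K = {x. joint_limit A A s s J x x}"
  have "s ` J \<subseteq> carrier A" using s by blast
  note jl = joint_limit_closed[OF cstar_algebra_axioms cstar_algebra_axioms this this]
  have K: "\<exists>\<tau>. (\<forall>n. letters (\<tau> n) \<subseteq> J) \<and> conv (\<lambda>n. ev s (\<tau> n)) x" "x \<in> carrier A" if "x \<in> K" for x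
    using that by (auto simp: K_def joint_limit_def)
  have evc: "ev s \<tau> \<in> carrier A" if "letters \<tau> \<subseteq> J" for \<tau> using that s by (intro ev_closed) auto
  have ev_K: "ev s \<tau> \<in> K" if "letters \<tau> \<subseteq> J" for \<tau> using jl(1)[OF that] by (simp add: K_def)
  have sm_K: "c \<odot> x \<in> K" if "x \<in> K" for c x using jl(2) that by (simp add: K_def)
  have "cstar_subalgebra K A"
    unfolding cstar_subalgebra_def
  proof (intro conjI allI ballI impI)
    show "subring K A"
    proof (rule subringI)
      show "K \<subseteq> carrier A" using K by blast
      show "\<one> \<in> K" using ev_K[of TOne] by simp
      show "\<ominus> x \<in> K" if "x \<in> K" for x using sm_K[OF that, of "-1"] K[OF that] by (simp add: sm_minus_one)
      show "x \<otimes> y \<in> K" "x \<oplus> y \<in> K" if "x \<in> K" "y \<in> K" for x y using jl(4,5) that by (simp_all add: K_def)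
    qed
    show "c \<odot> x \<in> K" if "x \<in> K" for c x by (rule sm_K[OF that])
    show "star x \<in> K" if "x \<in> K" for x using jl(3) that by (simp add: K_def)
    fix X x assume X: "range X \<subseteq> K" "x \<in> carrier A" "(\<lambda>n::nat. nrm (X n \<ominus> x)) \<longlonglongrightarrow> 0"
    have XK: "X n \<in> K" "X n \<in> carrier A" for n using X(1) K by blast+
    \<comment> \<open>A diagonal choice: a polynomial close to \<open>X n\<close>, with an error
      that tends to zero, replaces the sequence approximating \<open>X n\<close>.\<close>
    have "\<exists>\<tau>. letters \<tau> \<subseteq> J \<and> nrm (ev s \<tau> \<ominus> X n) < inverse (Suc n)" for n
    proof -
      obtain \<tau> where \<tau>: "\<And>k. letters (\<tau> k) \<subseteq> J" "(\<lambda>k. nrm (ev s (\<tau> k) \<ominus> X n)) \<longlonglongrightarrow> 0"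
        using K(1)[OF XK(1)[of n]] unfolding conv_def by blast
      have "\<forall>\<^sub>F k in sequentially. nrm (ev s (\<tau> k) \<ominus> X n) < inverse (Suc n)"
        by (rule order_tendstoD(2)[OF \<tau>(2)]) simp
      then show ?thesis using \<tau>(1) by (auto simp: eventually_sequentially)
    qed
    then obtain \<tau> where \<tau>: "\<And>n. letters (\<tau> n) \<subseteq> J" "\<And>n. nrm (ev s (\<tau> n) \<ominus> X n) < inverse (Suc n)" by metis
    have "conv (\<lambda>n. ev s (\<tau> n)) x"
    proof (rule conv_bound)
      fix n show "nrm (ev s (\<tau> n) \<ominus> x) \<le> inverse (Suc n) + nrm (X n \<ominus> x)"
        using nrm_diff_trans[OF evc[OF \<tau>(1)] XK(2) X(2), of n n] \<tau>(2)[of n] by linarith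
    next
      show "(\<lambda>n. inverse (Suc n) + nrm (X n \<ominus> x)) \<longlonglongrightarrow> 0"
        using tendsto_add[OF LIMSEQ_inverse_real_of_nat X(3)] by simp
    qed (use evc \<tau>(1) X(2) in auto)
    then show "x \<in> K" unfolding K_def joint_limit_def using X(2) \<tau>(1) by blast
  qed
  moreover have "s ` J \<subseteq> K" using ev_K[of "TGen i" for i] by auto
  ultimately have "x \<in> K" using x unfolding cstar_span_def by blast
  then show ?thesis using K by blast
qed

text \<open>The norm inequality turns Cauchy sequences of polynomials in \<open>A\<close> into
  Cauchy sequences in \<open>B\<close> and makes the limit independent of the approximation, so the
  relation \<open>R\<close> is the graph of a map. Its algebraic properties are the closure
  properties of \<open>R\<close>.\<close>

theorem star_hom_extension:
  fixes A :: "('a, 'm) cstar_scheme" and B :: "('b, 'n) cstar_scheme"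
  assumes "cstar_algebra A" "cstar_algebra B"
    and s: "\<And>i. i \<in> J \<Longrightarrow> s i \<in> carrier A" and t: "\<And>i. i \<in> J \<Longrightarrow> t i \<in> carrier B"
    and gen: "carrier A = cstar_span A (s ` J)"
    and le: "\<And>\<tau>. letters \<tau> \<subseteq> J \<Longrightarrow>
      cstar_norm B (cstar_algebra.ev B t \<tau>) \<le> cstar_norm A (cstar_algebra.ev A s \<tau>)"
  obtains \<phi> where "\<phi> \<in> star_hom A B"
    "\<And>\<tau>. letters \<tau> \<subseteq> J \<Longrightarrow> \<phi> (cstar_algebra.ev A s \<tau>) = cstar_algebra.ev B t \<tau>"
    "\<And>x. x \<in> carrier A \<Longrightarrow> cstar_norm B (\<phi> x) \<le> cstar_norm A x"
proof -
  interpret A: cstar_algebra A by fact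
  interpret B: cstar_algebra B by fact
  have ea: "A.ev s \<tau> \<in> carrier A" and eb: "B.ev t \<tau> \<in> carrier B" if "letters \<tau> \<subseteq> J" for \<tau>
    using that s t by (auto intro!: A.ev_closed B.ev_closed)
  define R where "R = joint_limit A B s t J"
  note R_def' = R_def joint_limit_def
  have "s ` J \<subseteq> carrier A" "t ` J \<subseteq> carrier B" using s t by blast+
  note jl = joint_limit_closed[OF assms(1,2) this, folded R_def]
  \<comment> \<open>The inequality is used for the single polynomial \<tau> minus \<sigma>.\<close>
  have diff: "B.nrm (B.ev t \<tau> \<ominus>\<^bsub>B\<^esub> B.ev t \<sigma>) \<le> A.nrm (A.ev s \<tau> \<ominus>\<^bsub>A\<^esub> A.ev s \<sigma>)"
    if "letters \<tau> \<subseteq> J" "letters \<sigma> \<subseteq> J" for \<tau> \<sigma>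
    using le[of "TAdd \<tau> (TScl (-1) \<sigma>)"] that ea[OF that(2)] eb[OF that(2)]
    by (simp add: A.sm_minus_one B.sm_minus_one a_minus_def)
  have ex: "\<exists>y. R x y" if x: "x \<in> carrier A" for x
  proof -
    obtain \<tau> where \<tau>: "\<And>n. letters (\<tau> n) \<subseteq> J" "A.conv (\<lambda>n. A.ev s (\<tau> n)) x"
      using A.ev_dense[of J s x] s x gen by auto
    have "\<exists>y\<in>carrier B. (\<lambda>n. B.nrm (B.ev t (\<tau> n) \<ominus>\<^bsub>B\<^esub> y)) \<longlonglongrightarrow> 0"
    proof (rule B.complete)
      show "range (\<lambda>n. B.ev t (\<tau> n)) \<subseteq> carrier B" using eb \<tau>(1) by auto
      fix e :: real assume "0 < e"
      then have "\<forall>\<^sub>F n in sequentially. A.nrm (A.ev s (\<tau> n) \<ominus>\<^bsub>A\<^esub> x) < e / 2"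
        using order_tendstoD(2)[OF \<tau>(2)[unfolded A.conv_def], of "e/2"] by simp
      then obtain N where N: "\<And>n. n \<ge> N \<Longrightarrow> A.nrm (A.ev s (\<tau> n) \<ominus>\<^bsub>A\<^esub> x) < e / 2"
        by (auto simp: eventually_sequentially)
      have "B.nrm (B.ev t (\<tau> m) \<ominus>\<^bsub>B\<^esub> B.ev t (\<tau> n)) < e" if "m \<ge> N" "n \<ge> N" for m n
      proof -
        have "B.nrm (B.ev t (\<tau> m) \<ominus>\<^bsub>B\<^esub> B.ev t (\<tau> n)) \<le> A.nrm (A.ev s (\<tau> m) \<ominus>\<^bsub>A\<^esub> A.ev s (\<tau> n))"
          by (intro diff \<tau>)
        also have "\<dots> \<le> A.nrm (A.ev s (\<tau> m) \<ominus>\<^bsub>A\<^esub> x) + A.nrm (x \<ominus>\<^bsub>A\<^esub> A.ev s (\<tau> n))"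
          using ea \<tau>(1) x by (intro A.nrm_diff_trans) auto
        also have "\<dots> < e" using N[OF that(1)] N[OF that(2)] A.nrm_diff_commute[OF x ea[OF \<tau>(1)], of n] by simp
        finally show ?thesis .
      qed
      then show "\<exists>N. \<forall>m\<ge>N. \<forall>n\<ge>N. B.nrm (B.ev t (\<tau> m) \<ominus>\<^bsub>B\<^esub> B.ev t (\<tau> n)) < e" by blast
    qed
    then show ?thesis unfolding R_def' B.conv_def[symmetric] using x \<tau> by blast
  qed
  have uniq: "y = y'" if r: "R x y" "R x y'" for x y y'
  proof -
    obtain \<tau> where \<tau>: "\<And>n. letters (\<tau> n) \<subseteq> J" "A.conv (\<lambda>n. A.ev s (\<tau> n)) x" "B.conv (\<lambda>n. B.ev t (\<tau> n)) y"
      using r(1) unfolding R_def' by blast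
    obtain \<sigma> where \<sigma>: "\<And>n. letters (\<sigma> n) \<subseteq> J" "A.conv (\<lambda>n. A.ev s (\<sigma> n)) x" "B.conv (\<lambda>n. B.ev t (\<sigma> n)) y'"
      using r(2) unfolding R_def' by blast
    have c: "x \<in> carrier A" "y \<in> carrier B" "y' \<in> carrier B" using r by (auto simp: R_def')
    have "B.conv (\<lambda>n. B.ev t (\<tau> n)) y'"
    proof (rule B.conv_bound)
      fix n
      have "B.nrm (B.ev t (\<tau> n) \<ominus>\<^bsub>B\<^esub> y') \<le> B.nrm (B.ev t (\<tau> n) \<ominus>\<^bsub>B\<^esub> B.ev t (\<sigma> n)) + B.nrm (B.ev t (\<sigma> n) \<ominus>\<^bsub>B\<^esub> y')"
        using eb \<tau>(1) \<sigma>(1) c by (intro B.nrm_diff_trans) auto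
      also have "B.nrm (B.ev t (\<tau> n) \<ominus>\<^bsub>B\<^esub> B.ev t (\<sigma> n)) \<le> A.nrm (A.ev s (\<tau> n) \<ominus>\<^bsub>A\<^esub> A.ev s (\<sigma> n))"
        by (intro diff \<tau> \<sigma>)
      also have "\<dots> \<le> A.nrm (A.ev s (\<tau> n) \<ominus>\<^bsub>A\<^esub> x) + A.nrm (A.ev s (\<sigma> n) \<ominus>\<^bsub>A\<^esub> x)"
        using A.nrm_diff_trans[OF ea[OF \<tau>(1)] c(1) ea[OF \<sigma>(1)], of n n] A.nrm_diff_commute[OF c(1) ea[OF \<sigma>(1)], of n] by simp
      finally show "B.nrm (B.ev t (\<tau> n) \<ominus>\<^bsub>B\<^esub> y') \<le> A.nrm (A.ev s (\<tau> n) \<ominus>\<^bsub>A\<^esub> x) + A.nrm (A.ev s (\<sigma> n) \<ominus>\<^bsub>A\<^esub> x) + B.nrm (B.ev t (\<sigma> n) \<ominus>\<^bsub>B\<^esub> y')"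
        by simp
    next
      show "(\<lambda>n. A.nrm (A.ev s (\<tau> n) \<ominus>\<^bsub>A\<^esub> x) + A.nrm (A.ev s (\<sigma> n) \<ominus>\<^bsub>A\<^esub> x) + B.nrm (B.ev t (\<sigma> n) \<ominus>\<^bsub>B\<^esub> y')) \<longlonglongrightarrow> 0"
        using tendsto_add[OF tendsto_add[OF \<tau>(2)[unfolded A.conv_def] \<sigma>(2)[unfolded A.conv_def]] \<sigma>(3)[unfolded B.conv_def]] by simp
    qed (use eb \<tau>(1) c in auto)
    then show ?thesis using \<tau>(3) eb \<tau>(1) c B.conv_unique[of "\<lambda>n. B.ev t (\<tau> n)" y y'] by blast
  qed
  define \<phi> where "\<phi> x = (THE y. R x y)" for x
  have \<phi>I: "\<phi> x = y" if "R x y" for x y unfolding \<phi>_def using that uniq by blast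
  have \<phi>: "R x (\<phi> x)" if "x \<in> carrier A" for x using ex[OF that] \<phi>I by metis
  have \<phi>c: "\<phi> x \<in> carrier B" if "x \<in> carrier A" for x using \<phi>[OF that] by (simp add: R_def')
  show ?thesis
  proof (rule that[of \<phi>])
    show "\<phi> \<in> star_hom A B"
      unfolding star_hom_def ring_hom_def
    proof (intro CollectI conjI ballI allI Pi_I)
      show "\<phi> \<one>\<^bsub>A\<^esub> = \<one>\<^bsub>B\<^esub>" using \<phi>I[OF jl(1)[of TOne]] by simp
    qed (use \<phi>c \<phi>I[OF jl(4)[OF \<phi> \<phi>]] \<phi>I[OF jl(5)[OF \<phi> \<phi>]] \<phi>I[OF jl(2)[OF \<phi>]] \<phi>I[OF jl(3)[OF \<phi>]] in auto)
    show "\<phi> (A.ev s \<tau>) = B.ev t \<tau>" if "letters \<tau> \<subseteq> J" for \<tau> using \<phi>I[OF jl(1)[OF that]] .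
    show "B.nrm (\<phi> x) \<le> A.nrm x" if x: "x \<in> carrier A" for x
    proof -
      obtain \<tau> where \<tau>: "\<And>n. letters (\<tau> n) \<subseteq> J" "A.conv (\<lambda>n. A.ev s (\<tau> n)) x" "B.conv (\<lambda>n. B.ev t (\<tau> n)) (\<phi> x)"
        using \<phi>[OF x] unfolding R_def' by blast
      show ?thesis
      proof (rule LIMSEQ_le)
        show "(\<lambda>n. B.nrm (B.ev t (\<tau> n))) \<longlonglongrightarrow> B.nrm (\<phi> x)" using B.conv_nrm[OF \<tau>(3)] eb \<tau>(1) \<phi>c[OF x] by blast
        show "(\<lambda>n. A.nrm (A.ev s (\<tau> n))) \<longlonglongrightarrow> A.nrm x" using A.conv_nrm[OF \<tau>(2)] ea \<tau>(1) x by blast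
      qed (use le \<tau>(1) in blast)
    qed
  qed
qed

section \<open>Square-integrable classes and bounded operators on them\<close>

subsection \<open>The Hilbert space \<open>L\<^sup>2\<close>\<close>

definition sqint :: "'x measure \<Rightarrow> ('x \<Rightarrow> complex) \<Rightarrow> bool" where
  "sqint M f \<longleftrightarrow> f \<in> borel_measurable M \<and> integrable M (\<lambda>x. (cmod (f x))\<^sup>2)"

lemma cnj_measurable [measurable]: "cnj \<in> borel_measurable borel"
  by (intro borel_measurable_continuous_onI continuous_intros)

lemma L2_class_eq_iff:
  assumes "f \<in> borel_measurable M" "h \<in> borel_measurable M"
  shows "L2_class M f = L2_class M h \<longleftrightarrow> (AE x in M. f x = h x)"
proof
  assume "L2_class M f = L2_class M h"
  moreover have "f \<in> L2_class M f" using assms by (simp add: L2_class_def)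
  ultimately have "f \<in> L2_class M h" by simp
  then show "AE x in M. f x = h x" by (simp add: L2_class_def)
next
  assume e: "AE x in M. f x = h x"
  have "(AE x in M. k x = f x) \<longleftrightarrow> (AE x in M. k x = h x)" for k
  proof
    show "AE x in M. k x = h x" if "AE x in M. k x = f x" using that e by eventually_elim simp
    show "AE x in M. k x = f x" if "AE x in M. k x = h x" using that e by eventually_elim simp
  qed
  then show "L2_class M f = L2_class M h" by (simp add: L2_class_def)
qed

lemma L2_rep_class:
  assumes "f \<in> borel_measurable M"
  shows "L2_rep (L2_class M f) \<in> borel_measurable M" "AE x in M. L2_rep (L2_class M f) x = f x"
proof -
  have "f \<in> L2_class M f" using assms by (simp add: L2_class_def)
  then have "L2_rep (L2_class M f) \<in> L2_class M f" unfolding L2_rep_def by (rule someI[where P = "\<lambda>k. k \<in> L2_class M f"])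
  then show "L2_rep (L2_class M f) \<in> borel_measurable M" "AE x in M. L2_rep (L2_class M f) x = f x"
    by (simp_all add: L2_class_def)
qed

lemma sqint_cong:
  assumes "sqint M f" "h \<in> borel_measurable M" "AE x in M. f x = h x"
  shows "sqint M h"
  unfolding sqint_def
proof
  have "integrable M (\<lambda>x. (cmod (f x))\<^sup>2) \<longleftrightarrow> integrable M (\<lambda>x. (cmod (h x))\<^sup>2)"
    using assms by (intro integrable_cong_AE) (auto simp: sqint_def elim: eventually_mono)
  then show "integrable M (\<lambda>x. (cmod (h x))\<^sup>2)" using assms by (simp add: sqint_def)
qed fact

lemma L2I [simp, intro]: "sqint M f \<Longrightarrow> L2_class M f \<in> L2 M"
  by (auto simp: L2_def sqint_def)

lemma L2_rep_sqint:
  assumes "u \<in> L2 M" shows "sqint M (L2_rep u)"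
proof -
  obtain f where f: "sqint M f" "u = L2_class M f" using assms by (auto simp: L2_def sqint_def)
  have m: "f \<in> borel_measurable M" using f by (simp add: sqint_def)
  show ?thesis unfolding f(2)
    by (rule sqint_cong[OF f(1) L2_rep_class(1)[OF m]]) (use L2_rep_class(2)[OF m] in \<open>auto elim: eventually_mono\<close>)
qed

lemma L2_class_rep [simp]:
  assumes "u \<in> L2 M" shows "L2_class M (L2_rep u) = u"
proof -
  obtain f where f: "sqint M f" "u = L2_class M f" using assms by (auto simp: L2_def sqint_def)
  have m: "f \<in> borel_measurable M" using f by (simp add: sqint_def)
  show ?thesis unfolding f(2) using L2_rep_class[OF m] L2_class_eq_iff[OF _ m] by blast
qed

lemma L2_cases:
  assumes "u \<in> L2 M" obtains f where "sqint M f" "u = L2_class M f"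
  using assms by (auto simp: L2_def sqint_def)

lemma sqint_measurable: "sqint M f \<Longrightarrow> f \<in> borel_measurable M"
  by (simp add: sqint_def)

lemma cmod_add_sq_le: "(cmod (a + b))\<^sup>2 \<le> 2 * (cmod a)\<^sup>2 + 2 * (cmod b)\<^sup>2"
proof -
  have "(cmod (a + b))\<^sup>2 \<le> (cmod a + cmod b)\<^sup>2" by (intro power_mono norm_triangle_ineq) auto
  also have "\<dots> \<le> 2 * (cmod a)\<^sup>2 + 2 * (cmod b)\<^sup>2"
    using sum_squares_bound[of "cmod a" "cmod b"] by (simp add: power2_sum)
  finally show ?thesis .
qed

lemma sqint_add: assumes "sqint M f" "sqint M h" shows "sqint M (\<lambda>x. f x + h x)"
  unfolding sqint_def
proof
  have [measurable]: "f \<in> borel_measurable M" "h \<in> borel_measurable M" using assms by (auto simp: sqint_def)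
  show m: "(\<lambda>x. f x + h x) \<in> borel_measurable M" by measurable
  show "integrable M (\<lambda>x. (cmod (f x + h x))\<^sup>2)"
  proof (rule Bochner_Integration.integrable_bound[of M "\<lambda>x. 2 * (cmod (f x))\<^sup>2 + 2 * (cmod (h x))\<^sup>2"])
    show "(\<lambda>x. (cmod (f x + h x))\<^sup>2) \<in> borel_measurable M" by measurable
    show "AE x in M. norm ((cmod (f x + h x))\<^sup>2) \<le> norm (2 * (cmod (f x))\<^sup>2 + 2 * (cmod (h x))\<^sup>2)"
      by (rule always_eventually) (simp add: cmod_add_sq_le)
  qed (use assms in \<open>auto simp: sqint_def\<close>)
qed

lemma sqint_bounded_mult:
  assumes "sqint M f" "k \<in> borel_measurable M" "AE x in M. cmod (k x) \<le> K"
  shows "sqint M (\<lambda>x. k x * f x)"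
  unfolding sqint_def
proof
  have [measurable]: "f \<in> borel_measurable M" "k \<in> borel_measurable M" using assms by (auto simp: sqint_def)
  show "(\<lambda>x. k x * f x) \<in> borel_measurable M" by measurable
  show "integrable M (\<lambda>x. (cmod (k x * f x))\<^sup>2)"
  proof (rule Bochner_Integration.integrable_bound[of M "\<lambda>x. K\<^sup>2 * (cmod (f x))\<^sup>2"])
    show "(\<lambda>x. (cmod (k x * f x))\<^sup>2) \<in> borel_measurable M" by measurable
    show "AE x in M. norm ((cmod (k x * f x))\<^sup>2) \<le> norm (K\<^sup>2 * (cmod (f x))\<^sup>2)"
      using assms(3) by eventually_elim (auto simp: norm_mult power_mult_distrib intro!: mult_right_mono power_mono)
  qed (use assms in \<open>auto simp: sqint_def\<close>)
qed

lemma sqint_scale: "sqint M f \<Longrightarrow> sqint M (\<lambda>x. c * f x)"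
  by (rule sqint_bounded_mult[of _ _ "\<lambda>_. c" "cmod c"]) auto

lemma sqint_zero [simp]: "sqint M (\<lambda>_. 0)" by (simp add: sqint_def)

lemma sqint_diff: "sqint M f \<Longrightarrow> sqint M h \<Longrightarrow> sqint M (\<lambda>x. f x - h x)"
  using sqint_add[of M f "\<lambda>x. - 1 * h x"] sqint_scale[of M h "- 1"] by simp

lemma sqint_inner: assumes "sqint M f" "sqint M h" shows "integrable M (\<lambda>x. f x * cnj (h x))"
proof (rule Bochner_Integration.integrable_bound[of M "\<lambda>x. (cmod (f x))\<^sup>2 + (cmod (h x))\<^sup>2"])
  have "cmod (a * cnj b) \<le> (cmod a)\<^sup>2 + (cmod b)\<^sup>2" for a b
    using sum_squares_bound[of "cmod a" "cmod b"] norm_ge_zero[of a] norm_ge_zero[of b]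
      mult_nonneg_nonneg[OF norm_ge_zero[of a] norm_ge_zero[of b]]
    unfolding norm_mult complex_mod_cnj by linarith
  then show "AE x in M. norm (f x * cnj (h x)) \<le> norm ((cmod (f x))\<^sup>2 + (cmod (h x))\<^sup>2)" by (auto intro!: always_eventually)
qed (use assms in \<open>auto simp: sqint_def\<close>)

text \<open>The operations are defined through a chosen representative of a class. This lemma and
  its companions below replace it by an arbitrary one, so that identities of classes reduce to
  identities of functions.\<close>

lemma L2_add_class:
  assumes "sqint M f" "sqint M h"
  shows "L2_add M (L2_class M f) (L2_class M h) = L2_class M (\<lambda>x. f x + h x)"
  unfolding L2_add_def
proof (subst L2_class_eq_iff)
  have m: "f \<in> borel_measurable M" "h \<in> borel_measurable M" using assms by (auto simp: sqint_def)
  show "AE x in M. L2_rep (L2_class M f) x + L2_rep (L2_class M h) x = f x + h x"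
    using L2_rep_class(2)[OF m(1)] L2_rep_class(2)[OF m(2)] by eventually_elim simp
  note [measurable] = m L2_rep_class(1)[OF m(1)] L2_rep_class(1)[OF m(2)]
  show "(\<lambda>x. L2_rep (L2_class M f) x + L2_rep (L2_class M h) x) \<in> borel_measurable M"
    "(\<lambda>x. f x + h x) \<in> borel_measurable M" by measurable
qed

lemma L2_scale_class:
  assumes "sqint M f"
  shows "L2_scale M c (L2_class M f) = L2_class M (\<lambda>x. c * f x)"
  unfolding L2_scale_def
proof (subst L2_class_eq_iff)
  have m: "f \<in> borel_measurable M" using assms by (auto simp: sqint_def)
  show "AE x in M. c * L2_rep (L2_class M f) x = c * f x"
    using L2_rep_class(2)[OF m(1)] by eventually_elim simp
  note [measurable] = m L2_rep_class(1)[OF m]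
  show "(\<lambda>x. c * L2_rep (L2_class M f) x) \<in> borel_measurable M"
    "(\<lambda>x. c * f x) \<in> borel_measurable M" by measurable
qed

lemma L2_inner_class:
  assumes "sqint M f" "sqint M h"
  shows "L2_inner M (L2_class M f) (L2_class M h) = (LINT x|M. f x * cnj (h x))"
  unfolding L2_inner_def
proof (rule integral_cong_AE)
  have m: "f \<in> borel_measurable M" "h \<in> borel_measurable M" using assms by (auto simp: sqint_def)
  show "AE x in M. L2_rep (L2_class M f) x * cnj (L2_rep (L2_class M h) x) = f x * cnj (h x)"
    using L2_rep_class(2)[OF m(1)] L2_rep_class(2)[OF m(2)] by eventually_elim simp
  note [measurable] = m L2_rep_class(1)[OF m(1)] L2_rep_class(1)[OF m(2)]
  show "(\<lambda>x. L2_rep (L2_class M f) x * cnj (L2_rep (L2_class M h) x)) \<in> borel_measurable M"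
    "(\<lambda>x. f x * cnj (h x)) \<in> borel_measurable M" by measurable
qed

lemma L2_norm_class:
  assumes "sqint M f"
  shows "L2_norm M (L2_class M f) = sqrt (LINT x|M. (cmod (f x))\<^sup>2)"
  unfolding L2_norm_def
proof (intro arg_cong[of _ _ sqrt] integral_cong_AE)
  have m: "f \<in> borel_measurable M" using assms by (auto simp: sqint_def)
  show "AE x in M. (cmod (L2_rep (L2_class M f) x))\<^sup>2 = (cmod (f x))\<^sup>2"
    using L2_rep_class(2)[OF m(1)] by eventually_elim simp
  note [measurable] = m L2_rep_class(1)[OF m]
  show "(\<lambda>x. (cmod (L2_rep (L2_class M f) x))\<^sup>2) \<in> borel_measurable M"
    "(\<lambda>x. (cmod (f x))\<^sup>2) \<in> borel_measurable M" by measurable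
qed

abbreviation L2_zero :: "'x measure \<Rightarrow> ('x \<Rightarrow> complex) set" where
  "L2_zero M \<equiv> L2_class M (\<lambda>_. 0)"

definition L2_diff :: "'x measure \<Rightarrow> ('x \<Rightarrow> complex) set \<Rightarrow> ('x \<Rightarrow> complex) set \<Rightarrow> ('x \<Rightarrow> complex) set" where
  "L2_diff M u v = L2_add M u (L2_scale M (-1) v)"

abbreviation "L2_dist M u v \<equiv> L2_norm M (L2_diff M u v)"

lemma L2_diff_class:
  "sqint M f \<Longrightarrow> sqint M h \<Longrightarrow> L2_diff M (L2_class M f) (L2_class M h) = L2_class M (\<lambda>x. f x - h x)"
  by (simp add: L2_diff_def L2_scale_class L2_add_class sqint_scale sqint_add[of M f "\<lambda>x. - h x"]
      sqint_scale[of M h "-1", simplified])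

context
  fixes M :: "'x measure"
begin

lemma L2_zero_in [simp]: "L2_zero M \<in> L2 M" by (rule L2I) simp

lemma L2_add_closed [simp, intro]: "u \<in> L2 M \<Longrightarrow> v \<in> L2 M \<Longrightarrow> L2_add M u v \<in> L2 M"
  by (elim L2_cases) (auto simp: L2_add_class sqint_add)

lemma L2_scale_closed [simp, intro]: "u \<in> L2 M \<Longrightarrow> L2_scale M c u \<in> L2 M"
  by (elim L2_cases) (auto simp: L2_scale_class sqint_scale)

lemma L2_diff_closed [simp, intro]: "u \<in> L2 M \<Longrightarrow> v \<in> L2 M \<Longrightarrow> L2_diff M u v \<in> L2 M"
  by (simp add: L2_diff_def)

lemma L2_add_commute: "u \<in> L2 M \<Longrightarrow> v \<in> L2 M \<Longrightarrow> L2_add M u v = L2_add M v u"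
  by (elim L2_cases) (auto simp: L2_add_class add.commute)

lemma L2_add_assoc: "u \<in> L2 M \<Longrightarrow> v \<in> L2 M \<Longrightarrow> w \<in> L2 M \<Longrightarrow>
    L2_add M (L2_add M u v) w = L2_add M u (L2_add M v w)"
  by (elim L2_cases) (auto simp: L2_add_class sqint_add add.assoc)

lemma L2_add_left_commute: "u \<in> L2 M \<Longrightarrow> v \<in> L2 M \<Longrightarrow> w \<in> L2 M \<Longrightarrow>
    L2_add M u (L2_add M v w) = L2_add M v (L2_add M u w)"
  by (elim L2_cases) (auto simp: L2_add_class sqint_add add.left_commute)

lemma L2_add_zero [simp]: "u \<in> L2 M \<Longrightarrow> L2_add M (L2_zero M) u = u"
  by (elim L2_cases) (auto simp: L2_add_class)

lemma L2_scale_add: "u \<in> L2 M \<Longrightarrow> v \<in> L2 M \<Longrightarrow>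
    L2_scale M c (L2_add M u v) = L2_add M (L2_scale M c u) (L2_scale M c v)"
  by (elim L2_cases) (auto simp: L2_add_class L2_scale_class sqint_add sqint_scale distrib_left)

lemma L2_scale_add_left: "u \<in> L2 M \<Longrightarrow>
    L2_scale M (c + d) u = L2_add M (L2_scale M c u) (L2_scale M d u)"
  by (elim L2_cases) (auto simp: L2_add_class L2_scale_class sqint_scale distrib_right)

lemma L2_scale_scale: "u \<in> L2 M \<Longrightarrow> L2_scale M c (L2_scale M d u) = L2_scale M (c * d) u"
  by (elim L2_cases) (auto simp: L2_scale_class sqint_scale mult.assoc)

lemma L2_scale_one [simp]: "u \<in> L2 M \<Longrightarrow> L2_scale M 1 u = u"
  by (elim L2_cases) (auto simp: L2_scale_class)

lemma L2_scale_zero_right [simp]: "L2_scale M c (L2_zero M) = L2_zero M"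
  by (simp add: L2_scale_class)

lemma L2_add_inverse: "u \<in> L2 M \<Longrightarrow> L2_add M (L2_scale M (-1) u) u = L2_zero M"
  by (elim L2_cases) (auto simp: L2_scale_class L2_add_class sqint_scale[of M _ "-1", simplified])

lemma L2_inner_add: "u \<in> L2 M \<Longrightarrow> v \<in> L2 M \<Longrightarrow> w \<in> L2 M \<Longrightarrow>
    L2_inner M (L2_add M u v) w = L2_inner M u w + L2_inner M v w"
  by (elim L2_cases) (auto simp: L2_add_class L2_inner_class sqint_add distrib_right sqint_inner)

lemma L2_inner_scale: "u \<in> L2 M \<Longrightarrow> w \<in> L2 M \<Longrightarrow>
    L2_inner M (L2_scale M c u) w = c * L2_inner M u w"
  by (elim L2_cases) (auto simp: L2_scale_class L2_inner_class sqint_scale mult.assoc sqint_inner)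

lemma L2_inner_commute: "u \<in> L2 M \<Longrightarrow> w \<in> L2 M \<Longrightarrow> L2_inner M w u = cnj (L2_inner M u w)"
  by (elim L2_cases) (simp add: L2_inner_class, subst Bochner_Integration.integral_cnj[symmetric], simp add: mult.commute)

lemma L2_inner_add_right: "u \<in> L2 M \<Longrightarrow> v \<in> L2 M \<Longrightarrow> w \<in> L2 M \<Longrightarrow>
    L2_inner M w (L2_add M u v) = L2_inner M w u + L2_inner M w v"
  by (subst (1 2 3) L2_inner_commute[where w = w]) (auto simp: L2_inner_add)

lemma L2_inner_scale_right: "u \<in> L2 M \<Longrightarrow> w \<in> L2 M \<Longrightarrow>
    L2_inner M w (L2_scale M c u) = cnj c * L2_inner M w u"
  by (subst (1 2) L2_inner_commute[where w = w]) (auto simp: L2_inner_scale)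

lemma L2_norm_nonneg [simp]: "0 \<le> L2_norm M u" by (simp add: L2_norm_def)

lemma L2_norm_sq: "u \<in> L2 M \<Longrightarrow> L2_inner M u u = of_real ((L2_norm M u)\<^sup>2)"
  by (elim L2_cases) (auto simp: L2_inner_class L2_norm_class complex_norm_square[symmetric] simp flip: of_real_power)

lemma L2_norm_zero [simp]: "L2_norm M (L2_zero M) = 0"
  by (simp add: L2_norm_class)

lemma L2_norm_eq_zero: assumes "u \<in> L2 M" "L2_norm M u = 0" shows "u = L2_zero M"
proof -
  obtain f where f: "sqint M f" "u = L2_class M f" using assms(1) by (rule L2_cases)
  have "(LINT x|M. (cmod (f x))\<^sup>2) = 0" using assms(2) f by (simp add: L2_norm_class)
  then have "AE x in M. (cmod (f x))\<^sup>2 = 0"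
    using f(1) by (subst (asm) integral_nonneg_eq_0_iff_AE) (auto simp: sqint_def)
  then show ?thesis using f by (subst f(2), subst L2_class_eq_iff) (auto simp: sqint_def)
qed

lemma L2_norm_scale: "u \<in> L2 M \<Longrightarrow> L2_norm M (L2_scale M c u) = cmod c * L2_norm M u"
  by (elim L2_cases) (auto simp: L2_scale_class L2_norm_class sqint_scale norm_mult power_mult_distrib real_sqrt_mult)

lemma L2_cauchy_schwarz: assumes u: "u \<in> L2 M" and v: "v \<in> L2 M"
  shows "cmod (L2_inner M u v) \<le> L2_norm M u * L2_norm M v"
proof -
  let ?z = "L2_inner M u v" and ?a = "L2_norm M u" and ?b = "L2_norm M v"
  have q: "0 \<le> ?b\<^sup>2 * (?a\<^sup>2 * ?b\<^sup>2 - (cmod ?z)\<^sup>2)"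
  proof -
    \<comment> \<open>Up to the factor \<open>?b^2\<close> this is the component of \<open>u\<close>
      orthogonal to \<open>v\<close>; expanding its squared norm gives the claim without dividing by
      \<open>?b\<close>.\<close>
    let ?w = "L2_add M (L2_scale M (of_real (?b\<^sup>2)) u) (L2_scale M (- ?z) v)"
    have zz: "?z * cnj ?z = of_real ((cmod ?z)\<^sup>2)" by (simp only: complex_norm_square)
    have w: "?w \<in> L2 M" using u v by auto
    have "of_real ((L2_norm M ?w)\<^sup>2) = L2_inner M ?w ?w" using L2_norm_sq[OF w] by simp
    also have "\<dots> = of_real (?b\<^sup>2) * of_real (?b\<^sup>2) * L2_inner M u u + of_real (?b\<^sup>2) * (- cnj ?z) * ?z
        + (- ?z) * of_real (?b\<^sup>2) * L2_inner M v u + (- ?z) * (- cnj ?z) * L2_inner M v v"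
      using u v by (simp add: L2_inner_add L2_inner_add_right L2_inner_scale L2_inner_scale_right algebra_simps)
    also have "\<dots> = of_real (?b\<^sup>2) * (of_real (?b\<^sup>2) * of_real (?a\<^sup>2) - ?z * cnj ?z)"
      using L2_norm_sq[OF u] L2_norm_sq[OF v] L2_inner_commute[OF u v] by (simp add: algebra_simps)
    also have "\<dots> = of_real (?b\<^sup>2 * (?a\<^sup>2 * ?b\<^sup>2 - (cmod ?z)\<^sup>2))" unfolding zz by (simp add: mult.commute)
    finally have "(L2_norm M ?w)\<^sup>2 = ?b\<^sup>2 * (?a\<^sup>2 * ?b\<^sup>2 - (cmod ?z)\<^sup>2)" by (simp only: of_real_eq_iff)
    then show ?thesis by (metis zero_le_power2)
  qed
  show ?thesis
  proof (cases "?b = 0")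
    case True
    then have v0: "v = L2_zero M" using L2_norm_eq_zero[OF v] by simp
    have "L2_inner M u (L2_zero M) = 0"
      using L2_inner_scale_right[of "L2_zero M" u 0] u by simp
    then show ?thesis by (simp add: v0)
  next
    case False
    then have "0 < ?b\<^sup>2" by simp
    then have "0 \<le> ?a\<^sup>2 * ?b\<^sup>2 - (cmod ?z)\<^sup>2" using q by (simp add: zero_le_mult_iff)
    then have "(cmod ?z)\<^sup>2 \<le> (?a * ?b)\<^sup>2" by (simp add: power_mult_distrib)
    then show ?thesis by (rule power2_le_imp_le) simp
  qed
qed

lemma L2_norm_triangle: assumes u: "u \<in> L2 M" and v: "v \<in> L2 M"
  shows "L2_norm M (L2_add M u v) \<le> L2_norm M u + L2_norm M v"
proof (rule power2_le_imp_le)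
  have "of_real ((L2_norm M (L2_add M u v))\<^sup>2) = L2_inner M (L2_add M u v) (L2_add M u v)"
    using L2_norm_sq u v by simp
  also have "\<dots> = L2_inner M u u + L2_inner M v v + (L2_inner M u v + cnj (L2_inner M u v))"
    using u v L2_inner_commute[OF u v] by (simp add: L2_inner_add L2_inner_add_right)
  also have "\<dots> = of_real ((L2_norm M u)\<^sup>2 + (L2_norm M v)\<^sup>2 + 2 * Re (L2_inner M u v))"
    using L2_norm_sq u v by (simp add: complex_add_cnj)
  finally have "(L2_norm M (L2_add M u v))\<^sup>2 = (L2_norm M u)\<^sup>2 + (L2_norm M v)\<^sup>2 + 2 * Re (L2_inner M u v)"
    by (simp only: of_real_eq_iff)
  also have "\<dots> \<le> (L2_norm M u)\<^sup>2 + (L2_norm M v)\<^sup>2 + 2 * (L2_norm M u * L2_norm M v)"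
    using L2_cauchy_schwarz[OF u v] complex_Re_le_cmod[of "L2_inner M u v"] by simp
  also have "\<dots> = (L2_norm M u + L2_norm M v)\<^sup>2" by (simp add: power2_sum)
  finally show "(L2_norm M (L2_add M u v))\<^sup>2 \<le> (L2_norm M u + L2_norm M v)\<^sup>2" .
qed simp

lemma L2_norm_diff_trans: assumes "u \<in> L2 M" "v \<in> L2 M" "w \<in> L2 M"
  shows "L2_dist M u w \<le> L2_dist M u v + L2_dist M v w"
proof -
  have "L2_diff M u w = L2_add M (L2_diff M u v) (L2_diff M v w)"
    using assms by (elim L2_cases) (auto simp: L2_diff_class L2_add_class sqint_diff)
  then show ?thesis using L2_norm_triangle[of "L2_diff M u v" "L2_diff M v w"] assms by simp
qed

lemma L2_norm_diff_commute: assumes "u \<in> L2 M" "v \<in> L2 M"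
  shows "L2_dist M u v = L2_dist M v u"
proof -
  have "L2_diff M u v = L2_scale M (-1) (L2_diff M v u)"
    using assms by (elim L2_cases) (auto simp: L2_diff_class L2_scale_class sqint_diff)
  then show ?thesis using assms by (simp add: L2_norm_scale)
qed

lemma L2_diff_eq_zero: assumes "u \<in> L2 M" "v \<in> L2 M" "L2_dist M u v = 0"
  shows "u = v"
proof -
  obtain f h where fh: "sqint M f" "u = L2_class M f" "sqint M h" "v = L2_class M h"
    using assms(1,2) by (elim L2_cases)
  have "L2_class M (\<lambda>x. f x - h x) = L2_zero M" using L2_norm_eq_zero[OF _ assms(3)] fh by (simp add: L2_diff_class sqint_diff)
  then have "AE x in M. f x - h x = 0" using fh by (subst (asm) L2_class_eq_iff) (auto simp: sqint_def)
  then show ?thesis using fh by (simp add: L2_class_eq_iff sqint_def)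
qed

lemma L2_norm_nn:
  assumes "sqint M f" shows "(\<integral>\<^sup>+x. ennreal ((cmod (f x))\<^sup>2) \<partial>M) = ennreal ((L2_norm M (L2_class M f))\<^sup>2)"
  using assms by (subst nn_integral_eq_integral) (auto simp: sqint_def L2_norm_class)

text \<open>The Riesz-Fischer argument: a fast subsequence converges almost everywhere, Fatou's
  lemma estimates the distance to its limit, and the Cauchy property carries this over to the whole
  sequence.\<close>

lemma L2_complete:
  assumes u: "\<And>n. u n \<in> L2 M"
    and C: "\<And>e. 0 < e \<Longrightarrow> \<exists>N. \<forall>m\<ge>N. \<forall>n\<ge>N. L2_dist M (u m) (u n) < e"
  shows "\<exists>v\<in>L2 M. (\<lambda>n. L2_dist M (u n) v) \<longlonglongrightarrow> 0"
proof -
  have "\<exists>N. \<forall>m\<ge>N. \<forall>n\<ge>N. L2_dist M (u m) (u n) < (1/2)^k" for k :: nat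
    by (rule C) simp
  then obtain N where N: "\<And>k m n. N k \<le> m \<Longrightarrow> N k \<le> n \<Longrightarrow> L2_dist M (u m) (u n) < (1/2)^k" by metis
  \<comment> \<open>Partial sums make the indices increase while staying above
    \<open>N k\<close>.\<close>
  define r where "r k = (\<Sum>j\<le>k. N j)" for k
  have rN: "N k \<le> r k" "r k \<le> r (Suc k)" for k by (auto simp: r_def intro: member_le_sum)
  have rm: "r k \<le> r l" if "k \<le> l" for k l using that by (rule lift_Suc_mono_le[of r, OF rN(2)])
  define F where "F k = L2_rep (u (r k))" for k
  have F: "sqint M (F k)" "L2_class M (F k) = u (r k)" for k unfolding F_def using u L2_rep_sqint by auto
  have Fm [measurable]: "F k \<in> borel_measurable M" for k using F by (simp add: sqint_def)
  have nrmF: "L2_norm M (L2_class M (\<lambda>x. F l x - F k x)) < (1/2)^k" if "k \<le> l" for k l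
    using N[of k "r l" "r k"] rN(1)[of k] rm[OF that] F by (simp add: L2_diff_class[symmetric])
  define d where "d k x = cmod (F (Suc k) x - F k x)" for k x
  have dm [measurable]: "d k \<in> borel_measurable M" for k unfolding d_def by measurable
  have "(\<integral>\<^sup>+x. (\<Sum>k. ennreal (2^k * (d k x)\<^sup>2)) \<partial>M) = (\<Sum>k. \<integral>\<^sup>+x. ennreal (2^k * (d k x)\<^sup>2) \<partial>M)"
    by (rule nn_integral_suminf) measurable
  also have "\<dots> \<le> (\<Sum>k. ennreal ((1/2)^k))"
  proof (intro suminf_le allI)
    fix k
    have "(\<integral>\<^sup>+x. ennreal (2^k * (d k x)\<^sup>2) \<partial>M) = ennreal (2^k) * (\<integral>\<^sup>+x. ennreal ((cmod (F (Suc k) x - F k x))\<^sup>2) \<partial>M)"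
      unfolding d_def by (subst nn_integral_cmult[symmetric]) (auto simp: ennreal_mult)
    also have "\<dots> = ennreal (2^k * (L2_norm M (L2_class M (\<lambda>x. F (Suc k) x - F k x)))\<^sup>2)"
      by (subst L2_norm_nn) (auto simp: F sqint_diff ennreal_mult)
    also have "\<dots> \<le> ennreal (2^k * ((1/2)^k)\<^sup>2)"
      using nrmF[of k "Suc k"] by (intro ennreal_leI mult_left_mono power_mono) auto
    also have "2^k * ((1/2)^k)\<^sup>2 = (1/2::real)^k" by (simp add: power2_eq_square power_mult_distrib[symmetric] flip: mult.assoc)
    finally show "(\<integral>\<^sup>+x. ennreal (2^k * (d k x)\<^sup>2) \<partial>M) \<le> ennreal ((1/2)^k)" .
  qed auto
  also have "\<dots> < \<infinity>" using summable_geometric[of "1/2::real"] by (simp add: suminf_ennreal2 less_top[symmetric])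
  finally have "AE x in M. (\<Sum>k. ennreal (2^k * (d k x)\<^sup>2)) \<noteq> \<infinity>"
    by (intro nn_integral_PInf_AE) auto
  then have conv: "AE x in M. convergent (\<lambda>k. F k x)"
  proof eventually_elim
    fix x assume "(\<Sum>k. ennreal (2^k * (d k x)\<^sup>2)) \<noteq> \<infinity>"
    then have s: "summable (\<lambda>k. 2^k * (d k x)\<^sup>2)" by (intro summable_suminf_not_top) auto
    have "summable (\<lambda>k. F (Suc k) x - F k x)"
    proof (rule summable_comparison_test')
      show "summable (\<lambda>k. (1/2)^k + 2^k * (d k x)\<^sup>2)" using s by (intro summable_add) auto
      fix k
      \<comment> \<open>Either \<open>d k x\<close> is below \<open>(1/2)^k\<close>, or
        \<open>2^k * d k x\<close> exceeds 1. This turns the weighted sum of squares into absolute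
        summability.\<close>
      have "d k x \<le> (1/2)^k + 2^k * (d k x)\<^sup>2"
      proof (cases "d k x \<le> (1/2)^k")
        case False
        have "d k x = 2^k * ((1/2)^k * d k x)" by (simp add: power_divide)
        also have "\<dots> \<le> 2^k * (d k x * d k x)" using False by (intro mult_left_mono mult_right_mono) (auto simp: d_def)
        finally show ?thesis by (simp add: power2_eq_square add_increasing)
      qed (simp add: add_increasing2)
      then show "norm (F (Suc k) x - F k x) \<le> (1/2)^k + 2^k * (d k x)\<^sup>2" by (simp add: d_def)
    qed
    then have "convergent (\<lambda>n. \<Sum>k<n. F (Suc k) x - F k x)" by (simp add: summable_iff_convergent)
    moreover have "(\<Sum>k<n. F (Suc k) x - F k x) = F n x - F 0 x" for n by (rule sum_lessThan_telescope)
    ultimately have "convergent (\<lambda>n. F n x - F 0 x)" by simp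
    then have "convergent (\<lambda>n. (F n x - F 0 x) + F 0 x)" by (intro convergent_add convergent_const)
    then show "convergent (\<lambda>k. F k x)" by simp
  qed
  define f where "f x = lim (\<lambda>k. F k x)" for x
  have fm [measurable]: "f \<in> borel_measurable M" unfolding f_def by measurable
  \<comment> \<open>Fatou's lemma: the distance to the limit function is at most the lower limit of
    the distances to the later members.\<close>
  have bound: "(\<integral>\<^sup>+x. ennreal ((cmod (F k x - f x))\<^sup>2) \<partial>M) \<le> ennreal (((1/2)^k)\<^sup>2)" for k
  proof -
    have "(\<integral>\<^sup>+x. ennreal ((cmod (F k x - f x))\<^sup>2) \<partial>M) = (\<integral>\<^sup>+x. liminf (\<lambda>l. ennreal ((cmod (F k x - F l x))\<^sup>2)) \<partial>M)"
    proof (rule nn_integral_cong_AE)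
      show "AE x in M. ennreal ((cmod (F k x - f x))\<^sup>2) = liminf (\<lambda>l. ennreal ((cmod (F k x - F l x))\<^sup>2))"
        using conv
      proof eventually_elim
        fix x assume "convergent (\<lambda>l. F l x)"
        then have "(\<lambda>l. F l x) \<longlonglongrightarrow> f x" unfolding f_def by (simp add: convergent_LIMSEQ_iff)
        then have "(\<lambda>l. ennreal ((cmod (F k x - F l x))\<^sup>2)) \<longlonglongrightarrow> ennreal ((cmod (F k x - f x))\<^sup>2)"
          by (intro tendsto_intros)
        then show "ennreal ((cmod (F k x - f x))\<^sup>2) = liminf (\<lambda>l. ennreal ((cmod (F k x - F l x))\<^sup>2))"
          by (intro lim_imp_Liminf[symmetric]) auto
      qed
    qed
    also have "\<dots> \<le> liminf (\<lambda>l. \<integral>\<^sup>+x. ennreal ((cmod (F k x - F l x))\<^sup>2) \<partial>M)"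
      by (rule nn_integral_liminf) measurable
    also have "\<dots> \<le> ennreal (((1/2)^k)\<^sup>2)"
    proof (rule Liminf_le)
      have "(\<integral>\<^sup>+x. ennreal ((cmod (F k x - F l x))\<^sup>2) \<partial>M) \<le> ennreal (((1/2)^k)\<^sup>2)" if "k \<le> l" for l
      proof -
        have "(\<integral>\<^sup>+x. ennreal ((cmod (F k x - F l x))\<^sup>2) \<partial>M) = (\<integral>\<^sup>+x. ennreal ((cmod (F l x - F k x))\<^sup>2) \<partial>M)"
          by (simp add: norm_minus_commute)
        also have "\<dots> = ennreal ((L2_norm M (L2_class M (\<lambda>x. F l x - F k x)))\<^sup>2)"
          by (rule L2_norm_nn) (simp add: F sqint_diff)
        also have "\<dots> \<le> ennreal (((1/2)^k)\<^sup>2)" using nrmF[OF that] by (intro ennreal_leI power_mono) auto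
        finally show ?thesis .
      qed
      then show "\<forall>\<^sub>F l in sequentially. (\<integral>\<^sup>+x. ennreal ((cmod (F k x - F l x))\<^sup>2) \<partial>M) \<le> ennreal (((1/2)^k)\<^sup>2)"
        by (auto simp: eventually_sequentially)
    qed simp
    finally show ?thesis .
  qed
  have Ff: "sqint M (\<lambda>x. F k x - f x)" for k
    unfolding sqint_def
  proof
    show "integrable M (\<lambda>x. (cmod (F k x - f x))\<^sup>2)"
      using le_less_trans[OF bound[of k]] by (intro integrableI_bounded) auto
  qed measurable
  have fs: "sqint M f" using sqint_diff[OF F(1)[of 0] Ff[of 0]] by simp
  have nf: "L2_dist M (u (r k)) (L2_class M f) \<le> (1/2)^k" for k
  proof -
    have "ennreal ((L2_norm M (L2_class M (\<lambda>x. F k x - f x)))\<^sup>2) \<le> ennreal (((1/2)^k)\<^sup>2)"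
      using bound[of k] unfolding L2_norm_nn[OF Ff] .
    then have "(L2_norm M (L2_class M (\<lambda>x. F k x - f x)))\<^sup>2 \<le> ((1/2)^k)\<^sup>2" by (simp add: ennreal_le_iff)
    then have "L2_norm M (L2_class M (\<lambda>x. F k x - f x)) \<le> (1/2)^k" by (rule power2_le_imp_le) simp
    then show ?thesis using F fs by (simp add: L2_diff_class[symmetric])
  qed
  show ?thesis
  proof (intro bexI[of _ "L2_class M f"])
    show "(\<lambda>n. L2_dist M (u n) (L2_class M f)) \<longlonglongrightarrow> 0"
    proof (rule LIMSEQ_I)
      fix e :: real assume e: "0 < e"
      obtain k where k: "(1/2::real)^k < e/2" using real_arch_pow_inv[of "e/2" "1/2"] e by auto
      have "L2_dist M (u n) (L2_class M f) < e" if "N k \<le> n" for n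
        using L2_norm_diff_trans[OF u u L2I[OF fs], of n "r k"] N[OF that rN(1)] nf[of k] k by linarith
      then show "\<exists>no. \<forall>n\<ge>no. norm (L2_dist M (u n) (L2_class M f) - 0) < e" by auto
    qed
  qed (rule L2I[OF fs])
qed

end

abbreviation "LO \<equiv> L2_operators"
abbreviation "opn M T \<equiv> cstar_norm (LO M) T"
abbreviation "op_lim M X T \<equiv> \<forall>e>0. \<exists>N::nat. \<forall>n\<ge>N. \<forall>u\<in>L2 M. L2_dist M (X n u) (T u) \<le> e * L2_norm M u"

subsection \<open>The C*-algebra of adjointable operators on \<open>L\<^sup>2\<close>\<close>

lemma L2_operators_simps [simp]:
  "carrier (LO M) = {T. bounded_op M T}"
  "S \<otimes>\<^bsub>LO M\<^esub> T = compose (L2 M) S T"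
  "\<one>\<^bsub>LO M\<^esub> = (\<lambda>u\<in>L2 M. u)"
  "\<zero>\<^bsub>LO M\<^esub> = (\<lambda>u\<in>L2 M. L2_zero M)"
  "S \<oplus>\<^bsub>LO M\<^esub> T = (\<lambda>u\<in>L2 M. L2_add M (S u) (T u))"
  "c \<odot>\<^bsub>LO M\<^esub> T = (\<lambda>u\<in>L2 M. L2_scale M c (T u))"
  by (simp_all add: L2_operators_def)

context
  fixes M :: "'x measure"
begin

lemma bop_in: "bounded_op M T \<Longrightarrow> u \<in> L2 M \<Longrightarrow> T u \<in> L2 M"
  by (auto simp: bounded_op_def)

lemma bop_ext: "bounded_op M T \<Longrightarrow> u \<notin> L2 M \<Longrightarrow> T u = undefined"
  by (auto simp: bounded_op_def PiE_def extensional_def)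

lemma bop_add: "bounded_op M T \<Longrightarrow> u \<in> L2 M \<Longrightarrow> v \<in> L2 M \<Longrightarrow> T (L2_add M u v) = L2_add M (T u) (T v)"
  by (simp add: bounded_op_def)

lemma bop_scale: "bounded_op M T \<Longrightarrow> u \<in> L2 M \<Longrightarrow> T (L2_scale M c u) = L2_scale M c (T u)"
  by (simp add: bounded_op_def)

lemma bop_eqI:
  assumes "bounded_op M S" "bounded_op M T" "\<And>u. u \<in> L2 M \<Longrightarrow> S u = T u"
  shows "S = T"
proof
  fix u show "S u = T u" using assms(3) bop_ext[OF assms(1)] bop_ext[OF assms(2)] by (cases "u \<in> L2 M") simp_all
qed

lemma bop_bdd:
  assumes "bounded_op M T"
  shows "bdd_above ((\<lambda>u. L2_norm M (T u)) ` {u \<in> L2 M. L2_norm M u \<le> 1})"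
proof -
  obtain K where "\<forall>u\<in>L2 M. L2_norm M (T u) \<le> K * L2_norm M u"
    using assms unfolding bounded_op_def by blast
  then have K: "\<And>u. u \<in> L2 M \<Longrightarrow> L2_norm M (T u) \<le> K * L2_norm M u" by blast
  have "L2_norm M (T u) \<le> \<bar>K\<bar>" if "u \<in> L2 M" "L2_norm M u \<le> 1" for u
  proof -
    have "L2_norm M (T u) \<le> K * L2_norm M u" by (rule K[OF that(1)])
    also have "\<dots> \<le> \<bar>K\<bar> * L2_norm M u" by (intro mult_right_mono) auto
    also have "\<dots> \<le> \<bar>K\<bar> * 1" using that by (intro mult_left_mono) auto
    finally show ?thesis by simp
  qed
  then show ?thesis by (auto intro!: bdd_aboveI)
qed

lemma opn_eq: "opn M T = (SUP u\<in>{u \<in> L2 M. L2_norm M u \<le> 1}. L2_norm M (T u))"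
  by (simp add: L2_operators_def)

lemma opn_nonneg: assumes "bounded_op M T" shows "0 \<le> opn M T"
proof -
  have "L2_norm M (T (L2_zero M)) \<le> opn M T"
    unfolding opn_eq by (rule cSUP_upper[OF _ bop_bdd[OF assms]]) simp
  then show ?thesis using L2_norm_nonneg order_trans by blast
qed

lemma opn_bound: assumes T: "bounded_op M T" and u: "u \<in> L2 M"
  shows "L2_norm M (T u) \<le> opn M T * L2_norm M u"
proof (cases "L2_norm M u = 0")
  case True
  obtain K where "\<forall>u\<in>L2 M. L2_norm M (T u) \<le> K * L2_norm M u"
    using T unfolding bounded_op_def by blast
  from bspec[OF this u] True show ?thesis by simp
next
  case False
  then have pos: "0 < L2_norm M u" by (simp add: less_le)
  let ?c = "complex_of_real (1 / L2_norm M u)"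
  have "L2_norm M (T (L2_scale M ?c u)) \<le> opn M T"
    unfolding opn_eq
    by (rule cSUP_upper[OF _ bop_bdd[OF T]]) (use u pos in \<open>simp add: L2_norm_scale norm_divide\<close>)
  then have "L2_norm M (T u) / L2_norm M u \<le> opn M T"
    using u bop_in[OF T u] by (simp add: bop_scale[OF T u] L2_norm_scale norm_divide)
  then show ?thesis using pos by (simp add: divide_le_eq)
qed

lemma opn_le: assumes "0 \<le> K" "\<And>u. u \<in> L2 M \<Longrightarrow> L2_norm M (T u) \<le> K * L2_norm M u"
  shows "opn M T \<le> K"
  unfolding opn_eq
proof (rule cSUP_least)
  have "L2_zero M \<in> {u \<in> L2 M. L2_norm M u \<le> 1}" by simp
  then show "{u \<in> L2 M. L2_norm M u \<le> 1} \<noteq> {}" by blast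
  fix u assume "u \<in> {u \<in> L2 M. L2_norm M u \<le> 1}"
  then show "L2_norm M (T u) \<le> K" using assms(2)[of u] mult_left_mono[of "L2_norm M u" 1 K] assms(1) by simp
qed

lemma bounded_opI:
  assumes "T \<in> L2 M \<rightarrow>\<^sub>E L2 M"
    and "\<And>u v. u \<in> L2 M \<Longrightarrow> v \<in> L2 M \<Longrightarrow> T (L2_add M u v) = L2_add M (T u) (T v)"
    and "\<And>c u. u \<in> L2 M \<Longrightarrow> T (L2_scale M c u) = L2_scale M c (T u)"
    and "\<And>u. u \<in> L2 M \<Longrightarrow> L2_norm M (T u) \<le> K * L2_norm M u"
  shows "bounded_op M T"
  unfolding bounded_op_def by (intro conjI ballI allI exI[of _ K]) (fact assms | rule assms, assumption+)+

lemma bop_zero: "bounded_op M (\<lambda>u\<in>L2 M. L2_zero M)"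
  by (rule bounded_opI[where K = 0]) auto

lemma bop_one: "bounded_op M (\<lambda>u\<in>L2 M. u)"
  by (rule bounded_opI[where K = 1]) auto

lemma bop_plus:
  assumes S: "bounded_op M S" and T: "bounded_op M T"
  shows "bounded_op M (\<lambda>u\<in>L2 M. L2_add M (S u) (T u))"
proof (rule bounded_opI[where K = "opn M S + opn M T"])
  show "(\<lambda>u\<in>L2 M. L2_add M (S u) (T u)) \<in> L2 M \<rightarrow>\<^sub>E L2 M" using S T by (auto simp: bop_in)
  fix u v assume uv: "u \<in> L2 M" "v \<in> L2 M"
  then show "(\<lambda>u\<in>L2 M. L2_add M (S u) (T u)) (L2_add M u v) = L2_add M ((\<lambda>u\<in>L2 M. L2_add M (S u) (T u)) u) ((\<lambda>u\<in>L2 M. L2_add M (S u) (T u)) v)"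
    using S T by (simp add: bop_add bop_in L2_add_assoc L2_add_left_commute)
next
  fix c u assume u: "u \<in> L2 M"
  then show "(\<lambda>u\<in>L2 M. L2_add M (S u) (T u)) (L2_scale M c u) = L2_scale M c ((\<lambda>u\<in>L2 M. L2_add M (S u) (T u)) u)"
    using S T by (simp add: bop_scale bop_in L2_scale_add)
  show "L2_norm M ((\<lambda>u\<in>L2 M. L2_add M (S u) (T u)) u) \<le> (opn M S + opn M T) * L2_norm M u"
    using L2_norm_triangle[OF bop_in[OF S u] bop_in[OF T u]] opn_bound[OF S u] opn_bound[OF T u] u
    by (simp add: distrib_right)
qed

lemma bop_smult:
  assumes S: "bounded_op M S"
  shows "bounded_op M (\<lambda>u\<in>L2 M. L2_scale M c (S u))"
proof (rule bounded_opI[where K = "cmod c * opn M S"])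
  show "(\<lambda>u\<in>L2 M. L2_scale M c (S u)) \<in> L2 M \<rightarrow>\<^sub>E L2 M" using S by (auto simp: bop_in)
  fix u v assume uv: "u \<in> L2 M" "v \<in> L2 M"
  then show "(\<lambda>u\<in>L2 M. L2_scale M c (S u)) (L2_add M u v) = L2_add M ((\<lambda>u\<in>L2 M. L2_scale M c (S u)) u) ((\<lambda>u\<in>L2 M. L2_scale M c (S u)) v)"
    using S by (simp add: bop_add bop_in L2_scale_add)
next
  fix d u assume u: "u \<in> L2 M"
  then show "(\<lambda>u\<in>L2 M. L2_scale M c (S u)) (L2_scale M d u) = L2_scale M d ((\<lambda>u\<in>L2 M. L2_scale M c (S u)) u)"
    using S by (simp add: bop_scale bop_in L2_scale_scale mult.commute)
  show "L2_norm M ((\<lambda>u\<in>L2 M. L2_scale M c (S u)) u) \<le> cmod c * opn M S * L2_norm M u"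
    using mult_left_mono[OF opn_bound[OF S u], of "cmod c"] u by (simp add: L2_norm_scale bop_in[OF S u] mult.assoc)
qed

lemma bop_compose_bound:
  assumes S: "bounded_op M S" and T: "bounded_op M T" and u: "u \<in> L2 M"
  shows "L2_norm M (compose (L2 M) S T u) \<le> opn M S * opn M T * L2_norm M u"
proof -
  have "L2_norm M (S (T u)) \<le> opn M S * L2_norm M (T u)" by (rule opn_bound[OF S bop_in[OF T u]])
  also have "\<dots> \<le> opn M S * (opn M T * L2_norm M u)"
    by (rule mult_left_mono[OF opn_bound[OF T u] opn_nonneg[OF S]])
  finally show ?thesis using u by (simp add: compose_def mult.assoc)
qed

lemma bop_compose:
  assumes S: "bounded_op M S" and T: "bounded_op M T"
  shows "bounded_op M (compose (L2 M) S T)"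
proof (rule bounded_opI[OF _ _ _ bop_compose_bound[OF S T]])
  show "compose (L2 M) S T \<in> L2 M \<rightarrow>\<^sub>E L2 M" using S T by (auto simp: compose_def bop_in)
qed (use S T in \<open>auto simp: compose_def bop_add bop_scale bop_in\<close>)

text \<open>The adjoint is carried as an explicit partner. \<open>cstar_adj\<close> is a definite
  description and becomes usable through \<open>cstar_adj_eqI\<close> once such a partner is
  exhibited.\<close>

definition adjoint_of :: "'x L2_op \<Rightarrow> 'x L2_op \<Rightarrow> bool" where
  "adjoint_of T T' \<longleftrightarrow> bounded_op M T \<and> bounded_op M T' \<and>
     (\<forall>u\<in>L2 M. \<forall>v\<in>L2 M. L2_inner M (T u) v = L2_inner M u (T' v))"

lemma L2_eqI_inner:
  assumes "u \<in> L2 M" "v \<in> L2 M" "\<And>w. w \<in> L2 M \<Longrightarrow> L2_inner M w u = L2_inner M w v"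
  shows "u = v"
proof (rule L2_diff_eq_zero)
  have "L2_inner M w (L2_diff M u v) = 0" if "w \<in> L2 M" for w
    using assms that by (simp add: L2_diff_def L2_inner_add_right L2_inner_scale_right)
  from this[of "L2_diff M u v"] show "L2_dist M u v = 0"
    using L2_norm_sq[of "L2_diff M u v"] assms by simp
qed fact+

lemma adjoint_unique:
  assumes "adjoint_of T T'" "adjoint_of T T''" shows "T' = T''"
proof (rule bop_eqI)
  show "bounded_op M T'" "bounded_op M T''" using assms by (auto simp: adjoint_of_def)
  fix u assume u: "u \<in> L2 M"
  show "T' u = T'' u"
  proof (rule L2_eqI_inner)
    fix w assume "w \<in> L2 M"
    then show "L2_inner M w (T' u) = L2_inner M w (T'' u)"
      using assms u unfolding adjoint_of_def by metis
  qed (use assms u in \<open>auto simp: adjoint_of_def bop_in\<close>)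
qed

lemma cstar_adj_eqI:
  assumes "adjoint_of T T'" shows "cstar_adj (LO M) T = T'"
proof -
  have "(THE T'. bounded_op M T' \<and> (\<forall>u\<in>L2 M. \<forall>v\<in>L2 M. L2_inner M (T u) v = L2_inner M u (T' v))) = T'"
  proof (rule the_equality)
    show "bounded_op M T' \<and> (\<forall>u\<in>L2 M. \<forall>v\<in>L2 M. L2_inner M (T u) v = L2_inner M u (T' v))"
      using assms by (simp add: adjoint_of_def)
    fix S assume "bounded_op M S \<and> (\<forall>u\<in>L2 M. \<forall>v\<in>L2 M. L2_inner M (T u) v = L2_inner M u (S v))"
    then have "adjoint_of T S" using assms by (simp add: adjoint_of_def)
    then show "S = T'" using assms adjoint_unique by blast
  qed
  then show ?thesis by (simp add: L2_operators_def)
qed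

lemma adjoint_sym: assumes "adjoint_of T T'" shows "adjoint_of T' T"
  unfolding adjoint_of_def
proof (intro conjI ballI)
  show "bounded_op M T'" "bounded_op M T" using assms by (auto simp: adjoint_of_def)
  fix u v assume uv: "u \<in> L2 M" "v \<in> L2 M"
  have "L2_inner M (T' u) v = cnj (L2_inner M v (T' u))"
    using uv assms by (intro L2_inner_commute) (auto simp: adjoint_of_def bop_in)
  also have "L2_inner M v (T' u) = L2_inner M (T v) u" using assms uv by (simp add: adjoint_of_def)
  also have "cnj (L2_inner M (T v) u) = L2_inner M u (T v)"
    using uv assms by (intro L2_inner_commute[symmetric]) (auto simp: adjoint_of_def bop_in)
  finally show "L2_inner M (T' u) v = L2_inner M u (T v)" .
qed

lemma adjoint_one: "adjoint_of (\<lambda>u\<in>L2 M. u) (\<lambda>u\<in>L2 M. u)"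
  by (simp add: adjoint_of_def bop_one)

lemma adjoint_plus:
  assumes "adjoint_of S S'" "adjoint_of T T'"
  shows "adjoint_of (\<lambda>u\<in>L2 M. L2_add M (S u) (T u)) (\<lambda>u\<in>L2 M. L2_add M (S' u) (T' u))"
  using assms unfolding adjoint_of_def
  by (auto simp: bop_plus bop_in L2_inner_add L2_inner_add_right)

lemma adjoint_smult:
  assumes "adjoint_of S S'"
  shows "adjoint_of (\<lambda>u\<in>L2 M. L2_scale M c (S u)) (\<lambda>u\<in>L2 M. L2_scale M (cnj c) (S' u))"
  using assms unfolding adjoint_of_def
  by (auto simp: bop_smult bop_in L2_inner_scale L2_inner_scale_right)

lemma adjoint_compose:
  assumes "adjoint_of S S'" "adjoint_of T T'"
  shows "adjoint_of (compose (L2 M) S T) (compose (L2 M) T' S')"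
  using assms unfolding adjoint_of_def
  by (auto simp: bop_compose[unfolded compose_def] bop_in compose_def)

text \<open>The squared norm of \<open>T' u\<close> is the inner product of \<open>T (T' u)\<close>
  with \<open>u\<close>; Cauchy-Schwarz, then cancel one factor.\<close>

lemma opn_adjoint_le: assumes "adjoint_of T T'" shows "opn M T' \<le> opn M T"
proof (rule opn_le)
  have b: "bounded_op M T" "bounded_op M T'" using assms by (auto simp: adjoint_of_def)
  show "0 \<le> opn M T" by (rule opn_nonneg) fact
  fix u assume u: "u \<in> L2 M"
  let ?v = "T' u"
  have v: "?v \<in> L2 M" using bop_in b u by blast
  have "of_real ((L2_norm M ?v)\<^sup>2) = L2_inner M (T ?v) u"
    using L2_norm_sq[OF v] assms v u by (simp add: adjoint_of_def)
  then have "(L2_norm M ?v)\<^sup>2 = cmod (L2_inner M (T ?v) u)" by (metis norm_of_real abs_power2)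
  also have "\<dots> \<le> L2_norm M (T ?v) * L2_norm M u" using bop_in[OF b(1) v] u by (rule L2_cauchy_schwarz)
  also have "\<dots> \<le> (opn M T * L2_norm M ?v) * L2_norm M u" by (intro mult_right_mono opn_bound b v) simp
  finally have "L2_norm M ?v * L2_norm M ?v \<le> (opn M T * L2_norm M u) * L2_norm M ?v"
    by (simp add: power2_eq_square mult_ac)
  moreover have "0 \<le> opn M T * L2_norm M u" using opn_nonneg[OF b(1)] by simp
  ultimately show "L2_norm M ?v \<le> opn M T * L2_norm M u"
    using L2_norm_nonneg[of M ?v] by (cases "L2_norm M ?v = 0") (auto simp: mult_le_cancel_right)
qed

lemma opn_cstar: assumes "adjoint_of T T'" shows "opn M (compose (L2 M) T' T) = (opn M T)\<^sup>2"
proof (rule antisym)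
  have b: "bounded_op M T" "bounded_op M T'" using assms by (auto simp: adjoint_of_def)
  note n = opn_nonneg[OF b(1)] opn_nonneg[OF b(2)] opn_nonneg[OF bop_compose[OF b(2,1)]]
  have "opn M (compose (L2 M) T' T) \<le> opn M T' * opn M T" by (rule opn_le[OF _ bop_compose_bound[OF b(2,1)]]) (use n in simp)
  also have "\<dots> \<le> opn M T * opn M T" by (intro mult_right_mono opn_adjoint_le[OF assms] n)
  finally show "opn M (compose (L2 M) T' T) \<le> (opn M T)\<^sup>2" by (simp add: power2_eq_square)
  have "opn M T \<le> sqrt (opn M (compose (L2 M) T' T))"
  proof (rule opn_le)
    fix u assume u: "u \<in> L2 M"
    have Tu: "T u \<in> L2 M" "T' (T u) \<in> L2 M" using bop_in b u by blast+
    have "of_real ((L2_norm M (T u))\<^sup>2) = L2_inner M u (T' (T u))"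
      using L2_norm_sq[OF Tu(1)] assms Tu u by (simp add: adjoint_of_def)
    then have "(L2_norm M (T u))\<^sup>2 = cmod (L2_inner M u (T' (T u)))" by (metis norm_of_real abs_power2)
    also have "\<dots> \<le> L2_norm M u * L2_norm M (compose (L2 M) T' T u)"
      using L2_cauchy_schwarz[OF u Tu(2)] u by (simp add: compose_def)
    also have "\<dots> \<le> L2_norm M u * (opn M (compose (L2 M) T' T) * L2_norm M u)"
      by (intro mult_left_mono opn_bound bop_compose b u) simp
    also have "\<dots> = (sqrt (opn M (compose (L2 M) T' T)) * L2_norm M u)\<^sup>2"
      using n by (simp add: power_mult_distrib) (simp add: power2_eq_square)
    finally show "L2_norm M (T u) \<le> sqrt (opn M (compose (L2 M) T' T)) * L2_norm M u"
      by (rule power2_le_imp_le) (use n in simp)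
  qed (use n in simp)
  then show "(opn M T)\<^sup>2 \<le> opn M (compose (L2 M) T' T)"
    using power_mono[OF _ n(1), of "sqrt (opn M (compose (L2 M) T' T))" 2] n by simp
qed

text \<open>Pointwise limits exist because the space is complete, and letting \<open>m\<close> tend
  to infinity in the uniform Cauchy estimate keeps it uniform in \<open>u\<close>. Estimates of the
  form \<open>e * L2_norm M u\<close> avoid speaking of differences of operators.\<close>

lemma bop_complete:
  fixes X :: "nat \<Rightarrow> 'x L2_op"
  assumes X: "\<And>n. bounded_op M (X n)"
    and C: "\<And>e. 0 < e \<Longrightarrow> \<exists>N. \<forall>m\<ge>N. \<forall>n\<ge>N. \<forall>u\<in>L2 M. L2_dist M (X m u) (X n u) \<le> e * L2_norm M u"
  shows "\<exists>T. bounded_op M T \<and> op_lim M X T"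
proof -
  have Xin: "X n u \<in> L2 M" if "u \<in> L2 M" for n u using X bop_in that by blast
  have "\<exists>v\<in>L2 M. (\<lambda>n. L2_dist M (X n u) v) \<longlonglongrightarrow> 0" if u: "u \<in> L2 M" for u
  proof (rule L2_complete)
    fix e :: real assume e: "0 < e"
    \<comment> \<open>Adding 1 guards against a vector of norm zero.\<close>
    define d where "d = e / (L2_norm M u + 1)"
    have d: "0 < d" using e L2_norm_nonneg[of M u] by (simp add: d_def add_nonneg_pos)
    then obtain N where N: "\<forall>m\<ge>N. \<forall>n\<ge>N. \<forall>u\<in>L2 M. L2_dist M (X m u) (X n u) \<le> d * L2_norm M u"
      using C by blast
    have "d * L2_norm M u < d * (L2_norm M u + 1)" using d by simp
    also have "\<dots> = e" using add_nonneg_pos[OF L2_norm_nonneg[of M u] zero_less_one] by (simp add: d_def)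
    finally show "\<exists>N. \<forall>m\<ge>N. \<forall>n\<ge>N. L2_dist M (X m u) (X n u) < e"
      using N u by (meson le_less_trans)
  qed (use Xin u in blast)
  then obtain f where f: "\<And>u. u \<in> L2 M \<Longrightarrow> f u \<in> L2 M \<and> (\<lambda>n. L2_dist M (X n u) (f u)) \<longlonglongrightarrow> 0" by metis
  define T where "T = restrict f (L2 M)"
  have T: "T u \<in> L2 M" "(\<lambda>n. L2_dist M (X n u) (T u)) \<longlonglongrightarrow> 0" if "u \<in> L2 M" for u
    using f that by (auto simp: T_def)
  have uni: "\<exists>N. \<forall>n\<ge>N. \<forall>u\<in>L2 M. L2_dist M (X n u) (T u) \<le> e * L2_norm M u" if e: "0 < e" for e
  proof -
    obtain N where N: "\<forall>m\<ge>N. \<forall>n\<ge>N. \<forall>u\<in>L2 M. L2_dist M (X m u) (X n u) \<le> e * L2_norm M u"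
      using C[OF e] by blast
    have "L2_dist M (X n u) (T u) \<le> e * L2_norm M u" if n: "n \<ge> N" and u: "u \<in> L2 M" for n u
    proof (rule LIMSEQ_le)
      show "(\<lambda>_. L2_dist M (X n u) (T u)) \<longlonglongrightarrow> L2_dist M (X n u) (T u)" by simp
      show "(\<lambda>m. e * L2_norm M u + L2_dist M (X m u) (T u)) \<longlonglongrightarrow> e * L2_norm M u"
        using tendsto_add[OF tendsto_const T(2)[OF u]] by simp
      have "L2_dist M (X n u) (T u) \<le> e * L2_norm M u + L2_dist M (X m u) (T u)" if "m \<ge> N" for m
        using L2_norm_diff_trans[OF Xin[OF u] Xin[OF u] T(1)[OF u], of n m] N n that u by (smt (verit))
      then show "\<exists>N'. \<forall>m\<ge>N'. L2_dist M (X n u) (T u) \<le> e * L2_norm M u + L2_dist M (X m u) (T u)"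
        by blast
    qed
    then show ?thesis by blast
  qed
  have lim_unique: "v = w" if "v \<in> L2 M" "w \<in> L2 M" "\<And>n::nat. Y n \<in> L2 M"
    "(\<lambda>n. L2_dist M (Y n) v) \<longlonglongrightarrow> 0" "(\<lambda>n. L2_dist M (Y n) w) \<longlonglongrightarrow> 0" for v w Y
  proof (rule L2_diff_eq_zero[OF that(1,2)])
    have "(\<lambda>n. L2_dist M (Y n) v + L2_dist M (Y n) w) \<longlonglongrightarrow> 0"
      using tendsto_add[OF that(4,5)] by simp
    moreover have "L2_dist M v w \<le> L2_dist M (Y n) v + L2_dist M (Y n) w" for n
      using L2_norm_diff_trans[OF that(1) that(3) that(2), of n] L2_norm_diff_commute[OF that(1) that(3), of n] by simp
    ultimately have "L2_dist M v w \<le> 0" by (intro LIMSEQ_le_const) auto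
    then show "L2_dist M v w = 0" using L2_norm_nonneg[of M "L2_diff M v w"] by simp
  qed
  have "bounded_op M T"
  proof -
    obtain N where N: "\<forall>n\<ge>N. \<forall>u\<in>L2 M. L2_dist M (X n u) (T u) \<le> 1 * L2_norm M u"
      using uni[of 1] by auto
    show ?thesis
    proof (rule bounded_opI[where K = "opn M (X N) + 1"])
      show "T \<in> L2 M \<rightarrow>\<^sub>E L2 M" using T by (auto simp: T_def)
    next
      fix u v assume u: "u \<in> L2 M" and v: "v \<in> L2 M"
      show "T (L2_add M u v) = L2_add M (T u) (T v)"
      proof (rule lim_unique[of _ _ "\<lambda>n. X n (L2_add M u v)"])
        show "(\<lambda>n. L2_dist M (X n (L2_add M u v)) (L2_add M (T u) (T v))) \<longlonglongrightarrow> 0"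
        proof (rule tendsto_sandwich[OF _ _ tendsto_const])
          show "\<forall>\<^sub>F n in sequentially. L2_dist M (X n (L2_add M u v)) (L2_add M (T u) (T v))
              \<le> L2_dist M (X n u) (T u) + L2_dist M (X n v) (T v)"
          proof (rule always_eventually, rule allI)
            fix n
            have "L2_diff M (L2_add M (X n u) (X n v)) (L2_add M (T u) (T v))
              = L2_add M (L2_diff M (X n u) (T u)) (L2_diff M (X n v) (T v))"
              using Xin[OF u, of n] Xin[OF v, of n] T(1)[OF u] T(1)[OF v]
              by (elim L2_cases) (simp add: L2_diff_class L2_add_class sqint_diff sqint_add add_diff_add)
            then show "L2_dist M (X n (L2_add M u v)) (L2_add M (T u) (T v))
              \<le> L2_dist M (X n u) (T u) + L2_dist M (X n v) (T v)"
              using L2_norm_triangle[of "L2_diff M (X n u) (T u)" M "L2_diff M (X n v) (T v)"]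
                Xin[OF u, of n] Xin[OF v, of n] T(1)[OF u] T(1)[OF v] by (simp add: bop_add[OF X u v])
          qed
          show "(\<lambda>n. L2_dist M (X n u) (T u) + L2_dist M (X n v) (T v)) \<longlonglongrightarrow> 0"
            using tendsto_add[OF T(2)[OF u] T(2)[OF v]] by simp
        qed simp
      qed (use T Xin u v in auto)
    next
      fix c u assume u: "u \<in> L2 M"
      show "T (L2_scale M c u) = L2_scale M c (T u)"
      proof (rule lim_unique[of _ _ "\<lambda>n. X n (L2_scale M c u)"])
        have "L2_dist M (X n (L2_scale M c u)) (L2_scale M c (T u)) = cmod c * L2_dist M (X n u) (T u)" for n
        proof -
          have "L2_diff M (L2_scale M c (X n u)) (L2_scale M c (T u)) = L2_scale M c (L2_diff M (X n u) (T u))"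
            using Xin[OF u, of n] T(1)[OF u]
            by (elim L2_cases) (simp add: L2_diff_class L2_scale_class sqint_diff sqint_scale right_diff_distrib)
          then show ?thesis using Xin[OF u, of n] T(1)[OF u] by (simp add: bop_scale[OF X u] L2_norm_scale)
        qed
        then show "(\<lambda>n. L2_dist M (X n (L2_scale M c u)) (L2_scale M c (T u))) \<longlonglongrightarrow> 0"
          using tendsto_mult_right_zero[OF T(2)[OF u], of "cmod c"] by simp
      qed (use T Xin u in auto)
      have "L2_norm M (T u) \<le> L2_norm M (X N u) + L2_dist M (X N u) (T u)"
      proof -
        have "T u = L2_add M (X N u) (L2_diff M (T u) (X N u))"
          using Xin[OF u, of N] T(1)[OF u] by (elim L2_cases) (simp add: L2_diff_class L2_add_class sqint_diff)
        then show ?thesis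
          using L2_norm_triangle[OF Xin[OF u] L2_diff_closed[OF T(1)[OF u] Xin[OF u]], of N N]
            L2_norm_diff_commute[OF T(1)[OF u] Xin[OF u], of N] by simp
      qed
      then show "L2_norm M (T u) \<le> (opn M (X N) + 1) * L2_norm M u"
        using opn_bound[OF X u, of N] N u by (fastforce simp: distrib_right)
    qed
  qed
  then show ?thesis using uni by blast
qed

end

section \<open>Closed subalgebras, and the C*-algebra of adjointable operators\<close>

subsection \<open>Subalgebras\<close>

text \<open>The additive inverse is a description over the carrier, so changing the carrier could
  change it; uniqueness of inverses shows that it does not.\<close>

lemma (in ring) subring_minus:
  assumes "subring K R" "x \<in> K" "y \<in> K"
  shows "x \<ominus>\<^bsub>R\<lparr>carrier := K\<rparr>\<^esub> y = x \<ominus> y"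
proof -
  interpret K: ring "R\<lparr>carrier := K\<rparr>" by (rule subring_is_ring[OF assms(1)])
  have c: "x \<in> carrier R" "y \<in> carrier R" "\<ominus> y \<in> K" using subringE(1,5)[OF assms(1)] assms(2,3) by auto
  have "\<ominus>\<^bsub>R\<lparr>carrier := K\<rparr>\<^esub> y = \<ominus> y"
    by (rule K.minus_equality) (use c assms in \<open>auto simp: l_neg\<close>)
  then show ?thesis by (simp add: a_minus_def)
qed

text \<open>Finite sums, too, refer to the carrier of the record, and are compared by induction over
  the index set.\<close>

lemma finsum_subring:
  assumes "ring R" "subring K R" "f \<in> I \<rightarrow> K"
  shows "finsum (R\<lparr>carrier := K\<rparr>) f I = finsum R f I"
proof -
  interpret R: ring R by fact
  interpret K: ring "R\<lparr>carrier := K\<rparr>" by (rule R.subring_is_ring[OF assms(2)])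
  show ?thesis
  proof (cases "finite I")
    case True
    then show ?thesis using assms(3)
    proof (induction I rule: finite_induct)
      case (insert x F)
      have "f \<in> F \<rightarrow> carrier R" "f x \<in> carrier R" using insert.prems subringE(1)[OF assms(2)] by auto
      then show ?case using insert by (simp add: R.finsum_insert K.finsum_insert Pi_def)
    qed simp
  next
    case False
    then show ?thesis by (simp add: K.finsum_infinite R.finsum_infinite)
  qed
qed

lemma complex_ring_cring: "cring complex_ring"
proof (rule cringI)
  show "abelian_group complex_ring"
  proof (rule abelian_groupI)
    fix x show "\<exists>y\<in>carrier complex_ring. y \<oplus>\<^bsub>complex_ring\<^esub> x = \<zero>\<^bsub>complex_ring\<^esub>"
      by (rule bexI[of _ "- x"]) (auto simp: complex_ring_def)
  qed (auto simp: complex_ring_def)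
  show "Group.comm_monoid complex_ring"
    by (rule comm_monoidI) (auto simp: complex_ring_def mult_ac)
qed (auto simp: complex_ring_def distrib_right)

lemma cstar_subalgebraD:
  fixes R (structure)
  assumes "cstar_subalgebra K R"
  shows "K \<subseteq> carrier R" "\<one> \<in> K" "\<zero> \<in> K" "\<And>x y. x \<in> K \<Longrightarrow> y \<in> K \<Longrightarrow> x \<oplus> y \<in> K"
    "\<And>x y. x \<in> K \<Longrightarrow> y \<in> K \<Longrightarrow> x \<otimes> y \<in> K" "\<And>c x. x \<in> K \<Longrightarrow> c \<odot>\<^bsub>R\<^esub> x \<in> K"
    "\<And>x. x \<in> K \<Longrightarrow> cstar_adj R x \<in> K"
    "\<And>X x. range X \<subseteq> K \<Longrightarrow> x \<in> carrier R \<Longrightarrow> (\<lambda>n::nat. cstar_norm R (X n \<ominus> x)) \<longlonglongrightarrow> 0 \<Longrightarrow> x \<in> K"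
proof -
  have K: "subring K R" "\<And>c x. x \<in> K \<Longrightarrow> c \<odot>\<^bsub>R\<^esub> x \<in> K" "\<And>x. x \<in> K \<Longrightarrow> cstar_adj R x \<in> K"
    "\<And>X x. range X \<subseteq> K \<Longrightarrow> x \<in> carrier R \<Longrightarrow> (\<lambda>n::nat. cstar_norm R (X n \<ominus> x)) \<longlonglongrightarrow> 0 \<Longrightarrow> x \<in> K"
    using assms unfolding cstar_subalgebra_def by auto
  note E = subringE[OF K(1)]
  show "K \<subseteq> carrier R" "\<one> \<in> K" "\<zero> \<in> K" by (rule E)+
  show "x \<oplus> y \<in> K" "x \<otimes> y \<in> K" if "x \<in> K" "y \<in> K" for x y using that by (rule E)+
  show "c \<odot>\<^bsub>R\<^esub> x \<in> K" "cstar_adj R x \<in> K" if "x \<in> K" for x c using that by (rule K)+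
  show "x \<in> K" if "range X \<subseteq> K" "x \<in> carrier R" "(\<lambda>n::nat. cstar_norm R (X n \<ominus> x)) \<longlonglongrightarrow> 0" for X x using that by (rule K(4))
qed

lemma cstar_subalgebra_cstar_algebra:
  fixes A :: "('a, 'm) cstar_scheme"
  assumes "cstar_algebra A" "cstar_subalgebra K A"
  shows "cstar_algebra (A\<lparr>carrier := K\<rparr>)"
proof -
  interpret A: cstar_algebra A by fact
  let ?K = "A\<lparr>carrier := K\<rparr>"
  have K: "subring K A" "\<And>c x. x \<in> K \<Longrightarrow> c \<odot>\<^bsub>A\<^esub> x \<in> K" "\<And>x. x \<in> K \<Longrightarrow> A.star x \<in> K"
    using assms(2) unfolding cstar_subalgebra_def by blast+
  note cl = cstar_subalgebraD(8)[OF assms(2)]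
  have sub: "\<And>x. x \<in> K \<Longrightarrow> x \<in> carrier A" using subringE(1)[OF K(1)] by blast
  interpret K: ring ?K by (rule A.subring_is_ring[OF K(1)])
  have "Module.module complex_ring ?K"
  proof (rule moduleI[OF complex_ring_cring K.abelian_group_axioms])
  qed (auto simp: K(2) sub complex_ring_def A.sm_l_distr A.sm_r_distr A.sm_assoc)
  moreover have "cstar_algebra_axioms ?K"
  proof unfold_locales
    fix X :: "nat \<Rightarrow> 'a"
    assume X: "range X \<subseteq> carrier ?K"
      and C: "\<And>e::real. 0 < e \<Longrightarrow> \<exists>N. \<forall>m\<ge>N. \<forall>n\<ge>N. cstar_norm ?K (X m \<ominus>\<^bsub>?K\<^esub> X n) < e"
    have XK: "X n \<in> K" for n using X by auto
    have m: "X m \<ominus>\<^bsub>?K\<^esub> x = X m \<ominus>\<^bsub>A\<^esub> x" if "x \<in> K" for x m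
      by (rule A.subring_minus[OF K(1) XK that])
    have C': "\<exists>N. \<forall>m\<ge>N. \<forall>n\<ge>N. A.nrm (X m \<ominus>\<^bsub>A\<^esub> X n) < e" if "0 < e" for e
      using C[OF that] by (simp add: m XK)
    obtain x where x: "x \<in> carrier A" "(\<lambda>n. A.nrm (X n \<ominus>\<^bsub>A\<^esub> x)) \<longlonglongrightarrow> 0"
      using A.complete[OF _ C'] XK sub by blast
    have "x \<in> K" using cl[OF _ x] XK by blast
    then show "\<exists>x\<in>carrier ?K. (\<lambda>n. cstar_norm ?K (X n \<ominus>\<^bsub>?K\<^esub> x)) \<longlonglongrightarrow> 0"
      using x by (intro bexI[of _ x]) (simp_all add: m)
  qed (simp_all add: sub K(2,3) A.smult_mult_left A.smult_mult_right A.adj_adj A.adj_add A.adj_smult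
      A.adj_mult A.norm_nonneg A.norm_eq_zero A.norm_triangle A.norm_smult A.norm_mult A.norm_cstar)
  ultimately show ?thesis by (intro cstar_algebra.intro K.ring_axioms)
qed

text \<open>Since \<open>K\<close> is closed, a limit in \<open>A\<close> of elements of
  \<open>K'\<close> already lies in \<open>K\<close>, so closedness relative to \<open>K\<close> and
  closedness in \<open>A\<close> coincide.\<close>

lemma cstar_subalgebra_trans:
  assumes "ring A" "cstar_subalgebra K A" "K' \<subseteq> K"
  shows "cstar_subalgebra K' (A\<lparr>carrier := K\<rparr>) \<longleftrightarrow> cstar_subalgebra K' A"
proof -
  interpret A: ring A by fact
  let ?K = "A\<lparr>carrier := K\<rparr>"
  have K: "subring K A" using assms(2) by (simp add: cstar_subalgebra_def)
  note cl = cstar_subalgebraD(8)[OF assms(2)]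
  interpret K: ring ?K by (rule A.subring_is_ring[OF K])
  have KA: "K \<subseteq> carrier A" by (rule subringE(1)[OF K])
  have sr: "subring K' ?K \<longleftrightarrow> subring K' A"
  proof
    assume s: "subring K' ?K"
    have "ring (?K\<lparr>carrier := K'\<rparr>)" by (rule K.subring_is_ring[OF s])
    then show "subring K' A" using assms(3) KA by (intro A.ring_incl_imp_subring) auto
  next
    assume s: "subring K' A"
    have "ring (A\<lparr>carrier := K'\<rparr>)" by (rule A.subring_is_ring[OF s])
    then show "subring K' ?K" using assms(3) by (intro K.ring_incl_imp_subring) auto
  qed
  have m: "X n \<ominus>\<^bsub>?K\<^esub> x = X n \<ominus>\<^bsub>A\<^esub> x" if "range X \<subseteq> K'" "x \<in> K" for X :: "nat \<Rightarrow> 'a" and x n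
    using that assms(3) by (intro A.subring_minus[OF K]) auto
  have "(\<forall>X x. range X \<subseteq> K' \<longrightarrow> x \<in> K \<longrightarrow> (\<lambda>n::nat. cstar_norm ?K (X n \<ominus>\<^bsub>?K\<^esub> x)) \<longlonglongrightarrow> 0 \<longrightarrow> x \<in> K')
    \<longleftrightarrow> (\<forall>X x. range X \<subseteq> K' \<longrightarrow> x \<in> carrier A \<longrightarrow> (\<lambda>n::nat. cstar_norm A (X n \<ominus>\<^bsub>A\<^esub> x)) \<longlonglongrightarrow> 0 \<longrightarrow> x \<in> K')"
    (is "?L \<longleftrightarrow> ?R")
  proof
    assume L: ?L
    show ?R
    proof (intro allI impI)
      fix X x assume h: "range X \<subseteq> K'" "x \<in> carrier A" "(\<lambda>n::nat. cstar_norm A (X n \<ominus>\<^bsub>A\<^esub> x)) \<longlonglongrightarrow> 0"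
      then have xK: "x \<in> K" using cl[of X x] assms(3) by blast
      have "(\<lambda>n. cstar_norm ?K (X n \<ominus>\<^bsub>?K\<^esub> x)) \<longlonglongrightarrow> 0" using h(3) m[OF h(1) xK] by simp
      then show "x \<in> K'" using L h(1) xK by blast
    qed
  next
    assume R: ?R
    show ?L
    proof (intro allI impI)
      fix X x assume h: "range X \<subseteq> K'" "x \<in> K" "(\<lambda>n::nat. cstar_norm ?K (X n \<ominus>\<^bsub>?K\<^esub> x)) \<longlonglongrightarrow> 0"
      have "(\<lambda>n. cstar_norm A (X n \<ominus>\<^bsub>A\<^esub> x)) \<longlonglongrightarrow> 0" using h(3) m[OF h(1,2)] by simp
      then show "x \<in> K'" using R h(1,2) KA by blast
    qed
  qed
  then show ?thesis unfolding cstar_subalgebra_def sr by simp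
qed

lemma cstar_subalgebra_Inter:
  assumes "ring A" "S \<noteq> {}" "\<And>K. K \<in> S \<Longrightarrow> cstar_subalgebra K A"
  shows "cstar_subalgebra (\<Inter>S) A"
proof -
  interpret A: ring A by fact
  have "subring (\<Inter>S) A" using assms(2,3) by (intro A.subring_Inter) (auto simp: cstar_subalgebra_def)
  moreover have "x \<in> \<Inter>S" if h: "range X \<subseteq> \<Inter>S" "x \<in> carrier A" "(\<lambda>n::nat. cstar_norm A (X n \<ominus>\<^bsub>A\<^esub> x)) \<longlonglongrightarrow> 0" for X x
  proof
    fix K assume K: "K \<in> S"
    then have "range X \<subseteq> K" using h(1) by blast
    then show "x \<in> K" using assms(3)[OF K] h(2,3) unfolding cstar_subalgebra_def by blast
  qed
  ultimately show ?thesis using assms(3) unfolding cstar_subalgebra_def by blast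
qed

lemma cstar_span_subalgebra:
  assumes "ring A" "cstar_subalgebra K A" "X \<subseteq> K"
  shows "cstar_subalgebra (cstar_span A X) A"
  unfolding cstar_span_def using assms by (intro cstar_subalgebra_Inter) auto

lemma cstar_span_superset: "X \<subseteq> cstar_span A X"
  unfolding cstar_span_def by blast

lemma cstar_span_least: "cstar_subalgebra K A \<Longrightarrow> X \<subseteq> K \<Longrightarrow> cstar_span A X \<subseteq> K"
  unfolding cstar_span_def by blast

lemma cstar_span_sub:
  assumes "ring A" "cstar_subalgebra K A" "X \<subseteq> K"
  shows "cstar_span (A\<lparr>carrier := K\<rparr>) X = cstar_span A X"
proof
  have s: "cstar_subalgebra (cstar_span A X) A" by (rule cstar_span_subalgebra[OF assms])
  have "cstar_span A X \<subseteq> K" by (rule cstar_span_least[OF assms(2,3)])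
  then have "cstar_subalgebra (cstar_span A X) (A\<lparr>carrier := K\<rparr>)"
    using cstar_subalgebra_trans[OF assms(1,2)] s by blast
  then show "cstar_span (A\<lparr>carrier := K\<rparr>) X \<subseteq> cstar_span A X"
    by (rule cstar_span_least[OF _ cstar_span_superset])
  show "cstar_span A X \<subseteq> cstar_span (A\<lparr>carrier := K\<rparr>) X"
    unfolding cstar_span_def[of "A\<lparr>carrier := K\<rparr>"]
  proof (rule Inter_greatest)
    fix B assume B: "B \<in> {B. cstar_subalgebra B (A\<lparr>carrier := K\<rparr>) \<and> X \<subseteq> B}"
    then have "B \<subseteq> K" using subringE(1)[of B "A\<lparr>carrier := K\<rparr>"] by (auto simp: cstar_subalgebra_def)
    then have "cstar_subalgebra B A" using B cstar_subalgebra_trans[OF assms(1,2)] by blast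
    then show "cstar_span A X \<subseteq> B" using B by (intro cstar_span_least) auto
  qed
qed

lemma (in cstar_algebra) carrier_subalgebra: "cstar_subalgebra (carrier A) A"
  unfolding cstar_subalgebra_def using carrier_is_subring by auto

subsection \<open>Adjointable operators form a C*-algebra\<close>

lemma L2_operators_ring: "ring (LO M)"
proof (rule ringI)
  show "abelian_group (LO M)"
  proof (rule abelian_groupI)
    fix S T R :: "'a L2_op"
    assume STR: "S \<in> carrier (LO M)" "T \<in> carrier (LO M)" "R \<in> carrier (LO M)"
    show "S \<oplus>\<^bsub>LO M\<^esub> T \<oplus>\<^bsub>LO M\<^esub> R = S \<oplus>\<^bsub>LO M\<^esub> (T \<oplus>\<^bsub>LO M\<^esub> R)"
      using STR by (auto simp: bop_in L2_add_assoc intro!: restrict_ext)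
  next
    fix S T :: "'a L2_op"
    assume ST: "S \<in> carrier (LO M)" "T \<in> carrier (LO M)"
    then show "S \<oplus>\<^bsub>LO M\<^esub> T = T \<oplus>\<^bsub>LO M\<^esub> S"
      by (intro bop_eqI[of M]) (auto simp: bop_plus bop_in L2_add_commute)
    show "S \<oplus>\<^bsub>LO M\<^esub> T \<in> carrier (LO M)" using ST by (simp add: bop_plus)
  next
    fix S :: "'a L2_op" assume S: "S \<in> carrier (LO M)"
    show "\<zero>\<^bsub>LO M\<^esub> \<oplus>\<^bsub>LO M\<^esub> S = S"
      using S bop_ext[of M S] by (intro ext) (simp add: bop_in)
    show "\<exists>T\<in>carrier (LO M). T \<oplus>\<^bsub>LO M\<^esub> S = \<zero>\<^bsub>LO M\<^esub>"
    proof (rule bexI)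
      show "(\<lambda>u\<in>L2 M. L2_scale M (-1) (S u)) \<in> carrier (LO M)" using S by (simp add: bop_smult)
      show "(\<lambda>u\<in>L2 M. L2_scale M (-1) (S u)) \<oplus>\<^bsub>LO M\<^esub> S = \<zero>\<^bsub>LO M\<^esub>"
        using S by (auto simp: bop_in L2_add_inverse intro!: restrict_ext)
    qed
  qed (simp add: bop_zero)
  show "Group.monoid (LO M)"
  proof (rule monoidI)
    fix S T R :: "'a L2_op"
    assume STR: "S \<in> carrier (LO M)" "T \<in> carrier (LO M)" "R \<in> carrier (LO M)"
    show "S \<otimes>\<^bsub>LO M\<^esub> T \<otimes>\<^bsub>LO M\<^esub> R = S \<otimes>\<^bsub>LO M\<^esub> (T \<otimes>\<^bsub>LO M\<^esub> R)"
      using STR by (auto simp: compose_def bop_in intro!: restrict_ext)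
  next
    fix S T :: "'a L2_op"
    assume ST: "S \<in> carrier (LO M)" "T \<in> carrier (LO M)"
    then show "S \<otimes>\<^bsub>LO M\<^esub> T \<in> carrier (LO M)" by (simp add: bop_compose)
  next
    fix S :: "'a L2_op" assume S: "S \<in> carrier (LO M)"
    show "\<one>\<^bsub>LO M\<^esub> \<otimes>\<^bsub>LO M\<^esub> S = S" "S \<otimes>\<^bsub>LO M\<^esub> \<one>\<^bsub>LO M\<^esub> = S"
      using S bop_ext[of M S] by (intro ext; simp add: compose_def bop_in)+
  qed (simp add: bop_one)
  fix S T R :: "'a L2_op"
  assume STR: "S \<in> carrier (LO M)" "T \<in> carrier (LO M)" "R \<in> carrier (LO M)"
  show "(S \<oplus>\<^bsub>LO M\<^esub> T) \<otimes>\<^bsub>LO M\<^esub> R = S \<otimes>\<^bsub>LO M\<^esub> R \<oplus>\<^bsub>LO M\<^esub> T \<otimes>\<^bsub>LO M\<^esub> R"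
    "R \<otimes>\<^bsub>LO M\<^esub> (S \<oplus>\<^bsub>LO M\<^esub> T) = R \<otimes>\<^bsub>LO M\<^esub> S \<oplus>\<^bsub>LO M\<^esub> R \<otimes>\<^bsub>LO M\<^esub> T"
    using STR by (auto simp: compose_def bop_in bop_add intro!: restrict_ext)
qed

lemma L2_operators_minus:
  assumes "bounded_op M S" "bounded_op M T"
  shows "S \<ominus>\<^bsub>LO M\<^esub> T = (\<lambda>u\<in>L2 M. L2_diff M (S u) (T u))"
proof -
  interpret ring "LO M" by (rule L2_operators_ring)
  have "\<ominus>\<^bsub>LO M\<^esub> T = (\<lambda>u\<in>L2 M. L2_scale M (-1) (T u))"
    by (rule minus_equality) (use assms in \<open>auto simp: bop_smult bop_in L2_add_inverse intro!: restrict_ext\<close>)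
  then show ?thesis by (auto simp: a_minus_def L2_diff_def intro!: restrict_ext)
qed

lemma opn_minus:
  assumes "bounded_op M S" "bounded_op M T"
  shows "u \<in> L2 M \<Longrightarrow> L2_dist M (S u) (T u) \<le> opn M (S \<ominus>\<^bsub>LO M\<^esub> T) * L2_norm M u"
    "0 \<le> opn M (S \<ominus>\<^bsub>LO M\<^esub> T)"
    "0 \<le> e \<Longrightarrow> (\<And>u. u \<in> L2 M \<Longrightarrow> L2_dist M (S u) (T u) \<le> e * L2_norm M u) \<Longrightarrow> opn M (S \<ominus>\<^bsub>LO M\<^esub> T) \<le> e"
proof -
  interpret ring "LO M" by (rule L2_operators_ring)
  have b: "bounded_op M (S \<ominus>\<^bsub>LO M\<^esub> T)" using minus_closed[of S T] assms by simp
  show "L2_dist M (S u) (T u) \<le> opn M (S \<ominus>\<^bsub>LO M\<^esub> T) * L2_norm M u" if "u \<in> L2 M"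
    using opn_bound[OF b that] that by (simp add: L2_operators_minus[OF assms])
  show "0 \<le> opn M (S \<ominus>\<^bsub>LO M\<^esub> T)" by (rule opn_nonneg[OF b])
  show "opn M (S \<ominus>\<^bsub>LO M\<^esub> T) \<le> e" if "0 \<le> e" "\<And>u. u \<in> L2 M \<Longrightarrow> L2_dist M (S u) (T u) \<le> e * L2_norm M u"
    unfolding L2_operators_minus[OF assms] by (rule opn_le) (use that in auto)
qed

text \<open>Existence of an adjoint is built into the carrier instead of being derived for every
  bounded operator. The restricted algebra is complete, and all operators of interest come with
  their adjoints.\<close>

definition adjointables :: "'x measure \<Rightarrow> 'x L2_op set" where
  "adjointables M = {T. \<exists>T'. adjoint_of M T T'}"

definition BL :: "'x measure \<Rightarrow> 'x L2_op cstar" where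
  "BL M = LO M\<lparr>carrier := adjointables M\<rparr>"

lemma BL_simps [simp]:
  "carrier (BL M) = adjointables M"
  "S \<otimes>\<^bsub>BL M\<^esub> T = S \<otimes>\<^bsub>LO M\<^esub> T"
  "\<one>\<^bsub>BL M\<^esub> = \<one>\<^bsub>LO M\<^esub>"
  "\<zero>\<^bsub>BL M\<^esub> = \<zero>\<^bsub>LO M\<^esub>"
  "S \<oplus>\<^bsub>BL M\<^esub> T = S \<oplus>\<^bsub>LO M\<^esub> T"
  "c \<odot>\<^bsub>BL M\<^esub> T = c \<odot>\<^bsub>LO M\<^esub> T"
  "cstar_adj (BL M) T = cstar_adj (LO M) T"
  "cstar_norm (BL M) T = opn M T"
  by (simp_all add: BL_def)

lemma adjointable_bounded: "T \<in> adjointables M \<Longrightarrow> bounded_op M T"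
  by (auto simp: adjointables_def adjoint_of_def)

lemma adjoint_of_bounded: "adjoint_of M T T' \<Longrightarrow> bounded_op M T" "adjoint_of M T T' \<Longrightarrow> bounded_op M T'"
  by (auto simp: adjoint_of_def)

lemma adjoint_of_adjointables: "adjoint_of M T T' \<Longrightarrow> T \<in> adjointables M"
  by (auto simp: adjointables_def)

lemma adjointables_adjoint: "T \<in> adjointables M \<Longrightarrow> adjoint_of M T (cstar_adj (LO M) T)"
  by (auto simp: adjointables_def dest: cstar_adj_eqI)

lemma adjointables_subring: "subring (adjointables M) (LO M)"
proof -
  interpret ring "LO M" by (rule L2_operators_ring)
  show ?thesis
  proof (rule subringI)
    show "adjointables M \<subseteq> carrier (LO M)" using adjointable_bounded by auto
    show "\<one>\<^bsub>LO M\<^esub> \<in> adjointables M" using adjoint_of_adjointables[OF adjoint_one] by simp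
  next
    fix T assume T: "T \<in> adjointables M"
    have "\<ominus>\<^bsub>LO M\<^esub> T = (\<lambda>u\<in>L2 M. L2_scale M (-1) (T u))"
      by (rule minus_equality) (use adjointable_bounded[OF T] in \<open>auto simp: bop_smult bop_in L2_add_inverse intro!: restrict_ext\<close>)
    then show "\<ominus>\<^bsub>LO M\<^esub> T \<in> adjointables M"
      using adjoint_of_adjointables[OF adjoint_smult[OF adjointables_adjoint[OF T]]] by simp
  next
    fix S T assume ST: "S \<in> adjointables M" "T \<in> adjointables M"
    show "S \<otimes>\<^bsub>LO M\<^esub> T \<in> adjointables M"
      using adjoint_of_adjointables[OF adjoint_compose[OF ST[THEN adjointables_adjoint]]] by simp
    show "S \<oplus>\<^bsub>LO M\<^esub> T \<in> adjointables M"
      using adjoint_of_adjointables[OF adjoint_plus[OF ST[THEN adjointables_adjoint]]] by simp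
  qed
qed

lemma BL_minus: "S \<in> adjointables M \<Longrightarrow> T \<in> adjointables M \<Longrightarrow> S \<ominus>\<^bsub>BL M\<^esub> T = S \<ominus>\<^bsub>LO M\<^esub> T"
  unfolding BL_def by (rule ring.subring_minus[OF L2_operators_ring adjointables_subring])

lemma opn_eq_zero: assumes "bounded_op M T" "opn M T = 0" shows "T = \<zero>\<^bsub>LO M\<^esub>"
proof (rule bop_eqI[OF assms(1)])
  show "bounded_op M \<zero>\<^bsub>LO M\<^esub>" by (simp add: bop_zero)
  fix u assume u: "u \<in> L2 M"
  have "L2_norm M (T u) = 0" using opn_bound[OF assms(1) u] assms(2) L2_norm_nonneg[of M "T u"] by simp
  then show "T u = \<zero>\<^bsub>LO M\<^esub> u" using L2_norm_eq_zero[OF bop_in[OF assms(1) u]] u by simp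
qed

text \<open>The defining identity holds along the sequences, and the two inner products differ from
  their limits by at most \<open>e\<close> times the norms of \<open>u\<close> and
  \<open>v\<close>.\<close>

lemma adjoint_limit:
  assumes X: "\<And>n::nat. adjoint_of M (X n) (X' n)" and T: "bounded_op M T" "bounded_op M T'"
    and c: "op_lim M X T"
    and c': "op_lim M X' T'"
  shows "adjoint_of M T T'"
  unfolding adjoint_of_def
proof (intro conjI ballI T)
  fix u v assume u: "u \<in> L2 M" and v: "v \<in> L2 M"
  let ?K = "2 * (L2_norm M u * L2_norm M v)"
  have le: "cmod (L2_inner M (T u) v - L2_inner M u (T' v)) \<le> e * ?K" if e: "0 < e" for e
  proof -
    obtain N N' where N: "\<forall>n\<ge>N. \<forall>u\<in>L2 M. L2_dist M (X n u) (T u) \<le> e * L2_norm M u"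
      and N': "\<forall>n\<ge>N'. \<forall>u\<in>L2 M. L2_dist M (X' n u) (T' u) \<le> e * L2_norm M u"
      using c[rule_format, OF e] c'[rule_format, OF e] by blast
    define n where "n = max N N'"
    have in2: "X n u \<in> L2 M" "X' n v \<in> L2 M" "T u \<in> L2 M" "T' v \<in> L2 M"
      using adjoint_of_bounded[OF X] T u v bop_in by blast+
    have "L2_inner M (X n u) v = L2_inner M u (X' n v)" using X[of n] u v by (simp add: adjoint_of_def)
    then have "L2_inner M (T u) v - L2_inner M u (T' v) = L2_inner M u (L2_diff M (X' n v) (T' v)) - L2_inner M (L2_diff M (X n u) (T u)) v"
      using in2 u v by (simp add: L2_diff_def L2_inner_add L2_inner_add_right L2_inner_scale L2_inner_scale_right)
    also have "cmod \<dots> \<le> cmod (L2_inner M u (L2_diff M (X' n v) (T' v))) + cmod (L2_inner M (L2_diff M (X n u) (T u)) v)"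
      by (rule norm_triangle_ineq4)
    also have "\<dots> \<le> L2_norm M u * L2_dist M (X' n v) (T' v) + L2_dist M (X n u) (T u) * L2_norm M v"
      using in2 u v by (intro add_mono L2_cauchy_schwarz) auto
    also have "\<dots> \<le> L2_norm M u * (e * L2_norm M v) + (e * L2_norm M u) * L2_norm M v"
      using N N' u v by (intro add_mono mult_left_mono mult_right_mono) (auto simp: n_def)
    finally show ?thesis by (simp add: algebra_simps)
  qed
  have "cmod (L2_inner M (T u) v - L2_inner M u (T' v)) \<le> 0 + e" if e: "0 < e" for e
  proof -
    have K: "0 \<le> ?K" by simp
    have K1: "0 < ?K + 1" by (rule add_nonneg_pos[OF K zero_less_one])
    have "cmod (L2_inner M (T u) v - L2_inner M u (T' v)) \<le> e / (?K + 1) * ?K" using e K1 by (intro le divide_pos_pos)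
    also have "\<dots> = e * (?K / (?K + 1))" by simp
    also have "\<dots> \<le> e * 1" using e K1 by (intro mult_left_mono) (simp_all add: divide_le_eq_1)
    finally show ?thesis by simp
  qed
  then have "cmod (L2_inner M (T u) v - L2_inner M u (T' v)) \<le> 0" by (rule field_le_epsilon)
  then show "L2_inner M (T u) v = L2_inner M u (T' v)" by simp
qed

theorem BL_cstar_algebra: "cstar_algebra (BL M)"
proof -
  interpret L: ring "LO M" by (rule L2_operators_ring)
  interpret B: ring "BL M" unfolding BL_def by (rule L.subring_is_ring[OF adjointables_subring])
  have b: "T \<in> adjointables M \<Longrightarrow> bounded_op M T" for T by (rule adjointable_bounded)
  have sm: "(\<lambda>u\<in>L2 M. L2_scale M c (T u)) \<in> adjointables M" if "T \<in> adjointables M" for c T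
    by (rule adjoint_of_adjointables[OF adjoint_smult[OF adjointables_adjoint[OF that]]])
  have "Module.module complex_ring (BL M)"
  proof (rule moduleI[OF complex_ring_cring B.abelian_group_axioms])
  qed (auto simp: sm complex_ring_def b bop_in L2_scale_add_left L2_scale_add L2_scale_scale intro!: restrict_ext bop_eqI[of M] bop_smult)
  moreover have "cstar_algebra_axioms (BL M)"
  proof unfold_locales
    fix S T :: "'a L2_op" and c
    assume S: "S \<in> carrier (BL M)" and T: "T \<in> carrier (BL M)"
    have bST: "bounded_op M S" "bounded_op M T" using S T b by auto
    note adj = adjointables_adjoint[OF S[simplified]] adjointables_adjoint[OF T[simplified]]
    show "(c \<odot>\<^bsub>BL M\<^esub> S) \<otimes>\<^bsub>BL M\<^esub> T = c \<odot>\<^bsub>BL M\<^esub> (S \<otimes>\<^bsub>BL M\<^esub> T)" "S \<otimes>\<^bsub>BL M\<^esub> (c \<odot>\<^bsub>BL M\<^esub> T) = c \<odot>\<^bsub>BL M\<^esub> (S \<otimes>\<^bsub>BL M\<^esub> T)"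
      using bST by (auto simp: compose_def bop_in bop_scale intro!: restrict_ext)
    show "cstar_adj (BL M) (S \<oplus>\<^bsub>BL M\<^esub> T) = cstar_adj (BL M) S \<oplus>\<^bsub>BL M\<^esub> cstar_adj (BL M) T"
      using cstar_adj_eqI[OF adjoint_plus[OF adj]] by simp
    show "cstar_adj (BL M) (S \<otimes>\<^bsub>BL M\<^esub> T) = cstar_adj (BL M) T \<otimes>\<^bsub>BL M\<^esub> cstar_adj (BL M) S"
      using cstar_adj_eqI[OF adjoint_compose[OF adj]] by simp
    show "cstar_norm (BL M) (S \<oplus>\<^bsub>BL M\<^esub> T) \<le> cstar_norm (BL M) S + cstar_norm (BL M) T"
      unfolding BL_simps L2_operators_simps
    proof (rule opn_le)
      show "0 \<le> opn M S + opn M T" using opn_nonneg[OF bST(1)] opn_nonneg[OF bST(2)] by simp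
      fix u assume u: "u \<in> L2 M"
      show "L2_norm M ((\<lambda>u\<in>L2 M. L2_add M (S u) (T u)) u) \<le> (opn M S + opn M T) * L2_norm M u"
        using L2_norm_triangle[OF bop_in[OF bST(1) u] bop_in[OF bST(2) u]] opn_bound[OF bST(1) u] opn_bound[OF bST(2) u] u
        by (simp add: distrib_right)
    qed
    show "cstar_norm (BL M) (S \<otimes>\<^bsub>BL M\<^esub> T) \<le> cstar_norm (BL M) S * cstar_norm (BL M) T"
      unfolding BL_simps L2_operators_simps
      by (rule opn_le[OF _ bop_compose_bound[OF bST]]) (use opn_nonneg[OF bST(1)] opn_nonneg[OF bST(2)] in simp)
  next
    fix S :: "'a L2_op" and c
    assume S: "S \<in> carrier (BL M)"
    have bS: "bounded_op M S" using S b by auto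
    note adj = adjointables_adjoint[OF S[simplified]]
    show "cstar_adj (BL M) S \<in> carrier (BL M)" using adjoint_of_adjointables[OF adjoint_sym[OF adj]] by simp
    show "cstar_adj (BL M) (cstar_adj (BL M) S) = S" using cstar_adj_eqI[OF adjoint_sym[OF adj]] by simp
    show "cstar_adj (BL M) (c \<odot>\<^bsub>BL M\<^esub> S) = cnj c \<odot>\<^bsub>BL M\<^esub> cstar_adj (BL M) S"
      using cstar_adj_eqI[OF adjoint_smult[OF adj]] by simp
    show "0 \<le> cstar_norm (BL M) S" using opn_nonneg[OF bS] by simp
    show "cstar_norm (BL M) S = 0 \<longleftrightarrow> S = \<zero>\<^bsub>BL M\<^esub>"
    proof
      assume "cstar_norm (BL M) S = 0"
      then show "S = \<zero>\<^bsub>BL M\<^esub>" using opn_eq_zero[OF bS] by simp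
    next
      assume "S = \<zero>\<^bsub>BL M\<^esub>"
      then have "opn M S \<le> 0" by (intro opn_le) auto
      then show "cstar_norm (BL M) S = 0" using opn_nonneg[OF bS] by simp
    qed
    have le: "opn M (\<lambda>u\<in>L2 M. L2_scale M d (R u)) \<le> cmod d * opn M R"
      if R: "bounded_op M R" for d R
    proof (rule opn_le)
      fix u assume u: "u \<in> L2 M"
      show "L2_norm M ((\<lambda>u\<in>L2 M. L2_scale M d (R u)) u) \<le> cmod d * opn M R * L2_norm M u"
        using mult_left_mono[OF opn_bound[OF R u], of "cmod d"] u by (simp add: L2_norm_scale bop_in[OF R u] mult.assoc)
    qed (use opn_nonneg[OF R] in simp)
    show "cstar_norm (BL M) (c \<odot>\<^bsub>BL M\<^esub> S) = cmod c * cstar_norm (BL M) S"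
      unfolding BL_simps L2_operators_simps
    proof (cases "c = 0")
      case True
      have "opn M (\<lambda>u\<in>L2 M. L2_scale M c (S u)) = 0"
        using le[OF bS, of c] True opn_nonneg[OF bop_smult[OF bS], of c] by simp
      then show "opn M (\<lambda>u\<in>L2 M. L2_scale M c (S u)) = cmod c * opn M S" using True by simp
    next
      case False
      \<comment> \<open>The reverse inequality is the same estimate for the scalar
        \<open>1 / c\<close>.\<close>
      have "(\<lambda>u\<in>L2 M. L2_scale M (1/c) ((\<lambda>u\<in>L2 M. L2_scale M c (S u)) u)) = S"
        using False bS by (intro bop_eqI[of M] bop_smult) (auto simp: bop_in L2_scale_scale)
      then have "opn M S \<le> cmod (1/c) * opn M (\<lambda>u\<in>L2 M. L2_scale M c (S u))"
        using le[OF bop_smult[OF bS], of "1/c" c] by simp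
      then have "cmod c * opn M S \<le> opn M (\<lambda>u\<in>L2 M. L2_scale M c (S u))"
        using False by (simp add: norm_divide field_simps)
      then show "opn M (\<lambda>u\<in>L2 M. L2_scale M c (S u)) = cmod c * opn M S"
        using le[OF bS, of c] by simp
    qed
    show "cstar_norm (BL M) (cstar_adj (BL M) S \<otimes>\<^bsub>BL M\<^esub> S) = (cstar_norm (BL M) S)\<^sup>2"
      using opn_cstar[OF adj] by simp
  next
    fix X :: "nat \<Rightarrow> 'a L2_op"
    assume X: "range X \<subseteq> carrier (BL M)"
      and C: "\<And>e::real. 0 < e \<Longrightarrow> \<exists>N. \<forall>m\<ge>N. \<forall>n\<ge>N. cstar_norm (BL M) (X m \<ominus>\<^bsub>BL M\<^esub> X n) < e"
    have XA: "X n \<in> adjointables M" for n using X by auto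
    define X' where "X' n = cstar_adj (LO M) (X n)" for n
    have adj: "adjoint_of M (X n) (X' n)" for n unfolding X'_def by (rule adjointables_adjoint[OF XA])
    have X'A: "X' n \<in> adjointables M" for n by (rule adjoint_of_adjointables[OF adjoint_sym[OF adj]])
    \<comment> \<open>A difference of adjoints is the adjoint of the difference, so the adjoints
      form a Cauchy sequence as well and have a limit of their own.\<close>
    have adjd: "opn M (X' m \<ominus>\<^bsub>LO M\<^esub> X' n) \<le> opn M (X m \<ominus>\<^bsub>LO M\<^esub> X n)" for m n
    proof -
      have "adjoint_of M (\<lambda>u\<in>L2 M. L2_add M (X m u) ((\<lambda>u\<in>L2 M. L2_scale M (-1) (X n u)) u)) (\<lambda>u\<in>L2 M. L2_add M (X' m u) ((\<lambda>u\<in>L2 M. L2_scale M (cnj (-1)) (X' n u)) u))"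
        by (intro adjoint_plus adjoint_smult adj)
      moreover have "(\<lambda>u\<in>L2 M. L2_add M (X m u) ((\<lambda>u\<in>L2 M. L2_scale M (-1) (X n u)) u)) = X m \<ominus>\<^bsub>LO M\<^esub> X n"
        using L2_operators_minus[OF b[OF XA] b[OF XA], of m n] by (auto simp: L2_diff_def intro!: restrict_ext)
      moreover have "(\<lambda>u\<in>L2 M. L2_add M (X' m u) ((\<lambda>u\<in>L2 M. L2_scale M (cnj (-1)) (X' n u)) u)) = X' m \<ominus>\<^bsub>LO M\<^esub> X' n"
        using L2_operators_minus[OF b[OF X'A] b[OF X'A], of m n] by (auto simp: L2_diff_def intro!: restrict_ext)
      ultimately show ?thesis using opn_adjoint_le by metis
    qed
    have C1: "\<exists>N. \<forall>m\<ge>N. \<forall>n\<ge>N. opn M (X m \<ominus>\<^bsub>LO M\<^esub> X n) < e" if "0 < e" for e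
      using C[OF that] by (simp add: BL_minus XA)
    have C2: "\<exists>N. \<forall>m\<ge>N. \<forall>n\<ge>N. \<forall>u\<in>L2 M. L2_dist M (X m u) (X n u) \<le> e * L2_norm M u
        \<and> L2_dist M (X' m u) (X' n u) \<le> e * L2_norm M u" if e: "0 < e" for e
    proof -
      obtain N where N: "\<And>m n. m \<ge> N \<Longrightarrow> n \<ge> N \<Longrightarrow> opn M (X m \<ominus>\<^bsub>LO M\<^esub> X n) < e"
        using C1[OF e] by blast
      show ?thesis
      proof (intro exI[of _ N] allI impI ballI conjI)
        fix m n u assume mn: "N \<le> m" "N \<le> n" and u: "u \<in> L2 M"
        show "L2_dist M (X m u) (X n u) \<le> e * L2_norm M u"
          using N[OF mn] by (intro order_trans[OF opn_minus(1)[OF b[OF XA] b[OF XA] u]] mult_right_mono) auto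
        show "L2_dist M (X' m u) (X' n u) \<le> e * L2_norm M u"
          using N[OF mn] adjd[of m n] by (intro order_trans[OF opn_minus(1)[OF b[OF X'A] b[OF X'A] u]] mult_right_mono) auto
      qed
    qed
    have C2a: "\<exists>N. \<forall>m\<ge>N. \<forall>n\<ge>N. \<forall>u\<in>L2 M. L2_dist M (X m u) (X n u) \<le> e * L2_norm M u"
      and C2b: "\<exists>N. \<forall>m\<ge>N. \<forall>n\<ge>N. \<forall>u\<in>L2 M. L2_dist M (X' m u) (X' n u) \<le> e * L2_norm M u"
      if "0 < e" for e using C2[OF that] by fast+
    obtain T where T: "bounded_op M T" "op_lim M X T"
      using bop_complete[OF b[OF XA] C2a] by blast
    obtain T' where T': "bounded_op M T'" "op_lim M X' T'"
      using bop_complete[OF b[OF X'A] C2b] by blast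
    have TA: "T \<in> adjointables M"
      by (rule adjoint_of_adjointables[OF adjoint_limit[OF adj T(1) T'(1) T(2) T'(2)]])
    show "\<exists>T\<in>carrier (BL M). (\<lambda>n. cstar_norm (BL M) (X n \<ominus>\<^bsub>BL M\<^esub> T)) \<longlonglongrightarrow> 0"
    proof (rule bexI[of _ T])
      show "(\<lambda>n. cstar_norm (BL M) (X n \<ominus>\<^bsub>BL M\<^esub> T)) \<longlonglongrightarrow> 0"
      proof (rule LIMSEQ_I)
        fix e :: real assume e: "0 < e"
        obtain N where N: "\<forall>n\<ge>N. \<forall>u\<in>L2 M. L2_dist M (X n u) (T u) \<le> e/2 * L2_norm M u"
          using T(2)[rule_format, of "e/2"] e by auto
        have "norm (cstar_norm (BL M) (X n \<ominus>\<^bsub>BL M\<^esub> T) - 0) < e" if n: "n \<ge> N" for n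
        proof -
          have "opn M (X n \<ominus>\<^bsub>LO M\<^esub> T) \<le> e/2" by (rule opn_minus(3)[OF b[OF XA] T(1)]) (use e N n in auto)
          then show ?thesis using opn_minus(2)[OF b[OF XA] T(1)] e by (simp add: BL_minus[OF XA TA])
        qed
        then show "\<exists>no. \<forall>n\<ge>no. norm (cstar_norm (BL M) (X n \<ominus>\<^bsub>BL M\<^esub> T) - 0) < e" by blast
      qed
    qed (use TA in simp)
  qed
  ultimately show ?thesis by (intro cstar_algebra.intro B.ring_axioms)
qed

section \<open>Moebius transformations of the closed ball and their conformal factor\<close>

subsection \<open>The group \<open>PSL(2,\<complex>)\<close>\<close>

definition psl :: "complex^2^2 \<Rightarrow> psl2" where
  "psl A = {A, - A}"

lemma neg_matrix_mult: "(- A) ** B = - (A ** (B :: complex^2^2))" "A ** (- B) = - (A ** (B :: complex^2^2))"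
  by (simp_all add: matrix_matrix_mult_def vec_eq_iff sum_negf)

lemma det_neg_2: "det (- A) = det (A :: complex^2^2)"
  by (simp add: det_2)

lemma SL2C_group: "group SL2C"
proof (rule groupI)
  fix A assume "A \<in> carrier SL2C"
  then have d: "det A = 1" by (simp add: SL2C_def)
  then obtain B where B: "A ** B = mat 1" "B ** A = mat 1" using invertible_det_nz[of A] by (auto simp: invertible_def)
  then have "det B = 1" using det_mul[of B A] d by simp
  then show "\<exists>B\<in>carrier SL2C. B \<otimes>\<^bsub>SL2C\<^esub> A = \<one>\<^bsub>SL2C\<^esub>" using B by (auto simp: SL2C_def)
qed (auto simp: SL2C_def det_mul matrix_mul_assoc)

lemma center_normal: "{mat 1, - mat 1} \<lhd> SL2C"
proof -
  interpret group SL2C by (rule SL2C_group)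
  have sub: "subgroup {mat 1, - mat 1} SL2C"
  proof (rule subgroupI)
    show "{mat 1, - mat 1} \<subseteq> carrier SL2C" by (auto simp: SL2C_def det_neg_2)
    fix A assume A: "A \<in> {mat 1 :: complex^2^2, - mat 1}"
    have "inv\<^bsub>SL2C\<^esub> A = A" by (rule inv_equality) (use A in \<open>auto simp: SL2C_def det_neg_2 neg_matrix_mult\<close>)
    then show "inv\<^bsub>SL2C\<^esub> A \<in> {mat 1, - mat 1}" using A by simp
  qed (auto simp: SL2C_def neg_matrix_mult)
  show ?thesis
    by (rule normalI[OF sub]) (auto simp: r_coset_def l_coset_def SL2C_def neg_matrix_mult)
qed

lemma PSL2C_group: "group PSL2C"
  unfolding PSL2C_def by (rule normal.factorgroup_is_group[OF center_normal])

lemma PSL2C_carrier: "carrier PSL2C = psl ` {A. det A = 1}"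
  by (auto simp: PSL2C_def FactGroup_def RCOSETS_def r_coset_def SL2C_def psl_def neg_matrix_mult)

lemma PSL2C_mult: "psl A \<otimes>\<^bsub>PSL2C\<^esub> psl B = psl (A ** B)"
  by (auto simp: PSL2C_def FactGroup_def set_mult_def SL2C_def psl_def neg_matrix_mult)

lemma PSL2C_one: "\<one>\<^bsub>PSL2C\<^esub> = psl (mat 1)"
  by (auto simp: PSL2C_def FactGroup_def psl_def)

abbreviation gmult (infixl "\<ast>" 70) where "\<gamma> \<ast> \<eta> \<equiv> \<gamma> \<otimes>\<^bsub>PSL2C\<^esub> \<eta>"
abbreviation "ginv \<gamma> \<equiv> inv\<^bsub>PSL2C\<^esub> \<gamma>"
abbreviation "gunit \<equiv> \<one>\<^bsub>PSL2C\<^esub>"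

lemma PSL2C_cases:
  assumes "\<gamma> \<in> carrier PSL2C" obtains A where "det A = 1" "\<gamma> = psl A"
  using assms by (auto simp: PSL2C_carrier)

subsection \<open>The action on the closed ball\<close>

definition hal :: "complex^2^2 \<Rightarrow> pt \<Rightarrow> real" where
  "hal A p = (cmod (A$1$1))\<^sup>2 * (1 + snd p) + (cmod (A$1$2))\<^sup>2 * (1 - snd p) + 2 * Re (A$1$1 * fst p * cnj (A$1$2))"

definition hbe :: "complex^2^2 \<Rightarrow> pt \<Rightarrow> real" where
  "hbe A p = (cmod (A$2$1))\<^sup>2 * (1 + snd p) + (cmod (A$2$2))\<^sup>2 * (1 - snd p) + 2 * Re (A$2$1 * fst p * cnj (A$2$2))"

definition hze :: "complex^2^2 \<Rightarrow> pt \<Rightarrow> complex" where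
  "hze A p = A$1$1 * cnj (A$2$1) * of_real (1 + snd p) + A$1$2 * cnj (A$2$2) * of_real (1 - snd p)
    + A$1$1 * cnj (A$2$2) * fst p + A$1$2 * cnj (A$2$1) * cnj (fst p)"

text \<open>With \<open>N\<^sub>p = (1 + t, z; cnj z, 1 - t)\<close>, the matrix \<open>A N\<^sub>p A\<^sup>*\<close> is
  \<open>(hal, hze; cnj hze, hbe)\<close>; half its trace is the inverse of the conformal factor.\<close>

definition tau :: "complex^2^2 \<Rightarrow> pt \<Rightarrow> real" where
  "tau A p = (hal A p + hbe A p) / 2"

definition mob :: "complex^2^2 \<Rightarrow> pt \<Rightarrow> pt" where
  "mob A p = (hze A p / of_real (tau A p), (hal A p - hbe A p) / (2 * tau A p))"

text \<open>\<open>gal\<close>, \<open>gbe\<close> and \<open>gze\<close> are the two diagonal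
  entries and the upper off-diagonal entry of \<open>M\<close> times its conjugate transpose;
  \<open>gal + gbe\<close> is the trace.\<close>

definition gal :: "complex^2^2 \<Rightarrow> real" where "gal M = (cmod (M$1$1))\<^sup>2 + (cmod (M$1$2))\<^sup>2"
definition gbe :: "complex^2^2 \<Rightarrow> real" where "gbe M = (cmod (M$2$1))\<^sup>2 + (cmod (M$2$2))\<^sup>2"
definition gze :: "complex^2^2 \<Rightarrow> complex" where "gze M = M$1$1 * cnj (M$2$1) + M$1$2 * cnj (M$2$2)"

lemma ball_point_eq:
  "ball_point M = (2 * gze M / of_real (gal M + gbe M), (gal M - gbe M) / (gal M + gbe M))"
proof -
  let ?N = "M ** (\<chi> i j. cnj (M $ j $ i))"
  have N: "?N $ 1 $ 1 = of_real (gal M)" "?N $ 2 $ 2 = of_real (gbe M)" "?N $ 1 $ 2 = gze M"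
    by (simp_all add: matrix_matrix_mult_def sum_2 gal_def gbe_def gze_def complex_norm_square[symmetric])
  have "trace ?N = of_real (gal M + gbe M)" by (simp add: trace_def sum_2 N)
  moreover have "?N $ 1 $ 1 - ?N $ 2 $ 2 = of_real (gal M - gbe M)" by (simp add: N)
  ultimately have "(?N $ 1 $ 1 - ?N $ 2 $ 2) / trace ?N = of_real ((gal M - gbe M) / (gal M + gbe M))"
    by (simp only: of_real_divide)
  then have "Re ((?N $ 1 $ 1 - ?N $ 2 $ 2) / trace ?N) = (gal M - gbe M) / (gal M + gbe M)" by (simp only: Re_complex_of_real)
  then show ?thesis unfolding ball_point_def Let_def \<open>trace ?N = _\<close> N(3) by simp
qed

lemma gal_gbe_pos: assumes "M \<noteq> 0" shows "0 < gal M + gbe M"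
proof -
  have "0 \<le> gal M + gbe M" by (simp add: gal_def gbe_def)
  moreover have "gal M + gbe M \<noteq> 0"
  proof
    assume "gal M + gbe M = 0"
    then have "M$1$1 = 0 \<and> M$1$2 = 0 \<and> M$2$1 = 0 \<and> M$2$2 = 0"
      by (simp add: gal_def gbe_def add_nonneg_eq_0_iff)
    then have "M = 0" by (simp add: vec_eq_iff forall_2)
    with assms show False by simp
  qed
  ultimately show ?thesis by simp
qed

lemma gal_mult: "gal (A ** M) = (cmod (A$1$1))\<^sup>2 * gal M + (cmod (A$1$2))\<^sup>2 * gbe M + 2 * Re (A$1$1 * gze M * cnj (A$1$2))"
proof -
  have "complex_of_real (gal (A ** M)) = of_real ((cmod (A$1$1))\<^sup>2 * gal M + (cmod (A$1$2))\<^sup>2 * gbe M) + (A$1$1 * gze M * cnj (A$1$2) + cnj (A$1$1 * gze M * cnj (A$1$2)))"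
    by (simp add: gal_def gbe_def gze_def matrix_matrix_mult_def sum_2 complex_norm_square[unfolded of_real_power] algebra_simps)
  also have "A$1$1 * gze M * cnj (A$1$2) + cnj (A$1$1 * gze M * cnj (A$1$2)) = of_real (2 * Re (A$1$1 * gze M * cnj (A$1$2)))"
    by (rule complex_add_cnj)
  finally show ?thesis by (simp only: of_real_add[symmetric] of_real_eq_iff)
qed

lemma gbe_mult: "gbe (A ** M) = (cmod (A$2$1))\<^sup>2 * gal M + (cmod (A$2$2))\<^sup>2 * gbe M + 2 * Re (A$2$1 * gze M * cnj (A$2$2))"
proof -
  have "complex_of_real (gbe (A ** M)) = of_real ((cmod (A$2$1))\<^sup>2 * gal M + (cmod (A$2$2))\<^sup>2 * gbe M) + (A$2$1 * gze M * cnj (A$2$2) + cnj (A$2$1 * gze M * cnj (A$2$2)))"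
    by (simp add: gal_def gbe_def gze_def matrix_matrix_mult_def sum_2 complex_norm_square[unfolded of_real_power] algebra_simps)
  also have "A$2$1 * gze M * cnj (A$2$2) + cnj (A$2$1 * gze M * cnj (A$2$2)) = of_real (2 * Re (A$2$1 * gze M * cnj (A$2$2)))"
    by (rule complex_add_cnj)
  finally show ?thesis by (simp only: of_real_add[symmetric] of_real_eq_iff)
qed

lemma gze_mult: "gze (A ** M) = A$1$1 * cnj (A$2$1) * of_real (gal M) + A$1$2 * cnj (A$2$2) * of_real (gbe M)
    + A$1$1 * cnj (A$2$2) * gze M + A$1$2 * cnj (A$2$1) * cnj (gze M)"
  by (simp add: gal_def gbe_def gze_def matrix_matrix_mult_def sum_2 complex_norm_square[unfolded of_real_power] algebra_simps)

text \<open>The Hermitian matrix of the point \<open>ball_point M\<close> is \<open>M\<close> times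
  its conjugate transpose, scaled by \<open>k\<close> to have trace 2. Acting with \<open>A\<close>
  replaces \<open>M\<close> by \<open>A ** M\<close> and keeps the factor \<open>k\<close>.\<close>

lemma h_ball_point:
  assumes "M \<noteq> 0"
  defines "k \<equiv> 2 / (gal M + gbe M)"
  shows "hal A (ball_point M) = k * gal (A ** M)" "hbe A (ball_point M) = k * gbe (A ** M)"
    "hze A (ball_point M) = of_real k * gze (A ** M)"
proof -
  have pos: "gal M + gbe M \<noteq> 0" using gal_gbe_pos[OF assms(1)] by simp
  have e: "1 + snd (ball_point M) = k * gal M" "1 - snd (ball_point M) = k * gbe M" "fst (ball_point M) = of_real k * gze M"
    using pos by (auto simp: ball_point_eq k_def field_simps)
  have re: "Re (x * (of_real k * y) * z) = k * Re (x * y * z)" for x y z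
  proof -
    have "x * (of_real k * y) * z = of_real k * (x * y * z)" by (simp add: mult_ac)
    moreover have "Re (of_real k * w) = k * Re w" for w by simp
    ultimately show ?thesis by (simp only:)
  qed
  show "hal A (ball_point M) = k * gal (A ** M)"
    unfolding hal_def gal_mult e re by (simp add: algebra_simps)
  show "hbe A (ball_point M) = k * gbe (A ** M)"
    unfolding hbe_def gbe_mult e re by (simp add: algebra_simps)
  show "hze A (ball_point M) = of_real k * gze (A ** M)"
    unfolding hze_def gze_mult e by (simp add: algebra_simps)
qed

lemma mob_ball_point:
  assumes "M \<noteq> 0" shows "mob A (ball_point M) = ball_point (A ** M)"
proof -
  define k where "k = 2 / (gal M + gbe M)"
  have k: "k \<noteq> 0" using gal_gbe_pos[OF assms] by (simp add: k_def)
  note h = h_ball_point[OF assms, folded k_def]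
  let ?a = "gal (A ** M)" and ?b = "gbe (A ** M)"
  have t: "tau A (ball_point M) = k * ((?a + ?b) / 2)" by (simp add: tau_def h distrib_left)
  have "of_real k * gze (A ** M) / of_real (k * ((?a + ?b) / 2)) = gze (A ** M) / of_real ((?a + ?b) / 2)"
    using k by (simp only: of_real_mult) simp
  also have "\<dots> = 2 * gze (A ** M) / of_real (?a + ?b)" by (simp add: mult.commute)
  finally have f1: "of_real k * gze (A ** M) / of_real (k * ((?a + ?b) / 2)) = 2 * gze (A ** M) / of_real (?a + ?b)" .
  have f2: "(k * ?a - k * ?b) / (2 * (k * ((?a + ?b) / 2))) = (?a - ?b) / (?a + ?b)"
    using k by (simp flip: right_diff_distrib distrib_left)
  show ?thesis unfolding mob_def t h ball_point_eq[of "A ** M"] f1 f2 ..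
qed

text \<open>In this form \<open>tau\<close> is a quotient of two half traces, from which its
  positivity and the cocycle identity can be read off.\<close>

lemma tau_ball_point:
  assumes "M \<noteq> 0"
  shows "tau A (ball_point M) = ((gal (A ** M) + gbe (A ** M)) / 2) / ((gal M + gbe M) / 2)"
proof -
  have "(2 / r * x + 2 / r * y) / 2 = ((x + y) / 2) / (r / 2)" for r x y :: real
    by (simp add: add_divide_distrib)
  then show ?thesis unfolding tau_def h_ball_point[OF assms] .
qed

lemma mem_cball_pt: "p \<in> cball (0 :: pt) 1 \<longleftrightarrow> (cmod (fst p))\<^sup>2 + (snd p)\<^sup>2 \<le> 1"
  by (simp add: dist_prod_def norm_prod_def[symmetric] norm_prod_def)

lemma mem_sphere_pt: "p \<in> sphere (0 :: pt) 1 \<longleftrightarrow> (cmod (fst p))\<^sup>2 + (snd p)\<^sup>2 = 1"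
  by (simp add: norm_prod_def)

lemma gze_bound: "(cmod (gze M))\<^sup>2 \<le> gal M * gbe M"
proof -
  have "(cmod (gze M))\<^sup>2 \<le> (cmod (M$1$1) * cmod (M$2$1) + cmod (M$1$2) * cmod (M$2$2))\<^sup>2"
    unfolding gze_def by (intro power_mono order_trans[OF norm_triangle_ineq]) (auto simp: norm_mult)
  also have "\<dots> \<le> gal M * gbe M"
  proof -
    have "0 \<le> (cmod (M$1$1) * cmod (M$2$2) - cmod (M$1$2) * cmod (M$2$1))\<^sup>2" by simp
    then show ?thesis by (simp add: gal_def gbe_def power2_eq_square algebra_simps)
  qed
  finally show ?thesis .
qed

lemma ball_point_in_cball: assumes "M \<noteq> 0" shows "ball_point M \<in> cball 0 1"
proof -
  let ?s = "gal M + gbe M"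
  have s: "0 < ?s" by (rule gal_gbe_pos[OF assms])
  have "4 * (cmod (gze M))\<^sup>2 + (gal M - gbe M)\<^sup>2 \<le> ?s\<^sup>2"
    using gze_bound[of M] by (simp add: power2_eq_square algebra_simps)
  then have "(4 * (cmod (gze M))\<^sup>2 + (gal M - gbe M)\<^sup>2) / ?s\<^sup>2 \<le> 1" using s by (simp add: divide_le_eq_1)
  moreover have "(cmod (2 * gze M / of_real ?s))\<^sup>2 + ((gal M - gbe M) / ?s)\<^sup>2 = (4 * (cmod (gze M))\<^sup>2 + (gal M - gbe M)\<^sup>2) / ?s\<^sup>2"
    by (simp add: norm_divide norm_mult power_divide power_mult_distrib add_divide_distrib del: of_real_add)
  ultimately show ?thesis unfolding mem_cball_pt ball_point_eq by simp
qed

text \<open>\<open>M\<close> is the Cholesky factor of the Hermitian matrix of \<open>p\<close>; the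
  Schur complement \<open>c\<close> is nonnegative because \<open>p\<close> lies in the ball. The
  upper left entry vanishes only for \<open>t = -1\<close>, and then \<open>z = 0\<close>.\<close>

lemma ball_point_surj:
  assumes "p \<in> cball 0 1" shows "\<exists>M. M \<noteq> 0 \<and> ball_point M = p"
proof -
  obtain z t where p: "p = (z, t)" by (cases p)
  have zt: "(cmod z)\<^sup>2 + t\<^sup>2 \<le> 1" using assms unfolding mem_cball_pt p by simp
  have t1: "- 1 \<le> t" "t \<le> 1"
  proof -
    have "t\<^sup>2 \<le> 1" using zt zero_le_power2[of "cmod z"] by linarith
    then have "\<bar>t\<bar> \<le> 1" by (simp add: abs_square_le_1)
    then show "- 1 \<le> t" "t \<le> 1" by auto
  qed
  show ?thesis
  proof (cases "t = - 1")
    case True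
    then have z0: "z = 0" using zt by simp
    define M :: "complex^2^2" where "M = vector [vector [0, 0], vector [0, 1]]"
    have "gal M = 0" "gbe M = 1" "gze M = 0" by (simp_all add: M_def gal_def gbe_def gze_def vector_2)
    then have "M \<noteq> 0" "ball_point M = p" using True z0 p by (auto simp: ball_point_eq gbe_def)
    then show ?thesis by blast
  next
    case False
    define r where "r = sqrt (1 + t)"
    define c where "c = (1 - t) - (cmod z)\<^sup>2 / (1 + t)"
    have t: "0 < 1 + t" using t1 False by simp
    have r: "r\<^sup>2 = 1 + t" "r \<noteq> 0" using t by (auto simp: r_def)
    have "(cmod z)\<^sup>2 \<le> (1 - t) * (1 + t)" using zt by (simp add: power2_eq_square algebra_simps)
    then have c: "0 \<le> c" using t by (simp add: c_def divide_le_eq)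
    define M :: "complex^2^2" where "M = vector [vector [of_real r, 0], vector [cnj z / of_real r, of_real (sqrt c)]]"
    have g: "gal M = 1 + t" "gbe M = 1 - t" "gze M = z"
      using r c t by (simp_all add: M_def gal_def gbe_def gze_def vector_2 norm_divide power_divide c_def)
    have "M \<noteq> 0"
    proof
      assume "M = 0"
      then have "gal M = 0" by (simp add: gal_def)
      then show False using g t by simp
    qed
    moreover have "ball_point M = p" by (simp add: ball_point_eq g p)
    ultimately show ?thesis by blast
  qed
qed

lemma ball_point_neg: "ball_point (- M) = ball_point M"
  by (simp add: ball_point_eq gal_def gbe_def gze_def)

text \<open>The action is defined by two arbitrary choices. A sign change of the matrix cancels in
  \<open>ball_point\<close>, and \<open>mob_ball_point\<close> shows that the choice of
  \<open>M\<close> does not matter either.\<close>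

lemma psl_act_eq:
  assumes "p \<in> cball 0 1" shows "psl_act (psl A) p = mob A p"
proof -
  define B where "B = (SOME B. B \<in> psl A)"
  define M where "M = (SOME M. M \<noteq> 0 \<and> ball_point M = p)"
  have B: "B = A \<or> B = - A"
    using someI[of "\<lambda>B. B \<in> psl A" A] by (auto simp: B_def psl_def)
  have M: "M \<noteq> 0" "ball_point M = p" unfolding M_def using someI_ex[OF ball_point_surj[OF assms]] by auto
  have "psl_act (psl A) p = ball_point (B ** M)" by (simp add: psl_act_def B_def M_def)
  also have "\<dots> = ball_point (A ** M)" using B by (auto simp: neg_matrix_mult ball_point_neg)
  also have "\<dots> = mob A p" using mob_ball_point[OF M(1), of A] M by simp
  finally show ?thesis .
qed

lemma mult_nonzero: assumes "det A = 1" "M \<noteq> 0" shows "A ** M \<noteq> (0 :: complex^2^2)"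
proof
  assume z: "A ** M = 0"
  obtain B where "B ** A = mat 1" using assms(1) invertible_det_nz[of A] by (auto simp: invertible_def)
  then have "M = B ** (A ** M)" by (simp add: matrix_mul_assoc)
  also have "\<dots> = 0" unfolding z by (simp add: matrix_matrix_mult_def vec_eq_iff)
  finally show False using assms by simp
qed

lemma tau_pos: assumes "det A = 1" "p \<in> cball 0 1" shows "0 < tau A p"
proof -
  obtain M where M: "M \<noteq> 0" "ball_point M = p" using ball_point_surj[OF assms(2)] by blast
  have "tau A p = ((gal (A ** M) + gbe (A ** M)) / 2) / ((gal M + gbe M) / 2)"
    using tau_ball_point[OF M(1), of A] M(2) by simp
  also have "\<dots> > 0" using gal_gbe_pos[OF M(1)] gal_gbe_pos[OF mult_nonzero[OF assms(1) M(1)]] by simp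
  finally show ?thesis .
qed

lemma mob_in_cball: assumes "det A = 1" "p \<in> cball 0 1" shows "mob A p \<in> cball 0 1"
proof -
  obtain M where M: "M \<noteq> 0" "ball_point M = p" using ball_point_surj[OF assms(2)] by blast
  show ?thesis using mob_ball_point[OF M(1), of A] M(2) ball_point_in_cball[OF mult_nonzero[OF assms(1) M(1)]] by simp
qed

lemma mob_mult: assumes "det B = 1" "p \<in> cball 0 1" shows "mob (A ** B) p = mob A (mob B p)"
proof -
  obtain M where M: "M \<noteq> 0" "ball_point M = p" using ball_point_surj[OF assms(2)] by blast
  show ?thesis
    using mob_ball_point[OF M(1), of "A ** B"] mob_ball_point[OF M(1), of B] M(2)
      mob_ball_point[OF mult_nonzero[OF assms(1) M(1)], of A] by (simp add: matrix_mul_assoc)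
qed

text \<open>The half traces for \<open>M\<close>, \<open>B ** M\<close> and
  \<open>A ** B ** M\<close> form a telescoping quotient.\<close>

lemma tau_mult: assumes "det B = 1" "p \<in> cball 0 1" shows "tau (A ** B) p = tau A (mob B p) * tau B p"
proof -
  obtain M where M: "M \<noteq> 0" "ball_point M = p" using ball_point_surj[OF assms(2)] by blast
  define r x y where "r = (gal M + gbe M) / 2" and "x = (gal (A ** B ** M) + gbe (A ** B ** M)) / 2"
    and "y = (gal (B ** M) + gbe (B ** M)) / 2"
  have "tau (A ** B) p = x / r" "tau B p = y / r" "tau A (mob B p) = x / y"
    using tau_ball_point[OF M(1)] tau_ball_point[OF mult_nonzero[OF assms(1) M(1)], of A] mob_ball_point[OF M(1), of B] M(2)
    by (simp_all add: r_def x_def y_def matrix_mul_assoc)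
  moreover have "y \<noteq> 0" using gal_gbe_pos[OF mult_nonzero[OF assms(1) M(1)]] by (simp add: y_def)
  ultimately show ?thesis by simp
qed

lemma mob_one: "mob (mat 1) p = p"
  by (simp add: mob_def tau_def hal_def hbe_def hze_def mat_def)

lemma tau_one: "tau (mat 1) p = 1"
  by (simp add: tau_def hal_def hbe_def mat_def)

lemma tau_continuous: "continuous_on S (tau A)"
  unfolding tau_def hal_def hbe_def by (auto intro!: continuous_intros)

lemma mob_continuous: assumes "det A = 1" shows "continuous_on (cball 0 1) (mob A)"
proof -
  have n: "\<forall>p\<in>cball 0 1. tau A p \<noteq> 0" using tau_pos[OF assms] by fastforce
  have h: "continuous_on (cball 0 1) (hal A)" "continuous_on (cball 0 1) (hbe A)" "continuous_on (cball 0 1) (hze A)"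
    unfolding hal_def hbe_def hze_def by (auto intro!: continuous_intros)
  have "continuous_on (cball 0 1) (\<lambda>p. hze A p / of_real (tau A p))"
    using n by (intro continuous_on_divide continuous_on_of_real h tau_continuous) simp
  moreover have "continuous_on (cball 0 1) (\<lambda>p. (hal A p - hbe A p) / (2 * tau A p))"
    using n by (intro continuous_on_divide continuous_on_diff continuous_on_mult continuous_on_const h tau_continuous) simp
  ultimately show ?thesis unfolding mob_def by (rule continuous_on_Pair)
qed

subsection \<open>The chordal metric\<close>

text \<open>Polarised multiplicativity of the determinant for 2 by 2 matrices. The primed letters
  stand for complex conjugates; treated as independent variables they make it an identity in any
  commutative ring.\<close>

lemma mixed_discriminant_identity:
  fixes a b c d a' b' c' d' x y z z' u v w w' :: "'r :: comm_ring_1"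
  shows "(a * a' * x + b * b' * y + (a * z * b' + a' * z' * b)) * (c * c' * u + d * d' * v + (c * w * d' + c' * w' * d))
     + (c * c' * x + d * d' * y + (c * z * d' + c' * z' * d)) * (a * a' * u + b * b' * v + (a * w * b' + a' * w' * b))
     - ((a * c' * x + b * d' * y + a * d' * z + b * c' * z') * (a' * c * u + b' * d * v + a' * d * w' + b' * c * w)
      + (a' * c * x + b' * d * y + a' * d * z' + b' * c * z) * (a * c' * u + b * d' * v + a * d' * w + b * c' * w'))
   = ((a * d - b * c) * (a' * d' - b' * c')) * (x * v + y * u - (z * w' + z' * w))"
  by (simp add: algebra_simps)

lemma mixed_discriminant:
  "hal A p * hbe A q + hbe A p * hal A q - 2 * Re (hze A p * cnj (hze A q)) =
    (cmod (det A))\<^sup>2 * ((1 + snd p) * (1 - snd q) + (1 - snd p) * (1 + snd q) - 2 * Re (fst p * cnj (fst q)))"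
proof -
  define a b c d where abcd: "a = A$1$1" "b = A$1$2" "c = A$2$1" "d = A$2$2"
  have two: "complex_of_real (2 * Re w) = w + cnj w" for w by (rule complex_add_cnj[symmetric])
  have H: "complex_of_real (hal A p) = a * cnj a * of_real (1 + snd p) + b * cnj b * of_real (1 - snd p) + (a * fst p * cnj b + cnj a * cnj (fst p) * b)"
    "complex_of_real (hbe A p) = c * cnj c * of_real (1 + snd p) + d * cnj d * of_real (1 - snd p) + (c * fst p * cnj d + cnj c * cnj (fst p) * d)" for p
    unfolding hal_def hbe_def abcd of_real_add of_real_mult[of _ "1 + snd p"] of_real_mult[of _ "1 - snd p"] complex_norm_square two
    by simp_all
  have Z: "hze A p = a * cnj c * of_real (1 + snd p) + b * cnj d * of_real (1 - snd p) + a * cnj d * fst p + b * cnj c * cnj (fst p)" for p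
    by (simp add: hze_def abcd)
  have "complex_of_real (hal A p * hbe A q + hbe A p * hal A q - 2 * Re (hze A p * cnj (hze A q))) =
    complex_of_real (hal A p) * complex_of_real (hbe A q) + complex_of_real (hbe A p) * complex_of_real (hal A q)
     - (hze A p * cnj (hze A q) + cnj (hze A p * cnj (hze A q)))"
    by (simp only: of_real_add of_real_diff of_real_mult[of "hal A p"] of_real_mult[of "hbe A p"] two)
  also have "\<dots> = ((a * d - b * c) * cnj (a * d - b * c)) * (of_real (1 + snd p) * of_real (1 - snd q) + of_real (1 - snd p) * of_real (1 + snd q)
     - (fst p * cnj (fst q) + cnj (fst p * cnj (fst q))))"
    unfolding H Z complex_cnj_add complex_cnj_mult complex_cnj_diff complex_cnj_cnj complex_cnj_complex_of_real
    by (rule mixed_discriminant_identity)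
  also have "\<dots> = complex_of_real ((cmod (det A))\<^sup>2 * ((1 + snd p) * (1 - snd q) + (1 - snd p) * (1 + snd q) - 2 * Re (fst p * cnj (fst q))))"
    by (simp only: of_real_add of_real_diff of_real_mult[of _ "_ - _ * Re _"] of_real_mult[of "1 + snd p"] of_real_mult[of "1 - snd p"] two complex_norm_square det_2 abcd)
  finally show ?thesis by (simp only: of_real_eq_iff)
qed

text \<open>On the unit sphere the squared chordal distance is 2 minus twice the Euclidean inner
  product, which is the mixed discriminant of the two Hermitian matrices.\<close>

lemma dist_sphere:
  assumes "p \<in> sphere 0 1" "q \<in> sphere 0 1"
  shows "(dist p q)\<^sup>2 = (1 + snd p) * (1 - snd q) + (1 - snd p) * (1 + snd q) - 2 * Re (fst p * cnj (fst q))"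
proof -
  have s: "(cmod (fst p))\<^sup>2 + (snd p)\<^sup>2 = 1" "(cmod (fst q))\<^sup>2 + (snd q)\<^sup>2 = 1"
    using assms unfolding mem_sphere_pt by auto
  have "(dist p q)\<^sup>2 = (cmod (fst p - fst q))\<^sup>2 + (snd p - snd q)\<^sup>2"
    by (simp add: dist_prod_def dist_norm real_norm_def)
  also have "(cmod (fst p - fst q))\<^sup>2 = (cmod (fst p))\<^sup>2 + (cmod (fst q))\<^sup>2 - 2 * Re (fst p * cnj (fst q))"
    unfolding cmod_power2 by (simp add: power2_eq_square algebra_simps)
  finally show ?thesis using s by (simp add: power2_eq_square algebra_simps)
qed

text \<open>The sphere consists of the points whose matrix is singular, and \<open>A\<close>
  preserves singularity: this is \<open>mixed_discriminant\<close> with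
  \<open>q = p\<close>.\<close>

lemma mob_sphere:
  assumes "det A = 1" "p \<in> sphere 0 1" shows "mob A p \<in> sphere 0 1"
proof -
  have t: "0 < tau A p" using tau_pos assms by auto
  have "hal A p * hbe A p = (cmod (hze A p))\<^sup>2"
    using mixed_discriminant[of A p p] dist_sphere[OF assms(2,2)] assms(1)
    by (simp add: complex_mult_cnj cmod_power2 mult.commute)
  then have "(cmod (hze A p))\<^sup>2 + ((hal A p - hbe A p) / 2)\<^sup>2 = (tau A p)\<^sup>2"
    by (simp add: tau_def power2_eq_square field_simps)
  then have "((cmod (hze A p))\<^sup>2 + ((hal A p - hbe A p) / 2)\<^sup>2) / (tau A p)\<^sup>2 = 1" using t by simp
  then show ?thesis unfolding mem_sphere_pt mob_def
    using t by (simp add: norm_divide power_divide add_divide_distrib power_mult_distrib)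
qed

text \<open>A matrix of determinant 1 preserves the mixed discriminant; only the normalisations of
  the two images, \<open>tau A p\<close> and \<open>tau A q\<close>, enter.\<close>

lemma dist_mob:
  assumes A: "det A = 1" and p: "p \<in> sphere 0 1" and q: "q \<in> sphere 0 1"
  shows "dist (mob A p) (mob A q) = dist p q / sqrt (tau A p * tau A q)"
proof -
  have t: "0 < tau A p" "0 < tau A q" using tau_pos assms by auto
  have s: "1 + snd (mob A p) = hal A p / tau A p" "1 - snd (mob A p) = hbe A p / tau A p" if "0 < tau A p" for p
    using that by (auto simp: mob_def tau_def field_simps)
  have r: "Re (fst (mob A p) * cnj (fst (mob A q))) = Re (hze A p * cnj (hze A q)) / (tau A p * tau A q)"
  proof -
    have "fst (mob A p) * cnj (fst (mob A q)) = hze A p * cnj (hze A q) / of_real (tau A p * tau A q)" by (simp add: mob_def)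
    then show ?thesis by (simp only: Re_divide_of_real)
  qed
  have "(dist (mob A p) (mob A q))\<^sup>2 = (hal A p * hbe A q + hbe A p * hal A q - 2 * Re (hze A p * cnj (hze A q))) / (tau A p * tau A q)"
    unfolding dist_sphere[OF mob_sphere[OF A p] mob_sphere[OF A q]] s[OF t(1)] s[OF t(2)] r
    by (simp add: add_divide_distrib diff_divide_distrib)
  also have "\<dots> = (dist p q)\<^sup>2 / (tau A p * tau A q)"
    unfolding mixed_discriminant dist_sphere[OF p q] A by simp
  also have "\<dots> = (dist p q / sqrt (tau A p * tau A q))\<^sup>2" using t by (simp add: power_divide)
  finally show ?thesis by (rule power2_eq_imp_eq) (use t in simp_all)
qed

lemma sphere_pt_islimpt: assumes "x \<in> sphere 0 1" shows "x islimpt sphere (0 :: pt) 1"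
proof (rule connected_imp_perfect)
  show "connected (sphere (0 :: pt) 1)" by (rule connected_sphere) simp
  have two: "(0, 1) \<in> sphere (0 :: pt) 1" "(0, - 1) \<in> sphere (0 :: pt) 1" by (simp_all add: norm_prod_def)
  show "sphere (0 :: pt) 1 \<noteq> {a}" for a
  proof
    assume "sphere (0 :: pt) 1 = {a}"
    then have "(0, 1) = a" "(0, - 1) = a" using two by auto
    then show False by auto
  qed
qed (rule assms)

text \<open>By \<open>dist_mob\<close> the difference quotient equals
  \<open>1 / sqrt (tau A y * tau A x)\<close>, which is continuous in \<open>y\<close>.\<close>

lemma conformal_deriv_eq:
  assumes A: "det A = 1" and x: "x \<in> sphere 0 1"
  shows "conformal_deriv (psl A) x = 1 / tau A x"
  unfolding conformal_deriv_def
proof (rule tendsto_Lim)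
  show "\<not> trivial_limit (at x within sphere 0 1)" using sphere_pt_islimpt[OF x] by (simp add: trivial_limit_within)
  have t: "0 < tau A x" using tau_pos[OF A, of x] x by simp
  have "(tau A \<longlongrightarrow> tau A x) (at x within sphere 0 1)"
    using tau_continuous[of "sphere 0 1" A] x by (simp add: continuous_on_def)
  then have "((\<lambda>y. 1 / sqrt (tau A y * tau A x)) \<longlongrightarrow> 1 / sqrt (tau A x * tau A x)) (at x within sphere 0 1)"
    using t by (intro tendsto_intros) auto
  then have l: "((\<lambda>y. 1 / sqrt (tau A y * tau A x)) \<longlongrightarrow> 1 / tau A x) (at x within sphere 0 1)" using t by simp
  show "((\<lambda>y. dist (psl_act (psl A) y) (psl_act (psl A) x) / dist y x) \<longlongrightarrow> 1 / tau A x) (at x within sphere 0 1)"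
  proof (rule Lim_transform_eventually[OF l])
    show "\<forall>\<^sub>F y in at x within sphere 0 1. 1 / sqrt (tau A y * tau A x) = dist (psl_act (psl A) y) (psl_act (psl A) x) / dist y x"
      unfolding eventually_at_filter
    proof (rule always_eventually, intro allI impI)
      fix y assume y: "y \<noteq> x" "y \<in> sphere 0 1"
      have "psl_act (psl A) y = mob A y" "psl_act (psl A) x = mob A x" using x y by (auto intro!: psl_act_eq)
      then show "1 / sqrt (tau A y * tau A x) = dist (psl_act (psl A) y) (psl_act (psl A) x) / dist y x"
        using dist_mob[OF A y(2) x] y(1) by simp
    qed
  qed
qed

lemma psl_act_mult:
  assumes "\<gamma> \<in> carrier PSL2C" "\<eta> \<in> carrier PSL2C" "p \<in> cball 0 1"
  shows "psl_act (\<gamma> \<ast> \<eta>) p = psl_act \<gamma> (psl_act \<eta> p)"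
proof -
  obtain A B where AB: "det A = 1" "\<gamma> = psl A" "det B = 1" "\<eta> = psl B" using assms by (elim PSL2C_cases)
  then show ?thesis
    using psl_act_eq[OF mob_in_cball[OF AB(3) assms(3)]] psl_act_eq[OF assms(3)] mob_mult[OF AB(3) assms(3)]
    by (simp add: PSL2C_mult)
qed

lemma psl_act_in_cball: "\<gamma> \<in> carrier PSL2C \<Longrightarrow> p \<in> cball 0 1 \<Longrightarrow> psl_act \<gamma> p \<in> cball 0 1"
  by (elim PSL2C_cases) (use mob_in_cball psl_act_eq in metis)

lemma psl_act_one: "p \<in> cball 0 1 \<Longrightarrow> psl_act gunit p = p"
  by (simp add: PSL2C_one psl_act_eq mob_one)

lemma psl_act_continuous: "\<gamma> \<in> carrier PSL2C \<Longrightarrow> continuous_on (cball 0 1) (psl_act \<gamma>)"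
  by (elim PSL2C_cases) (use mob_continuous psl_act_eq continuous_on_cong in metis)

lemma psl_act_inv:
  assumes "\<gamma> \<in> carrier PSL2C" "p \<in> cball 0 1"
  shows "psl_act (ginv \<gamma>) (psl_act \<gamma> p) = p" "psl_act \<gamma> (psl_act (ginv \<gamma>) p) = p"
proof -
  interpret group PSL2C by (rule PSL2C_group)
  show "psl_act (ginv \<gamma>) (psl_act \<gamma> p) = p" "psl_act \<gamma> (psl_act (ginv \<gamma>) p) = p"
    using psl_act_mult[of "ginv \<gamma>" \<gamma> p] psl_act_mult[of \<gamma> "ginv \<gamma>" p] assms psl_act_one[OF assms(2)] by auto
qed

text \<open>With \<open>?k = (cmod l)^2\<close> the fixed point equation forces
  \<open>tau = ?k\<close> unless \<open>snd p = -1\<close>, and \<open>tau = inverse ?k\<close>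
  unless \<open>snd p = 1\<close>. Both together would give \<open>?k = 1\<close>.\<close>

lemma diagonal_fixed_points:
  assumes l: "l \<noteq> 0" "cmod l \<noteq> 1" and p: "p \<in> sphere 0 1"
    and fp: "mob (vector [vector [l, 0], vector [0, inverse l]]) p = p"
  shows "p = (0, 1) \<or> p = (0, - 1)"
proof -
  let ?D = "vector [vector [l, 0], vector [0, inverse l]] :: complex^2^2"
  let ?k = "(cmod l)\<^sup>2"
  have k: "0 < ?k" "?k \<noteq> 1" using l norm_ge_zero[of l] by (auto simp: power2_eq_1_iff simp del: norm_ge_zero)
  have d: "det ?D = 1" using l by (simp add: det_2 vector_2)
  have t: "0 < tau ?D p" using tau_pos[OF d, of p] p by simp
  have h: "hal ?D p = ?k * (1 + snd p)" "hbe ?D p = inverse ?k * (1 - snd p)"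
    by (simp_all add: hal_def hbe_def vector_2 norm_inverse power_inverse)
  have "snd (mob ?D p) = snd p" using fp by simp
  then have "(hal ?D p - hbe ?D p) / 2 = snd p * tau ?D p" using t by (simp add: mob_def field_simps)
  moreover have "(hal ?D p + hbe ?D p) / 2 = tau ?D p" by (simp add: tau_def)
  ultimately have "hal ?D p = (1 + snd p) * tau ?D p" "hbe ?D p = (1 - snd p) * tau ?D p"
    by (simp_all add: algebra_simps)
  then have e: "(1 + snd p) * (?k - tau ?D p) = 0" "(1 - snd p) * (inverse ?k - tau ?D p) = 0"
    by (simp_all add: h algebra_simps)
  have "snd p = 1 \<or> snd p = - 1"
  proof (rule ccontr)
    assume "\<not> (snd p = 1 \<or> snd p = - 1)"
    then have "?k = tau ?D p" "inverse ?k = tau ?D p" using e by (auto simp: add_eq_0_iff)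
    then have "?k = inverse ?k" by simp
    then have "?k * ?k = 1" using k by (simp add: field_simps)
    then have "?k = 1" using k by (metis abs_of_pos abs_square_eq_1 power2_eq_square)
    then show False using k by simp
  qed
  moreover from this have "fst p = 0" using p unfolding mem_sphere_pt by auto
  ultimately show ?thesis by (cases p) auto
qed

text \<open>Conjugation to diagonal form carries the fixed points to the two poles.\<close>

lemma loxodromic_fixed_points:
  assumes "\<gamma> \<in> carrier PSL2C" "loxodromic \<gamma>"
  shows "\<exists>a b. \<forall>p\<in>sphere 0 1. psl_act \<gamma> p = p \<longrightarrow> p = a \<or> p = b"
proof -
  obtain A B l where A: "A \<in> \<gamma>" and B: "det B = 1" and l: "l \<noteq> 0" "cmod l \<noteq> 1"
    and AB: "A ** B = B ** vector [vector [l, 0], vector [0, inverse l]]"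
    using assms(2) by (auto simp: loxodromic_def SL2C_def)
  let ?D = "vector [vector [l, 0], vector [0, inverse l]] :: complex^2^2"
  have d: "det ?D = 1" using l by (simp add: det_2 vector_2)
  obtain A' where A': "det A' = 1" "\<gamma> = psl A'" using assms(1) by (rule PSL2C_cases)
  then have "\<gamma> = psl A" "det A = 1" using A by (auto simp: psl_def det_neg_2)
  obtain B' where B': "B ** B' = mat 1" "B' ** B = mat 1" using B invertible_det_nz[of B] by (auto simp: invertible_def)
  have dB': "det B' = 1" using det_mul[of B' B] B B' by simp
  show ?thesis
  proof (intro exI ballI impI)
    fix p assume p: "p \<in> sphere 0 1" and f: "psl_act \<gamma> p = p"
    have pc: "p \<in> cball 0 1" using p by simp
    define q where "q = mob B' p"
    have q: "q \<in> sphere 0 1" "q \<in> cball 0 1" using mob_sphere[OF dB' p] by (simp_all add: q_def)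
    have pq: "mob B q = p" using mob_mult[OF dB' pc, of B] B' by (simp add: q_def mob_one)
    have "mob A p = p" using f psl_act_eq[OF pc] \<open>\<gamma> = psl A\<close> by simp
    then have "mob (A ** B) q = mob B q" using mob_mult[OF B q(2), of A] pq by simp
    then have "mob B (mob ?D q) = mob B q" unfolding AB using mob_mult[OF d q(2), of B] by simp
    then have "mob B' (mob B (mob ?D q)) = mob B' (mob B q)" by simp
    then have "mob ?D q = q"
      using mob_mult[OF B q(2), of B'] mob_mult[OF B mob_in_cball[OF d q(2)], of B'] B' by (simp add: mob_one)
    then have "q = (0, 1) \<or> q = (0, - 1)" by (rule diagonal_fixed_points[OF l q(1)])
    then show "p = mob B (0, 1) \<or> p = mob B (0, - 1)" using pq by auto
  qed
qed

section \<open>Symbolic dynamics on the limit set\<close>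

subsection \<open>The coding of the limit set\<close>

locale schottky =
  fixes g :: nat and \<Gamma> :: "psl2 set" and gen :: "nat \<Rightarrow> psl2" and x\<^sub>0 :: pt
  assumes g2: "2 \<le> g" and sch: "schottky_group g \<Gamma> gen" and x0: "x\<^sub>0 \<in> ball 0 1"
    and coded: "coded_limit_set g \<Gamma> gen x\<^sub>0"
begin

abbreviation "\<Lambda> \<equiv> limit_set \<Gamma>"
abbreviation "RS \<equiv> reduced_sequences g"
abbreviation "J \<equiv> {1..2*g}"
abbreviation "L \<equiv> letter g gen"
abbreviation "bar \<equiv> inv_letter g"
abbreviation "cd \<equiv> coding g gen x\<^sub>0"
abbreviation "Cont f \<equiv> continuous_on \<Lambda> f"

sublocale PSL: group PSL2C by (rule PSL2C_group)

lemma \<Gamma>_subgroup: "subgroup \<Gamma> PSL2C" using sch by (simp add: schottky_group_def)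

lemma \<Gamma>_carrier: "\<gamma> \<in> \<Gamma> \<Longrightarrow> \<gamma> \<in> carrier PSL2C" using subgroup.mem_carrier[OF \<Gamma>_subgroup] .

lemma \<Gamma>_eq: "\<Gamma> = generate PSL2C (gen ` {1..g})" using sch by (simp add: schottky_group_def free_basis_def)

lemma gen_carrier: "i \<in> {1..g} \<Longrightarrow> gen i \<in> carrier PSL2C"
  using sch by (auto simp: schottky_group_def free_basis_def)

lemma L_in: "i \<in> J \<Longrightarrow> L i \<in> \<Gamma>"
proof (cases "i \<le> g")
  case True
  assume "i \<in> J"
  then show ?thesis using True unfolding \<Gamma>_eq letter_def by (auto intro: generate.incl)
next
  case False
  assume "i \<in> J"
  then have "i - g \<in> {1..g}" using False by auto
  then show ?thesis using False unfolding \<Gamma>_eq letter_def by (auto intro: generate.inv)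
qed

lemma L_carrier [simp]: "i \<in> J \<Longrightarrow> L i \<in> carrier PSL2C"
  using L_in \<Gamma>_carrier by blast

lemma L_bar: "i \<in> J \<Longrightarrow> L (bar i) = ginv (L i)"
  using gen_carrier[of "i - g"] by (auto simp: letter_def inv_letter_def)

lemma \<Gamma>_induct [consumes 1, case_names one letter mult]:
  assumes "\<gamma> \<in> \<Gamma>" "P gunit" "\<And>i. i \<in> J \<Longrightarrow> P (L i)"
    "\<And>\<gamma> \<eta>. \<gamma> \<in> \<Gamma> \<Longrightarrow> \<eta> \<in> \<Gamma> \<Longrightarrow> P \<gamma> \<Longrightarrow> P \<eta> \<Longrightarrow> P (\<gamma> \<ast> \<eta>)"
  shows "P \<gamma>"
proof -
  have "\<gamma> \<in> generate PSL2C (gen ` {1..g})" using assms(1) \<Gamma>_eq by simp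
  then have "\<gamma> \<in> \<Gamma> \<and> P \<gamma>"
  proof (induction rule: generate.induct)
    case one then show ?case using assms(2) subgroup.one_closed[OF \<Gamma>_subgroup] by simp
  next
    case (incl h)
    then obtain i where i: "i \<in> {1..g}" "h = gen i" by auto
    then have "h = L i" "i \<in> J" by (auto simp: letter_def)
    then show ?case using assms(3) L_in by simp
  next
    case (inv h)
    then obtain i where i: "i \<in> {1..g}" "h = gen i" by auto
    then have "ginv h = L (i + g)" "i + g \<in> J" by (auto simp: letter_def)
    then show ?case using assms(3) L_in by simp
  next
    case (eng h1 h2) then show ?case using assms(4) subgroup.m_closed[OF \<Gamma>_subgroup] by simp
  qed
  then show ?thesis by simp
qed

definition code :: "pt \<Rightarrow> nat \<Rightarrow> nat" where
  "code = (SOME d. homeomorphism RS \<Lambda> cd d)"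

lemma code_homeo: "homeomorphism RS \<Lambda> cd code"
  unfolding code_def using coded by (intro someI_ex[where P = "homeomorphism RS \<Lambda> cd"]) (simp add: coded_limit_set_def)

lemma \<Lambda>_eq: "\<Lambda> = cd ` RS" using code_homeo by (simp add: homeomorphism_def)
lemma code_in [simp]: "x \<in> \<Lambda> \<Longrightarrow> code x \<in> RS" using code_homeo by (auto simp: homeomorphism_def)
lemma cd_in [simp]: "a \<in> RS \<Longrightarrow> cd a \<in> \<Lambda>" using \<Lambda>_eq by blast
lemma cd_code [simp]: "x \<in> \<Lambda> \<Longrightarrow> cd (code x) = x" using code_homeo by (simp add: homeomorphism_def)
lemma code_cd [simp]: "a \<in> RS \<Longrightarrow> code (cd a) = a" using code_homeo by (simp add: homeomorphism_def)

lemma code_continuous: "Cont (\<lambda>x. code x k)"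
proof -
  have "Cont code" using code_homeo by (simp add: homeomorphism_def)
  then show ?thesis by (rule continuous_on_product_then_coordinatewise)
qed

lemma \<Lambda>_sphere: "\<Lambda> \<subseteq> sphere 0 1" by (auto simp: limit_set_def)
lemma \<Lambda>_cball: "x \<in> \<Lambda> \<Longrightarrow> x \<in> cball 0 1" using \<Lambda>_sphere by auto

lemma \<Lambda>_compact: "compact \<Lambda>"
proof -
  have "\<Lambda> = sphere 0 1 \<inter> {p. p islimpt ((\<lambda>\<gamma>. psl_act \<gamma> 0) ` \<Gamma>)}" by (auto simp: limit_set_def)
  then show ?thesis using compact_Int_closed[OF compact_sphere closed_limpts] by metis
qed

lemma RS_iff: "a \<in> RS \<longleftrightarrow> (\<forall>k. a k \<in> J) \<and> (\<forall>k. a (Suc k) \<noteq> bar (a k))"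
  unfolding reduced_sequences_def using schottky_matrix_iff[of "a _" g "a (Suc _)"]
  by (auto simp: image_subset_iff simp del: atLeastAtMost_iff)

lemma RS_Cons: "a \<in> RS \<Longrightarrow> i \<in> J \<Longrightarrow> a 0 \<noteq> bar i \<Longrightarrow> case_nat i a \<in> RS"
  unfolding RS_iff by (auto split: nat.split simp del: atLeastAtMost_iff)

lemma RS_Suc: "a \<in> RS \<Longrightarrow> (\<lambda>k. a (Suc k)) \<in> RS"
  unfolding RS_iff by (auto simp del: atLeastAtMost_iff)

lemma word_val_closed: "set w \<subseteq> J \<Longrightarrow> word_val g gen w \<in> \<Gamma>"
proof (induction w)
  case Nil then show ?case using subgroup.one_closed[OF \<Gamma>_subgroup] by (simp add: word_val_def)
next
  case (Cons i w)
  then show ?case using subgroup.m_closed[OF \<Gamma>_subgroup L_in[of i]] by (simp add: word_val_def)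
qed

lemma x0_cball: "x\<^sub>0 \<in> cball 0 1" using x0 by simp

lemma orbit_lim: "a \<in> RS \<Longrightarrow> orbit_seq g gen x\<^sub>0 a \<longlonglongrightarrow> cd a"
  using coded by (simp add: coded_limit_set_def coding_def convergent_LIMSEQ_iff)

lemma orbit_in_cball: assumes "a \<in> RS" shows "orbit_seq g gen x\<^sub>0 a l \<in> cball 0 1"
proof -
  have "word_val g gen (map a [0..<Suc l]) \<in> \<Gamma>"
    using assms by (intro word_val_closed) (auto simp: RS_iff simp del: atLeastAtMost_iff)
  then show ?thesis unfolding orbit_seq_def by (intro psl_act_in_cball \<Gamma>_carrier x0_cball)
qed

text \<open>The orbit of the longer sequence, one index later, is the \<open>L i\<close>-translate
  of the orbit of \<open>a\<close>; continuity of the action on the closed ball passes to the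
  limit.\<close>

lemma cd_Cons:
  assumes a: "a \<in> RS" and i: "i \<in> J" "a 0 \<noteq> bar i"
  shows "cd (case_nat i a) = psl_act (L i) (cd a)"
proof -
  have r: "case_nat i a \<in> RS" by (rule RS_Cons[OF a i])
  have "orbit_seq g gen x\<^sub>0 (case_nat i a) (Suc l) = psl_act (L i) (orbit_seq g gen x\<^sub>0 a l)" for l
  proof -
    have "map (case_nat i a) [0..<Suc (Suc l)] = i # map a [0..<Suc l]"
      by (subst upt_conv_Cons) (auto simp: map_Suc_upt[symmetric] simp del: upt_Suc)
    then have "word_val g gen (map (case_nat i a) [0..<Suc (Suc l)]) = L i \<ast> word_val g gen (map a [0..<Suc l])"
      by (simp add: word_val_def del: upt_Suc)
    moreover have "word_val g gen (map a [0..<Suc l]) \<in> carrier PSL2C"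
      using a by (intro \<Gamma>_carrier word_val_closed) (auto simp: RS_iff simp del: atLeastAtMost_iff)
    ultimately show ?thesis unfolding orbit_seq_def using i x0_cball by (simp add: psl_act_mult del: upt_Suc)
  qed
  moreover have "(\<lambda>l. orbit_seq g gen x\<^sub>0 (case_nat i a) (Suc l)) \<longlonglongrightarrow> cd (case_nat i a)"
    by (rule LIMSEQ_Suc[OF orbit_lim[OF r]])
  moreover have "(\<lambda>l. psl_act (L i) (orbit_seq g gen x\<^sub>0 a l)) \<longlonglongrightarrow> psl_act (L i) (cd a)"
    by (rule continuous_on_tendsto_compose[OF psl_act_continuous orbit_lim[OF a]])
       (use i a orbit_in_cball[OF a] \<Lambda>_cball[OF cd_in[OF a]] in auto)
  ultimately show ?thesis using LIMSEQ_unique by force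
qed

lemma cd_bar:
  assumes a: "a \<in> RS"
  shows "psl_act (L (bar (a 0))) (cd a) = cd (\<lambda>k. a (Suc k))"
proof -
  have a0: "a 0 \<in> J" "a (Suc 0) \<noteq> bar (a 0)" using a unfolding RS_iff by blast+
  have "case_nat (a 0) (\<lambda>k. a (Suc k)) = a" by (auto split: nat.split)
  then have "cd a = psl_act (L (a 0)) (cd (\<lambda>k. a (Suc k)))"
    using cd_Cons[OF RS_Suc[OF a] a0(1)] a0(2) by simp
  then show ?thesis using psl_act_inv(1)[of "L (a 0)"] a0 \<Lambda>_cball[OF cd_in[OF RS_Suc[OF a]]] L_bar by simp
qed

text \<open>Invariance is obtained through the coding: a generator either prepends its letter or
  removes the first one, and both operations preserve reduced sequences.\<close>

lemma L_\<Lambda>: assumes "x \<in> \<Lambda>" "i \<in> J" shows "psl_act (L i) x \<in> \<Lambda>"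
proof -
  let ?a = "code x"
  have a: "?a \<in> RS" "x = cd ?a" using assms by auto
  show ?thesis
  proof (cases "?a 0 = bar i")
    case True
    then have "i = bar (?a 0)" using assms(2) by simp
    then have "psl_act (L i) x = cd (\<lambda>k. ?a (Suc k))" using cd_bar[OF a(1)] a(2) by metis
    then show ?thesis using RS_Suc[OF a(1)] by simp
  next
    case False
    then have "psl_act (L i) x = cd (case_nat i ?a)" using cd_Cons[OF a(1) assms(2)] a(2) by metis
    then show ?thesis using RS_Cons[OF a(1) assms(2) False] by simp
  qed
qed

lemma act_\<Lambda>: assumes "\<gamma> \<in> \<Gamma>" shows "\<forall>x\<in>\<Lambda>. psl_act \<gamma> x \<in> \<Lambda>"
  using assms
proof (induction rule: \<Gamma>_induct)
  case one then show ?case using \<Lambda>_cball psl_act_one by auto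
next
  case (letter i) then show ?case using L_\<Lambda> by blast
next
  case (mult \<gamma> \<eta>) then show ?case using psl_act_mult \<Gamma>_carrier \<Lambda>_cball by auto
qed

lemma act_continuous: "\<gamma> \<in> \<Gamma> \<Longrightarrow> Cont (psl_act \<gamma>)"
  using psl_act_continuous[OF \<Gamma>_carrier] by (rule continuous_on_subset) (use \<Lambda>_cball in auto)

lemma act_mult: "\<gamma> \<in> \<Gamma> \<Longrightarrow> \<eta> \<in> \<Gamma> \<Longrightarrow> x \<in> \<Lambda> \<Longrightarrow> psl_act (\<gamma> \<ast> \<eta>) x = psl_act \<gamma> (psl_act \<eta> x)"
  by (intro psl_act_mult \<Gamma>_carrier \<Lambda>_cball)

lemma inv_\<Gamma>: "\<gamma> \<in> \<Gamma> \<Longrightarrow> ginv \<gamma> \<in> \<Gamma>" by (rule subgroup.m_inv_closed[OF \<Gamma>_subgroup])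

lemma act_inv: "\<gamma> \<in> \<Gamma> \<Longrightarrow> x \<in> \<Lambda> \<Longrightarrow> psl_act (ginv \<gamma>) (psl_act \<gamma> x) = x"
  "\<gamma> \<in> \<Gamma> \<Longrightarrow> x \<in> \<Lambda> \<Longrightarrow> psl_act \<gamma> (psl_act (ginv \<gamma>) x) = x"
  by (intro psl_act_inv \<Gamma>_carrier \<Lambda>_cball; assumption)+

subsection \<open>Cylinders\<close>

definition cyl :: "nat list \<Rightarrow> pt set" where
  "cyl w = {x \<in> \<Lambda>. \<forall>k<length w. code x k = w ! k}"

lemma cyl_single: "x \<in> cyl [i] \<longleftrightarrow> x \<in> \<Lambda> \<and> code x 0 = i" by (simp add: cyl_def)

lemma code_L:
  assumes x: "x \<in> \<Lambda>" and i: "i \<in> J"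
  shows "code (psl_act (L i) x) = (if code x 0 = bar i then (\<lambda>k. code x (Suc k)) else case_nat i (code x))"
proof (cases "code x 0 = bar i")
  case True
  then have "psl_act (L i) x = cd (\<lambda>k. code x (Suc k))" using cd_bar[OF code_in[OF x]] x i by simp
  then show ?thesis using True RS_Suc[OF code_in[OF x]] by simp
next
  case False
  then have "psl_act (L i) x = cd (case_nat i (code x))" using cd_Cons[OF code_in[OF x] i] x by simp
  then show ?thesis using False RS_Cons[OF code_in[OF x] i] by simp
qed

text \<open>If the code of \<open>x\<close> starts with \<open>i\<close>, the inverse generator
  removes this letter, and reducedness forbids the inverse letter from coming next. Otherwise it
  prepends the inverse letter.\<close>

lemma cyl_letter_iff:
  assumes x: "x \<in> \<Lambda>" and i: "i \<in> J"
  shows "x \<in> cyl [i] \<longleftrightarrow> psl_act (L (bar i)) x \<notin> cyl [bar i]"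
proof -
  have b: "bar i \<in> J" "bar (bar i) = i" using i by (rule inv_letter_in, rule inv_letter_inv)
  have "code x (Suc 0) \<noteq> bar (code x 0)" using code_in[OF x] unfolding RS_iff by blast
  then show ?thesis
    using code_L[OF x b(1)] L_\<Lambda>[OF x b(1)] x unfolding cyl_single b(2) by (auto split: if_splits)
qed

lemma cyl_Cons:
  assumes x: "x \<in> \<Lambda>" and r: "reduced_word g (i # w)" and w: "w \<noteq> []"
  shows "x \<in> cyl (i # w) \<longleftrightarrow> x \<in> cyl [i] \<and> psl_act (L (bar i)) x \<in> cyl w"
proof -
  have i: "i \<in> J" using r by (simp add: reduced_word_Cons)
  then have b: "bar i \<in> J" "bar (bar i) = i" by (rule inv_letter_in, rule inv_letter_inv)
  have y: "psl_act (L (bar i)) x \<in> \<Lambda>" by (rule L_\<Lambda>[OF x b(1)])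
  show ?thesis
  proof (cases "code x 0 = i")
    case True
    then have "code (psl_act (L (bar i)) x) = (\<lambda>k. code x (Suc k))" using code_L[OF x b(1)] b by simp
    then show ?thesis using x y True by (auto simp: cyl_def nth_Cons split: nat.split)
  next
    case False then show ?thesis by (auto simp: cyl_def)
  qed
qed

text \<open>The letters are continuous functions with discrete values, and the indicator is a finite
  product of functions of single letters.\<close>

lemma cyl_indicator_continuous: "Cont (indicator (cyl w) :: pt \<Rightarrow> complex)"
proof -
  have "Cont (\<lambda>x. (if code x k = w ! k then 1 else 0) :: complex)" for k
    using continuous_on_compose[OF code_continuous Topological_Spaces.continuous_on_discrete[of _ "\<lambda>n. (if n = w ! k then 1 else 0) :: complex"]]
    by (simp add: o_def)
  then have "Cont (\<lambda>x. \<Prod>k<length w. (if code x k = w ! k then 1 else 0) :: complex)"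
    by (intro continuous_on_prod)
  moreover have "(\<Prod>k<length w. (if code x k = w ! k then 1 else 0) :: complex) = indicator (cyl w) x" if "x \<in> \<Lambda>" for x
    using that by (auto simp: indicator_def cyl_def intro!: prod.neutral)
  ultimately show ?thesis
    using continuous_on_cong[OF refl, of \<Lambda> "\<lambda>x. \<Prod>k<length w. (if code x k = w ! k then 1 else 0) :: complex" "indicator (cyl w)"]
    by blast
qed

text \<open>If nothing cancels at the junction, the group element of a reduced word acts on codes by
  prepending the word, one letter at a time.\<close>

lemma cylinder_seq_word:
  "reduced_word g w \<Longrightarrow> a \<in> RS \<Longrightarrow> w = [] \<or> a 0 \<noteq> bar (last w) \<Longrightarrow>
    (\<lambda>k. if k < length w then w ! k else a (k - length w)) \<in> RS \<and>
    cd (\<lambda>k. if k < length w then w ! k else a (k - length w)) = psl_act (word_val g gen w) (cd a)"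
proof (induction w)
  case Nil
  then show ?case using psl_act_one[OF \<Lambda>_cball[OF cd_in]] by (simp add: word_val_def)
next
  case (Cons i w)
  let ?b = "\<lambda>k. if k < length w then w ! k else a (k - length w)"
  have i: "i \<in> J" "reduced_word g w" using Cons.prems by (auto simp: reduced_word_Cons)
  have IH: "?b \<in> RS" "cd ?b = psl_act (word_val g gen w) (cd a)" using Cons.IH i(2) Cons.prems by (auto split: if_splits)
  have b0: "?b 0 \<noteq> bar i"
  proof (cases w)
    case Nil then show ?thesis using Cons.prems by simp
  next
    case (Cons j v)
    have "j \<in> J" using i(2) Cons by (simp add: reduced_word_Cons)
    then show ?thesis using Cons.prems(1) Cons i schottky_matrix_iff[OF i(1)] by (simp add: reduced_word_Cons)
  qed
  have e: "(\<lambda>k. if k < length (i # w) then (i # w) ! k else a (k - length (i # w))) = case_nat i ?b"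
    by (rule ext) (simp split: nat.split)
  have "word_val g gen w \<in> carrier PSL2C" using i(2) by (intro \<Gamma>_carrier word_val_closed reduced_word_letters)
  then have "psl_act (word_val g gen (i # w)) (cd a) = psl_act (L i) (psl_act (word_val g gen w) (cd a))"
    using psl_act_mult[OF L_carrier[OF i(1)] _ \<Lambda>_cball[OF cd_in[OF Cons.prems(2)]], of "word_val g gen w"]
    by (simp add: word_val_def)
  then show ?case unfolding e using RS_Cons[OF IH(1) i(1) b0] cd_Cons[OF IH(1) i(1) b0] IH(2) by simp
qed

lemma const_RS: "c \<in> J \<Longrightarrow> (\<lambda>_. c) \<in> RS"
  unfolding RS_iff using inv_letter_neq[of g c] g2 by auto

text \<open>The action on the limit set separates reduced words: both elements are applied to a
  constant sequence whose letter cancels with neither, and the resulting codes are compared.\<close>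

lemma word_val_inj:
  assumes r: "reduced_word g w" "reduced_word g w'" and e: "word_val g gen w = word_val g gen w'"
  shows "w = w'"
proof -
  have *: False if r: "reduced_word g u" "reduced_word g v" and e: "word_val g gen u = word_val g gen v" and l: "length u < length v" for u v
  proof -
    \<comment> \<open>Avoiding \<open>v ! length u\<close> makes the codes differ right after the
      shorter word. For an empty word \<open>last\<close> is unspecified, and avoiding its value
      does no harm.\<close>
    obtain c where c: "c \<in> J" "c \<noteq> bar (last u)" "c \<noteq> bar (last v)" "c \<noteq> v ! length u"
      using exists_letter_avoiding[OF g2] by blast
    let ?b = "\<lambda>u k. if k < length u then u ! k else c"
    have "?b u \<in> RS" "cd (?b u) = psl_act (word_val g gen u) (cd (\<lambda>_. c))"
      "?b v \<in> RS" "cd (?b v) = psl_act (word_val g gen v) (cd (\<lambda>_. c))"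
      using cylinder_seq_word[OF r(1) const_RS[OF c(1)]] cylinder_seq_word[OF r(2) const_RS[OF c(1)]] c by auto
    then have "?b u = ?b v" using e code_cd by metis
    then have "?b u (length u) = ?b v (length u)" by meson
    then show False using l c(4) by simp
  qed
  have len: "length w = length w'" using *[OF r e] *[OF r(2,1) e[symmetric]] by force
  obtain c where c: "c \<in> J" "c \<noteq> bar (last w)" "c \<noteq> bar (last w')" using exists_letter_avoiding[OF g2] by blast
  let ?b = "\<lambda>u k. if k < length u then u ! k else c"
  have "?b w \<in> RS" "cd (?b w) = psl_act (word_val g gen w) (cd (\<lambda>_. c))"
    "?b w' \<in> RS" "cd (?b w') = psl_act (word_val g gen w') (cd (\<lambda>_. c))"
    using cylinder_seq_word[OF r(1) const_RS[OF c(1)]] cylinder_seq_word[OF r(2) const_RS[OF c(1)]] c by auto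
  then have b: "?b w = ?b w'" using e code_cd by metis
  show ?thesis
  proof (rule nth_equalityI[OF len])
    fix k assume "k < length w"
    then show "w ! k = w' ! k" using fun_cong[OF b, of k] len by simp
  qed
qed

lemma cylinder_eq: assumes "reduced_word g w" shows "cylinder g gen x\<^sub>0 (word_val g gen w) = cyl w"
proof
  show "cylinder g gen x\<^sub>0 (word_val g gen w) \<subseteq> cyl w"
  proof
    fix x assume "x \<in> cylinder g gen x\<^sub>0 (word_val g gen w)"
    then obtain a w' where "x = cd a" "a \<in> RS" "reduced_word g w'" "word_val g gen w' = word_val g gen w" "\<forall>k<length w'. a k = w' ! k"
      by (auto simp: cylinder_def)
    moreover from this have "w' = w" using word_val_inj assms by blast
    ultimately show "x \<in> cyl w" by (auto simp: cyl_def)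
  qed
  show "cyl w \<subseteq> cylinder g gen x\<^sub>0 (word_val g gen w)"
  proof
    fix x assume x: "x \<in> cyl w"
    then have "x = cd (code x)" "code x \<in> RS" "\<forall>k<length w. code x k = w ! k" by (auto simp: cyl_def)
    then show "x \<in> cylinder g gen x\<^sub>0 (word_val g gen w)" unfolding cylinder_def using assms by blast
  qed
qed

lemma cylinder_cases: "cylinder g gen x\<^sub>0 \<gamma> = {} \<or> (\<exists>w. reduced_word g w \<and> \<gamma> = word_val g gen w)"
  unfolding cylinder_def by blast

lemma cylinder_indicator_continuous: "Cont (indicator (cylinder g gen x\<^sub>0 \<gamma>) :: pt \<Rightarrow> complex)"
  using cylinder_cases[of \<gamma>] cylinder_eq cyl_indicator_continuous by auto

lemma cylinder_letter: "i \<in> J \<Longrightarrow> cylinder g gen x\<^sub>0 (L i) = cyl [i]"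
  using cylinder_eq[of "[i]"] by (simp add: reduced_word_Cons word_val_def)

text \<open>Otherwise two sequences of points agree on ever longer prefixes while their values stay
  apart. Compactness gives limits along a common subsequence, whose codes coincide, so the limits
  are equal, against continuity of \<open>f\<close>. The general codomain allows real and complex
  functions.\<close>

lemma cylinder_uniform:
  assumes f: "Cont (f :: pt \<Rightarrow> 'b::metric_space)" and e: "0 < e"
  shows "\<exists>n. \<forall>x\<in>\<Lambda>. \<forall>y\<in>\<Lambda>. (\<forall>k<n. code x k = code y k) \<longrightarrow> dist (f x) (f y) < e"
proof (rule ccontr)
  assume "\<not> ?thesis"
  then have "\<forall>n. \<exists>x y. x \<in> \<Lambda> \<and> y \<in> \<Lambda> \<and> (\<forall>k<n. code x k = code y k) \<and> e \<le> dist (f x) (f y)"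
    by (meson not_le)
  then obtain X Y where XY: "\<And>n. X n \<in> \<Lambda>" "\<And>n. Y n \<in> \<Lambda>" "\<And>n k. k < n \<Longrightarrow> code (X n) k = code (Y n) k"
    "\<And>n. e \<le> dist (f (X n)) (f (Y n))" by metis
  obtain x r where x: "x \<in> \<Lambda>" "strict_mono r" "(X \<circ> r) \<longlonglongrightarrow> x"
    using \<Lambda>_compact XY(1) unfolding compact_def by blast
  obtain y r' where y: "y \<in> \<Lambda>" "strict_mono r'" "(Y \<circ> r \<circ> r') \<longlonglongrightarrow> y"
    using \<Lambda>_compact XY(2) unfolding compact_def by (metis comp_apply)
  let ?s = "r \<circ> r'"
  have s: "strict_mono ?s" using x y by (intro strict_mono_o)
  have Xs: "(\<lambda>n. X (?s n)) \<longlonglongrightarrow> x" using LIMSEQ_subseq_LIMSEQ[OF x(3) y(2)] by (simp add: o_def)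
  have Ys: "(\<lambda>n. Y (?s n)) \<longlonglongrightarrow> y" using y(3) by (simp add: o_def)
  have "code x k = code y k" for k
  proof -
    have l1: "(\<lambda>n. code (X (?s n)) k) \<longlonglongrightarrow> code x k"
      by (rule continuous_on_tendsto_compose[OF code_continuous Xs x(1)]) (simp add: XY)
    have l2: "(\<lambda>n. code (Y (?s n)) k) \<longlonglongrightarrow> code y k"
      by (rule continuous_on_tendsto_compose[OF code_continuous Ys y(1)]) (simp add: XY)
    have ev: "\<forall>\<^sub>F n in sequentially. code (X (?s n)) k = code (Y (?s n)) k"
      unfolding eventually_sequentially
    proof (intro exI allI impI)
      fix n assume "Suc k \<le> n"
      then have "k < ?s n" using seq_suble[OF s, of n] by simp
      then show "code (X (?s n)) k = code (Y (?s n)) k" by (rule XY(3))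
    qed
    show ?thesis by (rule LIMSEQ_unique[OF iffD1[OF tendsto_cong[OF ev] l1] l2])
  qed
  then have "x = y" using x(1) y(1) cd_code by (metis ext)
  have "(\<lambda>n. dist (f (X (?s n))) (f (Y (?s n)))) \<longlonglongrightarrow> dist (f x) (f y)"
    using continuous_on_tendsto_compose[OF f Xs x(1)] continuous_on_tendsto_compose[OF f Ys y(1)] XY
    by (intro tendsto_dist) auto
  then have "e \<le> dist (f x) (f y)" using XY(4) by (intro LIMSEQ_le_const) auto
  then show False using e \<open>x = y\<close> by simp
qed

text \<open>A long prefix of the code of \<open>x\<close> extends by at least
  \<open>2 * g - 1\<close> constant tails, which is at least three. Three points are one more than a
  loxodromic element can fix.\<close>

lemma three_points_near:
  assumes x: "x \<in> \<Lambda>" and e: "0 < e"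
  shows "\<exists>P\<subseteq>\<Lambda> \<inter> ball x e. finite P \<and> 3 \<le> card P"
proof -
  \<comment> \<open>Uniformity for the distance from \<open>x\<close> says that points sharing a
    long prefix with \<open>x\<close> lie in the ball.\<close>
  have "Cont (\<lambda>y. dist y x)" by (intro continuous_intros)
  from cylinder_uniform[OF this e] obtain n where
    "\<forall>x'\<in>\<Lambda>. \<forall>y\<in>\<Lambda>. (\<forall>k<n. code x' k = code y k) \<longrightarrow> dist (dist x' x) (dist y x) < e" ..
  then have n: "\<And>y. y \<in> \<Lambda> \<Longrightarrow> (\<forall>k<n. code x k = code y k) \<Longrightarrow> dist (dist x x) (dist y x) < e"
    using x by blast
  define w where "w = map (code x) [0..<Suc n]"
  have cx: "\<And>k. code x k \<in> J" "\<And>k. code x (Suc k) \<noteq> bar (code x k)" using code_in[OF x] unfolding RS_iff by auto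
  have wr: "reduced_word g w"
    unfolding reduced_word_def w_def using cx schottky_matrix_iff by (auto simp del: upt_Suc atLeastAtMost_iff)
  define C where "C = J - {bar (last w)}"
  define h where "h c = cd (\<lambda>k. if k < length w then w ! k else c)" for c
  have h: "(\<lambda>k. if k < length w then w ! k else c) \<in> RS" if "c \<in> C" for c
    using cylinder_seq_word[OF wr const_RS, of c] that by (auto simp: C_def)
  have "h c \<in> \<Lambda> \<inter> ball x e" if c: "c \<in> C" for c
  proof -
    have "code (h c) k = code x k" if "k < n" for k
      using that code_cd[OF h[OF c]] by (simp add: h_def w_def del: upt_Suc)
    then have "dist (dist x x) (dist (h c) x) < e" using h[OF c] by (intro n) (auto simp: h_def)
    then show ?thesis using h[OF c] by (simp add: h_def dist_commute)
  qed
  moreover have "inj_on h C"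
  proof (rule inj_onI)
    fix c c' assume cc: "c \<in> C" "c' \<in> C" "h c = h c'"
    have "code (h c) = code (h c')" by (simp only: cc(3))
    then have "(\<lambda>k. if k < length w then w ! k else c) = (\<lambda>k. if k < length w then w ! k else c')"
      unfolding h_def code_cd[OF h[OF cc(1)]] code_cd[OF h[OF cc(2)]] .
    from fun_cong[OF this, of "length w"] show "c = c'" by simp
  qed
  moreover have "3 \<le> card C"
    using g2 card_Diff1_le[of J "bar (last w)"] diff_card_le_card_Diff[of "{bar (last w)}" J] by (simp add: C_def)
  moreover have "finite C" by (simp add: C_def)
  ultimately show ?thesis by (intro exI[of _ "h ` C"]) (simp add: card_image image_subset_iff)
qed

lemma topologically_free:
  assumes \<gamma>: "\<gamma> \<in> \<Gamma>" "\<gamma> \<noteq> gunit" and x: "x \<in> \<Lambda>" and e: "0 < e"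
  shows "\<exists>y\<in>\<Lambda> \<inter> ball x e. psl_act \<gamma> y \<noteq> y"
proof (rule ccontr)
  assume c: "\<not> ?thesis"
  have "loxodromic \<gamma>" using sch \<gamma> by (auto simp: schottky_group_def)
  then obtain a b where ab: "\<And>p. p \<in> sphere 0 1 \<Longrightarrow> psl_act \<gamma> p = p \<Longrightarrow> p = a \<or> p = b"
    using loxodromic_fixed_points[OF \<Gamma>_carrier[OF \<gamma>(1)]] by blast
  obtain P where P: "P \<subseteq> \<Lambda> \<inter> ball x e" "finite P" "3 \<le> card P" using three_points_near[OF x e] by blast
  have "P \<subseteq> {a, b}" using P c ab \<Lambda>_sphere by blast
  then have "card P \<le> card {a, b}" by (intro card_mono) auto
  also have "\<dots> \<le> 2" by (simp add: card_insert_if)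
  finally show False using P(3) by simp
qed

definition chi :: "nat list \<Rightarrow> pt \<Rightarrow> complex" where
  "chi w = indicator (cyl w)"

lemma chi_continuous: "Cont (chi w)"
  unfolding chi_def by (rule cyl_indicator_continuous)

lemma chi_single: "x \<in> \<Lambda> \<Longrightarrow> chi [i] x = (if code x 0 = i then 1 else 0)"
  by (simp add: chi_def indicator_def cyl_single)

lemma code_J: "x \<in> \<Lambda> \<Longrightarrow> code x k \<in> J"
  using code_in[of x] unfolding RS_iff by blast

lemma code_prefix_words: assumes x: "x \<in> \<Lambda>" shows "map (code x) [0..<n] \<in> words_eq g n"
proof -
  have c: "code x k \<in> J" "schottky_matrix g (code x k) (code x (Suc k)) = 1" for k
    using code_in[OF x] unfolding reduced_sequences_def by blast+
  have "set (map (code x) [0..<n]) \<subseteq> J" using c(1) by (simp only: set_map) blast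
  then show ?thesis unfolding words_eq_def reduced_word_def using c(2) by simp
qed

lemma chi_partition:
  assumes x: "x \<in> \<Lambda>"
  shows "(\<Sum>w\<in>words_eq g n. c w * chi w x) = c (map (code x) [0..<n])"
proof -
  have "chi w x = (if w = map (code x) [0..<n] then 1 else 0)" if "w \<in> words_eq g n" for w
    using that x by (auto simp: chi_def indicator_def cyl_def words_eq_def intro: nth_equalityI)
  then have "(\<Sum>w\<in>words_eq g n. c w * chi w x) = (\<Sum>w\<in>words_eq g n. if w = map (code x) [0..<n] then c w else 0)"
    by (intro sum.cong) auto
  also have "\<dots> = c (map (code x) [0..<n])" using code_prefix_words[OF x] by simp
  finally show ?thesis .
qed

text \<open>A continuous function varies little on long cylinders. The length \<open>Suc n\<close>
  keeps the words nonempty, as \<open>continuous_induct\<close> requires.\<close>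

lemma step_approx:
  assumes f: "Cont f" and e: "0 < e"
  shows "\<exists>n c. \<forall>x\<in>\<Lambda>. cmod ((\<Sum>w\<in>words_eq g (Suc n). c w * chi w x) - f x) \<le> e"
proof -
  obtain n where n: "\<forall>x\<in>\<Lambda>. \<forall>y\<in>\<Lambda>. (\<forall>k<n. code x k = code y k) \<longrightarrow> dist (f x) (f y) < e"
    using cylinder_uniform[OF f e] by blast
  \<comment> \<open>The value at an arbitrary point of the cylinder. Where the cylinder is empty the
    junk value is never looked up, since the sum only sees the prefix of \<open>x\<close>.\<close>
  define c where "c w = f (SOME y. y \<in> cyl w)" for w
  have "cmod ((\<Sum>w\<in>words_eq g (Suc n). c w * chi w x) - f x) \<le> e" if x: "x \<in> \<Lambda>" for x
  proof -
    let ?w = "map (code x) [0..<Suc n]"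
    have "x \<in> cyl ?w" using x by (simp add: cyl_def del: upt_Suc)
    then have y: "(SOME y. y \<in> cyl ?w) \<in> cyl ?w" by (rule someI)
    then have "dist (f (SOME y. y \<in> cyl ?w)) (f x) < e" using n x by (auto simp: cyl_def simp del: upt_Suc)
    then show ?thesis unfolding chi_partition[OF x] c_def by (simp add: dist_norm)
  qed
  then show ?thesis by blast
qed

text \<open>Density of step functions packaged as an induction principle. The limit clause compares
  functions on the limit set only, because \<open>P\<close> ranges over functions on the whole
  space.\<close>

lemma continuous_induct [consumes 1, case_names chi add scale limit]:
  assumes f: "Cont f"
    and chi: "\<And>w. reduced_word g w \<Longrightarrow> w \<noteq> [] \<Longrightarrow> P (chi w)"
    and add: "\<And>f h. Cont f \<Longrightarrow> Cont h \<Longrightarrow> P f \<Longrightarrow> P h \<Longrightarrow> P (\<lambda>x. f x + h x)"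
    and scale: "\<And>c f. Cont f \<Longrightarrow> P f \<Longrightarrow> P (\<lambda>x. c * f x)"
    and limit: "\<And>F f. (\<And>n. Cont (F n)) \<Longrightarrow> (\<And>n. P (F n)) \<Longrightarrow> Cont f \<Longrightarrow>
      (\<And>n x. x \<in> \<Lambda> \<Longrightarrow> cmod (F n x - f x) \<le> inverse (real (Suc n))) \<Longrightarrow> P f"
  shows "P f"
proof -
  have "reduced_word g [1]" using g2 by (auto simp: reduced_word_def)
  from scale[OF chi_continuous chi[OF this], of 0] have zero: "P (\<lambda>x. 0)" by simp
  have sum: "P (\<lambda>x. \<Sum>w\<in>I. c w * chi w x)" if "finite I" "I \<subseteq> {w. reduced_word g w \<and> w \<noteq> []}" for I and c :: "nat list \<Rightarrow> complex"
    using that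
  proof (induction I rule: finite_induct)
    case (insert w I)
    have "P (\<lambda>x. c w * chi w x + (\<Sum>w\<in>I. c w * chi w x))"
      using insert by (intro add scale chi chi_continuous continuous_intros) auto
    then show ?case using insert.hyps by simp
  qed (simp add: zero)
  have "\<forall>m::nat. \<exists>n c. \<forall>x\<in>\<Lambda>. cmod ((\<Sum>w\<in>words_eq g (Suc n). c w * chi w x) - f x) \<le> inverse (real (Suc m))"
    by (intro allI step_approx[OF f]) simp
  then obtain n c where nc: "\<And>m x. x \<in> \<Lambda> \<Longrightarrow> cmod ((\<Sum>w\<in>words_eq g (Suc (n m)). c m w * chi w x) - f x) \<le> inverse (real (Suc m))"
    by metis
  show ?thesis
  proof (rule limit[OF _ _ f nc])
    show "Cont (\<lambda>x. \<Sum>w\<in>words_eq g (Suc (n m)). c m w * chi w x)" for m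
      by (intro continuous_intros chi_continuous)
    show "P (\<lambda>x. \<Sum>w\<in>words_eq g (Suc (n m)). c m w * chi w x)" for m
      by (rule sum[OF finite_words_eq]) (auto simp: words_eq_def)
  qed
qed

end

section \<open>Covariant representations and the Cuntz-Krieger families they carry\<close>

subsection \<open>Covariant representations\<close>

text \<open>The common interface of the representation on \<open>L^2(mu)\<close> and of the crossed
  product. The functions live on all points, so \<open>\<pi>_cong\<close> says that only their
  values on the limit set count; contractivity is assumed as \<open>\<pi>_bound\<close>.\<close>

locale covariant = schottky g \<Gamma> gen x\<^sub>0 + cstar_algebra A
  for g \<Gamma> gen x\<^sub>0 and A :: "('a, 'm) cstar_scheme" (structure) +
  fixes \<pi> :: "(pt \<Rightarrow> complex) \<Rightarrow> 'a" and U :: "psl2 \<Rightarrow> 'a"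
  assumes \<pi>_closed: "Cont f \<Longrightarrow> \<pi> f \<in> carrier A"
    and \<pi>_cong: "Cont f \<Longrightarrow> (\<And>x. x \<in> \<Lambda> \<Longrightarrow> f x = h x) \<Longrightarrow> \<pi> f = \<pi> h"
    and \<pi>_add: "Cont f \<Longrightarrow> Cont h \<Longrightarrow> \<pi> (\<lambda>x. f x + h x) = \<pi> f \<oplus> \<pi> h"
    and \<pi>_mult: "Cont f \<Longrightarrow> Cont h \<Longrightarrow> \<pi> (\<lambda>x. f x * h x) = \<pi> f \<otimes> \<pi> h"
    and \<pi>_smult: "Cont f \<Longrightarrow> \<pi> (\<lambda>x. c * f x) = c \<odot> \<pi> f"
    and \<pi>_star: "Cont f \<Longrightarrow> \<pi> (\<lambda>x. cnj (f x)) = cstar_adj A (\<pi> f)"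
    and \<pi>_one: "\<pi> (\<lambda>_. 1) = \<one>"
    and \<pi>_bound: "Cont f \<Longrightarrow> (\<And>x. x \<in> \<Lambda> \<Longrightarrow> cmod (f x) \<le> K) \<Longrightarrow> 0 \<le> K \<Longrightarrow> cstar_norm A (\<pi> f) \<le> K"
    and U_closed: "\<gamma> \<in> \<Gamma> \<Longrightarrow> U \<gamma> \<in> carrier A"
    and U_mult: "\<gamma> \<in> \<Gamma> \<Longrightarrow> \<eta> \<in> \<Gamma> \<Longrightarrow> U (\<gamma> \<ast> \<eta>) = U \<gamma> \<otimes> U \<eta>"
    and U_one: "U gunit = \<one>"
    and U_star: "\<gamma> \<in> \<Gamma> \<Longrightarrow> cstar_adj A (U \<gamma>) = U (ginv \<gamma>)"
    and covariance: "\<gamma> \<in> \<Gamma> \<Longrightarrow> Cont f \<Longrightarrow>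
      U \<gamma> \<otimes> \<pi> f = \<pi> (\<lambda>x. f (psl_act (ginv \<gamma>) x)) \<otimes> U \<gamma>"
begin

lemma \<pi>_sum:
  assumes "finite I" "\<And>i. i \<in> I \<Longrightarrow> Cont (f i)"
  shows "\<pi> (\<lambda>x. \<Sum>i\<in>I. c i * f i x) = (\<Oplus>i\<in>I. c i \<odot> \<pi> (f i))"
  using assms
proof (induction I rule: finite_induct)
  case empty
  have "\<pi> (\<lambda>_. 0 * 1) = 0 \<odot> \<pi> (\<lambda>_. 1)" by (rule \<pi>_smult) simp
  then show ?case by (simp add: \<pi>_one)
next
  case (insert i I)
  have "\<pi> (\<lambda>x. c i * f i x + (\<Sum>i\<in>I. c i * f i x)) = \<pi> (\<lambda>x. c i * f i x) \<oplus> \<pi> (\<lambda>x. \<Sum>i\<in>I. c i * f i x)"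
    using insert.prems by (intro \<pi>_add continuous_intros) auto
  also have "\<pi> (\<lambda>x. c i * f i x) = c i \<odot> \<pi> (f i)" using insert.prems by (intro \<pi>_smult) simp
  finally show ?case using insert by (simp add: \<pi>_closed)
qed

definition S :: "nat \<Rightarrow> 'a" where
  "S i = (\<Oplus>j\<in>J. of_nat (schottky_matrix g i j) \<odot> (U (L i) \<otimes> \<pi> (chi [j])))"

definition Q :: "nat \<Rightarrow> pt \<Rightarrow> complex" where
  "Q i x = 1 - chi [bar i] x"

lemma Q_continuous: "Cont (Q i)"
  unfolding Q_def by (intro continuous_intros chi_continuous)

lemma UL [simp]: "i \<in> J \<Longrightarrow> U (L i) \<in> carrier A" using U_closed L_in by blast
lemma \<pi>chi [simp]: "\<pi> (chi w) \<in> carrier A" by (rule \<pi>_closed[OF chi_continuous])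
lemma \<pi>Q [simp]: "\<pi> (Q w) \<in> carrier A" by (rule \<pi>_closed[OF Q_continuous])

lemma chi_letter_sum:
  assumes i: "i \<in> J"
  shows "(\<Oplus>j\<in>J. of_nat (schottky_matrix g i j) \<odot> \<pi> (chi [j])) = \<pi> (Q i)"
proof -
  have "(\<Oplus>j\<in>J. of_nat (schottky_matrix g i j) \<odot> \<pi> (chi [j])) = \<pi> (\<lambda>x. \<Sum>j\<in>J. of_nat (schottky_matrix g i j) * chi [j] x)"
    by (rule \<pi>_sum[symmetric]) (auto intro: chi_continuous)
  also have "\<dots> = \<pi> (Q i)"
  proof (rule \<pi>_cong)
    show "Cont (\<lambda>x. \<Sum>j\<in>J. of_nat (schottky_matrix g i j) * chi [j] x)"
      by (intro continuous_intros chi_continuous)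
    fix x assume x: "x \<in> \<Lambda>"
    have "(\<Sum>j\<in>J. of_nat (schottky_matrix g i j) * chi [j] x) = (\<Sum>j\<in>J. if code x 0 = j then of_nat (schottky_matrix g i j) else 0)"
      using x by (intro sum.cong) (auto simp: chi_single)
    also have "\<dots> = of_nat (schottky_matrix g i (code x 0))" using code_J[OF x, of 0] by simp
    also have "\<dots> = Q i x"
      using schottky_matrix_iff[OF i code_J[OF x, of 0]] schottky_matrix_cases[of g i "code x 0"] x
      by (auto simp: Q_def chi_single)
    finally show "(\<Sum>j\<in>J. of_nat (schottky_matrix g i j) * chi [j] x) = Q i x" .
  qed
  finally show ?thesis .
qed

lemma S_eq: assumes i: "i \<in> J" shows "S i = U (L i) \<otimes> \<pi> (Q i)"
proof -
  have "S i = (\<Oplus>j\<in>J. U (L i) \<otimes> (of_nat (schottky_matrix g i j) \<odot> \<pi> (chi [j])))"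
    unfolding S_def using i by (intro finsum_cong') (auto simp: smult_mult_right)
  also have "\<dots> = U (L i) \<otimes> (\<Oplus>j\<in>J. of_nat (schottky_matrix g i j) \<odot> \<pi> (chi [j]))"
    using i by (intro finsum_rdistr[symmetric]) auto
  finally show ?thesis using chi_letter_sum[OF i] by simp
qed

lemma S_eq': assumes i: "i \<in> J" shows "S i = \<pi> (chi [i]) \<otimes> U (L i)"
proof -
  have "S i = \<pi> (\<lambda>x. Q i (psl_act (ginv (L i)) x)) \<otimes> U (L i)"
    unfolding S_eq[OF i] by (rule covariance[OF L_in[OF i] Q_continuous])
  also have "\<pi> (\<lambda>x. Q i (psl_act (ginv (L i)) x)) = \<pi> (chi [i])"
  proof (rule \<pi>_cong[symmetric, OF chi_continuous])
    fix x assume x: "x \<in> \<Lambda>"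
    show "chi [i] x = Q i (psl_act (ginv (L i)) x)"
      using cyl_letter_iff[OF x i] unfolding L_bar[OF i] by (simp add: Q_def chi_def indicator_def)
  qed
  finally show ?thesis .
qed

lemma S_closed [simp]: "i \<in> J \<Longrightarrow> S i \<in> carrier A"
  by (simp add: S_eq)

lemma \<pi>_idem: assumes "Cont f" "\<And>x. x \<in> \<Lambda> \<Longrightarrow> f x = 0 \<or> f x = 1"
  shows "\<pi> f \<otimes> \<pi> f = \<pi> f" "star (\<pi> f) = \<pi> f"
proof -
  have "\<pi> f \<otimes> \<pi> f = \<pi> (\<lambda>x. f x * f x)" by (rule \<pi>_mult[symmetric]) fact+
  also have "\<dots> = \<pi> f" by (rule \<pi>_cong[symmetric]) (use assms in force)+
  finally show "\<pi> f \<otimes> \<pi> f = \<pi> f" .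
  have "star (\<pi> f) = \<pi> (\<lambda>x. cnj (f x))" by (rule \<pi>_star[symmetric]) fact
  also have "\<dots> = \<pi> f" by (rule \<pi>_cong[symmetric]) (use assms in force)+
  finally show "star (\<pi> f) = \<pi> f" .
qed

lemma chi_proj [simp]: "\<pi> (chi w) \<otimes> \<pi> (chi w) = \<pi> (chi w)" "star (\<pi> (chi w)) = \<pi> (chi w)"
  by (rule \<pi>_idem[OF chi_continuous]; simp add: chi_def indicator_def)+

lemma Q_proj [simp]: "\<pi> (Q i) \<otimes> \<pi> (Q i) = \<pi> (Q i)" "star (\<pi> (Q i)) = \<pi> (Q i)"
  by (rule \<pi>_idem[OF Q_continuous]; simp add: Q_def chi_def indicator_def)+

lemma U_inv: assumes "\<gamma> \<in> \<Gamma>"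
  shows "U \<gamma> \<otimes> U (ginv \<gamma>) = \<one>" "U (ginv \<gamma>) \<otimes> U \<gamma> = \<one>"
  using U_mult[OF assms inv_\<Gamma>[OF assms]] U_mult[OF inv_\<Gamma>[OF assms] assms] \<Gamma>_carrier[OF assms] U_one by simp_all

lemma UL_star: "i \<in> J \<Longrightarrow> star (U (L i)) = U (L (bar i))"
  using U_star[OF L_in[of i]] L_bar[of i] by simp

lemma UL_inv: "i \<in> J \<Longrightarrow> U (L i) \<otimes> U (L (bar i)) = \<one>" "i \<in> J \<Longrightarrow> U (L (bar i)) \<otimes> U (L i) = \<one>"
  using U_inv[OF L_in[of i]] L_bar[of i] by simp_all

lemma ULbar [simp]: "i \<in> J \<Longrightarrow> U (L (bar i)) \<in> carrier A"
  using UL inv_letter_in by blast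

lemma S_S_star: assumes i: "i \<in> J" shows "S i \<otimes> star (S i) = \<pi> (chi [i])"
proof -
  have "S i \<otimes> star (S i) = \<pi> (chi [i]) \<otimes> (U (L i) \<otimes> U (L (bar i))) \<otimes> \<pi> (chi [i])"
    using i by (simp add: S_eq' adj_mult UL_star m_assoc)
  then show ?thesis using UL_inv[OF i] by simp
qed

lemma S_star_S: assumes i: "i \<in> J" shows "star (S i) \<otimes> S i = \<pi> (Q i)"
proof -
  have "star (S i) \<otimes> S i = \<pi> (Q i) \<otimes> (U (L (bar i)) \<otimes> U (L i)) \<otimes> \<pi> (Q i)"
    using i by (simp add: S_eq adj_mult UL_star m_assoc)
  then show ?thesis using UL_inv[OF i] by simp
qed

lemma S_ck_family: "cuntz_krieger_family (2*g) (schottky_matrix g) A S"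
  unfolding cuntz_krieger_family_def
proof (intro conjI ballI)
  fix i assume i: "i \<in> J"
  show "S i \<in> carrier A" using i by simp
  have "S i \<otimes> star (S i) \<otimes> S i = \<pi> (chi [i]) \<otimes> (\<pi> (chi [i]) \<otimes> U (L i))" using S_S_star[OF i] i by (simp add: S_eq')
  also have "\<dots> = (\<pi> (chi [i]) \<otimes> \<pi> (chi [i])) \<otimes> U (L i)" using i by (intro m_assoc[symmetric]) auto
  finally show "S i \<otimes> star (S i) \<otimes> S i = S i" using i by (simp add: S_eq')
  have "star (S i) \<otimes> S i = (\<Oplus>j\<in>J. of_nat (schottky_matrix g i j) \<odot> \<pi> (chi [j]))"
    using S_star_S[OF i] chi_letter_sum[OF i] by simp
  also have "\<dots> = (\<Oplus>j\<in>J. of_nat (schottky_matrix g i j) \<odot> (S j \<otimes> star (S j)))"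
    by (intro finsum_cong') (auto simp: S_S_star)
  finally show "star (S i) \<otimes> S i = (\<Oplus>j\<in>J. of_nat (schottky_matrix g i j) \<odot> (S j \<otimes> star (S j)))" .
next
  have "(\<Oplus>j\<in>J. S j \<otimes> star (S j)) = (\<Oplus>j\<in>J. 1 \<odot> \<pi> (chi [j]))"
    by (intro finsum_cong') (auto simp: S_S_star)
  also have "\<dots> = \<pi> (\<lambda>x. \<Sum>j\<in>J. 1 * chi [j] x)" by (rule \<pi>_sum[symmetric]) (auto intro: chi_continuous)
  also have "\<dots> = \<pi> (\<lambda>_. 1)"
  proof (rule \<pi>_cong)
    show "Cont (\<lambda>x. \<Sum>j\<in>J. 1 * chi [j] x)" by (intro continuous_intros chi_continuous)
    fix x assume x: "x \<in> \<Lambda>"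
    have "(\<Sum>j\<in>J. 1 * chi [j] x) = (\<Sum>j\<in>J. if code x 0 = j then 1 else 0)"
      using x by (intro sum.cong) (auto simp: chi_single)
    then show "(\<Sum>j\<in>J. 1 * chi [j] x) = 1" using code_J[OF x, of 0] by simp
  qed
  finally show "(\<Oplus>j\<in>J. S j \<otimes> star (S j)) = \<one>" by (simp add: \<pi>_one)
qed

sublocale CK: ck_family A g S
  using g2 S_ck_family by unfold_locales auto

text \<open>Split the unit as \<open>\<pi> (Q i) \<oplus> \<pi> (chi [bar i])\<close>: the first
  part of \<open>U (L i)\<close> is \<open>S i\<close>, and the second is the adjoint of the
  generator for the inverse letter.\<close>

lemma UL_eq: assumes i: "i \<in> J" shows "U (L i) = S i \<oplus> star (S (bar i))"
proof -
  have b: "bar i \<in> J" "bar (bar i) = i" using i by (rule inv_letter_in, rule inv_letter_inv)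
  have "star (S (bar i)) = U (L i) \<otimes> \<pi> (chi [bar i])"
    using i b UL_star[OF b(1)] by (simp add: S_eq' adj_mult)
  then have "S i \<oplus> star (S (bar i)) = U (L i) \<otimes> (\<pi> (Q i) \<oplus> \<pi> (chi [bar i]))"
    using i by (simp add: S_eq r_distr)
  also have "\<pi> (Q i) \<oplus> \<pi> (chi [bar i]) = \<pi> (\<lambda>x. Q i x + chi [bar i] x)"
    by (rule \<pi>_add[symmetric, OF Q_continuous chi_continuous])
  also have "\<dots> = \<one>" by (simp add: Q_def \<pi>_one)
  finally show ?thesis using i by simp
qed

text \<open>Conjugation by \<open>S i\<close> carries the indicator of the cylinder of
  \<open>w\<close> to that of \<open>i # w\<close>, by covariance and
  \<open>cyl_Cons\<close>.\<close>

lemma \<pi>_chi_word: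
  "reduced_word g w \<Longrightarrow> w \<noteq> [] \<Longrightarrow> \<pi> (chi w) = CK.sw w \<otimes> star (CK.sw w)"
proof (induction w)
  case (Cons i w)
  have i: "i \<in> J" "reduced_word g w" using Cons.prems by (auto simp: reduced_word_Cons)
  have swc: "CK.sw w \<in> carrier A" using CK.sw_closed[OF i(2)] .
  show ?case
  proof (cases "w = []")
    case True then show ?thesis using S_S_star[OF i(1)] i by simp
  next
    case False
    have cont: "Cont (\<lambda>x. chi w (psl_act (ginv (L i)) x))"
      using continuous_on_compose2[OF chi_continuous act_continuous[OF inv_\<Gamma>[OF L_in[OF i(1)]]]] act_\<Lambda>[OF inv_\<Gamma>[OF L_in[OF i(1)]]]
      by (auto simp: image_subset_iff)
    have "CK.sw (i # w) \<otimes> star (CK.sw (i # w)) = S i \<otimes> (CK.sw w \<otimes> star (CK.sw w)) \<otimes> star (S i)"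
      using i swc by (simp add: adj_mult m_assoc)
    also have "\<dots> = S i \<otimes> \<pi> (chi w) \<otimes> star (S i)" using Cons.IH i False by simp
    also have "\<dots> = \<pi> (chi [i]) \<otimes> (U (L i) \<otimes> \<pi> (chi w)) \<otimes> U (L (bar i)) \<otimes> \<pi> (chi [i])"
      using i by (simp add: S_eq' adj_mult UL_star m_assoc)
    also have "U (L i) \<otimes> \<pi> (chi w) = \<pi> (\<lambda>x. chi w (psl_act (ginv (L i)) x)) \<otimes> U (L i)"
      by (rule covariance[OF L_in[OF i(1)] chi_continuous])
    also have "\<pi> (chi [i]) \<otimes> (\<pi> (\<lambda>x. chi w (psl_act (ginv (L i)) x)) \<otimes> U (L i)) \<otimes> U (L (bar i)) \<otimes> \<pi> (chi [i])
      = \<pi> (chi [i]) \<otimes> \<pi> (\<lambda>x. chi w (psl_act (ginv (L i)) x)) \<otimes> (U (L i) \<otimes> U (L (bar i))) \<otimes> \<pi> (chi [i])"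
      using i \<pi>_closed[OF cont] by (simp add: m_assoc)
    also have "\<dots> = \<pi> (chi [i]) \<otimes> \<pi> (\<lambda>x. chi w (psl_act (ginv (L i)) x)) \<otimes> \<pi> (chi [i])"
      using i UL_inv[OF i(1)] \<pi>_closed[OF cont] by simp
    also have "\<dots> = \<pi> (\<lambda>x. (chi [i] x * chi w (psl_act (ginv (L i)) x)) * chi [i] x)"
      using cont by (simp add: \<pi>_mult chi_continuous continuous_on_mult)
    also have "\<dots> = \<pi> (chi (i # w))"
    proof (rule \<pi>_cong[symmetric, OF chi_continuous])
      fix x assume x: "x \<in> \<Lambda>"
      show "chi (i # w) x = (chi [i] x * chi w (psl_act (ginv (L i)) x)) * chi [i] x"
        using cyl_Cons[OF x Cons.prems(1) False] unfolding L_bar[OF i(1)] by (simp add: chi_def indicator_def)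
    qed
    finally show ?thesis by simp
  qed
qed simp

lemma \<pi>_conv:
  assumes F: "\<And>n. Cont (F n)" and f: "Cont f"
    and b: "\<And>n x. x \<in> \<Lambda> \<Longrightarrow> cmod (F n x - f x) \<le> inverse (real (Suc n))"
  shows "conv (\<lambda>n. \<pi> (F n)) (\<pi> f)"
proof -
  have "nrm (\<pi> (F m) \<ominus> \<pi> f) \<le> inverse (Suc m)" for m
  proof -
    have "\<pi> (F m) \<ominus> \<pi> f = \<pi> (\<lambda>x. F m x + (- 1) * f x)"
      using \<pi>_add[OF F, of "\<lambda>x. (- 1) * f x"] \<pi>_smult[OF f, of "- 1"] f \<pi>_closed[OF f] continuous_on_mult[OF continuous_on_const f, of "- 1"]
      by (simp add: a_minus_def sm_minus_one)
    also have "nrm \<dots> \<le> inverse (Suc m)"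
      using b by (intro \<pi>_bound continuous_intros F f) auto
    finally show ?thesis .
  qed
  then show ?thesis
    using conv_bound[of "\<lambda>m. \<pi> (F m)" "\<pi> f" "\<lambda>m. inverse (Suc m)"] LIMSEQ_inverse_real_of_nat \<pi>_closed[OF F] \<pi>_closed[OF f]
    by blast
qed

lemma \<pi>_in_closed:
  assumes K: "cstar_subalgebra K A" and chiK: "\<And>w. reduced_word g w \<Longrightarrow> w \<noteq> [] \<Longrightarrow> \<pi> (chi w) \<in> K"
    and f: "Cont f"
  shows "\<pi> f \<in> K"
  using f
proof (induction rule: continuous_induct)
  case (limit F f)
  show ?case
    using \<pi>_conv[OF limit(1,2,3)] limit(4) unfolding conv_def
    by (intro cstar_subalgebraD(8)[OF K, of "\<lambda>n. \<pi> (F n)", OF _ \<pi>_closed[OF limit(2)]]) auto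
qed (simp_all add: chiK \<pi>_add \<pi>_smult cstar_subalgebraD(4,6)[OF K])

definition gens :: "'a set" where
  "gens = \<pi> ` {f. Cont f} \<union> U ` \<Gamma>"

lemma U_in_closed:
  assumes K: "cstar_subalgebra K A" and SK: "S ` J \<subseteq> K" and \<gamma>: "\<gamma> \<in> \<Gamma>"
  shows "U \<gamma> \<in> K"
  using \<gamma>
proof (induction rule: \<Gamma>_induct)
  case one then show ?case using cstar_subalgebraD(2)[OF K] U_one by simp
next
  case (letter i)
  then have "S i \<in> K" "star (S (bar i)) \<in> K"
    using SK letter inv_letter_in[OF letter] by (blast, intro cstar_subalgebraD(7)[OF K], blast)
  then show ?case using UL_eq[OF letter] cstar_subalgebraD(4)[OF K] by simp
next
  case (mult \<gamma> \<eta>) then show ?case using U_mult cstar_subalgebraD(5)[OF K] by simp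
qed

lemma \<pi>_in_closed_S:
  assumes K: "cstar_subalgebra K A" and SK: "S ` J \<subseteq> K" and f: "Cont f"
  shows "\<pi> f \<in> K"
proof (rule \<pi>_in_closed[OF K _ f])
  fix w assume w: "reduced_word g w" "w \<noteq> []"
  note KA = cstar_subalgebraD[OF K]
  have "CK.sw v \<in> K" if "set v \<subseteq> J" for v
    using that
  proof (induction v)
    case (Cons i v)
    then have "S i \<in> K" "CK.sw v \<in> K" using SK by (simp_all add: image_subset_iff)
    then show ?case using KA(5) by simp
  qed (simp add: KA(2))
  from this[OF reduced_word_letters[OF w(1)]] show "\<pi> (chi w) \<in> K" unfolding \<pi>_chi_word[OF w] by (intro KA(5,7))
qed

lemma gens_span: "cstar_span A (S ` J) = cstar_span A gens"
proof
  have gc: "gens \<subseteq> carrier A" using \<pi>_closed U_closed by (auto simp: gens_def)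
  have sp: "cstar_subalgebra (cstar_span A (S ` J)) A" "cstar_subalgebra (cstar_span A gens) A"
    using gc by (auto intro!: cstar_span_subalgebra[OF ring_axioms carrier_subalgebra])
  show "cstar_span A gens \<subseteq> cstar_span A (S ` J)"
    using \<pi>_in_closed_S[OF sp(1) cstar_span_superset] U_in_closed[OF sp(1) cstar_span_superset]
    by (intro cstar_span_least[OF sp(1)]) (auto simp: gens_def)
  show "cstar_span A (S ` J) \<subseteq> cstar_span A gens"
  proof (rule cstar_span_least[OF sp(2)])
    have "S i \<in> cstar_span A gens" if i: "i \<in> J" for i
    proof -
      have "U (L i) \<in> cstar_span A gens" "\<pi> (Q i) \<in> cstar_span A gens"
        using cstar_span_superset[of gens A] L_in[OF i] Q_continuous by (auto simp: gens_def)
      then show ?thesis using S_eq[OF i] cstar_subalgebraD(5)[OF sp(2)] by simp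
    qed
    then show "S ` J \<subseteq> cstar_span A gens" by blast
  qed
qed

end

text \<open>The algebras of the theorem are generated inside all bounded operators. Closedness of
  the adjointable ones makes these spans agree with the spans in \<open>BL\<close>; it follows from
  completeness of \<open>BL\<close> and uniqueness of limits.\<close>

lemma adjointables_subalgebra: "cstar_subalgebra (adjointables M) (LO M)"
  unfolding cstar_subalgebra_def
proof (intro conjI allI ballI impI)
  interpret B: cstar_algebra "BL M" by (rule BL_cstar_algebra)
  show "subring (adjointables M) (LO M)" by (rule adjointables_subring)
  show "c \<odot>\<^bsub>LO M\<^esub> x \<in> adjointables M" if "x \<in> adjointables M" for c x
    using B.smult_closed[of c x] that by (simp add: complex_ring_def)
  show "cstar_adj (LO M) x \<in> adjointables M" if "x \<in> adjointables M" for x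
    using B.adj_closed[of x] that by simp
  fix X x assume X: "range X \<subseteq> adjointables M" and x: "x \<in> carrier (LO M)"
    and lim: "(\<lambda>n::nat. opn M (X n \<ominus>\<^bsub>LO M\<^esub> x)) \<longlonglongrightarrow> 0"
  have Xb: "X n \<in> adjointables M" "bounded_op M (X n)" for n using X adjointable_bounded by blast+
  have xb: "bounded_op M x" using x by simp
  let ?a = "\<lambda>n. opn M (X n \<ominus>\<^bsub>LO M\<^esub> x)"
  note ab = opn_minus(1)[OF Xb(2) xb] and an = opn_minus(2)[OF Xb(2) xb]
  have "\<exists>y\<in>carrier (BL M). (\<lambda>n. cstar_norm (BL M) (X n \<ominus>\<^bsub>BL M\<^esub> y)) \<longlonglongrightarrow> 0"
  proof (rule B.complete)
    show "range X \<subseteq> carrier (BL M)" using X by simp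
    fix e :: real assume e: "0 < e"
    obtain N where N: "\<And>n. n \<ge> N \<Longrightarrow> ?a n < e / 4"
      using LIMSEQ_D[OF lim, of "e / 4"] e an by fastforce
    have "cstar_norm (BL M) (X m \<ominus>\<^bsub>BL M\<^esub> X n) < e" if mn: "m \<ge> N" "n \<ge> N" for m n
    proof -
      have "opn M (X m \<ominus>\<^bsub>LO M\<^esub> X n) \<le> e / 2"
      proof (rule opn_minus(3)[OF Xb(2) Xb(2)])
        fix u assume u: "u \<in> L2 M"
        have "L2_dist M (X m u) (X n u) \<le> L2_dist M (X m u) (x u) + L2_dist M (X n u) (x u)"
          using L2_norm_diff_trans[of "X m u" M "x u" "X n u"] L2_norm_diff_commute[of "x u" M "X n u"]
            bop_in[OF xb u] bop_in[OF Xb(2) u] by simp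
        also have "\<dots> \<le> (?a m + ?a n) * L2_norm M u"
          using ab[OF u, of m] ab[OF u, of n] by (simp add: distrib_right)
        also have "\<dots> \<le> e / 2 * L2_norm M u" using N[OF mn(1)] N[OF mn(2)] by (intro mult_right_mono) auto
        finally show "L2_dist M (X m u) (X n u) \<le> e / 2 * L2_norm M u" .
      qed (use e in simp)
      then show ?thesis using e by (simp add: BL_minus Xb)
    qed
    then show "\<exists>N. \<forall>m\<ge>N. \<forall>n\<ge>N. cstar_norm (BL M) (X m \<ominus>\<^bsub>BL M\<^esub> X n) < e" by blast
  qed
  then obtain y where y: "y \<in> adjointables M"
    and ylim: "(\<lambda>n. opn M (X n \<ominus>\<^bsub>LO M\<^esub> y)) \<longlonglongrightarrow> 0"
    using Xb by (auto simp: BL_minus)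
  have yb: "bounded_op M y" using adjointable_bounded[OF y] .
  have "x = y"
  proof (rule bop_eqI[OF xb yb])
    fix u assume u: "u \<in> L2 M"
    let ?b = "\<lambda>n. opn M (X n \<ominus>\<^bsub>LO M\<^esub> y)"
    have "L2_dist M (x u) (y u) \<le> (?a n + ?b n) * L2_norm M u" for n
      using ab[OF u, of n] opn_minus(1)[OF Xb(2) yb u, of n] L2_norm_diff_trans[of "x u" M "X n u" "y u"] L2_norm_diff_commute[of "x u" M "X n u"]
        bop_in[OF xb u] bop_in[OF yb u] bop_in[OF Xb(2) u, of n] by (simp add: distrib_right)
    moreover have "(\<lambda>n. (?a n + ?b n) * L2_norm M u) \<longlonglongrightarrow> (0 + 0) * L2_norm M u"
      by (intro tendsto_intros lim ylim)
    ultimately have "L2_dist M (x u) (y u) \<le> 0" using LIMSEQ_le_const[of _ _ "L2_dist M (x u) (y u)"] by auto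
    then show "x u = y u" using bop_in[OF xb u] bop_in[OF yb u]
      by (intro L2_diff_eq_zero[of _ M]) (auto intro: antisym)
  qed
  then show "x \<in> adjointables M" using y by simp
qed

section \<open>Weighted composition operators and the representation on the limit set\<close>

subsection \<open>Weighted composition operators\<close>

text \<open>One shape for all operators in play: multiplication operators, the unitaries
  \<open>T_op\<close> and the translations of the crossed product.\<close>

definition wcomp :: "'x measure \<Rightarrow> ('x \<Rightarrow> complex) \<Rightarrow> ('x \<Rightarrow> 'x) \<Rightarrow> 'x L2_op" where
  "wcomp M k \<phi> = L2_lift M (\<lambda>f x. k x * f (\<phi> x))"

text \<open>An integral inequality for all nonnegative \<open>h\<close>. Used for squared moduli it
  yields at once the bound \<open>K\<close> and the compatibility with equality almost
  everywhere.\<close>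

definition wadm :: "'x measure \<Rightarrow> ('x \<Rightarrow> complex) \<Rightarrow> ('x \<Rightarrow> 'x) \<Rightarrow> real \<Rightarrow> bool" where
  "wadm M k \<phi> K \<longleftrightarrow> k \<in> borel_measurable M \<and> \<phi> \<in> measurable M M \<and> 0 \<le> K \<and>
     (\<forall>h\<in>borel_measurable M. (\<integral>\<^sup>+x. ennreal ((cmod (k x))\<^sup>2) * h (\<phi> x) \<partial>M) \<le> ennreal (K\<^sup>2) * (\<integral>\<^sup>+x. h x \<partial>M))"

lemma wadm_nn:
  assumes "wadm M k \<phi> K" "f \<in> borel_measurable M"
  shows "(\<integral>\<^sup>+x. ennreal ((cmod (k x * f (\<phi> x)))\<^sup>2) \<partial>M) \<le> ennreal (K\<^sup>2) * (\<integral>\<^sup>+x. ennreal ((cmod (f x))\<^sup>2) \<partial>M)"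
proof -
  have "(\<lambda>x. ennreal ((cmod (f x))\<^sup>2)) \<in> borel_measurable M" using assms(2) by measurable
  from bspec[OF conjunct2[OF conjunct2[OF conjunct2[OF assms(1)[unfolded wadm_def]]]] this]
  show ?thesis by (simp add: norm_mult power_mult_distrib ennreal_mult)
qed

lemma sqint_iff_nn: "sqint M f \<longleftrightarrow> f \<in> borel_measurable M \<and> (\<integral>\<^sup>+x. ennreal ((cmod (f x))\<^sup>2) \<partial>M) < \<infinity>"
proof -
  have "f \<in> borel_measurable M \<Longrightarrow> integrable M (\<lambda>x. (cmod (f x))\<^sup>2) \<longleftrightarrow> (\<integral>\<^sup>+x. ennreal ((cmod (f x))\<^sup>2) \<partial>M) < \<infinity>"
    by (subst integrable_iff_bounded) simp
  then show ?thesis unfolding sqint_def by blast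
qed

lemma wadm_measurable:
  assumes "wadm M k \<phi> K" "f \<in> borel_measurable M"
  shows "(\<lambda>x. k x * f (\<phi> x)) \<in> borel_measurable M"
  using assms measurable_compose[of \<phi> M M f borel] unfolding wadm_def by auto

lemma wadm_sqint:
  assumes a: "wadm M k \<phi> K" and f: "sqint M f"
  shows "sqint M (\<lambda>x. k x * f (\<phi> x))"
proof -
  have "(\<integral>\<^sup>+x. ennreal ((cmod (k x * f (\<phi> x)))\<^sup>2) \<partial>M) \<le> ennreal (K\<^sup>2) * (\<integral>\<^sup>+x. ennreal ((cmod (f x))\<^sup>2) \<partial>M)"
    by (rule wadm_nn[OF a sqint_measurable[OF f]])
  also have "\<dots> < \<infinity>" using f unfolding sqint_iff_nn by (simp add: ennreal_mult_less_top)
  finally show ?thesis using wadm_measurable[OF a sqint_measurable[OF f]] unfolding sqint_iff_nn by blast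
qed

text \<open>The admissibility inequality is applied to the difference of the two functions, whose
  squared modulus has integral zero.\<close>

lemma wadm_AE:
  assumes a: "wadm M k \<phi> K" and fh: "f \<in> borel_measurable M" "h \<in> borel_measurable M" "AE x in M. f x = h x"
  shows "AE x in M. k x * f (\<phi> x) = k x * h (\<phi> x)"
proof -
  have d: "(\<lambda>x. f x - h x) \<in> borel_measurable M" using fh by measurable
  have "(\<integral>\<^sup>+x. ennreal ((cmod (f x - h x))\<^sup>2) \<partial>M) = (\<integral>\<^sup>+x. 0 \<partial>M)" using fh(3) by (intro nn_integral_cong_AE) auto
  then have "(\<integral>\<^sup>+x. ennreal ((cmod (k x * (f (\<phi> x) - h (\<phi> x))))\<^sup>2) \<partial>M) = 0"
    using wadm_nn[OF a d] by simp
  then have "AE x in M. ennreal ((cmod (k x * (f (\<phi> x) - h (\<phi> x))))\<^sup>2) = 0"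
    using measurable_compose[OF wadm_measurable[OF a d], of "\<lambda>z. ennreal ((cmod z)\<^sup>2)" borel]
    by (subst (asm) nn_integral_0_iff_AE) auto
  then show ?thesis by eventually_elim (auto simp: right_diff_distrib)
qed

lemma wcomp_class:
  assumes a: "wadm M k \<phi> K" and f: "sqint M f"
  shows "wcomp M k \<phi> (L2_class M f) = L2_class M (\<lambda>x. k x * f (\<phi> x))"
proof -
  note r = L2_rep_class[OF sqint_measurable[OF f]]
  have "L2_class M (\<lambda>x. k x * L2_rep (L2_class M f) (\<phi> x)) = L2_class M (\<lambda>x. k x * f (\<phi> x))"
    using wadm_measurable[OF a r(1)] wadm_measurable[OF a sqint_measurable[OF f]]
      wadm_AE[OF a r(1) sqint_measurable[OF f] r(2)] by (simp add: L2_class_eq_iff)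
  then show ?thesis using f by (simp add: wcomp_def L2_lift_def)
qed

lemma wcomp_norm_le:
  assumes a: "wadm M k \<phi> K" and u: "u \<in> L2 M"
  shows "L2_norm M (wcomp M k \<phi> u) \<le> K * L2_norm M u"
proof -
  obtain f where f: "sqint M f" "u = L2_class M f" using L2_cases[OF u] .
  have K: "0 \<le> K" using a by (simp add: wadm_def)
  have "ennreal ((L2_norm M (wcomp M k \<phi> u))\<^sup>2) \<le> ennreal (K\<^sup>2) * ennreal ((L2_norm M u)\<^sup>2)"
    using wadm_nn[OF a sqint_measurable[OF f(1)]] unfolding f(2) wcomp_class[OF a f(1)]
    by (simp only: L2_norm_nn[OF f(1)] L2_norm_nn[OF wadm_sqint[OF a f(1)]])
  also have "\<dots> = ennreal ((K * L2_norm M u)\<^sup>2)" by (simp add: power_mult_distrib ennreal_mult)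
  finally have "(L2_norm M (wcomp M k \<phi> u))\<^sup>2 \<le> (K * L2_norm M u)\<^sup>2" by (simp add: ennreal_le_iff)
  then show ?thesis by (rule power2_le_imp_le) (use K in simp)
qed

lemma wcomp_bounded:
  assumes a: "wadm M k \<phi> K"
  shows "bounded_op M (wcomp M k \<phi>)"
proof (rule bounded_opI)
  show "wcomp M k \<phi> \<in> L2 M \<rightarrow>\<^sub>E L2 M"
  proof (rule PiE_I)
    fix u assume "u \<in> L2 M"
    then obtain f where f: "sqint M f" "u = L2_class M f" by (rule L2_cases)
    show "wcomp M k \<phi> u \<in> L2 M" unfolding f(2) wcomp_class[OF a f(1)] by (intro L2I wadm_sqint[OF a f(1)])
  qed (simp add: wcomp_def L2_lift_def)
  fix u assume u: "u \<in> L2 M"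
  then obtain f where f: "sqint M f" "u = L2_class M f" by (rule L2_cases)
  show "L2_norm M (wcomp M k \<phi> u) \<le> K * L2_norm M u" by (rule wcomp_norm_le[OF a u])
  show "wcomp M k \<phi> (L2_scale M c u) = L2_scale M c (wcomp M k \<phi> u)" for c
    unfolding f(2) L2_scale_class[OF f(1)] wcomp_class[OF a f(1)] wcomp_class[OF a sqint_scale[OF f(1)]]
      L2_scale_class[OF wadm_sqint[OF a f(1)]] by (simp add: mult.left_commute)
  fix v assume "v \<in> L2 M"
  then obtain h where h: "sqint M h" "v = L2_class M h" by (rule L2_cases)
  show "wcomp M k \<phi> (L2_add M u v) = L2_add M (wcomp M k \<phi> u) (wcomp M k \<phi> v)"
    unfolding f(2) h(2) L2_add_class[OF f(1) h(1)] wcomp_class[OF a f(1)] wcomp_class[OF a h(1)]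
      wcomp_class[OF a sqint_add[OF f(1) h(1)]] L2_add_class[OF wadm_sqint[OF a f(1)] wadm_sqint[OF a h(1)]]
    by (simp add: distrib_left)
qed

lemma wcomp_cong:
  assumes "\<And>x. x \<in> space M \<Longrightarrow> k x = k' x" "\<And>x. x \<in> space M \<Longrightarrow> \<phi> x = \<phi>' x"
  shows "wcomp M k \<phi> = wcomp M k' \<phi>'"
proof -
  have "(AE x in M. h x = k x * f (\<phi> x)) = (AE x in M. h x = k' x * f (\<phi>' x))" for h f :: "'a \<Rightarrow> complex"
    by (rule AE_cong) (simp add: assms)
  then show ?thesis by (simp add: wcomp_def L2_lift_def L2_class_def)
qed

lemma wcomp_compose:
  assumes a: "wadm M k \<phi> K" and b: "wadm M k' \<phi>' K'"
  shows "compose (L2 M) (wcomp M k \<phi>) (wcomp M k' \<phi>') = wcomp M (\<lambda>x. k x * k' (\<phi> x)) (\<lambda>x. \<phi>' (\<phi> x))"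
proof
  fix u
  show "compose (L2 M) (wcomp M k \<phi>) (wcomp M k' \<phi>') u = wcomp M (\<lambda>x. k x * k' (\<phi> x)) (\<lambda>x. \<phi>' (\<phi> x)) u"
  proof (cases "u \<in> L2 M")
    case True
    then have f: "sqint M (L2_rep u)" "L2_class M (L2_rep u) = u" using L2_rep_sqint by auto
    have "wcomp M k \<phi> (wcomp M k' \<phi>' (L2_class M (L2_rep u))) = L2_class M (\<lambda>x. k x * (k' (\<phi> x) * L2_rep u (\<phi>' (\<phi> x))))"
      unfolding wcomp_class[OF b f(1)] wcomp_class[OF a wadm_sqint[OF b f(1)]] ..
    then show ?thesis using True f(2) by (simp add: compose_def wcomp_def[of M "\<lambda>x. k x * k' (\<phi> x)"] L2_lift_def mult.assoc)
  qed (simp add: compose_def wcomp_def[of M "\<lambda>x. k x * k' (\<phi> x)"] L2_lift_def)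
qed

lemma wcomp_adjoint:
  assumes a: "wadm M k \<phi> K" and b: "wadm M k' \<phi>' K'"
    and e: "\<And>f h. sqint M f \<Longrightarrow> sqint M h \<Longrightarrow>
      (LINT x|M. k x * f (\<phi> x) * cnj (h x)) = (LINT x|M. f x * cnj (k' x * h (\<phi>' x)))"
  shows "adjoint_of M (wcomp M k \<phi>) (wcomp M k' \<phi>')"
  unfolding adjoint_of_def
proof (intro conjI ballI wcomp_bounded[OF a] wcomp_bounded[OF b])
  fix u v assume "u \<in> L2 M" "v \<in> L2 M"
  then obtain f h where f: "sqint M f" "u = L2_class M f" and h: "sqint M h" "v = L2_class M h" by (metis L2_cases)
  show "L2_inner M (wcomp M k \<phi> u) v = L2_inner M u (wcomp M k' \<phi>' v)"
    unfolding f(2) h(2) wcomp_class[OF a f(1)] wcomp_class[OF b h(1)]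
      L2_inner_class[OF f(1) wadm_sqint[OF b h(1)]] L2_inner_class[OF wadm_sqint[OF a f(1)] h(1)]
    by (rule e[OF f(1) h(1)])
qed

lemma wadm_id:
  assumes "k \<in> borel_measurable M" "0 \<le> K" "\<And>x. x \<in> space M \<Longrightarrow> cmod (k x) \<le> K"
  shows "wadm M k (\<lambda>x. x) K"
  unfolding wadm_def
proof (intro conjI ballI)
  fix h :: "'a \<Rightarrow> ennreal" assume h: "h \<in> borel_measurable M"
  have "(\<integral>\<^sup>+x. ennreal ((cmod (k x))\<^sup>2) * h x \<partial>M) \<le> (\<integral>\<^sup>+x. ennreal (K\<^sup>2) * h x \<partial>M)"
    using assms(3) by (intro nn_integral_mono mult_right_mono ennreal_leI power_mono) auto
  then show "(\<integral>\<^sup>+x. ennreal ((cmod (k x))\<^sup>2) * h x \<partial>M) \<le> ennreal (K\<^sup>2) * (\<integral>\<^sup>+x. h x \<partial>M)"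
    using h by (simp add: nn_integral_cmult)
qed (use assms in auto)

lemma mult_op_wcomp: "mult_op M f = wcomp M f (\<lambda>x. x)"
  by (simp add: mult_op_def wcomp_def)

lemma wcomp_id_adjoint:
  assumes "k \<in> borel_measurable M" "\<And>x. x \<in> space M \<Longrightarrow> cmod (k x) \<le> K" "0 \<le> K"
  shows "adjoint_of M (wcomp M k (\<lambda>x. x)) (wcomp M (\<lambda>x. cnj (k x)) (\<lambda>x. x))"
proof (rule wcomp_adjoint)
  show "wadm M k (\<lambda>x. x) K" using assms by (intro wadm_id) auto
  show "wadm M (\<lambda>x. cnj (k x)) (\<lambda>x. x) K" using assms measurable_compose[OF assms(1) cnj_measurable] by (intro wadm_id) auto
qed (simp add: mult.commute mult.left_commute)

lemma wcomp_linear: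
  assumes a: "wadm M k \<phi> K" and b: "wadm M k' \<phi> K'"
  shows "(\<lambda>u\<in>L2 M. L2_add M (wcomp M k \<phi> u) (wcomp M k' \<phi> u)) = wcomp M (\<lambda>x. k x + k' x) \<phi>"
    and "(\<lambda>u\<in>L2 M. L2_scale M c (wcomp M k \<phi> u)) = wcomp M (\<lambda>x. c * k x) \<phi>"
proof -
  have f: "sqint M (L2_rep u)" "L2_class M (L2_rep u) = u" if "u \<in> L2 M" for u using that L2_rep_sqint by auto
  have *: "wcomp M k \<phi> u = L2_class M (\<lambda>x. k x * L2_rep u (\<phi> x))" "wcomp M k' \<phi> u = L2_class M (\<lambda>x. k' x * L2_rep u (\<phi> x))"
    if "u \<in> L2 M" for u using that by (simp_all add: wcomp_def L2_lift_def)
  show "(\<lambda>u\<in>L2 M. L2_add M (wcomp M k \<phi> u) (wcomp M k' \<phi> u)) = wcomp M (\<lambda>x. k x + k' x) \<phi>"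
    unfolding wcomp_def[of M "\<lambda>x. k x + k' x"] L2_lift_def
    by (intro restrict_ext) (simp add: * L2_add_class[OF wadm_sqint[OF a f(1)] wadm_sqint[OF b f(1)]] distrib_right)
  show "(\<lambda>u\<in>L2 M. L2_scale M c (wcomp M k \<phi> u)) = wcomp M (\<lambda>x. c * k x) \<phi>"
    unfolding wcomp_def[of M "\<lambda>x. c * k x"] L2_lift_def
    by (intro restrict_ext) (simp add: * L2_scale_class[OF wadm_sqint[OF a f(1)]] mult.assoc)
qed

lemma wcomp_one: "wcomp M (\<lambda>_. 1) (\<lambda>x. x) = (\<lambda>u\<in>L2 M. u)"
  unfolding wcomp_def L2_lift_def by (intro restrict_ext) simp

text \<open>If the measure with density \<open>(cmod k)^2\<close> is pushed forward to
  \<open>M\<close> by \<phi>, the change of variables holds with equality, so \<open>K = 1\<close>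
  works.\<close>

lemma wadm_isometric:
  assumes k: "k \<in> borel_measurable M" and \<phi>: "\<phi> \<in> measurable M M"
    and d: "distr (density M (\<lambda>x. ennreal ((cmod (k x))\<^sup>2))) M \<phi> = M"
  shows "wadm M k \<phi> 1"
  unfolding wadm_def
proof (intro conjI ballI)
  fix h :: "'a \<Rightarrow> ennreal" assume h: "h \<in> borel_measurable M"
  have "(\<integral>\<^sup>+x. h x \<partial>M) = (\<integral>\<^sup>+x. h x \<partial>distr (density M (\<lambda>x. ennreal ((cmod (k x))\<^sup>2))) M \<phi>)" using d by simp
  also have "\<dots> = (\<integral>\<^sup>+x. ennreal ((cmod (k x))\<^sup>2) * h (\<phi> x) \<partial>M)"
    using h k \<phi> by (simp add: nn_integral_distr nn_integral_density)
  finally show "(\<integral>\<^sup>+x. ennreal ((cmod (k x))\<^sup>2) * h (\<phi> x) \<partial>M) \<le> ennreal (1\<^sup>2) * (\<integral>\<^sup>+x. h x \<partial>M)" by simp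
qed (use k \<phi> in auto)

text \<open>Change of variables in the inner product: \<open>\<phi>'\<close> undoes \<phi>, and
  \<open>k x * k' (\<phi> x) = 1\<close> reduces the weight
  \<open>(cmod (k x))^2 * cnj (k' (\<phi> x))\<close> to \<open>k x\<close>.\<close>

lemma wcomp_isometric_adjoint:
  assumes k: "k \<in> borel_measurable M" and \<phi>: "\<phi> \<in> measurable M M"
    and d: "distr (density M (\<lambda>x. ennreal ((cmod (k x))\<^sup>2))) M \<phi> = M"
    and b: "wadm M k' \<phi>' K'"
    and i: "\<And>x. x \<in> space M \<Longrightarrow> \<phi>' (\<phi> x) = x" "\<And>x. x \<in> space M \<Longrightarrow> k x * k' (\<phi> x) = 1"
  shows "adjoint_of M (wcomp M k \<phi>) (wcomp M k' \<phi>')"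
proof (rule wcomp_adjoint[OF wadm_isometric[OF k \<phi> d] b])
  fix f h assume f: "sqint M f" and h: "sqint M h"
  let ?G = "\<lambda>x. f x * cnj (k' x * h (\<phi>' x))"
  have G: "?G \<in> borel_measurable M"
    using sqint_measurable[OF f] measurable_compose[OF wadm_measurable[OF b sqint_measurable[OF h]] cnj_measurable]
    by measurable
  have "(LINT x|M. ?G x) = (LINT x|distr (density M (\<lambda>x. ennreal ((cmod (k x))\<^sup>2))) M \<phi>. ?G x)" using d by simp
  also have "\<dots> = (LINT x|density M (\<lambda>x. ennreal ((cmod (k x))\<^sup>2)). ?G (\<phi> x))"
    using \<phi> G by (intro integral_distr) auto
  also have "\<dots> = (LINT x|M. (cmod (k x))\<^sup>2 *\<^sub>R ?G (\<phi> x))"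
    using k measurable_compose[OF \<phi> G] by (intro integral_density) auto
  also have "\<dots> = (LINT x|M. k x * f (\<phi> x) * cnj (h x))"
  proof (rule Bochner_Integration.integral_cong[OF refl])
    fix x assume x: "x \<in> space M"
    have "(cmod (k x))\<^sup>2 *\<^sub>R ?G (\<phi> x) = k x * cnj (k x) * (f (\<phi> x) * cnj (k' (\<phi> x)) * cnj (h x))"
      using i(1)[OF x] by (simp add: scaleR_conv_of_real mult.assoc flip: complex_norm_square)
    also have "\<dots> = k x * f (\<phi> x) * cnj (h x) * (cnj (k x) * cnj (k' (\<phi> x)))" by (simp add: ac_simps)
    also have "cnj (k x) * cnj (k' (\<phi> x)) = 1"
      using i(2)[OF x] by (metis complex_cnj_mult complex_cnj_one)
    finally show "(cmod (k x))\<^sup>2 *\<^sub>R ?G (\<phi> x) = k x * f (\<phi> x) * cnj (h x)" by simp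
  qed
  finally show "(LINT x|M. k x * f (\<phi> x) * cnj (h x)) = (LINT x|M. ?G x)" by simp
qed

subsection \<open>The representation on \<open>L\<^sup>2(\<mu>)\<close>\<close>

lemma conformal_deriv_mult:
  assumes "\<gamma> \<in> carrier PSL2C" "\<eta> \<in> carrier PSL2C" "x \<in> sphere 0 1"
  shows "conformal_deriv (\<gamma> \<ast> \<eta>) x = conformal_deriv \<gamma> (psl_act \<eta> x) * conformal_deriv \<eta> x"
proof -
  obtain A B where A: "det A = 1" "\<gamma> = psl A" and B: "det B = 1" "\<eta> = psl B"
    using assms by (metis PSL2C_cases)
  have x: "x \<in> cball 0 1" using assms(3) by auto
  have "det (A ** B) = 1" using A B by (simp add: det_mul)
  then show ?thesis unfolding A(2) B(2) PSL2C_mult psl_act_eq[OF x]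
    using conformal_deriv_eq[OF _ assms(3)] conformal_deriv_eq[OF A(1) mob_sphere[OF B(1) assms(3)]] B(1) tau_mult[OF B(1) x]
    by simp
qed

lemma conformal_deriv_pos: "\<gamma> \<in> carrier PSL2C \<Longrightarrow> x \<in> sphere 0 1 \<Longrightarrow> 0 < conformal_deriv \<gamma> x"
  by (elim PSL2C_cases) (auto simp: conformal_deriv_eq intro!: tau_pos)

lemma conformal_deriv_one: "x \<in> sphere 0 1 \<Longrightarrow> conformal_deriv gunit x = 1"
  by (simp add: PSL2C_one conformal_deriv_eq tau_one)

lemma conformal_deriv_continuous:
  assumes "\<gamma> \<in> carrier PSL2C" shows "continuous_on (sphere 0 1) (conformal_deriv \<gamma>)"
proof -
  obtain A where A: "det A = 1" "\<gamma> = psl A" using assms by (rule PSL2C_cases)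
  have "tau A x \<noteq> 0" if "x \<in> sphere 0 1" for x using tau_pos[OF A(1), of x] that by force
  then have "continuous_on (sphere 0 1) (\<lambda>x. 1 / tau A x)" by (intro continuous_intros tau_continuous) auto
  then show ?thesis by (rule continuous_on_eq) (simp add: A conformal_deriv_eq)
qed

lemma (in schottky) continuous_bounded:
  assumes "Cont f" obtains K where "0 \<le> K" "\<And>x. x \<in> \<Lambda> \<Longrightarrow> cmod (f x) \<le> K"
proof -
  have "bounded (f ` \<Lambda>)" using compact_continuous_image[OF assms \<Lambda>_compact] by (rule compact_imp_bounded)
  then obtain B where "0 < B" "\<And>x. x \<in> \<Lambda> \<Longrightarrow> cmod (f x) \<le> B" by (auto simp: bounded_pos)
  then show thesis using that[of B] by simp
qed

lemma (in schottky) mult_\<Gamma>: "\<gamma> \<in> \<Gamma> \<Longrightarrow> \<eta> \<in> \<Gamma> \<Longrightarrow> \<gamma> \<ast> \<eta> \<in> \<Gamma>"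
  by (rule subgroup.m_closed[OF \<Gamma>_subgroup])

lemma (in schottky) one_\<Gamma>: "gunit \<in> \<Gamma>" by (rule subgroup.one_closed[OF \<Gamma>_subgroup])

lemma (in schottky) inv_mult_\<Gamma>: "\<gamma> \<in> \<Gamma> \<Longrightarrow> \<eta> \<in> \<Gamma> \<Longrightarrow> ginv (\<gamma> \<ast> \<eta>) = ginv \<eta> \<ast> ginv \<gamma>"
  using \<Gamma>_carrier by (simp add: PSL.inv_mult_group)

text \<open>Both representations come from a space \<open>M\<close> with an equivariant map
  \<open>e\<close> to the limit set and a cocycle weight \<rho>. On the limit set \<open>e\<close>
  is the identity; on the product with the group it sends a pair to the translated point, with
  weight 1.\<close>

lemma (in schottky) wcomp_covariant:
  fixes M :: "'x measure"
  assumes e: "e \<in> measurable M (restrict_space borel \<Lambda>)"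
    and \<phi>: "\<And>\<gamma>. \<gamma> \<in> \<Gamma> \<Longrightarrow> \<phi> \<gamma> \<in> measurable M M" and \<rho>: "\<And>\<gamma>. \<gamma> \<in> \<Gamma> \<Longrightarrow> \<rho> \<gamma> \<in> borel_measurable M"
    and d: "\<And>\<gamma>. \<gamma> \<in> \<Gamma> \<Longrightarrow> distr (density M (\<lambda>p. ennreal ((cmod (\<rho> \<gamma> p))\<^sup>2))) M (\<phi> \<gamma>) = M"
    and \<phi>1: "\<And>p. p \<in> space M \<Longrightarrow> \<phi> gunit p = p"
    and \<phi>m: "\<And>\<gamma> \<eta> p. \<gamma> \<in> \<Gamma> \<Longrightarrow> \<eta> \<in> \<Gamma> \<Longrightarrow> p \<in> space M \<Longrightarrow> \<phi> (\<gamma> \<ast> \<eta>) p = \<phi> \<eta> (\<phi> \<gamma> p)"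
    and \<rho>1: "\<And>p. p \<in> space M \<Longrightarrow> \<rho> gunit p = 1"
    and \<rho>m: "\<And>\<gamma> \<eta> p. \<gamma> \<in> \<Gamma> \<Longrightarrow> \<eta> \<in> \<Gamma> \<Longrightarrow> p \<in> space M \<Longrightarrow> \<rho> (\<gamma> \<ast> \<eta>) p = \<rho> \<gamma> p * \<rho> \<eta> (\<phi> \<gamma> p)"
    and eq: "\<And>\<gamma> p. \<gamma> \<in> \<Gamma> \<Longrightarrow> p \<in> space M \<Longrightarrow> e (\<phi> \<gamma> p) = psl_act (ginv \<gamma>) (e p)"
    and \<pi>: "\<And>f. \<pi> f = wcomp M (\<lambda>p. f (e p)) (\<lambda>p. p)" and U: "\<And>\<gamma>. \<gamma> \<in> \<Gamma> \<Longrightarrow> U \<gamma> = wcomp M (\<rho> \<gamma>) (\<phi> \<gamma>)"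
  shows "covariant g \<Gamma> gen x\<^sub>0 (BL M) \<pi> U"
proof (intro covariant.intro covariant_axioms.intro schottky_axioms BL_cstar_algebra)
  have e\<Lambda>: "e p \<in> \<Lambda>" if "p \<in> space M" for p using measurable_space[OF e that] by (simp add: space_restrict_space)
  have fm: "(\<lambda>p. f (e p)) \<in> borel_measurable M" if "Cont f" for f :: "pt \<Rightarrow> complex"
    using measurable_compose[OF e borel_measurable_continuous_on_restrict[OF that]] .
  have wf: "wadm M (\<lambda>p. f (e p)) (\<lambda>p. p) K" if "Cont f" "0 \<le> K" "\<And>x. x \<in> \<Lambda> \<Longrightarrow> cmod (f x) \<le> K" for f K
    using fm[OF that(1)] that(2,3) e\<Lambda> by (intro wadm_id) auto
  have wf': "\<exists>K. wadm M (\<lambda>p. f (e p)) (\<lambda>p. p) K" if "Cont f" for f using continuous_bounded[OF that] wf[OF that] by metis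
  have wU: "wadm M (\<rho> \<gamma>) (\<phi> \<gamma>) 1" if "\<gamma> \<in> \<Gamma>" for \<gamma> by (intro wadm_isometric \<rho> \<phi> d that)
  fix f h :: "pt \<Rightarrow> complex" and K :: real and c assume f: "Cont f"
  obtain Kf where af: "wadm M (\<lambda>p. f (e p)) (\<lambda>p. p) Kf" using wf'[OF f] by blast
  obtain K' where "0 \<le> K'" "\<And>x. x \<in> \<Lambda> \<Longrightarrow> cmod (f x) \<le> K'" using continuous_bounded[OF f] by blast
  then have adj: "adjoint_of M (\<pi> f) (\<pi> (\<lambda>x. cnj (f x)))" unfolding \<pi> by (intro wcomp_id_adjoint[OF fm[OF f], of K']) (simp_all add: e\<Lambda>)
  show "\<pi> f \<in> carrier (BL M)" using adjoint_of_adjointables[OF adj] by simp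
  show "\<pi> (\<lambda>x. cnj (f x)) = cstar_adj (BL M) (\<pi> f)" using cstar_adj_eqI[OF adj] by simp
  show "\<pi> (\<lambda>x. c * f x) = c \<odot>\<^bsub>BL M\<^esub> \<pi> f" using wcomp_linear(2)[OF af af] by (simp add: \<pi>)
  show "\<pi> f = \<pi> h" if "\<And>x. x \<in> \<Lambda> \<Longrightarrow> f x = h x"
    unfolding \<pi> by (rule wcomp_cong) (simp_all add: that e\<Lambda>)
  show "cstar_norm (BL M) (\<pi> f) \<le> K" if "\<And>x. x \<in> \<Lambda> \<Longrightarrow> cmod (f x) \<le> K" "0 \<le> K"
    unfolding BL_simps \<pi> by (rule opn_le[OF that(2) wcomp_norm_le[OF wf[OF f that(2,1)]]])
  show "U \<gamma> \<otimes>\<^bsub>BL M\<^esub> \<pi> f = \<pi> (\<lambda>x. f (psl_act (ginv \<gamma>) x)) \<otimes>\<^bsub>BL M\<^esub> U \<gamma>" if \<gamma>: "\<gamma> \<in> \<Gamma>" for \<gamma>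
  proof -
    have "Cont (\<lambda>x. f (psl_act (ginv \<gamma>) x))"
      using continuous_on_compose2[OF f act_continuous[OF inv_\<Gamma>[OF \<gamma>]]] act_\<Lambda>[OF inv_\<Gamma>[OF \<gamma>]] by blast
    then obtain K' where a: "wadm M (\<lambda>p. f (psl_act (ginv \<gamma>) (e p))) (\<lambda>p. p) K'" using wf' by blast
    show ?thesis unfolding BL_simps L2_operators_simps \<pi> U[OF \<gamma>] wcomp_compose[OF wU[OF \<gamma>] af] wcomp_compose[OF a wU[OF \<gamma>]]
      by (rule wcomp_cong) (simp_all add: eq[OF \<gamma>] mult.commute)
  qed
  assume h: "Cont h"
  obtain Kh where ah: "wadm M (\<lambda>p. h (e p)) (\<lambda>p. p) Kh" using wf'[OF h] by blast
  show "\<pi> (\<lambda>x. f x + h x) = \<pi> f \<oplus>\<^bsub>BL M\<^esub> \<pi> h" using wcomp_linear(1)[OF af ah] by (simp add: \<pi>)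
  show "\<pi> (\<lambda>x. f x * h x) = \<pi> f \<otimes>\<^bsub>BL M\<^esub> \<pi> h" using wcomp_compose[OF af ah] by (simp add: \<pi>)
next
  have wU: "wadm M (\<rho> \<gamma>) (\<phi> \<gamma>) 1" if "\<gamma> \<in> \<Gamma>" for \<gamma> by (intro wadm_isometric \<rho> \<phi> d that)
  show "\<pi> (\<lambda>_. 1) = \<one>\<^bsub>BL M\<^esub>" by (simp add: \<pi> wcomp_one)
  have "wcomp M (\<lambda>_. 1) (\<lambda>p. p) = wcomp M (\<rho> gunit) (\<phi> gunit)"
    by (rule wcomp_cong) (simp_all add: \<rho>1 \<phi>1)
  then show "U gunit = \<one>\<^bsub>BL M\<^esub>" by (simp add: U[OF one_\<Gamma>] wcomp_one)
  fix \<gamma> assume \<gamma>: "\<gamma> \<in> \<Gamma>"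
  have adj: "adjoint_of M (U \<gamma>) (U (ginv \<gamma>))"
    unfolding U[OF \<gamma>] U[OF inv_\<Gamma>[OF \<gamma>]]
    by (rule wcomp_isometric_adjoint[OF \<rho>[OF \<gamma>] \<phi>[OF \<gamma>] d[OF \<gamma>] wU[OF inv_\<Gamma>[OF \<gamma>]]])
       (simp_all add: PSL.r_inv[OF \<Gamma>_carrier[OF \<gamma>]] \<phi>1 \<rho>1 flip: \<phi>m[OF \<gamma> inv_\<Gamma>[OF \<gamma>]] \<rho>m[OF \<gamma> inv_\<Gamma>[OF \<gamma>]])
  show "U \<gamma> \<in> carrier (BL M)" using adjoint_of_adjointables[OF adj] by simp
  show "cstar_adj (BL M) (U \<gamma>) = U (ginv \<gamma>)" using cstar_adj_eqI[OF adj] by simp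
  fix \<eta> assume \<eta>: "\<eta> \<in> \<Gamma>"
  show "U (\<gamma> \<ast> \<eta>) = U \<gamma> \<otimes>\<^bsub>BL M\<^esub> U \<eta>"
    unfolding BL_simps L2_operators_simps U[OF \<gamma>] U[OF \<eta>] U[OF mult_\<Gamma>[OF \<gamma> \<eta>]] wcomp_compose[OF wU[OF \<gamma>] wU[OF \<eta>]]
    by (rule wcomp_cong) (simp_all add: \<rho>m[OF \<gamma> \<eta>] \<phi>m[OF \<gamma> \<eta>])
qed

locale patterson_sullivan = schottky +
  fixes \<mu> :: "pt measure"
  assumes ps: "patterson_sullivan_measure \<Gamma> \<mu>"
begin

sublocale \<mu>: prob_space \<mu> using ps by (simp add: patterson_sullivan_measure_def)

lemma sets_\<mu>: "sets \<mu> = sets (restrict_space borel \<Lambda>)"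
  using ps by (simp add: patterson_sullivan_measure_def)

lemma space_\<mu> [simp]: "space \<mu> = \<Lambda>"
  using sets_eq_imp_space_eq[OF sets_\<mu>] by (simp add: space_restrict_space)

lemma continuous_measurable: "Cont f \<Longrightarrow> f \<in> borel_measurable \<mu>"
  using borel_measurable_continuous_on_restrict[of \<Lambda> f] measurable_cong_sets[OF sets_\<mu> refl] by blast

lemma act_measurable:
  assumes "\<gamma> \<in> \<Gamma>" shows "psl_act \<gamma> \<in> measurable \<mu> \<mu>"
proof -
  have "psl_act \<gamma> \<in> measurable \<mu> (restrict_space borel \<Lambda>)"
    using act_\<Lambda>[OF assms] by (intro measurable_restrict_space2 continuous_measurable act_continuous[OF assms]) auto
  then show ?thesis using measurable_cong_sets[OF refl sets_\<mu>] by blast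
qed

abbreviation "\<delta> \<equiv> hausdorff_dim \<Lambda>"

definition rho :: "psl2 \<Rightarrow> pt \<Rightarrow> complex" where
  "rho \<gamma> x = of_real (conformal_deriv (ginv \<gamma>) x powr (\<delta> / 2))"

lemma T_op_wcomp: "T_op \<Gamma> \<mu> \<gamma> = wcomp \<mu> (rho \<gamma>) (psl_act (ginv \<gamma>))"
  by (simp add: T_op_def wcomp_def rho_def)

lemma cd_pos: "\<gamma> \<in> \<Gamma> \<Longrightarrow> x \<in> \<Lambda> \<Longrightarrow> 0 < conformal_deriv \<gamma> x"
  using conformal_deriv_pos[OF \<Gamma>_carrier] \<Lambda>_sphere by blast

lemma rho_measurable:
  assumes "\<gamma> \<in> \<Gamma>" shows "rho \<gamma> \<in> borel_measurable \<mu>"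
proof -
  have "Cont (conformal_deriv (ginv \<gamma>))"
    using continuous_on_subset[OF conformal_deriv_continuous[OF \<Gamma>_carrier[OF inv_\<Gamma>[OF assms]]] \<Lambda>_sphere] .
  then have "Cont (rho \<gamma>)"
    unfolding rho_def using cd_pos[OF inv_\<Gamma>[OF assms]] by (intro continuous_intros) force+
  then show ?thesis by (rule continuous_measurable)
qed

lemma rho_sq: "(cmod (rho \<gamma> x))\<^sup>2 = conformal_deriv (ginv \<gamma>) x powr \<delta>"
  by (simp add: rho_def power2_eq_square flip: powr_add)

text \<open>The conformality of the measure, applied to the preimage of \<open>E\<close> under the
  inverse element, is exactly this statement about a pushforward.\<close>

lemma distr_act:
  assumes \<gamma>: "\<gamma> \<in> \<Gamma>"
  shows "distr (density \<mu> (\<lambda>x. ennreal ((cmod (rho \<gamma> x))\<^sup>2))) \<mu> (psl_act (ginv \<gamma>)) = \<mu>"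
    (is "distr (density \<mu> ?d) \<mu> ?\<eta> = \<mu>")
proof (rule measure_eqI)
  note \<eta> = inv_\<Gamma>[OF \<gamma>]
  note m = act_measurable[OF \<eta>]
  fix E assume "E \<in> sets (distr (density \<mu> ?d) \<mu> ?\<eta>)"
  then have E: "E \<in> sets \<mu>" by simp
  have E': "?\<eta> -` E \<inter> space \<mu> \<in> sets \<mu>" using measurable_sets[OF m E] .
  have d: "?d \<in> borel_measurable \<mu>" using measurable_compose[OF rho_measurable[OF \<gamma>], of "\<lambda>z. ennreal ((cmod z)\<^sup>2)" borel] by simp
  have "emeasure (distr (density \<mu> ?d) \<mu> ?\<eta>) E = emeasure (density \<mu> ?d) (?\<eta> -` E \<inter> space \<mu>)"
    using m E by (simp add: emeasure_distr)
  also have "\<dots> = (\<integral>\<^sup>+x\<in>(?\<eta> -` E \<inter> space \<mu>). ennreal (conformal_deriv (ginv \<gamma>) x powr \<delta>) \<partial>\<mu>)"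
    by (subst emeasure_density[OF d E']) (simp only: rho_sq)
  also have "\<dots> = emeasure \<mu> (?\<eta> ` (?\<eta> -` E \<inter> space \<mu>))"
    using bspec[OF bspec[OF conjunct2[OF conjunct2[OF ps[unfolded patterson_sullivan_measure_def]]] \<eta>] E'] by simp
  also have "?\<eta> ` (?\<eta> -` E \<inter> space \<mu>) = E"
  proof -
    have "x \<in> ?\<eta> ` (?\<eta> -` E \<inter> space \<mu>)" if "x \<in> E" for x
    proof -
      have "x \<in> \<Lambda>" using sets.sets_into_space[OF E] that by auto
      then show ?thesis using act_\<Lambda>[OF \<gamma>] act_inv(1)[OF \<gamma>, of x] that by (intro image_eqI[of _ _ "psl_act \<gamma> x"]) auto
    qed
    then show ?thesis by auto
  qed
  finally show "emeasure (distr (density \<mu> ?d) \<mu> ?\<eta>) E = emeasure \<mu> E" .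
qed simp

lemma rho_mult:
  assumes "\<gamma> \<in> \<Gamma>" "\<eta> \<in> \<Gamma>" "x \<in> \<Lambda>"
  shows "rho (\<gamma> \<ast> \<eta>) x = rho \<gamma> x * rho \<eta> (psl_act (ginv \<gamma>) x)"
proof -
  note i = inv_\<Gamma>[OF assms(1)] inv_\<Gamma>[OF assms(2)]
  have xs: "x \<in> sphere 0 1" using assms(3) \<Lambda>_sphere by blast
  have "conformal_deriv (ginv (\<gamma> \<ast> \<eta>)) x
    = conformal_deriv (ginv \<eta>) (psl_act (ginv \<gamma>) x) * conformal_deriv (ginv \<gamma>) x"
    using conformal_deriv_mult[OF \<Gamma>_carrier[OF i(2)] \<Gamma>_carrier[OF i(1)] xs] inv_mult_\<Gamma>[OF assms(1,2)] by simp
  then show ?thesis unfolding rho_def by (simp add: powr_mult mult.commute)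
qed

lemma rho_one: "x \<in> \<Lambda> \<Longrightarrow> rho gunit x = 1"
  using \<Lambda>_sphere conformal_deriv_one[of x] by (auto simp: rho_def)

sublocale R: covariant g \<Gamma> gen x\<^sub>0 "BL \<mu>" "mult_op \<mu>" "T_op \<Gamma> \<mu>"
proof (rule wcomp_covariant[where e = "\<lambda>x. x" and \<rho> = rho and \<phi> = "\<lambda>\<gamma>. psl_act (ginv \<gamma>)"])
  show "(\<lambda>x. x) \<in> measurable \<mu> (restrict_space borel \<Lambda>)" by (rule measurable_ident_sets[OF sets_\<mu>])
  show "psl_act (ginv (\<gamma> \<ast> \<eta>)) x = psl_act (ginv \<eta>) (psl_act (ginv \<gamma>) x)"
    if "\<gamma> \<in> \<Gamma>" "\<eta> \<in> \<Gamma>" "x \<in> space \<mu>" for \<gamma> \<eta> x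
    using act_mult[OF inv_\<Gamma>[OF that(2)] inv_\<Gamma>[OF that(1)]] that by (simp add: inv_mult_\<Gamma>)
qed (simp_all add: mult_op_wcomp T_op_wcomp rho_measurable act_measurable inv_\<Gamma> distr_act rho_mult rho_one psl_act_one[OF \<Lambda>_cball])

text \<open>The comparison of norms needs a nonzero source algebra; a probability measure does not
  identify the constants 1 and 0.\<close>

lemma one_neq_zero: "\<one>\<^bsub>BL \<mu>\<^esub> \<noteq> \<zero>\<^bsub>BL \<mu>\<^esub>"
proof
  assume "\<one>\<^bsub>BL \<mu>\<^esub> = \<zero>\<^bsub>BL \<mu>\<^esub>"
  moreover have "sqint \<mu> (\<lambda>_. 1)" by (simp add: sqint_def)
  ultimately have "L2_class \<mu> (\<lambda>_. 1) = L2_class \<mu> (\<lambda>_. 0)" by (auto dest!: fun_cong[where x = "L2_class \<mu> (\<lambda>_. 1)"])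
  then have "AE x in \<mu>. (1::complex) = 0" by (subst (asm) L2_class_eq_iff) auto
  then show False by simp
qed

end

section \<open>Matrix entries and Fourier coefficients in the crossed product\<close>

subsection \<open>The crossed product\<close>

text \<open>On a counting measure a class is determined by its values, since no point is null.\<close>

lemma count_rep: "p \<in> A \<Longrightarrow> L2_rep (L2_class (count_space A) f) p = f p"
  using L2_rep_class(2)[of f "count_space A"] by (simp add: AE_count_space)

lemma count_eqI:
  assumes "u \<in> L2 (count_space A)" "v \<in> L2 (count_space A)" "\<And>p. p \<in> A \<Longrightarrow> L2_rep u p = L2_rep v p"
  shows "u = v"
proof -
  have "L2_class (count_space A) (L2_rep u) = L2_class (count_space A) (L2_rep v)"
    using assms(3) by (subst L2_class_eq_iff) (auto simp: AE_count_space)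
  then show ?thesis using assms by simp
qed

definition pt_mass :: "'x set \<Rightarrow> 'x \<Rightarrow> ('x \<Rightarrow> complex) set" where
  "pt_mass A p = L2_class (count_space A) (indicator {p})"

lemma sqint_pt_mass: "sqint (count_space A) (indicator {p})"
proof -
  have "(\<integral>\<^sup>+x. ennreal ((cmod (indicator {p} x))\<^sup>2) \<partial>count_space A) = (\<integral>\<^sup>+x. indicator ({p} \<inter> A) x \<partial>count_space A)"
    by (intro nn_integral_cong) (auto split: split_indicator)
  then show ?thesis by (simp add: sqint_iff_nn emeasure_count_space of_nat_less_top)
qed

lemma pt_mass_in [simp]: "pt_mass A p \<in> L2 (count_space A)"
  unfolding pt_mass_def by (rule L2I[OF sqint_pt_mass])

lemma pt_mass_rep: "q \<in> A \<Longrightarrow> L2_rep (pt_mass A p) q = (if q = p then 1 else 0)"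
  unfolding pt_mass_def by (simp add: count_rep)

lemma inner_pt_mass:
  assumes u: "u \<in> L2 (count_space A)" and p: "p \<in> A"
  shows "L2_inner (count_space A) u (pt_mass A p) = L2_rep u p"
proof -
  have "L2_inner (count_space A) u (pt_mass A p) = (LINT x|count_space A. L2_rep u x * cnj (indicator {p} x))"
    using L2_inner_class[OF L2_rep_sqint[OF u] sqint_pt_mass] u by (simp add: pt_mass_def)
  also have "\<dots> = (LINT x|count_space A. L2_rep u x * indicator {p} x)" by (intro Bochner_Integration.integral_cong) (auto split: split_indicator)
  also have "\<dots> = (\<Sum>x\<in>{p}. L2_rep u x * indicator {p} x)"
    using p by (intro lebesgue_integral_count_space_finite_support[THEN trans] sum.mono_neutral_left) (auto split: split_indicator_asm intro: finite_subset[of _ "{p}"])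
  finally show ?thesis by simp
qed

lemma inner_pt_mass_left:
  "u \<in> L2 (count_space A) \<Longrightarrow> p \<in> A \<Longrightarrow> L2_inner (count_space A) (pt_mass A p) u = cnj (L2_rep u p)"
  using L2_inner_commute[of u "count_space A" "pt_mass A p"] inner_pt_mass[of u A p] by simp

lemma pt_mass_norm: "p \<in> A \<Longrightarrow> L2_norm (count_space A) (pt_mass A p) = 1"
  using inner_pt_mass[of "pt_mass A p" A p] L2_norm_sq[of "pt_mass A p" "count_space A"] L2_norm_nonneg[of "count_space A" "pt_mass A p"]
  by (simp add: pt_mass_rep power2_eq_1_iff del: L2_norm_nonneg flip: of_real_power)

lemma rep_le_norm: "u \<in> L2 (count_space A) \<Longrightarrow> p \<in> A \<Longrightarrow> cmod (L2_rep u p) \<le> L2_norm (count_space A) u"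
  using L2_cauchy_schwarz[of u "count_space A" "pt_mass A p"] by (simp add: inner_pt_mass pt_mass_norm)

lemma adjoint_ofD:
  "adjoint_of M T T' \<Longrightarrow> u \<in> L2 M \<Longrightarrow> v \<in> L2 M \<Longrightarrow> L2_inner M (T u) v = L2_inner M u (T' v)"
  by (simp add: adjoint_of_def)

text \<open>The matrix entry in row \<open>p\<close> and column \<open>q\<close> with respect to the
  point masses.\<close>

definition mcoef :: "'x set \<Rightarrow> 'x L2_op \<Rightarrow> 'x \<Rightarrow> 'x \<Rightarrow> complex" where
  "mcoef A x p q = L2_rep (x (pt_mass A q)) p"

lemma mcoef_inner:
  assumes "bounded_op (count_space A) x" "p \<in> A"
  shows "mcoef A x p q = L2_inner (count_space A) (x (pt_mass A q)) (pt_mass A p)"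
  using inner_pt_mass[OF bop_in[OF assms(1) pt_mass_in] assms(2)] by (simp add: mcoef_def)

text \<open>Equal entries make the adjoints agree on point masses, and every coordinate of
  \<open>x u\<close> is an inner product of \<open>u\<close> with the adjoint at a point mass. No
  approximation of \<open>u\<close> is involved.\<close>

lemma mcoef_eqI:
  assumes x: "x \<in> adjointables (count_space A)" and y: "y \<in> adjointables (count_space A)"
    and e: "\<And>p q. p \<in> A \<Longrightarrow> q \<in> A \<Longrightarrow> mcoef A x p q = mcoef A y p q"
  shows "x = y"
proof -
  let ?M = "count_space A"
  note xb = adjointable_bounded[OF x] and yb = adjointable_bounded[OF y]
  let ?x = "cstar_adj (LO ?M) x" and ?y = "cstar_adj (LO ?M) y"
  note xa = adjointables_adjoint[OF x] and ya = adjointables_adjoint[OF y]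
  have xa': "L2_inner ?M (x u) v = L2_inner ?M u (?x v)" "?x v \<in> L2 ?M"
    and ya': "L2_inner ?M (y u) v = L2_inner ?M u (?y v)" "?y v \<in> L2 ?M"
    if "u \<in> L2 ?M" "v \<in> L2 ?M" for u v
    using adjoint_ofD[OF xa that] adjoint_ofD[OF ya that] bop_in[OF adjoint_of_bounded(2)[OF xa] that(2)]
      bop_in[OF adjoint_of_bounded(2)[OF ya] that(2)] by - assumption+
  have s: "?x (pt_mass A p) = ?y (pt_mass A p)" if p: "p \<in> A" for p
  proof (rule count_eqI)
    show "?x (pt_mass A p) \<in> L2 ?M" "?y (pt_mass A p) \<in> L2 ?M" by (rule xa'(2)[OF pt_mass_in pt_mass_in], rule ya'(2)[OF pt_mass_in pt_mass_in])
    fix q assume q: "q \<in> A"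
    have "L2_inner ?M (pt_mass A q) (?x (pt_mass A p)) = L2_inner ?M (pt_mass A q) (?y (pt_mass A p))"
      using e[OF p q] mcoef_inner[OF xb p, of q] mcoef_inner[OF yb p, of q] xa'(1)[of "pt_mass A q" "pt_mass A p"] ya'(1)[of "pt_mass A q" "pt_mass A p"] by simp
    then show "L2_rep (?x (pt_mass A p)) q = L2_rep (?y (pt_mass A p)) q"
      using inner_pt_mass_left[OF xa'(2)[OF pt_mass_in pt_mass_in] q, of p] inner_pt_mass_left[OF ya'(2)[OF pt_mass_in pt_mass_in] q, of p] by simp
  qed
  show ?thesis
  proof (rule bop_eqI[OF xb yb])
    fix u assume u: "u \<in> L2 ?M"
    show "x u = y u"
    proof (rule count_eqI[OF bop_in[OF xb u] bop_in[OF yb u]])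
      fix p assume p: "p \<in> A"
      show "L2_rep (x u) p = L2_rep (y u) p"
        using inner_pt_mass[OF bop_in[OF xb u] p] inner_pt_mass[OF bop_in[OF yb u] p] xa'(1)[OF u pt_mass_in, of p] ya'(1)[OF u pt_mass_in, of p] s[OF p] by simp
    qed
  qed
qed

lemma mcoef_add:
  assumes "bounded_op (count_space A) x" "bounded_op (count_space A) y" "p \<in> A"
  shows "mcoef A (\<lambda>u\<in>L2 (count_space A). L2_add (count_space A) (x u) (y u)) p q = mcoef A x p q + mcoef A y p q"
  using assms(3) by (simp add: mcoef_def L2_add_def count_rep)

lemma mcoef_scale:
  assumes "p \<in> A"
  shows "mcoef A (\<lambda>u\<in>L2 (count_space A). L2_scale (count_space A) c (x u)) p q = c * mcoef A x p q"
  using assms by (simp add: mcoef_def L2_scale_def count_rep)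

lemma mcoef_wcomp_left:
  assumes "bounded_op (count_space A) x" "p \<in> A"
  shows "mcoef A (compose (L2 (count_space A)) (wcomp (count_space A) k \<phi>) x) p q = k p * mcoef A x (\<phi> p) q"
  using assms bop_in[OF assms(1) pt_mass_in] by (simp add: mcoef_def compose_def wcomp_def L2_lift_def count_rep)

lemma mcoef_diff_le:
  assumes x: "bounded_op (count_space A) x" and y: "bounded_op (count_space A) y" and pq: "p \<in> A" "q \<in> A"
  shows "cmod (mcoef A x p q - mcoef A y p q) \<le> opn (count_space A) (x \<ominus>\<^bsub>LO (count_space A)\<^esub> y)"
proof -
  let ?M = "count_space A"
  have "mcoef A x p q - mcoef A y p q = L2_rep (L2_diff ?M (x (pt_mass A q)) (y (pt_mass A q))) p"
    using pq by (simp add: mcoef_def L2_diff_def L2_add_def L2_scale_def count_rep)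
  also have "cmod \<dots> \<le> L2_dist ?M (x (pt_mass A q)) (y (pt_mass A q))"
    using bop_in[OF x pt_mass_in] bop_in[OF y pt_mass_in] by (intro rep_le_norm pq(1)) auto
  also have "\<dots> \<le> opn ?M (x \<ominus>\<^bsub>LO ?M\<^esub> y)" using opn_minus(1)[OF x y pt_mass_in, of q] pq by (simp add: pt_mass_norm)
  finally show ?thesis .
qed

context schottky
begin

abbreviation "GX \<equiv> \<Gamma> \<times> \<Lambda>"
abbreviation "cs \<equiv> count_space GX"
abbreviation "\<G> \<equiv> PSL2C\<lparr>carrier := \<Gamma>\<rparr>"
abbreviation "cf \<equiv> crossed_fun \<G> psl_act \<Lambda>"
abbreviation "cu \<equiv> crossed_unitary \<G> \<Lambda>"

abbreviation xmult (infixl "\<otimes>\<^sub>X" 70) where "x \<otimes>\<^sub>X y \<equiv> x \<otimes>\<^bsub>BL cs\<^esub> y"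

lemma inv_\<G>: "\<gamma> \<in> \<Gamma> \<Longrightarrow> inv\<^bsub>\<G>\<^esub> \<gamma> = ginv \<gamma>"
  using PSL.m_inv_consistent[OF \<Gamma>_subgroup] by simp

lemma inv_mult_cancel:
  assumes "\<gamma> \<in> \<Gamma>" "\<eta> \<in> \<Gamma>"
  shows "ginv \<gamma> \<ast> (\<gamma> \<ast> \<eta>) = \<eta>" "\<gamma> \<ast> (ginv \<gamma> \<ast> \<eta>) = \<eta>"
  using assms \<Gamma>_carrier by (simp_all flip: PSL.m_assoc)

definition fac :: "(pt \<Rightarrow> complex) \<Rightarrow> psl2 \<times> pt \<Rightarrow> complex" where
  "fac f p = f (psl_act (fst p) (snd p))"
definition shift :: "psl2 \<Rightarrow> psl2 \<times> pt \<Rightarrow> psl2 \<times> pt" where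
  "shift t p = (ginv t \<ast> fst p, snd p)"

lemma cf_wcomp: "cf f = wcomp cs (fac f) (\<lambda>p. p)"
  by (simp add: crossed_fun_def wcomp_def fac_def case_prod_beta')

lemma cu_wcomp: "t \<in> \<Gamma> \<Longrightarrow> cu t = wcomp cs (\<lambda>_. 1) (shift t)"
  by (simp add: crossed_unitary_def wcomp_def shift_def inv_\<G> case_prod_beta')

lemma shift_in: "t \<in> \<Gamma> \<Longrightarrow> p \<in> GX \<Longrightarrow> shift t p \<in> GX"
  by (simp add: shift_def mem_Times_iff mult_\<Gamma> inv_\<Gamma>)

lemma shift_inv: "t \<in> \<Gamma> \<Longrightarrow> p \<in> GX \<Longrightarrow> shift (ginv t) (shift t p) = p"
  by (cases p) (simp add: shift_def inv_mult_cancel \<Gamma>_carrier)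

lemma distr_shift:
  assumes t: "t \<in> \<Gamma>" shows "distr (density cs (\<lambda>_. ennreal ((cmod 1)\<^sup>2))) cs (shift t) = cs"
proof -
  have "bij_betw (shift t) GX GX"
  proof (rule bij_betw_byWitness[of _ "shift (ginv t)"])
    show "\<forall>a\<in>GX. shift (ginv t) (shift t a) = a" using shift_inv[OF t] by blast
    show "\<forall>a\<in>GX. shift t (shift (ginv t) a) = a" using shift_inv[OF inv_\<Gamma>[OF t]] t \<Gamma>_carrier by simp
  qed (use shift_in t inv_\<Gamma> in blast)+
  then show ?thesis by (simp add: density_1 distr_bij_count_space)
qed

text \<open>Here \<open>e\<close> is the action map on pairs, which intertwines the shift of the
  group coordinate with the action on the limit set.\<close>

lemma crossed_covariant: "covariant g \<Gamma> gen x\<^sub>0 (BL cs) cf cu"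
proof (rule wcomp_covariant[where e = "\<lambda>p. psl_act (fst p) (snd p)" and \<rho> = "\<lambda>_ _. 1" and \<phi> = shift])
  show "(\<lambda>p. psl_act (fst p) (snd p)) \<in> measurable cs (restrict_space borel \<Lambda>)"
    using act_\<Lambda> by (simp add: space_restrict_space Pi_def mem_Times_iff)
  show "psl_act (fst (shift \<gamma> p)) (snd (shift \<gamma> p)) = psl_act (ginv \<gamma>) (psl_act (fst p) (snd p))"
    if "\<gamma> \<in> \<Gamma>" "p \<in> space cs" for \<gamma> p
    using that act_mult[OF inv_\<Gamma>[OF that(1)], of "fst p" "snd p"] by (simp add: shift_def mem_Times_iff)
  show "shift (\<gamma> \<ast> \<eta>) p = shift \<eta> (shift \<gamma> p)" if "\<gamma> \<in> \<Gamma>" "\<eta> \<in> \<Gamma>" "p \<in> space cs" for \<gamma> \<eta> p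
    using that \<Gamma>_carrier[OF that(1)] \<Gamma>_carrier[OF that(2)] \<Gamma>_carrier[of "fst p"]
    by (simp add: shift_def inv_mult_\<Gamma> PSL.m_assoc mem_Times_iff)
  show "shift gunit p = p" if "p \<in> space cs" for p
    using that \<Gamma>_carrier[of "fst p"] by (simp add: shift_def mem_Times_iff prod_eq_iff)
  show "shift \<gamma> \<in> measurable cs cs" if "\<gamma> \<in> \<Gamma>" for \<gamma> using shift_in[OF that] by simp
  show "distr (density cs (\<lambda>_. ennreal ((cmod 1)\<^sup>2))) cs (shift \<gamma>) = cs" if "\<gamma> \<in> \<Gamma>" for \<gamma> by (rule distr_shift[OF that])
qed (simp_all add: cf_wcomp cu_wcomp fac_def[abs_def])

interpretation X: covariant g \<Gamma> gen x\<^sub>0 "BL cs" cf cu by (rule crossed_covariant)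

text \<open>Informally, \<open>x = \<Sum>\<^sub>t e\<^sub>t U\<^sub>t\<close> with continuous Fourier coefficients \<open>e\<^sub>t\<close>.\<close>

definition coefs :: "(psl2 \<times> pt) L2_op \<Rightarrow> (psl2 \<Rightarrow> pt \<Rightarrow> complex) \<Rightarrow> bool" where
  "coefs x e \<longleftrightarrow> x \<in> adjointables cs \<and> (\<forall>r\<in>\<Gamma>. Cont (e r)) \<and>
     (\<forall>s\<in>\<Gamma>. \<forall>s'\<in>\<Gamma>. \<forall>y\<in>\<Lambda>. \<forall>y'\<in>\<Lambda>. mcoef GX x (s', y') (s, y) =
        (if y = y' then e (s' \<ast> ginv s) (psl_act s' y) else 0))"

lemma coefsI:
  assumes "x \<in> adjointables cs" "\<And>r. r \<in> \<Gamma> \<Longrightarrow> Cont (e r)"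
    "\<And>s s' y y'. s \<in> \<Gamma> \<Longrightarrow> s' \<in> \<Gamma> \<Longrightarrow> y \<in> \<Lambda> \<Longrightarrow> y' \<in> \<Lambda> \<Longrightarrow> mcoef GX x (s', y') (s, y) =
      (if y = y' then e (s' \<ast> ginv s) (psl_act s' y) else 0)"
  shows "coefs x e"
  unfolding coefs_def by (intro conjI ballI assms)

lemma coefsD:
  assumes "coefs x e"
  shows "x \<in> adjointables cs" "bounded_op cs x" "\<And>r. r \<in> \<Gamma> \<Longrightarrow> Cont (e r)"
    "\<And>s s' y y'. s \<in> \<Gamma> \<Longrightarrow> s' \<in> \<Gamma> \<Longrightarrow> y \<in> \<Lambda> \<Longrightarrow> y' \<in> \<Lambda> \<Longrightarrow> mcoef GX x (s', y') (s, y) =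
      (if y = y' then e (s' \<ast> ginv s) (psl_act s' y) else 0)"
  using assms adjointable_bounded unfolding coefs_def by blast+

lemma coefs_one: "coefs \<one>\<^bsub>BL cs\<^esub> (\<lambda>r _. if r = gunit then 1 else 0)"
proof (rule coefsI)
  fix s s' y y' assume a: "s \<in> \<Gamma>" "s' \<in> \<Gamma>" "y \<in> \<Lambda>" "y' \<in> \<Lambda>"
  have "s' \<ast> ginv s = gunit \<longleftrightarrow> s' = s"
    using \<Gamma>_carrier[OF a(1)] \<Gamma>_carrier[OF a(2)] PSL.r_inv PSL.inv_solve_right'[of "gunit" s' s] by auto
  moreover have "mcoef GX \<one>\<^bsub>BL cs\<^esub> (s', y') (s, y) = (if (s', y') = (s, y) then 1 else 0)"
    using a by (simp add: mcoef_def pt_mass_rep)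
  ultimately show "mcoef GX \<one>\<^bsub>BL cs\<^esub> (s', y') (s, y) =
    (if y = y' then if s' \<ast> ginv s = gunit then 1 else 0 else 0)" by auto
qed (use X.one_closed in \<open>auto\<close>)

lemma coefs_add:
  assumes "coefs x e" "coefs y e'" shows "coefs (x \<oplus>\<^bsub>BL cs\<^esub> y) (\<lambda>r z. e r z + e' r z)"
proof (rule coefsI)
  show "x \<oplus>\<^bsub>BL cs\<^esub> y \<in> adjointables cs" using X.a_closed[of x y] coefsD(1)[OF assms(1)] coefsD(1)[OF assms(2)] by simp
qed (use coefsD[OF assms(1)] coefsD[OF assms(2)] in \<open>auto simp: mcoef_add intro: continuous_on_add\<close>)

lemma coefs_scale:
  assumes "coefs x e" shows "coefs (c \<odot>\<^bsub>BL cs\<^esub> x) (\<lambda>r z. c * e r z)"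
proof (rule coefsI)
  show "c \<odot>\<^bsub>BL cs\<^esub> x \<in> adjointables cs" using X.smult_closed[of c x] coefsD(1)[OF assms(1)] by (simp add: complex_ring_def)
qed (use coefsD[OF assms(1)] in \<open>auto simp: mcoef_scale intro: continuous_on_mult_left\<close>)

lemma coefs_cf:
  assumes "coefs x e" and f: "Cont f" shows "coefs (cf f \<otimes>\<^sub>X x) (\<lambda>r z. f z * e r z)"
proof (rule coefsI)
  show "cf f \<otimes>\<^sub>X x \<in> adjointables cs" using X.m_closed[of "cf f" x] coefsD(1)[OF assms(1)] X.\<pi>_closed[OF f] by simp
  show "Cont (\<lambda>z. f z * e r z)" if "r \<in> \<Gamma>" for r by (intro continuous_on_mult f coefsD(3)[OF assms(1) that])
  fix s s' y y' assume a: "s \<in> \<Gamma>" "s' \<in> \<Gamma>" "y \<in> \<Lambda>" "y' \<in> \<Lambda>"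
  then have "(s', y') \<in> GX" by simp
  from mcoef_wcomp_left[OF coefsD(2)[OF assms(1)] this]
  show "mcoef GX (cf f \<otimes>\<^sub>X x) (s', y') (s, y) =
      (if y = y' then f (psl_act s' y) * e (s' \<ast> ginv s) (psl_act s' y) else 0)"
    using coefsD(4)[OF assms(1) a] by (simp add: cf_wcomp fac_def)
qed

text \<open>Multiplying the formal series by the unitary of \<open>t\<close> moves the coefficient
  at the inverse of \<open>t\<close> times \<open>r\<close> to \<open>r\<close> and translates it by
  \<open>t\<close>.\<close>

lemma coefs_cu:
  assumes "coefs x e" and t: "t \<in> \<Gamma>"
  shows "coefs (cu t \<otimes>\<^sub>X x) (\<lambda>r z. e (ginv t \<ast> r) (psl_act (ginv t) z))"
proof (rule coefsI)
  note t' = inv_\<Gamma>[OF t]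
  show "cu t \<otimes>\<^sub>X x \<in> adjointables cs" using X.m_closed[of "cu t" x] coefsD(1)[OF assms(1)] X.U_closed[OF t] by simp
  show "Cont (\<lambda>z. e (ginv t \<ast> r) (psl_act (ginv t) z))" if "r \<in> \<Gamma>" for r
    using act_\<Lambda>[OF t'] by (intro continuous_on_compose2[OF coefsD(3)[OF assms(1) mult_\<Gamma>[OF t' that]] act_continuous[OF t']]) blast
  fix s s' y y' assume a: "s \<in> \<Gamma>" "s' \<in> \<Gamma>" "y \<in> \<Lambda>" "y' \<in> \<Lambda>"
  have p: "(s', y') \<in> GX" using a by simp
  have "ginv t \<ast> s' \<ast> ginv s = ginv t \<ast> (s' \<ast> ginv s)"
    using \<Gamma>_carrier[OF t'] \<Gamma>_carrier[OF a(2)] \<Gamma>_carrier[OF inv_\<Gamma>[OF a(1)]] by (rule PSL.m_assoc)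
  moreover have "psl_act (ginv t \<ast> s') y = psl_act (ginv t) (psl_act s' y)"
    by (rule act_mult[OF t' a(2,3)])
  moreover have "shift t (s', y') = (ginv t \<ast> s', y')" by (simp add: shift_def)
  ultimately show "mcoef GX (cu t \<otimes>\<^sub>X x) (s', y') (s, y) =
      (if y = y' then e (ginv t \<ast> (s' \<ast> ginv s)) (psl_act (ginv t) (psl_act s' y)) else 0)"
    using mcoef_wcomp_left[OF coefsD(2)[OF assms(1)] p, of "\<lambda>_. 1" "shift t" "(s, y)"]
      coefsD(4)[OF assms(1) a(1) mult_\<Gamma>[OF t' a(2)] a(3,4)] by (cases "y = y'") (simp_all add: cu_wcomp[OF t])
qed

text \<open>Matrix entries are dominated by the operator norm, so the coefficients converge
  uniformly on the limit set and their limits are continuous.\<close>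

lemma coefs_limit:
  assumes c: "\<And>n. coefs (X n) (e n)" and x: "x \<in> adjointables cs"
    and lim: "(\<lambda>n::nat. opn cs (X n \<ominus>\<^bsub>LO cs\<^esub> x)) \<longlonglongrightarrow> 0"
  shows "\<exists>e. coefs x e"
proof -
  let ?a = "\<lambda>n. opn cs (X n \<ominus>\<^bsub>LO cs\<^esub> x)"
  \<comment> \<open>The coefficient at \<open>r\<close> is read off a column over the unit of the
    group; the translated second coordinate makes the argument come out as \<open>z\<close>.\<close>
  define E where "E r z = mcoef GX x (r, psl_act (ginv r) z) (gunit, psl_act (ginv r) z)" for r z
  have close: "cmod (mcoef GX (X n) p q - mcoef GX x p q) \<le> ?a n" if "p \<in> GX" "q \<in> GX" for n p q
    by (rule mcoef_diff_le[OF coefsD(2)[OF c] adjointable_bounded[OF x] that])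
  have en: "cmod (e n r z - E r z) \<le> ?a n" if r: "r \<in> \<Gamma>" and z: "z \<in> \<Lambda>" for n r z
  proof -
    let ?y = "psl_act (ginv r) z"
    have y: "?y \<in> \<Lambda>" using act_\<Lambda>[OF inv_\<Gamma>[OF r]] z by blast
    have "mcoef GX (X n) (r, ?y) (gunit, ?y) = e n r z"
      using coefsD(4)[OF c one_\<Gamma> r y y] act_inv(2)[OF r z] \<Gamma>_carrier[OF r] by simp
    then show ?thesis using close[of "(r, ?y)" "(gunit, ?y)" n] r y one_\<Gamma> by (simp add: E_def)
  qed
  have "coefs x E"
  proof (rule coefsI[OF x])
    fix r assume r: "r \<in> \<Gamma>"
    have "uniform_limit \<Lambda> (\<lambda>n. e n r) (E r) sequentially"
    proof (rule uniform_limitI)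
      fix \<epsilon> :: real assume "0 < \<epsilon>"
      then have "\<forall>\<^sub>F n in sequentially. ?a n < \<epsilon>" using lim by (rule order_tendstoD(2)[rotated])
      then show "\<forall>\<^sub>F n in sequentially. \<forall>z\<in>\<Lambda>. dist (e n r z) (E r z) < \<epsilon>"
        unfolding dist_norm by (rule eventually_mono) (blast intro: order.strict_trans1[OF en[OF r]])
    qed
    then show "Cont (E r)" by (rule uniform_limit_theorem[rotated]) (simp_all add: coefsD(3)[OF c r])
  next
    fix s s' y y' assume a: "s \<in> \<Gamma>" "s' \<in> \<Gamma>" "y \<in> \<Lambda>" "y' \<in> \<Lambda>"
    have pq: "(s', y') \<in> GX" "(s, y) \<in> GX" using a by auto
    have "(\<lambda>n. mcoef GX (X n) (s', y') (s, y)) \<longlonglongrightarrow> mcoef GX x (s', y') (s, y)"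
      by (rule Lim_null_comparison[THEN LIM_zero_cancel, OF _ lim]) (intro always_eventually allI close pq)
    moreover have "(\<lambda>n. e n (s' \<ast> ginv s) (psl_act s' y)) \<longlonglongrightarrow> E (s' \<ast> ginv s) (psl_act s' y)"
      using act_\<Lambda>[OF a(2)] a(3)
      by (intro Lim_null_comparison[THEN LIM_zero_cancel, OF _ lim] always_eventually allI en mult_\<Gamma> inv_\<Gamma> a) blast
    ultimately show "mcoef GX x (s', y') (s, y) = (if y = y' then E (s' \<ast> ginv s) (psl_act s' y) else 0)"
      using coefsD(4)[OF c a] LIMSEQ_unique by (cases "y = y'") auto
  qed
  then show ?thesis by blast
qed

text \<open>The claim concerns \<tau> multiplied onto some \<open>x\<close>, so that products only
  require multiplying a series from the left by generators, never a product of two series.\<close>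

lemma coefs_ev:
  "letters \<tau> \<subseteq> J \<Longrightarrow> coefs x e \<Longrightarrow> \<exists>e'. coefs (X.ev X.S \<tau> \<otimes>\<^sub>X x) e'"
proof (induction \<tau> arbitrary: x e)
  case TOne
  have "X.ev X.S TOne \<otimes>\<^sub>X x = x" unfolding X.ev.simps by (rule X.l_one) (simp add: coefsD(1)[OF TOne(2)])
  then show ?case using TOne(2) by metis
next
  case (TGen i)
  then have i: "i \<in> J" by simp
  have "coefs (cf (chi [i]) \<otimes>\<^sub>X (cu (L i) \<otimes>\<^sub>X x)) (\<lambda>r z. chi [i] z * e (ginv (L i) \<ast> r) (psl_act (ginv (L i)) z))"
    by (rule coefs_cf[OF coefs_cu[OF TGen(2) L_in[OF i]] chi_continuous])
  moreover have "X.ev X.S (TGen i) \<otimes>\<^sub>X x = cf (chi [i]) \<otimes>\<^sub>X (cu (L i) \<otimes>\<^sub>X x)"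
    unfolding X.ev.simps X.S_eq'[OF i] using coefsD(1)[OF TGen(2)] by (intro X.m_assoc X.\<pi>chi X.UL i) simp
  ultimately show ?case by metis
next
  case (TAdj i)
  then have i: "i \<in> J" by simp
  have b: "bar i \<in> J" using i by (rule inv_letter_in)
  have "\<exists>e'. coefs (cu (L (bar i)) \<otimes>\<^sub>X (cf (chi [i]) \<otimes>\<^sub>X x)) e'"
    using coefs_cu[OF coefs_cf[OF TAdj(2) chi_continuous] L_in[OF b]] by blast
  moreover have "X.ev X.S (TAdj i) \<otimes>\<^sub>X x = cu (L (bar i)) \<otimes>\<^sub>X (cf (chi [i]) \<otimes>\<^sub>X x)"
    unfolding X.ev.simps X.S_eq'[OF i] X.adj_mult[OF X.\<pi>chi X.UL[OF i]] X.UL_star[OF i] X.chi_proj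
    using coefsD(1)[OF TAdj(2)] by (intro X.m_assoc X.\<pi>chi X.UL b) simp
  ultimately show ?case by metis
next
  case (TAdd a b)
  then have l: "letters a \<subseteq> J" "letters b \<subseteq> J" by auto
  have c: "X.ev X.S a \<in> carrier (BL cs)" "X.ev X.S b \<in> carrier (BL cs)"
    using l by (auto intro!: X.ev_closed X.S_closed simp del: BL_simps atLeastAtMost_iff)
  obtain e1 e2 where "coefs (X.ev X.S a \<otimes>\<^sub>X x) e1" "coefs (X.ev X.S b \<otimes>\<^sub>X x) e2"
    using TAdd l by blast
  note ce = coefs_add[OF this]
  have eq: "X.ev X.S (TAdd a b) \<otimes>\<^sub>X x = X.ev X.S a \<otimes>\<^sub>X x \<oplus>\<^bsub>BL cs\<^esub> X.ev X.S b \<otimes>\<^sub>X x"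
    unfolding X.ev.simps by (rule X.l_distr[OF c]) (simp add: coefsD(1)[OF TAdd.prems(2)])
  show ?case unfolding eq using ce by blast
next
  case (TMul a b)
  then have l: "letters a \<subseteq> J" "letters b \<subseteq> J" by auto
  have c: "X.ev X.S a \<in> carrier (BL cs)" "X.ev X.S b \<in> carrier (BL cs)"
    using l by (auto intro!: X.ev_closed X.S_closed simp del: BL_simps atLeastAtMost_iff)
  obtain e1 where "coefs (X.ev X.S b \<otimes>\<^sub>X x) e1" using TMul l by blast
  then obtain e2 where "coefs (X.ev X.S a \<otimes>\<^sub>X (X.ev X.S b \<otimes>\<^sub>X x)) e2" using TMul l by blast
  moreover have "X.ev X.S (TMul a b) \<otimes>\<^sub>X x = X.ev X.S a \<otimes>\<^sub>X (X.ev X.S b \<otimes>\<^sub>X x)"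
    unfolding X.ev.simps by (rule X.m_assoc[OF c]) (simp add: coefsD(1)[OF TMul.prems(2)])
  ultimately show ?case by metis
next
  case (TScl k a)
  then have l: "letters a \<subseteq> J" by auto
  have c: "X.ev X.S a \<in> carrier (BL cs)"
    using l by (auto intro!: X.ev_closed X.S_closed simp del: BL_simps atLeastAtMost_iff)
  obtain e1 where "coefs (X.ev X.S a \<otimes>\<^sub>X x) e1" using TScl l by blast
  note ce = coefs_scale[OF this, of k]
  have eq: "X.ev X.S (TScl k a) \<otimes>\<^sub>X x = k \<odot>\<^bsub>BL cs\<^esub> (X.ev X.S a \<otimes>\<^sub>X x)"
    unfolding X.ev.simps by (rule X.smult_mult_left[OF c]) (simp add: coefsD(1)[OF TScl.prems(2)])
  show ?case unfolding eq using ce by blast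
qed

lemma coefs_span:
  assumes x: "x \<in> cstar_span (BL cs) (X.S ` J)" shows "\<exists>e. coefs x e"
proof -
  obtain \<tau> where xc: "x \<in> carrier (BL cs)" and \<tau>: "\<And>n. letters (\<tau> n) \<subseteq> J" and c: "X.conv (\<lambda>n. X.ev X.S (\<tau> n)) x"
    using X.ev_dense[OF X.S_closed x] by blast
  have ec: "X.ev X.S (\<tau> n) \<in> carrier (BL cs)" for n
    using \<tau> by (intro X.ev_closed X.S_closed) blast
  have "\<exists>e. coefs (X.ev X.S (\<tau> n)) e" for n
    using coefs_ev[OF \<tau> coefs_one, of n] X.r_one[OF ec] by metis
  then obtain e where "\<And>n. coefs (X.ev X.S (\<tau> n)) (e n)" by metis
  then show ?thesis
  proof (rule coefs_limit)
    show "x \<in> adjointables cs" using xc by simp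
    show "(\<lambda>n. opn cs (X.ev X.S (\<tau> n) \<ominus>\<^bsub>LO cs\<^esub> x)) \<longlonglongrightarrow> 0"
      using c ec xc by (simp add: X.conv_def BL_minus)
  qed
qed

text \<open>If \<open>\<Sum>\<^sub>t e\<^sub>t U\<^sub>t\<close> commutes with all \<open>f\<close>, then \<open>(f (z) - f (t\<^sup>-\<^sup>1 z)) e\<^sub>t (z) = 0\<close>, which forces
  \<open>e\<^sub>t = 0\<close> for \<open>t \<noteq> 1\<close> since the points moved by \<open>t\<close> are dense.\<close>

lemma crossed_commutant:
  assumes x: "x \<in> cstar_span (BL cs) (X.S ` J)"
    and comm: "\<And>f. Cont f \<Longrightarrow> x \<otimes>\<^sub>X cf f = cf f \<otimes>\<^sub>X x"
  shows "\<exists>f. Cont f \<and> x = cf f"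
proof -
  obtain e where e: "coefs x e" using coefs_span[OF x] by blast
  note xb = coefsD(2)[OF e]
  have moved: "e r z = 0" if r: "r \<in> \<Gamma>" and z: "z \<in> \<Lambda>" and ne: "psl_act (ginv r) z \<noteq> z" for r z
  proof -
    let ?y = "psl_act (ginv r) z"
    have y: "?y \<in> \<Lambda>" using act_\<Lambda>[OF inv_\<Gamma>[OF r]] z by blast
    \<comment> \<open>The distance from \<open>z\<close> vanishes at \<open>z\<close> but not at the
      translated point, so the entries of the two products can agree only if the coefficient is
      zero.\<close>
    define f :: "pt \<Rightarrow> complex" where "f w = of_real (dist w z)" for w
    have f: "Cont f" unfolding f_def by (intro continuous_intros)
    let ?p = "(r, ?y)" and ?q = "(gunit, ?y)"
    have pq: "?p \<in> GX" "?q \<in> GX" using r y one_\<Gamma> by auto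
    have m: "mcoef GX x ?p ?q = e r z"
      using coefsD(4)[OF e one_\<Gamma> r y y] act_inv(2)[OF r z] \<Gamma>_carrier[OF r] by simp
    have "mcoef GX (cf f \<otimes>\<^sub>X x) ?p ?q = f z * e r z"
      using mcoef_wcomp_left[OF xb pq(1)] m act_inv(2)[OF r z] by (simp add: cf_wcomp fac_def)
    also have "f z = 0" by (simp add: f_def)
    finally have 0: "mcoef GX (x \<otimes>\<^sub>X cf f) ?p ?q = 0" using comm[OF f] by simp
    have "cf f (pt_mass GX ?q) = L2_class cs (\<lambda>p. f ?y * indicator {?q} p)"
      unfolding cf_wcomp wcomp_def L2_lift_def
      by (simp, subst L2_class_eq_iff)
         (auto simp: AE_count_space pt_mass_rep fac_def psl_act_one[OF \<Lambda>_cball[OF y]] split: split_indicator)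
    also have "\<dots> = L2_scale cs (f ?y) (pt_mass GX ?q)" unfolding pt_mass_def by (rule L2_scale_class[OF sqint_pt_mass, symmetric])
    finally have "x (cf f (pt_mass GX ?q)) = L2_scale cs (f ?y) (x (pt_mass GX ?q))"
      using bop_scale[OF xb pt_mass_in] by simp
    then have "mcoef GX (x \<otimes>\<^sub>X cf f) ?p ?q = f ?y * mcoef GX x ?p ?q"
      using pq by (simp add: mcoef_def compose_def L2_scale_def count_rep)
    then have "f ?y * e r z = 0" using 0 m by simp
    moreover have "f ?y \<noteq> 0" using ne by (simp add: f_def)
    ultimately show ?thesis by simp
  qed
  have zero: "e r z = 0" if r: "r \<in> \<Gamma>" "r \<noteq> gunit" and z: "z \<in> \<Lambda>" for r z
  proof (rule ccontr)
    assume n: "e r z \<noteq> 0"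
    then obtain d where d: "0 < d" "\<And>y. y \<in> \<Lambda> \<Longrightarrow> dist y z < d \<Longrightarrow> dist (e r y) (e r z) < cmod (e r z)"
      using coefsD(3)[OF e r(1)] z unfolding continuous_on_iff by (metis zero_less_norm_iff)
    have ri: "ginv r \<noteq> gunit" using r \<Gamma>_carrier[OF r(1)] by simp
    then obtain y where y: "y \<in> \<Lambda>" "dist y z < d" "psl_act (ginv r) y \<noteq> y"
      using topologically_free[OF inv_\<Gamma>[OF r(1)] ri z d(1)] by (metis IntE mem_ball dist_commute)
    then show False using d(2)[OF y(1,2)] moved[OF r(1) y(1,3)] by simp
  qed
  let ?e = "e gunit"
  have ec: "Cont ?e" by (rule coefsD(3)[OF e one_\<Gamma>])
  have "x = cf ?e"
  proof (rule mcoef_eqI[OF coefsD(1)[OF e]])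
    show "cf ?e \<in> adjointables cs" using X.\<pi>_closed[OF ec] by simp
    fix p q assume "p \<in> GX" "q \<in> GX"
    then obtain s' y' s y where p: "p = (s', y')" "s' \<in> \<Gamma>" "y' \<in> \<Lambda>" and q: "q = (s, y)" "s \<in> \<Gamma>" "y \<in> \<Lambda>" by (metis mem_Sigma_iff surj_pair)
    have eq: "s' \<ast> ginv s = gunit \<longleftrightarrow> s' = s"
      using \<Gamma>_carrier[OF p(2)] \<Gamma>_carrier[OF q(2)] PSL.r_inv PSL.inv_solve_right'[of "gunit" s' s] by auto
    have "mcoef GX (cf ?e) p q = (if p = q then ?e (psl_act s' y') else 0)"
      using p q by (simp add: mcoef_def cf_wcomp wcomp_def L2_lift_def count_rep pt_mass_rep fac_def)
    moreover have "mcoef GX x p q = (if y = y' then e (s' \<ast> ginv s) (psl_act s' y) else 0)"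
      unfolding p(1) q(1) by (rule coefsD(4)[OF e q(2) p(2) q(3) p(3)])
    moreover have "e (s' \<ast> ginv s) (psl_act s' y) = 0" if "s' \<noteq> s"
      using zero[OF mult_\<Gamma>[OF p(2) inv_\<Gamma>[OF q(2)]]] act_\<Lambda>[OF p(2)] q(3) that eq by blast
    ultimately show "mcoef GX x p q = mcoef GX (cf ?e) p q" using eq p(1) q(1) by auto
  qed
  then show ?thesis using ec by blast
qed

text \<open>The diagonal entries over the unit of the group are the values of the function.\<close>

lemma cf_inj:
  assumes "Cont f" "Cont h" "cf f = cf h" "x \<in> \<Lambda>"
  shows "f x = h x"
proof -
  have "mcoef GX (cf k) (gunit, x) (gunit, x) = k x" for k
    using assms(4) one_\<Gamma> psl_act_one[OF \<Lambda>_cball[OF assms(4)]]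
    by (simp add: mcoef_def cf_wcomp wcomp_def L2_lift_def count_rep pt_mass_rep fac_def)
  from this[of f] this[of h] show ?thesis using assms(3) by simp
qed

end

section \<open>Isomorphism of the two generated algebras and maximality\<close>

subsection \<open>The isomorphism\<close>

lemma cuntz_krieger_family_subalgebra:
  assumes "ring A" "cstar_subalgebra K A" "s ` {1..n} \<subseteq> K" "cuntz_krieger_family n a A s"
  shows "cuntz_krieger_family n a (A\<lparr>carrier := K\<rparr>) s"
proof -
  have K: "subring K A" using assms(2) by (simp add: cstar_subalgebra_def)
  note KD = cstar_subalgebraD[OF assms(2)]
  have sK: "s i \<in> K" if "i \<in> {1..n}" for i using assms(3) that by blast
  then have q: "s j \<otimes>\<^bsub>A\<^esub> cstar_adj A (s j) \<in> K" if "j \<in> {1..n}" for j using that by (intro KD(5,7)) blast+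
  have "(\<Oplus>\<^bsub>A\<lparr>carrier := K\<rparr>\<^esub>j\<in>{1..n}. s j \<otimes>\<^bsub>A\<^esub> cstar_adj A (s j)) = (\<Oplus>\<^bsub>A\<^esub>j\<in>{1..n}. s j \<otimes>\<^bsub>A\<^esub> cstar_adj A (s j))"
    by (rule finsum_subring[OF assms(1) K]) (use q in blast)
  moreover have "(\<Oplus>\<^bsub>A\<lparr>carrier := K\<rparr>\<^esub>j\<in>{1..n}. of_nat (a i j) \<odot>\<^bsub>A\<^esub> (s j \<otimes>\<^bsub>A\<^esub> cstar_adj A (s j)))
    = (\<Oplus>\<^bsub>A\<^esub>j\<in>{1..n}. of_nat (a i j) \<odot>\<^bsub>A\<^esub> (s j \<otimes>\<^bsub>A\<^esub> cstar_adj A (s j)))" for i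
    by (rule finsum_subring[OF assms(1) K]) (use q KD(6) in blast)
  ultimately show ?thesis using assms(4) sK unfolding cuntz_krieger_family_def by simp
qed

lemma star_homD:
  assumes "\<phi> \<in> star_hom A B"
  shows "x \<in> carrier A \<Longrightarrow> \<phi> x \<in> carrier B" "x \<in> carrier A \<Longrightarrow> y \<in> carrier A \<Longrightarrow> \<phi> (x \<otimes>\<^bsub>A\<^esub> y) = \<phi> x \<otimes>\<^bsub>B\<^esub> \<phi> y"
    "x \<in> carrier A \<Longrightarrow> y \<in> carrier A \<Longrightarrow> \<phi> (x \<oplus>\<^bsub>A\<^esub> y) = \<phi> x \<oplus>\<^bsub>B\<^esub> \<phi> y" "\<phi> \<one>\<^bsub>A\<^esub> = \<one>\<^bsub>B\<^esub>"
    "x \<in> carrier A \<Longrightarrow> \<phi> (c \<odot>\<^bsub>A\<^esub> x) = c \<odot>\<^bsub>B\<^esub> \<phi> x" "x \<in> carrier A \<Longrightarrow> \<phi> (cstar_adj A x) = cstar_adj B (\<phi> x)"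
  using assms unfolding star_hom_def ring_hom_def by auto

lemma star_homI:
  assumes "\<And>x. x \<in> carrier A \<Longrightarrow> \<phi> x \<in> carrier B" "\<And>x y. x \<in> carrier A \<Longrightarrow> y \<in> carrier A \<Longrightarrow> \<phi> (x \<otimes>\<^bsub>A\<^esub> y) = \<phi> x \<otimes>\<^bsub>B\<^esub> \<phi> y"
    "\<And>x y. x \<in> carrier A \<Longrightarrow> y \<in> carrier A \<Longrightarrow> \<phi> (x \<oplus>\<^bsub>A\<^esub> y) = \<phi> x \<oplus>\<^bsub>B\<^esub> \<phi> y" "\<phi> \<one>\<^bsub>A\<^esub> = \<one>\<^bsub>B\<^esub>"
    "\<And>x c. x \<in> carrier A \<Longrightarrow> \<phi> (c \<odot>\<^bsub>A\<^esub> x) = c \<odot>\<^bsub>B\<^esub> \<phi> x" "\<And>x. x \<in> carrier A \<Longrightarrow> \<phi> (cstar_adj A x) = cstar_adj B (\<phi> x)"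
  shows "\<phi> \<in> star_hom A B"
  unfolding star_hom_def by (intro CollectI conjI allI ballI ring_hom_memI assms)

lemma star_hom_minus:
  assumes "cstar_algebra A" "cstar_algebra B" "\<phi> \<in> star_hom A B" "x \<in> carrier A" "y \<in> carrier A"
  shows "\<phi> (x \<ominus>\<^bsub>A\<^esub> y) = \<phi> x \<ominus>\<^bsub>B\<^esub> \<phi> y"
proof -
  interpret A: cstar_algebra A by fact
  interpret B: cstar_algebra B by fact
  note h = star_homD[OF assms(3)]
  have "\<phi> (x \<oplus>\<^bsub>A\<^esub> (- 1) \<odot>\<^bsub>A\<^esub> y) = \<phi> x \<oplus>\<^bsub>B\<^esub> (- 1) \<odot>\<^bsub>B\<^esub> \<phi> y"
    using h(3)[OF assms(4), of "(- 1) \<odot>\<^bsub>A\<^esub> y"] h(5)[OF assms(5), of "- 1"] assms(5) by simp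
  then show ?thesis using assms(4,5) h(1) by (simp add: a_minus_def A.sm_minus_one B.sm_minus_one)
qed

text \<open>The fixed points form a C*-subalgebra, closed because \<open>h\<close> is contractive,
  and it contains the generators.\<close>

lemma (in cstar_algebra) contractive_hom_fixes:
  assumes h: "h \<in> star_hom A A" and c: "\<And>x. x \<in> carrier A \<Longrightarrow> nrm (h x) \<le> nrm x"
    and gen: "carrier A = cstar_span A X" and fixes_X: "\<And>x. x \<in> X \<Longrightarrow> h x = x" and x: "x \<in> carrier A"
  shows "h x = x"
proof -
  note hD = star_homD[OF h]
  have "cstar_subalgebra {x \<in> carrier A. h x = x} A"
    unfolding cstar_subalgebra_def
  proof (intro conjI allI ballI impI)
    show "subring {x \<in> carrier A. h x = x} A"
    proof (rule subringI)
      fix y assume "y \<in> {x \<in> carrier A. h x = x}"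
      then show "\<ominus> y \<in> {x \<in> carrier A. h x = x}" using hD(5)[of y "- 1"] by (simp flip: sm_minus_one)
    qed (use hD(2-4) in auto)
  next
    fix Y y assume Y: "range Y \<subseteq> {x \<in> carrier A. h x = x}" and y: "y \<in> carrier A"
      and lim: "(\<lambda>n::nat. nrm (Y n \<ominus> y)) \<longlonglongrightarrow> 0"
    have Yc: "Y n \<in> carrier A" "h (Y n) = Y n" for n using Y by auto
    have "nrm (Y n \<ominus> h y) \<le> nrm (Y n \<ominus> y)" for n
      using c[of "Y n \<ominus> y"] star_hom_minus[OF cstar_algebra_axioms cstar_algebra_axioms h Yc(1) y] Yc y by simp
    then have "conv Y (h y)" by (rule conv_bound[OF _ lim Yc(1) hD(1)[OF y]])
    moreover have "conv Y y" using lim by (simp add: conv_def)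
    ultimately have "h y = y" using Yc(1) hD(1)[OF y] y by (rule conv_unique)
    then show "y \<in> {x \<in> carrier A. h x = x}" using y by simp
  qed (use hD(5,6) in \<open>auto simp: complex_ring_def adj_closed\<close>)
  moreover have "X \<subseteq> {x \<in> carrier A. h x = x}" using gen cstar_span_superset[of X A] fixes_X by auto
  ultimately show ?thesis using cstar_span_least gen x by blast
qed

lemma (in cstar_algebra) commutant_subalgebra:
  assumes Y: "Y \<subseteq> carrier A" "\<And>y. y \<in> Y \<Longrightarrow> star y \<in> Y"
  shows "cstar_subalgebra {x \<in> carrier A. \<forall>y\<in>Y. x \<otimes> y = y \<otimes> x} A" (is "cstar_subalgebra ?C A")
  unfolding cstar_subalgebra_def
proof (intro conjI allI ballI impI)
  have Yc: "y \<in> carrier A" if "y \<in> Y" for y using Y(1) that by blast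
  show "subring ?C A"
  proof (rule subringI)
    fix x assume x: "x \<in> ?C"
    show "\<ominus> x \<in> ?C" using x Yc by (simp add: l_minus r_minus)
    fix z assume z: "z \<in> ?C"
    show "x \<oplus> z \<in> ?C" using x z Yc by (simp add: l_distr r_distr)
    have "x \<otimes> z \<otimes> y = y \<otimes> (x \<otimes> z)" if y: "y \<in> Y" for y
    proof -
      have "x \<otimes> z \<otimes> y = x \<otimes> (y \<otimes> z)" using x z y Yc[OF y] by (simp add: m_assoc)
      also have "\<dots> = (y \<otimes> x) \<otimes> z" using x z y Yc[OF y] by (simp flip: m_assoc)
      finally show ?thesis using x z Yc[OF y] by (simp add: m_assoc)
    qed
    then show "x \<otimes> z \<in> ?C" using x z by simp
  qed (use Yc in auto)
  show "c \<odot> x \<in> ?C" if "x \<in> ?C" for c x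
    using that Yc by (simp add: smult_mult_left smult_mult_right complex_ring_def)
  show "star x \<in> ?C" if x: "x \<in> ?C" for x
  proof -
    have "star x \<otimes> y = y \<otimes> star x" if y: "y \<in> Y" for y
    proof -
      have "star x \<otimes> star (star y) = star (star y) \<otimes> star x"
        using x Y(2)[OF y] Yc[OF Y(2)[OF y]] adj_mult[of x "star y"] adj_mult[of "star y" x] by simp
      then show ?thesis using Yc[OF y] by (simp add: adj_adj)
    qed
    then show ?thesis using x by (simp add: adj_closed)
  qed
  fix X x assume X: "range X \<subseteq> ?C" and x: "x \<in> carrier A" and lim: "(\<lambda>n::nat. nrm (X n \<ominus> x)) \<longlonglongrightarrow> 0"
  have Xc: "X n \<in> carrier A" for n using X by blast
  have cx: "conv X x" using lim by (simp add: conv_def)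
  have "x \<otimes> y = y \<otimes> x" if y: "y \<in> Y" for y
  proof (rule conv_unique)
    have "conv (\<lambda>n. X n \<otimes> y) (x \<otimes> y)" "conv (\<lambda>n. y \<otimes> X n) (y \<otimes> x)"
      using conv_mult[OF cx conv_const[OF Yc[OF y]] Xc Yc[OF y] x Yc[OF y]]
        conv_mult[OF conv_const[OF Yc[OF y]] cx Yc[OF y] Xc Yc[OF y] x] by - assumption+
    moreover have "X n \<otimes> y = y \<otimes> X n" for n using X y by blast
    ultimately show "conv (\<lambda>n. X n \<otimes> y) (x \<otimes> y)" "conv (\<lambda>n. X n \<otimes> y) (y \<otimes> x)" by simp_all
  qed (use Xc x Yc[OF y] in auto)
  then show "x \<in> ?C" using x by simp
qed

context covariant
begin

definition OS :: "('a, 'm) cstar_scheme" where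
  "OS = A\<lparr>carrier := cstar_span A (S ` J)\<rparr>"

lemma S_in: "S ` J \<subseteq> carrier A" by (rule image_subsetI) (rule S_closed)

lemma OS_subalgebra: "cstar_subalgebra (cstar_span A (S ` J)) A"
  by (rule cstar_span_subalgebra[OF ring_axioms carrier_subalgebra S_in])

lemma OS_cstar: "cstar_algebra OS"
  unfolding OS_def by (rule cstar_subalgebra_cstar_algebra[OF cstar_algebra_axioms OS_subalgebra])

lemma OS_family: "cuntz_krieger_family (2*g) (schottky_matrix g) OS S"
  unfolding OS_def by (rule cuntz_krieger_family_subalgebra[OF ring_axioms OS_subalgebra cstar_span_superset S_ck_family])

lemma OS_ck_family: "ck_family OS g S"
  using OS_family g2 by (intro ck_family.intro ck_family_axioms.intro OS_cstar) simp_all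

lemma OS_gen: "carrier OS = cstar_span OS (S ` J)"
  unfolding OS_def cstar_span_sub[OF ring_axioms OS_subalgebra cstar_span_superset] by simp

lemma OS_simps:
  "x \<otimes>\<^bsub>OS\<^esub> y = x \<otimes> y" "x \<oplus>\<^bsub>OS\<^esub> y = x \<oplus> y" "\<one>\<^bsub>OS\<^esub> = \<one>" "\<zero>\<^bsub>OS\<^esub> = \<zero>" "c \<odot>\<^bsub>OS\<^esub> x = c \<odot> x"
  "cstar_adj OS x = star x" "cstar_norm OS x = nrm x" "carrier OS = cstar_span A (S ` J)"
  by (simp_all add: OS_def)

lemma OS_carrier: "x \<in> carrier OS \<Longrightarrow> x \<in> carrier A"
  using OS_subalgebra cstar_subalgebraD(1) unfolding OS_simps by blast

lemma S_OS: "i \<in> J \<Longrightarrow> S i \<in> carrier OS"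
  unfolding OS_simps using cstar_span_superset[of "S ` J" A] by blast

lemma U_OS: "\<gamma> \<in> \<Gamma> \<Longrightarrow> U \<gamma> \<in> carrier OS"
  unfolding OS_simps by (rule U_in_closed[OF OS_subalgebra cstar_span_superset])

lemma \<pi>_OS: "Cont f \<Longrightarrow> \<pi> f \<in> carrier OS"
  unfolding OS_simps by (rule \<pi>_in_closed_S[OF OS_subalgebra cstar_span_superset])

lemma OS_minus: "x \<in> carrier OS \<Longrightarrow> y \<in> carrier OS \<Longrightarrow> x \<ominus>\<^bsub>OS\<^esub> y = x \<ominus> y"
  using subring_minus[of "cstar_span A (S ` J)" x y] OS_subalgebra unfolding OS_def cstar_subalgebra_def by simp

lemma OS_S: assumes "i \<in> J"
  shows "S i = (\<Oplus>\<^bsub>OS\<^esub>j\<in>J. of_nat (schottky_matrix g i j) \<odot>\<^bsub>OS\<^esub> (U (L i) \<otimes>\<^bsub>OS\<^esub> \<pi> (chi [j])))"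
proof -
  note KD = cstar_subalgebraD[OF OS_subalgebra]
  have c: "of_nat (schottky_matrix g i j) \<odot> (U (L i) \<otimes> \<pi> (chi [j])) \<in> cstar_span A (S ` J)" for j
    using U_OS[OF L_in[OF assms]] \<pi>_OS[OF chi_continuous] unfolding OS_simps by (intro KD(5,6))
  have "subring (cstar_span A (S ` J)) A" using OS_subalgebra by (simp add: cstar_subalgebra_def)
  from finsum_subring[OF ring_axioms this, of "\<lambda>j. of_nat (schottky_matrix g i j) \<odot> (U (L i) \<otimes> \<pi> (chi [j]))" J] c
  show ?thesis unfolding S_def[of i] by (simp add: OS_def)
qed

end

lemma covariant_hom:
  fixes A :: "('a, 'm) cstar_scheme" and B :: "('b, 'n) cstar_scheme"
  assumes a: "covariant g \<Gamma> gen x\<^sub>0 A \<pi> U" and "cstar_algebra B"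
    and t: "cuntz_krieger_family (2*g) (schottky_matrix g) B t" and one: "\<one>\<^bsub>A\<^esub> \<noteq> \<zero>\<^bsub>A\<^esub>"
  obtains \<phi> where "\<phi> \<in> star_hom (covariant.OS g \<Gamma> gen x\<^sub>0 A \<pi> U) B"
    "\<And>i. i \<in> {1..2*g} \<Longrightarrow> \<phi> (covariant.S g \<Gamma> gen x\<^sub>0 A \<pi> U i) = t i"
    "\<And>x. x \<in> carrier (covariant.OS g \<Gamma> gen x\<^sub>0 A \<pi> U) \<Longrightarrow> cstar_norm B (\<phi> x) \<le> cstar_norm A x"
proof -
  interpret A: covariant g \<Gamma> gen x\<^sub>0 A \<pi> U by fact
  have t': "ck_family B g t" using t A.g2 by (intro ck_family.intro ck_family_axioms.intro assms(2)) simp_all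
  have tc: "t i \<in> carrier B" if "i \<in> {1..2*g}" for i using t that unfolding cuntz_krieger_family_def by blast
  have one': "\<one>\<^bsub>A.OS\<^esub> \<noteq> \<zero>\<^bsub>A.OS\<^esub>" using one by (simp add: A.OS_simps)
  obtain \<phi> where \<phi>: "\<phi> \<in> star_hom A.OS B"
    "\<And>\<tau>. letters \<tau> \<subseteq> {1..2*g} \<Longrightarrow> \<phi> (cstar_algebra.ev A.OS A.S \<tau>) = cstar_algebra.ev B t \<tau>"
    "\<And>x. x \<in> carrier A.OS \<Longrightarrow> cstar_norm B (\<phi> x) \<le> cstar_norm A.OS x"
    by (rule star_hom_extension[OF A.OS_cstar assms(2) A.S_OS tc A.OS_gen ck_family_nrm_le[OF A.OS_ck_family t' A.g2 one']]) (assumption | (rule that; assumption))+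
  show thesis
  proof (rule that[OF \<phi>(1)])
    show "\<phi> (A.S i) = t i" if "i \<in> {1..2*g}" for i
      using \<phi>(2)[of "TGen i"] that by (simp add: cstar_algebra.ev.simps[OF A.OS_cstar] cstar_algebra.ev.simps[OF assms(2)])
    show "cstar_norm B (\<phi> x) \<le> cstar_norm A x" if "x \<in> carrier A.OS" for x
      using \<phi>(3)[OF that] by (simp add: A.OS_simps)
  qed
qed

lemma star_hom_compose:
  "\<phi> \<in> star_hom A B \<Longrightarrow> \<psi> \<in> star_hom B C \<Longrightarrow> (\<lambda>x. \<psi> (\<phi> x)) \<in> star_hom A C"
  by (rule star_homI) (simp_all add: star_homD[of \<phi> A B] star_homD[of \<psi> B C])

text \<open>The comparison of norms works in both directions, and the two contractive homomorphisms
  are mutually inverse because their composites fix the generators. Images of unitaries and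
  functions follow, as both are expressed by the generators.\<close>

lemma covariant_iso:
  fixes A :: "('a, 'm) cstar_scheme" and B :: "('b, 'n) cstar_scheme"
  assumes a: "covariant g \<Gamma> gen x\<^sub>0 A \<pi> U" "\<one>\<^bsub>A\<^esub> \<noteq> \<zero>\<^bsub>A\<^esub>" and b: "covariant g \<Gamma> gen x\<^sub>0 B \<rho> V" "\<one>\<^bsub>B\<^esub> \<noteq> \<zero>\<^bsub>B\<^esub>"
  obtains \<phi> where "\<phi> \<in> star_hom (covariant.OS g \<Gamma> gen x\<^sub>0 A \<pi> U) (covariant.OS g \<Gamma> gen x\<^sub>0 B \<rho> V)"
    "bij_betw \<phi> (carrier (covariant.OS g \<Gamma> gen x\<^sub>0 A \<pi> U)) (carrier (covariant.OS g \<Gamma> gen x\<^sub>0 B \<rho> V))"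
    "\<And>i. i \<in> {1..2*g} \<Longrightarrow> \<phi> (covariant.S g \<Gamma> gen x\<^sub>0 A \<pi> U i) = covariant.S g \<Gamma> gen x\<^sub>0 B \<rho> V i"
    "\<And>\<gamma>. \<gamma> \<in> \<Gamma> \<Longrightarrow> \<phi> (U \<gamma>) = V \<gamma>"
    "\<And>f. continuous_on (limit_set \<Gamma>) f \<Longrightarrow> \<phi> (\<pi> f) = \<rho> f"
proof -
  interpret A: covariant g \<Gamma> gen x\<^sub>0 A \<pi> U by fact
  interpret B: covariant g \<Gamma> gen x\<^sub>0 B \<rho> V by fact
  interpret OA: cstar_algebra A.OS by (rule A.OS_cstar)
  interpret OB: cstar_algebra B.OS by (rule B.OS_cstar)
  obtain \<phi> where \<phi>: "\<phi> \<in> star_hom A.OS B.OS" "\<And>i. i \<in> {1..2*g} \<Longrightarrow> \<phi> (A.S i) = B.S i"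
    "\<And>x. x \<in> carrier A.OS \<Longrightarrow> cstar_norm B.OS (\<phi> x) \<le> cstar_norm A x"
    by (rule covariant_hom[OF a(1) B.OS_cstar B.OS_family a(2)]) (assumption | (rule that; assumption))+
  obtain \<psi> where \<psi>: "\<psi> \<in> star_hom B.OS A.OS" "\<And>i. i \<in> {1..2*g} \<Longrightarrow> \<psi> (B.S i) = A.S i"
    "\<And>x. x \<in> carrier B.OS \<Longrightarrow> cstar_norm A.OS (\<psi> x) \<le> cstar_norm B x"
    by (rule covariant_hom[OF b(1) A.OS_cstar A.OS_family b(2)]) (assumption | (rule that; assumption))+
  note \<phi>D = star_homD[OF \<phi>(1)] and \<psi>D = star_homD[OF \<psi>(1)]
  have inv: "\<psi> (\<phi> x) = x" if "x \<in> carrier A.OS" for x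
  proof (rule OA.contractive_hom_fixes[OF star_hom_compose[OF \<phi>(1) \<psi>(1)] _ A.OS_gen _ that])
    show "cstar_norm A.OS (\<psi> (\<phi> y)) \<le> cstar_norm A.OS y" if "y \<in> carrier A.OS" for y
      using \<phi>(3)[OF that] \<psi>(3)[OF \<phi>D(1)[OF that]] by (simp only: A.OS_simps B.OS_simps)
  qed (use \<phi>(2) \<psi>(2) in auto)
  have inv': "\<phi> (\<psi> x) = x" if "x \<in> carrier B.OS" for x
  proof (rule OB.contractive_hom_fixes[OF star_hom_compose[OF \<psi>(1) \<phi>(1)] _ B.OS_gen _ that])
    show "cstar_norm B.OS (\<phi> (\<psi> y)) \<le> cstar_norm B.OS y" if "y \<in> carrier B.OS" for y
      using \<psi>(3)[OF that] \<phi>(3)[OF \<psi>D(1)[OF that]] by (simp only: A.OS_simps B.OS_simps)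
  qed (use \<phi>(2) \<psi>(2) in auto)
  have bij: "bij_betw \<phi> (carrier A.OS) (carrier B.OS)"
    by (rule bij_betw_byWitness[of _ \<psi>]) (use inv inv' \<phi>D(1) \<psi>D(1) in auto)
  have \<phi>S': "\<phi> (A.star (A.S i)) = B.star (B.S i)" if "i \<in> {1..2*g}" for i
    using \<phi>D(6)[OF A.S_OS[OF that]] \<phi>(2)[OF that] by (simp only: A.OS_simps B.OS_simps)
  have S'c: "A.star (A.S i) \<in> carrier A.OS" if "i \<in> {1..2*g}" for i
    using OA.adj_closed[OF A.S_OS[OF that]] by (simp only: A.OS_simps)
  have U: "\<phi> (U \<gamma>) = V \<gamma>" if "\<gamma> \<in> \<Gamma>" for \<gamma>
    using that
  proof (induction rule: A.\<Gamma>_induct)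
    case one then show ?case using \<phi>D(4) by (simp only: A.U_one B.U_one A.OS_simps B.OS_simps)
  next
    case (letter i)
    note b = inv_letter_in[OF letter]
    show ?case using \<phi>D(3)[OF A.S_OS[OF letter] S'c[OF b]] \<phi>(2)[OF letter] \<phi>S'[OF b]
      by (simp only: A.UL_eq[OF letter] B.UL_eq[OF letter] A.OS_simps B.OS_simps)
  next
    case (mult \<gamma> \<eta>)
    then show ?case using \<phi>D(2)[OF A.U_OS[OF mult(1)] A.U_OS[OF mult(2)]]
      by (simp only: A.U_mult B.U_mult A.OS_simps B.OS_simps)
  qed
  have sw: "set w \<subseteq> {1..2*g} \<Longrightarrow> \<phi> (A.CK.sw w) = B.CK.sw w \<and> A.CK.sw w \<in> carrier A.OS" for w
  proof (induction w)
    case Nil show ?case using \<phi>D(4) OA.one_closed by (simp only: A.CK.sw.simps B.CK.sw.simps A.OS_simps B.OS_simps)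
  next
    case (Cons i w)
    then have i: "i \<in> {1..2*g}" and w: "\<phi> (A.CK.sw w) = B.CK.sw w" "A.CK.sw w \<in> carrier A.OS" by auto
    show ?case using \<phi>D(2)[OF A.S_OS[OF i] w(2)] \<phi>(2)[OF i] w OA.m_closed[OF A.S_OS[OF i] w(2)]
      by (simp only: A.CK.sw.simps B.CK.sw.simps A.OS_simps B.OS_simps)
  qed
  have \<pi>: "\<phi> (\<pi> f) = \<rho> f" if "continuous_on (limit_set \<Gamma>) f" for f
    using that
  proof (induction rule: A.continuous_induct)
    case (chi w)
    note s = sw[OF reduced_word_letters[OF chi(1)]]
    show ?case using \<phi>D(2)[OF conjunct2[OF s] OA.adj_closed[OF conjunct2[OF s]]] \<phi>D(6)[OF conjunct2[OF s]] conjunct1[OF s]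
      by (simp only: A.\<pi>_chi_word[OF chi] B.\<pi>_chi_word[OF chi] A.OS_simps B.OS_simps)
  next
    case (add f h)
    show ?case using \<phi>D(3)[OF A.\<pi>_OS[OF add(1)] A.\<pi>_OS[OF add(2)]] add(3,4)
      by (simp only: A.\<pi>_add[OF add(1,2)] B.\<pi>_add[OF add(1,2)] A.OS_simps B.OS_simps)
  next
    case (scale c f)
    show ?case using \<phi>D(5)[OF A.\<pi>_OS[OF scale(1)]] scale(2)
      by (simp only: A.\<pi>_smult[OF scale(1)] B.\<pi>_smult[OF scale(1)] A.OS_simps B.OS_simps)
  next
    case (limit F f)
    have c: "\<rho> (F n) \<in> carrier B.OS" "\<pi> (F n) \<in> carrier A.OS" for n using A.\<pi>_OS[OF limit(1)] B.\<pi>_OS[OF limit(1)] by auto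
    have cf: "\<phi> (\<pi> f) \<in> carrier B.OS" "\<pi> f \<in> carrier A.OS" using \<phi>D(1)[OF A.\<pi>_OS[OF limit(2)]] A.\<pi>_OS[OF limit(2)] by auto
    \<comment> \<open>The homomorphism is contractive, so the images of the approximants converge to
      the image of the limit; they also converge to \<open>\<rho> f\<close>.\<close>
    have "cstar_norm B (\<rho> (F n) \<ominus>\<^bsub>B\<^esub> \<phi> (\<pi> f)) \<le> cstar_norm A (\<pi> (F n) \<ominus>\<^bsub>A\<^esub> \<pi> f)" for n
    proof -
      have "\<rho> (F n) \<ominus>\<^bsub>B\<^esub> \<phi> (\<pi> f) = \<phi> (\<pi> (F n) \<ominus>\<^bsub>A.OS\<^esub> \<pi> f)"
        using star_hom_minus[OF A.OS_cstar B.OS_cstar \<phi>(1) c(2) cf(2)] limit(4) B.OS_minus[OF c(1) cf(1)] by simp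
      moreover have "\<pi> (F n) \<ominus>\<^bsub>A.OS\<^esub> \<pi> f = \<pi> (F n) \<ominus>\<^bsub>A\<^esub> \<pi> f" by (rule A.OS_minus[OF c(2) cf(2)])
      ultimately show ?thesis using \<phi>(3)[OF OA.minus_closed[OF c(2)[of n] cf(2)]] by (simp add: B.OS_simps(7))
    qed
    moreover have "(\<lambda>n. cstar_norm A (\<pi> (F n) \<ominus>\<^bsub>A\<^esub> \<pi> f)) \<longlonglongrightarrow> 0"
      using A.\<pi>_conv[OF limit(1,2,3)] unfolding A.conv_def .
    ultimately have "B.conv (\<lambda>n. \<rho> (F n)) (\<phi> (\<pi> f))"
      by (rule B.conv_bound[OF _ _ B.\<pi>_closed[OF limit(1)] B.OS_carrier[OF cf(1)]])
    then show ?case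
      by (rule B.conv_unique[OF _ B.\<pi>_conv[OF limit(1,2,3)] B.\<pi>_closed[OF limit(1)] B.OS_carrier[OF cf(1)] B.\<pi>_closed[OF limit(2)]])
  qed
  show thesis by (rule that[OF \<phi>(1) bij \<phi>(2) U \<pi>])
qed

text \<open>The two families of generators are compared only at the letters, so they cannot be
  identified as functions.\<close>

lemma cuntz_krieger_family_cong:
  assumes "cstar_algebra A" "cuntz_krieger_family n a A s" and e: "\<And>i. i \<in> {1..n} \<Longrightarrow> s' i = s i"
  shows "cuntz_krieger_family n a A s'"
proof -
  interpret cstar_algebra A by fact
  have s: "s i \<in> carrier A" if "i \<in> {1..n}" for i using assms(2) that by (simp add: cuntz_krieger_family_def)
  have "(\<Oplus>\<^bsub>A\<^esub>j\<in>{1..n}. s' j \<otimes>\<^bsub>A\<^esub> star (s' j)) = (\<Oplus>\<^bsub>A\<^esub>j\<in>{1..n}. s j \<otimes>\<^bsub>A\<^esub> star (s j))"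
    "(\<Oplus>\<^bsub>A\<^esub>j\<in>{1..n}. of_nat (a i j) \<odot>\<^bsub>A\<^esub> (s' j \<otimes>\<^bsub>A\<^esub> star (s' j))) =
     (\<Oplus>\<^bsub>A\<^esub>j\<in>{1..n}. of_nat (a i j) \<odot>\<^bsub>A\<^esub> (s j \<otimes>\<^bsub>A\<^esub> star (s j)))" for i
    using s by (intro finsum_cong' Pi_I smult_closed m_closed adj_closed carrier_complex_ring; simp add: e)+
  then show ?thesis using assms(2) e unfolding cuntz_krieger_family_def by simp
qed

lemma BL_update: "BL M\<lparr>carrier := K\<rparr> = LO M\<lparr>carrier := K\<rparr>"
  by (simp add: BL_def)

lemma cstar_span_BL: "X \<subseteq> adjointables M \<Longrightarrow> cstar_span (LO M) X = cstar_span (BL M) X"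
  unfolding BL_def by (rule cstar_span_sub[OF L2_operators_ring adjointables_subalgebra, symmetric])

context patterson_sullivan
begin

interpretation X: covariant g \<Gamma> gen x\<^sub>0 "BL cs" cf cu by (rule crossed_covariant)

abbreviation "CF \<equiv> carrier (continuous_functions \<Lambda>)"

lemma CF_iff: "f \<in> CF \<longleftrightarrow> f \<in> extensional \<Lambda> \<and> Cont f"
  by (simp add: continuous_functions_def)

lemma \<Lambda>_nonempty: "\<Lambda> \<noteq> {}" using \<mu>.not_empty by simp

lemma crossed_one_neq_zero: "\<one>\<^bsub>BL cs\<^esub> \<noteq> \<zero>\<^bsub>BL cs\<^esub>"
proof
  assume "\<one>\<^bsub>BL cs\<^esub> = \<zero>\<^bsub>BL cs\<^esub>"
  moreover have "cf (\<lambda>_. 0 * 1) = 0 \<odot>\<^bsub>BL cs\<^esub> cf (\<lambda>_. 1)" by (rule X.\<pi>_smult) simp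
  moreover have "0 \<odot>\<^bsub>BL cs\<^esub> cf (\<lambda>_. 1) = \<zero>\<^bsub>BL cs\<^esub>" by (rule X.sm_0_left) (rule X.\<pi>_closed, simp)
  ultimately have "cf (\<lambda>_. 1) = cf (\<lambda>_. 0)" using X.\<pi>_one by simp
  then show False using cf_inj[of "\<lambda>_. 1" "\<lambda>_. 0"] \<Lambda>_nonempty by auto
qed

lemma P_op_letter: "j \<in> J \<Longrightarrow> P_op g gen x\<^sub>0 \<mu> (L j) = mult_op \<mu> (chi [j])"
  by (simp only: P_op_def cylinder_letter chi_def)

lemma S_op_eq: assumes i: "i \<in> J" shows "S_op g \<Gamma> gen x\<^sub>0 \<mu> i = R.S i"
proof -
  let ?f = "\<lambda>j. of_nat (schottky_matrix g i j) \<odot>\<^bsub>BL \<mu>\<^esub> (T_op \<Gamma> \<mu> (L i) \<otimes>\<^bsub>BL \<mu>\<^esub> mult_op \<mu> (chi [j]))"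
  have c: "?f j \<in> carrier (BL \<mu>)" for j
    using R.UL[OF i] R.\<pi>chi[of "[j]"] by (intro R.smult_closed R.m_closed R.carrier_complex_ring)
  interpret M: ring "LO \<mu>" by (rule L2_operators_ring)
  have "S_op g \<Gamma> gen x\<^sub>0 \<mu> i = finsum (LO \<mu>) ?f J"
    unfolding S_op_def
  proof (rule M.finsum_cong'[OF refl])
    show "?f \<in> J \<rightarrow> carrier (LO \<mu>)" using c adjointable_bounded by fastforce
  qed (simp only: P_op_letter BL_simps)
  also have "\<dots> = finsum (BL \<mu>) ?f J"
    unfolding BL_def by (rule finsum_subring[OF L2_operators_ring adjointables_subring, symmetric]) (use c in \<open>simp add: BL_def\<close>)
  finally show ?thesis by (simp only: R.S_def)
qed

text \<open>The span taken among all bounded operators is the span taken among the adjointable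
  ones.\<close>

lemma OA_eq: "OA g \<Gamma> gen x\<^sub>0 \<mu> = R.OS"
proof -
  have S: "S_op g \<Gamma> gen x\<^sub>0 \<mu> ` J = R.S ` J" using S_op_eq by (rule image_cong[OF refl])
  have "R.S ` J \<subseteq> adjointables \<mu>" using R.S_in by (simp only: BL_simps)
  from cstar_span_BL[OF this] show ?thesis unfolding OA_def cstar_generated_def S R.OS_def BL_update by (simp only:)
qed

text \<open>Restriction to the limit set reconciles the extensional functions of
  \<open>continuous_functions\<close> with arbitrary continuous ones, and \<open>gens_span\<close>
  exchanges the generating sets.\<close>

lemma crossed_eq: "schottky_crossed_product \<Gamma> = X.OS"
proof -
  have "cf ` CF = cf ` {f. Cont f}"
  proof (intro equalityI image_subsetI)
    fix f :: "pt \<Rightarrow> complex" assume "f \<in> {f. Cont f}"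
    then have f: "Cont f" by simp
    have "restrict f \<Lambda> \<in> CF" using f by (simp add: CF_iff)
    moreover have "cf f = cf (restrict f \<Lambda>)" by (rule X.\<pi>_cong[OF f]) simp
    ultimately show "cf f \<in> cf ` CF" by blast
  qed (auto simp: CF_iff)
  then have g: "cf ` CF \<union> cu ` carrier \<G> = X.gens" by (simp add: X.gens_def)
  have "X.gens \<subseteq> adjointables cs"
    using X.\<pi>_closed X.U_closed unfolding X.gens_def by auto
  from cstar_span_BL[OF this]
  have "cstar_span (LO cs) X.gens = cstar_span (BL cs) (X.S ` J)" unfolding X.gens_span by (simp only:)
  moreover have "carrier \<G> = \<Gamma>" by simp
  ultimately show ?thesis
    unfolding schottky_crossed_product_def reduced_crossed_product_def cstar_generated_def X.OS_def BL_update g by (simp only:)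
qed

lemma OA_universal: "cuntz_krieger_algebra TYPE('b) (2*g) (schottky_matrix g) R.OS (S_op g \<Gamma> gen x\<^sub>0 \<mu>)"
  unfolding cuntz_krieger_algebra_def
proof (intro conjI allI impI R.OS_cstar)
  show "cuntz_krieger_family (2*g) (schottky_matrix g) R.OS (S_op g \<Gamma> gen x\<^sub>0 \<mu>)"
    by (rule cuntz_krieger_family_cong[OF R.OS_cstar R.OS_family S_op_eq])
  have "S_op g \<Gamma> gen x\<^sub>0 \<mu> ` J = R.S ` J" using S_op_eq by (rule image_cong[OF refl])
  then show "carrier R.OS = cstar_span R.OS (S_op g \<Gamma> gen x\<^sub>0 \<mu> ` J)" using R.OS_gen by (simp only:)
  fix B :: "'b cstar" and t assume "cstar_algebra B" "cuntz_krieger_family (2*g) (schottky_matrix g) B t"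
  then obtain \<phi> where \<phi>: "\<phi> \<in> star_hom R.OS B" "\<And>i. i \<in> J \<Longrightarrow> \<phi> (R.S i) = t i"
    using covariant_hom[OF R.covariant_axioms _ _ one_neq_zero] by metis
  show "\<exists>\<phi>\<in>star_hom R.OS B. \<forall>i\<in>J. \<phi> (S_op g \<Gamma> gen x\<^sub>0 \<mu> i) = t i"
    using \<phi>(2) S_op_eq by (intro bexI[OF _ \<phi>(1)] ballI) simp
qed

lemma mult_op_star_hom: "mult_op \<mu> \<in> star_hom (continuous_functions \<Lambda>) R.OS"
proof (rule star_homI)
  have r: "mult_op \<mu> (\<lambda>x\<in>\<Lambda>. k x) = mult_op \<mu> k" if "Cont k" for k
    by (rule R.\<pi>_cong[symmetric, OF that]) simp
  show "mult_op \<mu> \<one>\<^bsub>continuous_functions \<Lambda>\<^esub> = \<one>\<^bsub>R.OS\<^esub>"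
    using r[of "\<lambda>_. 1"] R.\<pi>_one by (simp add: continuous_functions_def R.OS_simps)
  fix f assume "f \<in> CF"
  then have f: "Cont f" by (simp add: CF_iff)
  show "mult_op \<mu> f \<in> carrier R.OS" by (rule R.\<pi>_OS[OF f])
  show "mult_op \<mu> (c \<odot>\<^bsub>continuous_functions \<Lambda>\<^esub> f) = c \<odot>\<^bsub>R.OS\<^esub> mult_op \<mu> f" for c
    using r[of "\<lambda>x. c * f x"] R.\<pi>_smult[OF f, of c] f by (simp only: continuous_functions_def R.OS_simps module.simps continuous_on_mult continuous_on_const)
  show "mult_op \<mu> (cstar_adj (continuous_functions \<Lambda>) f) = cstar_adj R.OS (mult_op \<mu> f)"
    using r[of "\<lambda>x. cnj (f x)"] R.\<pi>_star[OF f] f by (simp only: continuous_functions_def R.OS_simps cstar.simps continuous_on_cnj)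
  fix h assume "h \<in> CF"
  then have h: "Cont h" by (simp add: CF_iff)
  show "mult_op \<mu> (f \<otimes>\<^bsub>continuous_functions \<Lambda>\<^esub> h) = mult_op \<mu> f \<otimes>\<^bsub>R.OS\<^esub> mult_op \<mu> h"
    using r[of "\<lambda>x. f x * h x"] R.\<pi>_mult[OF f h] f h by (simp only: continuous_functions_def R.OS_simps monoid.simps continuous_on_mult)
  show "mult_op \<mu> (f \<oplus>\<^bsub>continuous_functions \<Lambda>\<^esub> h) = mult_op \<mu> f \<oplus>\<^bsub>R.OS\<^esub> mult_op \<mu> h"
    using r[of "\<lambda>x. f x + h x"] R.\<pi>_add[OF f h] f h by (simp only: continuous_functions_def R.OS_simps ring.simps continuous_on_add)
qed

lemma iso_obtain:
  obtains \<iota> where "\<iota> \<in> star_hom R.OS X.OS" "bij_betw \<iota> (carrier R.OS) (carrier X.OS)"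
    "\<And>i. i \<in> J \<Longrightarrow> \<iota> (R.S i) = X.S i" "\<And>\<gamma>. \<gamma> \<in> \<Gamma> \<Longrightarrow> \<iota> (T_op \<Gamma> \<mu> \<gamma>) = cu \<gamma>"
    "\<And>f. Cont f \<Longrightarrow> \<iota> (mult_op \<mu> f) = cf f"
  by (rule covariant_iso[OF R.covariant_axioms one_neq_zero X.covariant_axioms crossed_one_neq_zero]) (assumption | (rule that; assumption))+

text \<open>The isomorphism carries the question to the crossed product, where \<open>cf_inj\<close>
  recovers the function. In this way no argument about the support of the measure enters.\<close>

lemma mult_op_inj: "inj_on (mult_op \<mu>) CF"
proof (rule inj_onI)
  fix f h assume fh: "f \<in> CF" "h \<in> CF" "mult_op \<mu> f = mult_op \<mu> h"
  obtain \<iota> where "\<And>f. Cont f \<Longrightarrow> \<iota> (mult_op \<mu> f) = cf f" by (rule iso_obtain) (assumption | (rule that; assumption))+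
  then have "cf f = cf h" using fh unfolding CF_iff by metis
  then show "f = h" using cf_inj[of f h] fh unfolding CF_iff by (intro extensionalityI[of f \<Lambda> h]) auto
qed

lemma mult_op_commute: "f \<in> CF \<Longrightarrow> h \<in> CF \<Longrightarrow> mult_op \<mu> f \<otimes>\<^bsub>BL \<mu>\<^esub> mult_op \<mu> h = mult_op \<mu> h \<otimes>\<^bsub>BL \<mu>\<^esub> mult_op \<mu> f"
  using R.\<pi>_mult[of f h] R.\<pi>_mult[of h f] by (simp add: CF_iff mult.commute)

text \<open>An element commuting with the multiplication operators is mapped into the crossed
  product, recognised there as a function by \<open>crossed_commutant\<close>, and pulled back by
  injectivity.\<close>

lemma mult_op_commutant:
  "mult_op \<mu> ` CF = {x \<in> carrier R.OS. \<forall>y\<in>mult_op \<mu> ` CF. x \<otimes>\<^bsub>R.OS\<^esub> y = y \<otimes>\<^bsub>R.OS\<^esub> x}" (is "?D = ?C")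
proof
  show "?D \<subseteq> ?C" using mult_op_commute star_homD(1)[OF mult_op_star_hom] by (auto simp: R.OS_simps(1))
  show "?C \<subseteq> ?D"
  proof
    fix x assume "x \<in> ?C"
    then have x: "x \<in> carrier R.OS" and xc: "\<And>f. f \<in> CF \<Longrightarrow> x \<otimes>\<^bsub>R.OS\<^esub> mult_op \<mu> f = mult_op \<mu> f \<otimes>\<^bsub>R.OS\<^esub> x" by auto
    obtain \<iota> where \<iota>: "\<iota> \<in> star_hom R.OS X.OS" "bij_betw \<iota> (carrier R.OS) (carrier X.OS)"
      "\<And>f. Cont f \<Longrightarrow> \<iota> (mult_op \<mu> f) = cf f" by (rule iso_obtain) (assumption | (rule that; assumption))+
    note h = star_homD[OF \<iota>(1)]
    have "\<exists>e. Cont e \<and> \<iota> x = cf e"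
    proof (rule crossed_commutant)
      show "\<iota> x \<in> cstar_span (BL cs) (X.S ` J)" using h(1)[OF x] by (simp only: X.OS_simps)
      fix f :: "pt \<Rightarrow> complex" assume f: "Cont f"
      then have r: "restrict f \<Lambda> \<in> CF" "mult_op \<mu> f = mult_op \<mu> (restrict f \<Lambda>)"
        using R.\<pi>_cong[OF f, of "restrict f \<Lambda>"] by (simp_all add: CF_iff)
      show "\<iota> x \<otimes>\<^sub>X cf f = cf f \<otimes>\<^sub>X \<iota> x"
        using h(2)[OF x R.\<pi>_OS[OF f]] h(2)[OF R.\<pi>_OS[OF f] x] xc[OF r(1)] \<iota>(3)[OF f] by (simp only: r(2) X.OS_simps)
    qed
    then obtain e where e: "Cont e" "\<iota> x = \<iota> (mult_op \<mu> e)" using \<iota>(3) by metis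
    have "x = mult_op \<mu> e" using \<iota>(2) e(2) x R.\<pi>_OS[OF e(1)] unfolding bij_betw_def by (blast dest: inj_onD)
    also have "\<dots> = mult_op \<mu> (restrict e \<Lambda>)" by (rule R.\<pi>_cong[OF e(1)]) simp
    finally show "x \<in> ?D" using e(1) by (auto simp: CF_iff)
  qed
qed

text \<open>Being its own commutant, the image of the continuous functions is automatically a norm
  closed subalgebra.\<close>

lemma mult_op_subalgebra: "cstar_subalgebra (mult_op \<mu> ` CF) R.OS"
proof -
  have "cstar_subalgebra {x \<in> carrier R.OS. \<forall>y\<in>mult_op \<mu> ` CF. x \<otimes>\<^bsub>R.OS\<^esub> y = y \<otimes>\<^bsub>R.OS\<^esub> x} R.OS"
  proof (rule cstar_algebra.commutant_subalgebra[OF R.OS_cstar])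
    show "mult_op \<mu> ` CF \<subseteq> carrier R.OS" using star_homD(1)[OF mult_op_star_hom] by blast
    fix y assume "y \<in> mult_op \<mu> ` CF"
    then obtain f where f: "f \<in> CF" "y = mult_op \<mu> f" by blast
    have "cstar_adj (continuous_functions \<Lambda>) f \<in> CF" using f(1) by (simp add: continuous_functions_def continuous_on_cnj)
    then show "cstar_adj R.OS y \<in> mult_op \<mu> ` CF" using star_homD(6)[OF mult_op_star_hom f(1)] f(2) by (metis imageI)
  qed
  then show ?thesis by (simp only: mult_op_commutant[symmetric])
qed

text \<open>Each projection is multiplication by the continuous indicator of a cylinder; conversely
  these indicators generate all continuous functions by uniform approximation.\<close>

lemma mult_op_span: "mult_op \<mu> ` CF = cstar_span R.OS (P_op g gen x\<^sub>0 \<mu> ` \<Gamma>)"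
proof
  let ?P = "P_op g gen x\<^sub>0 \<mu> ` \<Gamma>"
  have PD: "?P \<subseteq> mult_op \<mu> ` CF"
  proof (rule image_subsetI)
    fix \<gamma>
    let ?k = "indicator (cylinder g gen x\<^sub>0 \<gamma>) :: pt \<Rightarrow> complex"
    have "mult_op \<mu> ?k = mult_op \<mu> (restrict ?k \<Lambda>)" by (rule R.\<pi>_cong[OF cylinder_indicator_continuous]) simp
    then show "P_op g gen x\<^sub>0 \<mu> \<gamma> \<in> mult_op \<mu> ` CF"
      using cylinder_indicator_continuous unfolding P_op_def by (auto simp: CF_iff)
  qed
  then show "cstar_span R.OS ?P \<subseteq> mult_op \<mu> ` CF" by (rule cstar_span_least[OF mult_op_subalgebra])
  have ring: "ring R.OS" using cstar_algebra.axioms(2)[OF R.OS_cstar] .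
  have sp: "cstar_subalgebra (cstar_span R.OS ?P) R.OS" by (rule cstar_span_subalgebra[OF ring mult_op_subalgebra PD])
  then have sp': "cstar_subalgebra (cstar_span R.OS ?P) (BL \<mu>)"
    using cstar_subalgebra_trans[OF R.ring_axioms R.OS_subalgebra, of "cstar_span R.OS ?P"] cstar_subalgebraD(1)[OF sp]
    unfolding R.OS_simps by (simp add: R.OS_def)
  show "mult_op \<mu> ` CF \<subseteq> cstar_span R.OS ?P"
  proof (rule image_subsetI)
    fix f assume "f \<in> CF"
    then have f: "Cont f" by (simp add: CF_iff)
    show "mult_op \<mu> f \<in> cstar_span R.OS ?P"
    proof (rule R.\<pi>_in_closed[OF sp' _ f])
      fix w assume w: "reduced_word g w" "w \<noteq> []"
      have "mult_op \<mu> (chi w) = P_op g gen x\<^sub>0 \<mu> (word_val g gen w)" unfolding P_op_def cylinder_eq[OF w(1)] chi_def ..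
      moreover have "word_val g gen w \<in> \<Gamma>" by (rule word_val_closed[OF reduced_word_letters[OF w(1)]])
      ultimately show "mult_op \<mu> (chi w) \<in> cstar_span R.OS ?P" using cstar_span_superset[of ?P R.OS] by auto
    qed
  qed
qed

text \<open>A commutative algebra containing the multiplication operators lies in their commutant,
  which is their own image.\<close>

lemma mult_op_maximal: "maximal_commutative_subalgebra (mult_op \<mu> ` CF) R.OS"
  unfolding maximal_commutative_subalgebra_def
proof (intro conjI allI impI mult_op_subalgebra)
  show "commutative_in (mult_op \<mu> ` CF) R.OS"
    unfolding commutative_in_def using mult_op_commutant by blast
  fix D' assume D': "cstar_subalgebra D' R.OS" "commutative_in D' R.OS" "mult_op \<mu> ` CF \<subseteq> D'"
  have "D' \<subseteq> {x \<in> carrier R.OS. \<forall>y\<in>mult_op \<mu> ` CF. x \<otimes>\<^bsub>R.OS\<^esub> y = y \<otimes>\<^bsub>R.OS\<^esub> x}"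
    using cstar_subalgebraD(1)[OF D'(1)] D'(2,3) unfolding commutative_in_def by blast
  from subset_trans[OF this equalityD2[OF mult_op_commutant]] show "D' = mult_op \<mu> ` CF" using D'(3) by (rule subset_antisym)
qed

lemma crossed_generator:
  assumes "i \<in> J"
  shows "X.S i = (\<Oplus>\<^bsub>X.OS\<^esub>j\<in>J. of_nat (schottky_matrix g i j) \<odot>\<^bsub>X.OS\<^esub>
    (cu (L i) \<otimes>\<^bsub>X.OS\<^esub> cf (indicator (cylinder g gen x\<^sub>0 (L j)))))"
proof -
  interpret O: cstar_algebra X.OS by (rule X.OS_cstar)
  have "of_nat (schottky_matrix g i j) \<odot>\<^bsub>X.OS\<^esub> (cu (L i) \<otimes>\<^bsub>X.OS\<^esub> cf (chi [j])) \<in> carrier X.OS" for j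
    using X.U_OS[OF L_in[OF assms]] X.\<pi>_OS[OF chi_continuous] by (intro O.smult_closed O.m_closed O.carrier_complex_ring)
  then show ?thesis unfolding X.OS_S[OF assms]
    by (intro O.finsum_cong') (auto simp only: cylinder_letter chi_def)
qed

lemma crossed_iso:
  "\<exists>\<iota>\<in>star_hom R.OS X.OS. (inj_on \<iota> (carrier R.OS) \<and>
     (\<forall>i\<in>J. \<iota> (S_op g \<Gamma> gen x\<^sub>0 \<mu> i) = (\<Oplus>\<^bsub>X.OS\<^esub>j\<in>J. of_nat (schottky_matrix g i j) \<odot>\<^bsub>X.OS\<^esub>
       (cu (L i) \<otimes>\<^bsub>X.OS\<^esub> cf (indicator (cylinder g gen x\<^sub>0 (L j))))))) \<and>
     ((\<forall>\<gamma>\<in>\<Gamma>. T_op \<Gamma> \<mu> \<gamma> \<in> carrier R.OS \<and> \<iota> (T_op \<Gamma> \<mu> \<gamma>) = cu \<gamma>) \<and>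
      (\<forall>f\<in>CF. \<iota> (mult_op \<mu> f) = cf f) \<and> \<iota> ` carrier R.OS = carrier X.OS)"
proof -
  obtain \<iota> where \<iota>: "\<iota> \<in> star_hom R.OS X.OS" "bij_betw \<iota> (carrier R.OS) (carrier X.OS)"
    "\<And>i. i \<in> J \<Longrightarrow> \<iota> (R.S i) = X.S i" "\<And>\<gamma>. \<gamma> \<in> \<Gamma> \<Longrightarrow> \<iota> (T_op \<Gamma> \<mu> \<gamma>) = cu \<gamma>"
    "\<And>f. Cont f \<Longrightarrow> \<iota> (mult_op \<mu> f) = cf f" by (rule iso_obtain) (assumption | (rule that; assumption))+
  show ?thesis
  proof (rule bexI[OF _ \<iota>(1)], intro conjI ballI)
    show "inj_on \<iota> (carrier R.OS)" "\<iota> ` carrier R.OS = carrier X.OS" using \<iota>(2) by (simp_all add: bij_betw_def)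
    show "\<iota> (S_op g \<Gamma> gen x\<^sub>0 \<mu> i) = (\<Oplus>\<^bsub>X.OS\<^esub>j\<in>J. of_nat (schottky_matrix g i j) \<odot>\<^bsub>X.OS\<^esub>
       (cu (L i) \<otimes>\<^bsub>X.OS\<^esub> cf (indicator (cylinder g gen x\<^sub>0 (L j)))))" if "i \<in> J" for i
      unfolding S_op_eq[OF that] \<iota>(3)[OF that] by (rule crossed_generator[OF that])
  qed (use \<iota>(4,5) R.U_OS in \<open>auto simp: CF_iff\<close>)
qed

end

theorem theorem6p2:
  fixes g :: nat and \<Gamma> :: "psl2 set" and gen :: "nat \<Rightarrow> psl2" and x\<^sub>0 :: pt and \<mu> :: "pt measure"
  assumes "2 \<le> g"
    and "schottky_group g \<Gamma> gen"
    and "x\<^sub>0 \<in> ball 0 1"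
    and "coded_limit_set g \<Gamma> gen x\<^sub>0"
    and "patterson_sullivan_measure \<Gamma> \<mu>"
  shows
    "let \<Lambda> = limit_set \<Gamma>;
         \<G> = PSL2C\<lparr>carrier := \<Gamma>\<rparr>;
         T = T_op \<Gamma> \<mu>;
         P = P_op g gen x\<^sub>0 \<mu>;
         S = S_op g \<Gamma> gen x\<^sub>0 \<mu>;
         \<O> = OA g \<Gamma> gen x\<^sub>0 \<mu>;
         X = schottky_crossed_product \<Gamma>
     in
       cuntz_krieger_algebra TYPE('b) (2 * g) (schottky_matrix g) \<O> S \<and>
       (mult_op \<mu> \<in> star_hom (continuous_functions \<Lambda>) \<O> \<and>
        inj_on (mult_op \<mu>) (carrier (continuous_functions \<Lambda>)) \<and>
        mult_op \<mu> ` carrier (continuous_functions \<Lambda>) = cstar_span \<O> (P ` \<Gamma>) \<and>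
        maximal_commutative_subalgebra (cstar_span \<O> (P ` \<Gamma>)) \<O>) \<and>
       (\<exists>\<iota> \<in> star_hom \<O> X.
          (inj_on \<iota> (carrier \<O>) \<and>
           (\<forall>i\<in>{1..2*g}. \<iota> (S i) = (\<Oplus>\<^bsub>X\<^esub>j\<in>{1..2*g}. of_nat (schottky_matrix g i j) \<odot>\<^bsub>X\<^esub>
              (crossed_unitary \<G> \<Lambda> (letter g gen i) \<otimes>\<^bsub>X\<^esub>
               crossed_fun \<G> psl_act \<Lambda> (indicator (cylinder g gen x\<^sub>0 (letter g gen j))))))) \<and>
          ((\<forall>\<gamma>\<in>\<Gamma>. T \<gamma> \<in> carrier \<O> \<and> \<iota> (T \<gamma>) = crossed_unitary \<G> \<Lambda> \<gamma>) \<and>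
           (\<forall>f\<in>carrier (continuous_functions \<Lambda>). \<iota> (mult_op \<mu> f) = crossed_fun \<G> psl_act \<Lambda> f) \<and>
           \<iota> ` carrier \<O> = carrier X))"
proof -
  interpret patterson_sullivan g \<Gamma> gen x\<^sub>0 \<mu>
    using assms by (intro patterson_sullivan.intro schottky.intro patterson_sullivan_axioms.intro)
  show ?thesis
    unfolding Let_def OA_eq crossed_eq
    by (intro conjI OA_universal mult_op_star_hom mult_op_inj mult_op_span mult_op_maximal[unfolded mult_op_span] crossed_iso)
qed

end
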